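(* Let $d$ be a positive integer. There exists a continuous action $T\colon \mathbb{R}^d\times \mathcal{X}\to \mathcal{X}$ on a compact metric space $(\mathcal{X}, \mathbf{d})$ with invariant probability measures $\nu_1, \nu_2 \in \mathscr{M}^T(\mathcal{X})$ satisfying: (i) the upper metric mean dimension $\overline{\mathrm{mdim}}_{\mathrm{M}}(\mathcal{X}, T, \mathbf{d})$ is finite; (ii) $\overline{\mathrm{rdim}}(\mathcal{X}, T, \mathbf{d}, \nu_1) = \overline{\mathrm{rdim}}(\mathcal{X}, T, \mathbf{d}, \nu_2) =1$; (iii) $\overline{\mathrm{rdim}}(\mathcal{X}, T, \mathbf{d}, \frac{1}{2}\nu_1 + \frac{1}{2}\nu_2) \leq \frac{1}{2}$.
   Context: Conventions: $\log=\log_2$, and $\mathbf{m}$ is Lebesgue measure on $\mathbb{R}^d$. $\mathscr{M}^T(\mathcal{X})$ is the set of $T$-invariant Borel probability measures on $\mathcal{X}$. Mutual information: for random variables $X,Y$ with values in finite sets, $I(X;Y)=H(X)+H(Y)-H(X,Y)$ where $H$ is Shannon entropy (base 2). For $X,Y$ with values in measurable spaces, $I(X;Y)$ is the supremum of $I(\alpha\circ X;\beta\circ Y)$ over all finite measurable partitions $\alpha,\beta$ of the two target spaces, where $\alpha\circ X$ is the index of the element of $\alpha$ containing $X$ (similarly $\beta\circ Y$). Rate distortion function: for $L>0$, $L^1([0,L)^d,\mathcal{X})$ is the space of measurable maps $[0,L)^d\to\mathcal{X}$ modulo $\mathbf{m}$-a.e. equality, with metric $D(f,g)=\int_{[0,L)^d}\mathbf{d}(f(u),g(u))\,d\mathbf{m}(u)$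 and its Borel $\sigma$-algebra. For $\mu\in\mathscr{M}^T(\mathcal{X})$ and $\varepsilon>0$, $R_L(\mathbf{d},\mu,\varepsilon)$ is the infimum of $I(X;Y)$ over pairs of random variables $X,Y$ defined on a common probability space such that $X$ takes values in $\mathcal{X}$ with law $\mu$, and $Y=(Y_u)_{u\in[0,L)^d}$ takes values in $L^1([0,L)^d,\mathcal{X})$ with $\mathbb{E}\big(\frac{1}{L^d}\int_{[0,L)^d}\mathbf{d}(T^uX,Y_u)\,d\mathbf{m}(u)\big)<\varepsilon$. Set $R(\mathbf{d},\mu,\varepsilon)=\lim_{L\to\infty}R_L(\mathbf{d},\mu,\varepsilon)/L^d$; this limit exists, is finite, and equals $\inf_{L>0}R_L(\mathbf{d},\mu,\varepsilon)/L^d$. Upper rate distortion dimension: $\overline{\mathrm{rdim}}(\mathcal{X},T,\mathbf{d},\mu)=\limsup_{\varepsilon\to0}\frac{R(\mathbf{d},\mu,\varepsilon)}{\log(1/\varepsilon)}$. Upper metric mean dimension: $\#(\mathcal{X},\mathbf{d},\varepsilon)$ is the minimum $n$ such that $\mathcal{X}$ has an open cover by $n$ sets each of $\mathbf{d}$-diameter $<\varepsilon$; $\mathbf{d}_L(x,y)=\sup_{u\in[0,L)^d}\mathbf{d}(T^ux,T^uy)$; $S(\mathcal{X},T,\mathbf{d},\varepsilon)=\lim_{L\to\infty}\frac{\log\#(\mathcal{X},\mathbf{d}_L,\varepsilon)}{L^d}$ (the limit exists and is finite); $\overline{\mathrm{mdim}}_{\mathrm{M}}(\mathcal{X},T,\mathbf{d})=\limsup_{\varepsilon\to0}\frac{S(\mathcal{X},T,\mathbf{d},\varepsilon)}{\log(1/\varepsilon)}$.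 *)

theory Defs
  imports "HOL-Probability.Probability"
begin

text \<open>
  A metric space is given by a carrier set \<open>M\<close> and a distance function \<open>d\<close> as in the library
  locale \<^locale>\<open>Metric_space\<close>; the group \<open>\<real>\<^sup>d\<close> is \<^typ>\<open>real ^ 'n\<close>, so the
  dimension is \<open>CARD('n)\<close>.  Quantities that may a priori be infinite are of type \<^typ>\<open>ereal\<close>.
\<close>

definition borel_met :: "'a set \<Rightarrow> ('a \<Rightarrow> 'a \<Rightarrow> real) \<Rightarrow> 'a measure" where
  "borel_met M d = sigma M {U. openin (Metric_space.mtopology M d) U}"

definition cube :: "real \<Rightarrow> (real ^ 'n) set" where
  "cube L = {u. \<forall>i. 0 \<le> u $ i \<and> u $ i < L}"


section \<open>Continuous actions and invariant measures\<close>

definition continuous_action ::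
    "'a set \<Rightarrow> ('a \<Rightarrow> 'a \<Rightarrow> real) \<Rightarrow> (real ^ 'n \<Rightarrow> 'a \<Rightarrow> 'a) \<Rightarrow> bool" where
  "continuous_action M d T \<longleftrightarrow>
     (\<forall>x\<in>M. T 0 x = x) \<and>
     (\<forall>u v. \<forall>x\<in>M. T (u + v) x = T u (T v x)) \<and>
     continuous_map (prod_topology euclidean (Metric_space.mtopology M d))
       (Metric_space.mtopology M d) (\<lambda>(u, x). T u x)"

definition invariant_measures ::
    "'a set \<Rightarrow> ('a \<Rightarrow> 'a \<Rightarrow> real) \<Rightarrow> (real ^ 'n \<Rightarrow> 'a \<Rightarrow> 'a) \<Rightarrow> 'a measure set" where
  "invariant_measures M d T =
     {\<mu>. prob_space \<mu> \<and> sets \<mu> = sets (borel_met M d) \<and>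
         (\<forall>u. distr \<mu> (borel_met M d) (T u) = \<mu>)}"

definition convex_mix :: "real \<Rightarrow> 'a measure \<Rightarrow> real \<Rightarrow> 'a measure \<Rightarrow> 'a measure" where
  "convex_mix a \<mu> b \<nu> =
     measure_of (space \<mu>) (sets \<mu>) (\<lambda>A. ennreal a * emeasure \<mu> A + ennreal b * emeasure \<nu> A)"

lemma emeasure_convex_mix:
  assumes "sets \<nu> = sets \<mu>" "A \<in> sets \<mu>"
  shows "emeasure (convex_mix a \<mu> b \<nu>) A = ennreal a * emeasure \<mu> A + ennreal b * emeasure \<nu> A"
proof (rule emeasure_measure_of[OF convex_mix_def])
  show "countably_additive (sets (convex_mix a \<mu> b \<nu>))
          (\<lambda>A. ennreal a * emeasure \<mu> A + ennreal b * emeasure \<nu> A)"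
    unfolding countably_additive_def
  proof (intro allI impI)
    fix F :: "nat \<Rightarrow> 'a set"
    assume F: "range F \<subseteq> sets (convex_mix a \<mu> b \<nu>)" "disjoint_family F"
      "(\<Union>i. F i) \<in> sets (convex_mix a \<mu> b \<nu>)"
    have F': "range F \<subseteq> sets \<mu>" "range F \<subseteq> sets \<nu>"
      using F(1) assms(1) by (auto simp: convex_mix_def)
    have "(\<Sum>i. ennreal a * emeasure \<mu> (F i) + ennreal b * emeasure \<nu> (F i))
        = (\<Sum>i. ennreal a * emeasure \<mu> (F i)) + (\<Sum>i. ennreal b * emeasure \<nu> (F i))"
      by (rule suminf_add[symmetric]) auto
    then show "(\<Sum>i. ennreal a * emeasure \<mu> (F i) + ennreal b * emeasure \<nu> (F i))
        = ennreal a * emeasure \<mu> (\<Union>i. F i) + ennreal b * emeasure \<nu> (\<Union>i. F i)"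
      using suminf_emeasure[OF F'(1) F(2)] suminf_emeasure[OF F'(2) F(2)] by simp
  qed
qed (use assms sets.space_closed in \<open>auto simp: convex_mix_def positive_def\<close>)


section \<open>Mutual information\<close>

text \<open>Shannon entropy, in bits, of a random variable taking finitely many values.\<close>

definition shannon_entropy :: "'w measure \<Rightarrow> ('w \<Rightarrow> 'c) \<Rightarrow> real" where
  "shannon_entropy P X = prob_space.entropy P 2 (count_space (X ` space P)) X"

lemma shannon_entropy_eq:
  assumes "prob_space P" "simple_function P X"
  shows "shannon_entropy P X =
    - (\<Sum>x\<in>X ` space P. measure P (X -` {x} \<inter> space P) * log 2 (measure P (X -` {x} \<inter> space P)))"
proof -
  interpret information_space P 2
    using assms(1) by (simp add: information_space_def information_space_axioms_def)
  have "simple_distributed P X (\<lambda>x. measure P (X -` {x} \<inter> space P))"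
    using assms(2) by (intro simple_distributedI) auto
  from entropy_simple_distributed[OF this] show ?thesis
    by (simp add: shannon_entropy_def)
qed

definition finite_mutual_info :: "'w measure \<Rightarrow> ('w \<Rightarrow> 'c) \<Rightarrow> ('w \<Rightarrow> 'e) \<Rightarrow> real" where
  "finite_mutual_info P X Y =
     shannon_entropy P X + shannon_entropy P Y - shannon_entropy P (\<lambda>\<omega>. (X \<omega>, Y \<omega>))"

definition finite_measurable_partition :: "'c measure \<Rightarrow> 'c set set \<Rightarrow> bool" where
  "finite_measurable_partition S \<alpha> \<longleftrightarrow> finite \<alpha> \<and> \<alpha> \<subseteq> sets S \<and> partition_on (space S) \<alpha>"

text \<open>A cell of a partition serves as its own index.\<close>

definition cell :: "'c set set \<Rightarrow> 'c \<Rightarrow> 'c set" where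
  "cell \<alpha> x = (THE A. A \<in> \<alpha> \<and> x \<in> A)"

text \<open>
  The library's \<open>mutual_information\<close> is an integral of a Radon--Nikodym density and is not
  meaningful when the joint law is not absolutely continuous with respect to the product of the
  marginals; the supremum over partitions is always meaningful.
\<close>

definition mutual_info ::
    "'w measure \<Rightarrow> 'c measure \<Rightarrow> 'e measure \<Rightarrow> ('w \<Rightarrow> 'c) \<Rightarrow> ('w \<Rightarrow> 'e) \<Rightarrow> ereal" where
  "mutual_info P S S' X Y =
     Sup {ereal (finite_mutual_info P (cell \<alpha> \<circ> X) (cell \<beta> \<circ> Y)) | \<alpha> \<beta>.
            finite_measurable_partition S \<alpha> \<and> finite_measurable_partition S' \<beta>}"


section \<open>The space \<open>L\<^sup>1([0,L)\<^sup>d, M)\<close>\<close>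

text \<open>
  Its points are classes of total functions on \<^typ>\<open>real ^ 'n\<close> that are measurable on the cube,
  modulo almost everywhere equality on the cube; values off the cube are irrelevant.
\<close>

definition L1_maps ::
    "'a set \<Rightarrow> ('a \<Rightarrow> 'a \<Rightarrow> real) \<Rightarrow> real \<Rightarrow> (real ^ 'n \<Rightarrow> 'a) set" where
  "L1_maps M d L = restrict_space lborel (cube L) \<rightarrow>\<^sub>M borel_met M d"

definition L1_rel ::
    "'a set \<Rightarrow> ('a \<Rightarrow> 'a \<Rightarrow> real) \<Rightarrow> real \<Rightarrow> (real ^ 'n \<Rightarrow> 'a) rel" where
  "L1_rel M d L = {(f, g). f \<in> L1_maps M d L \<and> g \<in> L1_maps M d L \<and>
                           (AE u in lborel. u \<in> cube L \<longrightarrow> f u = g u)}"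

definition L1_space ::
    "'a set \<Rightarrow> ('a \<Rightarrow> 'a \<Rightarrow> real) \<Rightarrow> real \<Rightarrow> (real ^ 'n \<Rightarrow> 'a) set set" where
  "L1_space M d L = L1_maps M d L // L1_rel M d L"

text \<open>An arbitrary representative; the integrals below do not depend on the choice.\<close>

definition L1_rep :: "(real ^ 'n \<Rightarrow> 'a) set \<Rightarrow> real ^ 'n \<Rightarrow> 'a" where
  "L1_rep F = (SOME f. f \<in> F)"

lemma equiv_L1_rel: "equiv (L1_maps M d L) (L1_rel M d L)"
proof (rule equivI)
  show "L1_rel M d L \<subseteq> L1_maps M d L \<times> L1_maps M d L"
    by (auto simp: L1_rel_def)
  show "refl_on (L1_maps M d L) (L1_rel M d L)"
    by (auto simp: refl_on_def L1_rel_def)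
  show "sym (L1_rel M d L)"
    by (auto simp: sym_def L1_rel_def elim!: eventually_mono)
  show "trans (L1_rel M d L)"
    unfolding trans_def L1_rel_def by (auto elim: eventually_elim2)
qed

lemma L1_rep_in: "F \<in> L1_space M d L \<Longrightarrow> L1_rep F \<in> F"
  unfolding L1_rep_def L1_space_def
  by (metis equiv_L1_rel in_quotient_imp_non_empty someI_ex ex_in_conv)

text \<open>Bochner integrals of bounded measurable functions, since \<open>M\<close> is compact.\<close>

definition L1_dist ::
    "('a \<Rightarrow> 'a \<Rightarrow> real) \<Rightarrow> real \<Rightarrow> (real ^ 'n \<Rightarrow> 'a) set \<Rightarrow> (real ^ 'n \<Rightarrow> 'a) set \<Rightarrow> real" where
  "L1_dist d L F G = (LINT u:cube L|lborel. d (L1_rep F u) (L1_rep G u))"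

definition L1_borel ::
    "'a set \<Rightarrow> ('a \<Rightarrow> 'a \<Rightarrow> real) \<Rightarrow> real \<Rightarrow> (real ^ 'n \<Rightarrow> 'a) set measure" where
  "L1_borel M d L = borel_met (L1_space M d L) (L1_dist d L)"


section \<open>Rate distortion dimension\<close>

definition distortion ::
    "('a \<Rightarrow> 'a \<Rightarrow> real) \<Rightarrow> (real ^ 'n \<Rightarrow> 'a \<Rightarrow> 'a) \<Rightarrow> real \<Rightarrow> 'w measure \<Rightarrow>
     ('w \<Rightarrow> 'a) \<Rightarrow> ('w \<Rightarrow> (real ^ 'n \<Rightarrow> 'a) set) \<Rightarrow> real" where
  "distortion d T L P X Y =
     (LINT \<omega>|P. 1 / L ^ CARD('n) * (LINT u:cube L|lborel. d (T u (X \<omega>)) (L1_rep (Y \<omega>) u)))"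

text \<open>
  The probability space \<open>P\<close> varies over all probability spaces (with arbitrary \<open>\<sigma>\<close>-algebra) on
  the type \<^typ>\<open>'a \<times> (real ^ 'n \<Rightarrow> 'a) set\<close>.  No generality is lost: the
  mutual information and the distortion depend only on the joint law of \<open>(X, Y)\<close>, and the joint
  law lives on a subset of this type.
\<close>

definition rate_distortion_L ::
    "'a set \<Rightarrow> ('a \<Rightarrow> 'a \<Rightarrow> real) \<Rightarrow> (real ^ 'n \<Rightarrow> 'a \<Rightarrow> 'a) \<Rightarrow> 'a measure \<Rightarrow> real \<Rightarrow> real \<Rightarrow> ereal" where
  "rate_distortion_L M d T \<mu> \<epsilon> L =
     Inf {mutual_info P (borel_met M d) (L1_borel M d L) X Y |
            (P :: ('a \<times> (real ^ 'n \<Rightarrow> 'a) set) measure) X Y.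
            prob_space P \<and>
            X \<in> P \<rightarrow>\<^sub>M borel_met M d \<and> distr P (borel_met M d) X = \<mu> \<and>
            Y \<in> P \<rightarrow>\<^sub>M L1_borel M d L \<and>
            distortion d T L P X Y < \<epsilon>}"

definition rate_distortion ::
    "'a set \<Rightarrow> ('a \<Rightarrow> 'a \<Rightarrow> real) \<Rightarrow> (real ^ 'n \<Rightarrow> 'a \<Rightarrow> 'a) \<Rightarrow> 'a measure \<Rightarrow> real \<Rightarrow> ereal" where
  "rate_distortion M d T \<mu> \<epsilon> =
     Lim at_top (\<lambda>L. rate_distortion_L M d T \<mu> \<epsilon> L / ereal (L ^ CARD('n)))"

definition upper_rdim ::
    "'a set \<Rightarrow> ('a \<Rightarrow> 'a \<Rightarrow> real) \<Rightarrow> (real ^ 'n \<Rightarrow> 'a \<Rightarrow> 'a) \<Rightarrow> 'a measure \<Rightarrow> ereal" where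
  "upper_rdim M d T \<mu> =
     Limsup (at_right 0) (\<lambda>\<epsilon>. rate_distortion M d T \<mu> \<epsilon> / ereal (log 2 (1 / \<epsilon>)))"


section \<open>Metric mean dimension\<close>

text \<open>The diameter is computed in \<^typ>\<open>ennreal\<close>, so that the empty set has diameter \<open>0\<close>.\<close>

definition covering_number :: "'a set \<Rightarrow> ('a \<Rightarrow> 'a \<Rightarrow> real) \<Rightarrow> real \<Rightarrow> nat" where
  "covering_number M d \<epsilon> =
     (LEAST n. \<exists>\<U>. finite \<U> \<and> card \<U> = n \<and> M \<subseteq> \<Union>\<U> \<and>
        (\<forall>U\<in>\<U>. openin (Metric_space.mtopology M d) U \<and>
                (SUP x\<in>U. SUP y\<in>U. ennreal (d x y)) < ennreal \<epsilon>))"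

text \<open>
  \<^locale>\<open>Metric_space\<close> demands non-negativity and symmetry of the distance on the whole type, and
  the supremum need not be bounded off the carrier; hence the default value \<open>0\<close> there.
\<close>

definition dyn_dist ::
    "'a set \<Rightarrow> ('a \<Rightarrow> 'a \<Rightarrow> real) \<Rightarrow> (real ^ 'n \<Rightarrow> 'a \<Rightarrow> 'a) \<Rightarrow> real \<Rightarrow> 'a \<Rightarrow> 'a \<Rightarrow> real" where
  "dyn_dist M d T L x y =
     (if x \<in> M \<and> y \<in> M then SUP u\<in>cube L. d (T u x) (T u y) else 0)"

definition covering_growth ::
    "'a set \<Rightarrow> ('a \<Rightarrow> 'a \<Rightarrow> real) \<Rightarrow> (real ^ 'n \<Rightarrow> 'a \<Rightarrow> 'a) \<Rightarrow> real \<Rightarrow> ereal" where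
  "covering_growth M d T \<epsilon> =
     Lim at_top (\<lambda>L. ereal (log 2 (real (covering_number M (dyn_dist M d T L) \<epsilon>)) / L ^ CARD('n)))"

definition upper_mdim ::
    "'a set \<Rightarrow> ('a \<Rightarrow> 'a \<Rightarrow> real) \<Rightarrow> (real ^ 'n \<Rightarrow> 'a \<Rightarrow> 'a) \<Rightarrow> ereal" where
  "upper_mdim M d T =
     Limsup (at_right 0) (\<lambda>\<epsilon>. covering_growth M d T \<epsilon> / ereal (log 2 (1 / \<epsilon>)))"

end

theory Submission
  imports Defs
begin

text \<open>
  Fix a set \<open>A\<close> of digit positions and place, on the unit cells of \<open>\<real>\<^sup>d\<close>, independent random numbers in
  \<open>[0,1]\<close> whose binary digits are fair coins at the positions in \<open>A\<close> and \<open>0\<close> elsewhere; with a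
  uniform phase this gives an invariant measure \<open>\<nu>\<^sub>A\<close> of the translation action. At scale \<open>2\<^sup>-\<^sup>n\<close>
  it costs \<open>card (A \<inter> {..<n})\<close> bits per unit volume. If \<open>A\<close> is the union of the blocks
  \<open>{m!..<(m+1)!}\<close> with \<open>m\<close> even, then along suitable scales both \<open>A\<close> and its complement contain
  almost all of the first \<open>n\<close> positions, whence both rate distortion dimensions are \<open>1\<close>. But at
  every single scale the two costs add up to \<open>n\<close>, and a code for the even mixture, which tells at
  a cost of one bit (for the whole cube) which component occurred, needs only their average.

  The lower bound comes from the Donsker--Varadhan inequality with an exponential moment of the
  distortion: as the digits of distinct cells are independent, Jensen's inequality reduces this
  moment to a power of the one for a single random number.
\<close>

section \<open>Borel structure of a totally bounded metric space\<close>

text \<open>The limsup of an average can lie strictly below the average of two limsups. The example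
  exploits just this, so the two measures must peak along different scales. Factorial blocks serve
  because \<open>m! / (m+1)!\<close> tends to 0: each block dwarfs everything before it. Three
  obstacles shape the proof. Mutual information is a supremum over partitions of a large space of
  maps, so everything is reduced to codes with a finite output alphabet, whose information is a
  finite sum of integrals. Both growth rates are defined through \<open>Lim\<close>, so convergence
  must be proved before anything can be said about them. And the estimates want an action by
  Lipschitz maps; hence the metric compares functions in an L1 norm with an exponential weight,
  which a translation distorts by a bounded factor only. The lower bound is taken at scale
  \<open>1 / (n * 2^n)\<close> rather than \<open>2^-n\<close>: the additional factor
  \<open>n\<close> pushes the contribution of distant values to the exponential moment down to
  \<open>exp (- n)\<close>, and it changes \<open>log (1 / \<epsilon>)\<close> only by
  \<open>log n\<close>.\<close>

context Metric_space
begin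

lemma space_borel_met [simp]: "space (borel_met M d) = M"
  unfolding borel_met_def
  by (rule space_measure_of) (use openin_subset topspace_mtopology in blast)

lemma openin_borel_met: "openin mtopology U \<Longrightarrow> U \<in> sets (borel_met M d)"
  unfolding borel_met_def
  by (subst sets_measure_of) (use openin_subset topspace_mtopology in blast)+

lemma lipschitz_borel_measurable:
  fixes f :: "'a \<Rightarrow> real"
  assumes "\<And>x y. x \<in> M \<Longrightarrow> y \<in> M \<Longrightarrow> \<bar>f x - f y\<bar> \<le> C * d x y"
  shows "f \<in> borel_measurable (borel_met M d)"
proof (rule borel_measurableI)
  fix S :: "real set" assume S: "open S"
  have "openin mtopology (f -` S \<inter> M)"
    unfolding openin_mtopology
  proof (intro conjI allI impI)
    fix x assume x: "x \<in> f -` S \<inter> M"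
    then obtain e where e: "e > 0" "\<And>z. dist z (f x) < e \<Longrightarrow> z \<in> S"
      using S unfolding open_dist by auto
    \<comment> \<open>The radius uses \<open>\<bar>C\<bar> + 1\<close> because \<open>C\<close> may
      be zero or negative, while the radius has to be positive.\<close>
    have "mball x (e / (\<bar>C\<bar> + 1)) \<subseteq> f -` S \<inter> M"
    proof
      fix y assume y: "y \<in> mball x (e / (\<bar>C\<bar> + 1))"
      have "\<bar>f y - f x\<bar> \<le> C * d y x" using assms x y by auto
      also have "\<dots> \<le> (\<bar>C\<bar> + 1) * d y x" by (intro mult_right_mono) auto
      also have "\<dots> < e" using y by (auto simp: field_simps commute)
      finally show "y \<in> f -` S \<inter> M" using e y by (auto simp: dist_real_def)
    qed
    then show "\<exists>r>0. mball x r \<subseteq> f -` S \<inter> M"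
      using e by (intro exI[of _ "e / (\<bar>C\<bar> + 1)"]) auto
  qed auto
  then show "f -` S \<inter> space (borel_met M d) \<in> sets (borel_met M d)"
    using openin_borel_met by simp
qed

lemma dist_borel_measurable [measurable]: "z \<in> M \<Longrightarrow> (\<lambda>x. d x z) \<in> borel_measurable (borel_met M d)"
  by (rule lipschitz_borel_measurable[where C = 1])
     (smt (verit) commute triangle)

lemma countable_dense_ex:
  assumes "mtotally_bounded M"
  shows "\<exists>Z. countable Z \<and> Z \<subseteq> M \<and> (\<forall>x\<in>M. \<forall>e>0. \<exists>z\<in>Z. d x z < e)"
proof -
  have "\<forall>n::nat. \<exists>K. finite K \<and> K \<subseteq> M \<and> M \<subseteq> (\<Union>x\<in>K. mball x (1 / Suc n))"
    using assms unfolding mtotally_bounded_def by simp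
  then obtain K where K: "\<And>n::nat. finite (K n)" "\<And>n. K n \<subseteq> M" "\<And>n. M \<subseteq> (\<Union>x\<in>K n. mball x (1 / Suc n))"
    by metis
  have "\<exists>z\<in>\<Union>(range K). d x z < e" if "x \<in> M" "e > 0" for x e
  proof -
    obtain n where "1 / Suc n < e" using \<open>e > 0\<close> nat_approx_posE by blast
    moreover have "x \<in> (\<Union>z\<in>K n. mball z (1 / Suc n))" using K(3)[of n] that(1) by blast
    ultimately show ?thesis by (force simp: commute)
  qed
  moreover have "countable (\<Union>(range K))" "\<Union>(range K) \<subseteq> M"
    using K(1,2) by (auto intro: countable_finite)
  ultimately show ?thesis by (intro exI[of _ "\<Union>(range K)"]) blast
qed

text \<open>In a separable space every open set is a countable union of balls with centres in a
  countable dense set and rational radii, so measurability can be tested on distances to fixed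
  points. This is how orbits, glued functions and random points are later shown to be
  measurable.\<close>

lemma measurable_into_borel_met:
  assumes tb: "mtotally_bounded M" and f: "f \<in> space N \<rightarrow> M"
    and meas: "\<And>z. z \<in> M \<Longrightarrow> (\<lambda>\<omega>. d (f \<omega>) z) \<in> borel_measurable N"
  shows "f \<in> N \<rightarrow>\<^sub>M borel_met M d"
  unfolding borel_met_def
proof (rule measurable_measure_of)
  show "{U. openin mtopology U} \<subseteq> Pow M" by (use openin_subset topspace_mtopology in blast)
  fix U assume "U \<in> {U. openin mtopology U}"
  then have U: "openin mtopology U" by simp
  obtain Z where Z: "countable Z" "Z \<subseteq> M" "\<And>x e. x \<in> M \<Longrightarrow> e > 0 \<Longrightarrow> \<exists>z\<in>Z. d x z < e"
    using countable_dense_ex[OF tb] by blast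
  define I where "I = {(z, q) \<in> Z \<times> \<rat>. mball z q \<subseteq> U}"
  have I: "countable I" unfolding I_def
    by (rule countable_subset[of _ "Z \<times> \<rat>"]) (auto intro: Z countable_rat)
  have "f -` U \<inter> space N = (\<Union>(z, q)\<in>I. {\<omega> \<in> space N. d (f \<omega>) z < q})"
  proof (intro equalityI subsetI)
    fix \<omega> assume "\<omega> \<in> f -` U \<inter> space N"
    then have w: "\<omega> \<in> space N" "f \<omega> \<in> U" by auto
    then obtain r where r: "r > 0" "mball (f \<omega>) r \<subseteq> U" using U openin_mtopology by auto
    have fM: "f \<omega> \<in> M" using w f by auto
    \<comment> \<open>With \<open>z\<close> closer than \<open>r / 4\<close> and
      \<open>r / 4 < q < r / 2\<close>, the ball of radius \<open>q\<close> about \<open>z\<close>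
      contains \<open>f \<omega>\<close> and stays within distance \<open>q + r / 4 < r\<close> of
      it.\<close>
    obtain q where q: "q \<in> \<rat>" "r / 4 < q" "q < r / 2"
      using Rats_dense_in_real[of "r/4" "r/2"] r by auto
    obtain z where z: "z \<in> Z" "d (f \<omega>) z < r / 4" using Z(3)[OF fM, of "r/4"] r by auto
    have "mball z q \<subseteq> mball (f \<omega>) r"
    proof
      fix y assume y: "y \<in> mball z q"
      then have "d (f \<omega>) y \<le> d (f \<omega>) z + d z y" using triangle fM by auto
      then show "y \<in> mball (f \<omega>) r" using y z q fM by auto
    qed
    then have "(z, q) \<in> I" using z q r by (auto simp: I_def)
    then show "\<omega> \<in> (\<Union>(z, q)\<in>I. {\<omega> \<in> space N. d (f \<omega>) z < q})" using z q w by force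
  next
    fix \<omega> assume "\<omega> \<in> (\<Union>(z, q)\<in>I. {\<omega> \<in> space N. d (f \<omega>) z < q})"
    then obtain z q where "(z, q) \<in> I" "\<omega> \<in> space N" "d (f \<omega>) z < q" by auto
    then show "\<omega> \<in> f -` U \<inter> space N" using f Z(2) by (fastforce simp: I_def commute)
  qed
  also have "\<dots> \<in> sets N"
  proof -
    have "{\<omega> \<in> space N. d (f \<omega>) z < q} \<in> sets N" if "(z, q) \<in> I" for z q
    proof -
      have z: "z \<in> M" using that Z(2) unfolding I_def by auto
      note [measurable] = meas[OF z]
      show ?thesis by simp
    qed
    then show ?thesis by (intro sets.countable_UN'[OF I]) auto
  qed
  finally show "f -` U \<inter> space N \<in> sets N" .
qed (use f in auto)

text \<open>Separability stands in for joint measurability of the metric on the product: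
  \<open>d (f \<omega>) (g \<omega>) < c\<close> holds exactly if some point of a countable dense
  set witnesses it through the triangle inequality.\<close>

lemma measurable_dist:
  assumes tb: "mtotally_bounded M" and f: "f \<in> N \<rightarrow>\<^sub>M borel_met M d" and g: "g \<in> N \<rightarrow>\<^sub>M borel_met M d"
  shows "(\<lambda>\<omega>. d (f \<omega>) (g \<omega>)) \<in> borel_measurable N"
proof (rule borel_measurable_iff_less[THEN iffD2], rule allI)
  fix c :: real
  obtain Z where Z: "countable Z" "Z \<subseteq> M" "\<And>x e. x \<in> M \<Longrightarrow> e > 0 \<Longrightarrow> \<exists>z\<in>Z. d x z < e"
    using countable_dense_ex[OF tb] by blast
  have fM: "f \<omega> \<in> M" "g \<omega> \<in> M" if "\<omega> \<in> space N" for \<omega>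
    using measurable_space[OF f that] measurable_space[OF g that] by auto
  have "{\<omega> \<in> space N. d (f \<omega>) (g \<omega>) < c} = (\<Union>z\<in>Z. {\<omega> \<in> space N. d (f \<omega>) z + d (g \<omega>) z < c})"
  proof safe
    fix \<omega> assume w: "\<omega> \<in> space N" "d (f \<omega>) (g \<omega>) < c"
    then obtain z where z: "z \<in> Z" "d (f \<omega>) z < (c - d (f \<omega>) (g \<omega>)) / 2"
      using Z(3)[OF fM(1)[OF w(1)], of "(c - d (f \<omega>) (g \<omega>)) / 2"] by auto
    have "d (g \<omega>) z \<le> d (g \<omega>) (f \<omega>) + d (f \<omega>) z"
      using triangle fM w z Z(2) by blast
    then have "d (f \<omega>) z + d (g \<omega>) z < c" using z commute[of "g \<omega>" "f \<omega>"] by (simp add: field_simps)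
    then show "\<omega> \<in> (\<Union>z\<in>Z. {\<omega> \<in> space N. d (f \<omega>) z + d (g \<omega>) z < c})" using w z by auto
  next
    fix \<omega> z assume w: "\<omega> \<in> space N" "z \<in> Z" "d (f \<omega>) z + d (g \<omega>) z < c"
    have "d (f \<omega>) (g \<omega>) \<le> d (f \<omega>) z + d z (g \<omega>)" using triangle fM w Z(2) by blast
    then show "d (f \<omega>) (g \<omega>) < c" using w by (simp add: commute)
  qed
  also have "\<dots> \<in> sets N"
  proof (rule sets.countable_UN'[OF Z(1)], rule image_subsetI)
    fix z assume "z \<in> Z"
    then have z: "z \<in> M" using Z by auto
    note [measurable] = measurable_compose[OF f dist_borel_measurable[OF z]]
      measurable_compose[OF g dist_borel_measurable[OF z]]
    show "{\<omega> \<in> space N. d (f \<omega>) z + d (g \<omega>) z < c} \<in> sets N" by simp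
  qed
  finally show "{\<omega> \<in> space N. d (f \<omega>) (g \<omega>) < c} \<in> sets N" .
qed

end

section \<open>Cubes\<close>

lemma cube_sets [measurable]: "cube L \<in> sets (borel :: (real ^ 'n) measure)"
proof -
  have "cube L = (\<Inter>i\<in>UNIV. {u::real^'n. 0 \<le> u $ i} \<inter> {u. u $ i < L})" by (auto simp: cube_def)
  also have "\<dots> \<in> sets borel"
    by (intro sets.finite_INT) auto
  finally show ?thesis .
qed

text \<open>The half-open cube lies between an open and a closed box of equal volume.\<close>

lemma emeasure_cube:
  assumes "0 \<le> L"
  shows "emeasure lborel (cube L :: (real ^ 'n) set) = ennreal (L ^ CARD('n))"
proof (rule antisym)
  let ?V = "(\<chi> i. L) :: real ^ 'n"
  have inner: "(\<chi> i. L) \<bullet> b = L" if "b \<in> Basis" for b :: "real ^ 'n"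
    using that by (auto simp: Basis_vec_def inner_axis)
  have P: "(\<Prod>b\<in>Basis. (?V - 0) \<bullet> b) = L ^ CARD('n)"
    by (simp add: inner)
  have "emeasure lborel (cube L :: (real ^ 'n) set) \<le> emeasure lborel (cbox 0 ?V)"
    by (intro emeasure_mono) (auto simp: cube_def mem_box_cart less_imp_le)
  also have "\<dots> = ennreal (L ^ CARD('n))"
    using assms P by (subst emeasure_lborel_cbox) (auto simp: inner)
  finally show "emeasure lborel (cube L :: (real ^ 'n) set) \<le> ennreal (L ^ CARD('n))" .
  have "ennreal (L ^ CARD('n)) = emeasure lborel (box 0 ?V)"
    using assms P by (subst emeasure_lborel_box) (auto simp: inner)
  also have "\<dots> \<le> emeasure lborel (cube L :: (real ^ 'n) set)"
    by (intro emeasure_mono) (auto simp: cube_def mem_box_cart less_imp_le)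
  finally show "ennreal (L ^ CARD('n)) \<le> emeasure lborel (cube L :: (real ^ 'n) set)" .
qed

lemma measure_cube: "0 \<le> L \<Longrightarrow> measure lborel (cube L :: (real ^ 'n) set) = L ^ CARD('n)"
  by (simp add: emeasure_cube measure_def)

lemma norm_le_cube:
  fixes u :: "real ^ 'n"
  assumes "u \<in> cube L"
  shows "norm u \<le> real CARD('n) * L"
proof -
  have "norm u \<le> (\<Sum>i\<in>UNIV. \<bar>u $ i\<bar>)" by (rule norm_le_l1_cart)
  also have "\<dots> \<le> (\<Sum>i\<in>(UNIV::'n set). L)"
    using assms by (intro sum_mono) (auto simp: cube_def less_imp_le)
  finally show ?thesis by simp
qed

text \<open>Indexes the cells of side \<open>L\<close> that tile the cube of side
  \<open>k * L\<close>; the cell of index \<open>j\<close> has its corner at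
  \<open>L *\<^sub>R rvec j\<close>.\<close>

definition ibox :: "nat \<Rightarrow> (int ^ 'n) set" where
  "ibox k = {j. \<forall>i. 0 \<le> j $ i \<and> j $ i < int k}"

definition rvec :: "int ^ 'n \<Rightarrow> real ^ 'n" where
  "rvec j = (\<chi> i. of_int (j $ i))"

definition fvec :: "real ^ 'n \<Rightarrow> int ^ 'n" where
  "fvec u = (\<chi> i. \<lfloor>u $ i\<rfloor>)"

lemma rvec_nth [simp]: "rvec j $ i = of_int (j $ i)" by (simp add: rvec_def)
lemma fvec_nth [simp]: "fvec u $ i = \<lfloor>u $ i\<rfloor>" by (simp add: fvec_def)

lemma finite_card_int_box:
  fixes a b :: int
  assumes "a \<le> b"
  shows "finite {j :: int ^ 'n. \<forall>i. a \<le> j $ i \<and> j $ i < b}"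
    and "card {j :: int ^ 'n. \<forall>i. a \<le> j $ i \<and> j $ i < b} = nat (b - a) ^ CARD('n)"
proof -
  let ?S = "{j :: int ^ 'n. \<forall>i. a \<le> j $ i \<and> j $ i < b}"
  have bij: "bij_betw vec_nth ?S (Pi\<^sub>E UNIV (\<lambda>_. {a..<b}))"
    by (rule bij_betw_byWitness[where f' = "\<lambda>f. \<chi> i. f i"]) (auto simp: vec_eq_iff)
  have "finite (Pi\<^sub>E (UNIV :: 'n set) (\<lambda>_. {a..<b}))" by (intro finite_PiE) auto
  then show "finite ?S" using bij_betw_finite[OF bij] by simp
  show "card ?S = nat (b - a) ^ CARD('n)"
    using bij_betw_same_card[OF bij] by (simp add: card_PiE)
qed

lemma finite_ibox [simp]: "finite (ibox k :: (int ^ 'n) set)"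
  unfolding ibox_def by (rule finite_card_int_box) simp

lemma card_ibox [simp]: "card (ibox k :: (int ^ 'n) set) = k ^ CARD('n)"
  unfolding ibox_def by (subst finite_card_int_box) simp_all

text \<open>Among all translates of the cube by \<open>L *\<^sub>R rvec j\<close> exactly one
  contains \<open>u\<close>, with \<open>j\<close> the coordinatewise floor of \<open>u / L\<close>.
  Half-open cubes make the tiling exact, without null sets.\<close>

lemma cube_decomp:
  fixes u :: "real ^ 'n"
  assumes "L > 0"
  shows "u \<in> cube (real k * L) \<longleftrightarrow> (\<exists>j\<in>ibox k. u - L *\<^sub>R rvec j \<in> cube L)"
    and "j \<noteq> j' \<Longrightarrow> u - L *\<^sub>R rvec j \<in> cube L \<Longrightarrow> u - L *\<^sub>R rvec j' \<notin> cube L"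
proof -
  have eq: "u - L *\<^sub>R rvec j \<in> cube L \<longleftrightarrow> j = fvec (u /\<^sub>R L)" for j
  proof -
    have "(0 \<le> u $ i - L * real_of_int (j $ i) \<and> u $ i - L * real_of_int (j $ i) < L) \<longleftrightarrow> j $ i = \<lfloor>u $ i / L\<rfloor>" for i
    proof -
      have "(0 \<le> u $ i - L * real_of_int (j $ i) \<and> u $ i - L * real_of_int (j $ i) < L)
         \<longleftrightarrow> of_int (j $ i) \<le> u $ i / L \<and> u $ i / L < of_int (j $ i) + 1"
        using assms by (auto simp: field_simps)
      also have "\<dots> \<longleftrightarrow> j $ i = \<lfloor>u $ i / L\<rfloor>" by (metis floor_eq_iff)
      finally show ?thesis .
    qed
    then show ?thesis by (auto simp: cube_def vec_eq_iff divide_inverse mult.commute)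
  qed
  show "j \<noteq> j' \<Longrightarrow> u - L *\<^sub>R rvec j \<in> cube L \<Longrightarrow> u - L *\<^sub>R rvec j' \<notin> cube L"
    unfolding eq by simp
  have "u \<in> cube (real k * L) \<longleftrightarrow> fvec (u /\<^sub>R L) \<in> ibox k"
  proof -
    have "(0 \<le> u $ i \<and> u $ i < real k * L) \<longleftrightarrow> 0 \<le> \<lfloor>u $ i / L\<rfloor> \<and> \<lfloor>u $ i / L\<rfloor> < int k" for i
      using assms by (auto simp: floor_less_iff le_floor_iff field_simps zero_le_divide_iff)
    then show ?thesis by (auto simp: cube_def ibox_def divide_inverse mult.commute)
  qed
  then show "u \<in> cube (real k * L) \<longleftrightarrow> (\<exists>j\<in>ibox k. u - L *\<^sub>R rvec j \<in> cube L)"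
    unfolding eq by auto
qed

lemma indicator_cube_decomp:
  fixes u :: "real ^ 'n"
  assumes "L > 0"
  shows "(indicator (cube (real k * L)) u :: real) = (\<Sum>j\<in>ibox k. indicator (cube L) (u - L *\<^sub>R rvec j))"
proof (cases "u \<in> cube (real k * L)")
  case True
  then obtain j where j: "j \<in> ibox k" "u - L *\<^sub>R rvec j \<in> cube L" using cube_decomp(1)[OF assms] by auto
  have "(\<Sum>j\<in>ibox k. indicator (cube L) (u - L *\<^sub>R rvec j) :: real) = (\<Sum>j'\<in>ibox k. if j' = j then 1 else 0)"
    using j cube_decomp(2)[OF assms, of j _ u] by (intro sum.cong refl) (auto simp: indicator_def)
  then show ?thesis using True j by simp
next
  case False
  then show ?thesis using cube_decomp(1)[OF assms, of u k] by (auto intro!: sum.neutral[symmetric])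
qed

text \<open>Splitting the indicator over the tiles reduces the claim to translation invariance of
  Lebesgue measure.\<close>

lemma set_integral_cube_decomp:
  fixes g :: "real ^ 'n \<Rightarrow> real"
  assumes L: "L > 0" and g: "set_integrable lborel (cube (real k * L)) g"
  shows "(LINT u:cube (real k * L)|lborel. g u) = (\<Sum>j\<in>ibox k. LINT u:cube L|lborel. g (u + L *\<^sub>R rvec j))"
    and "j \<in> ibox k \<Longrightarrow> set_integrable lborel (cube L) (\<lambda>u. g (u + L *\<^sub>R rvec j))"
proof -
  have int: "integrable lborel (\<lambda>u. indicator (cube L) (u - L *\<^sub>R rvec j) * g u)" if "j \<in> ibox k" for j
  proof -
    have m: "(\<lambda>u. u - L *\<^sub>R rvec j) -` cube L \<in> sets (lborel :: (real ^ 'n) measure)"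
    proof -
      have "(\<lambda>u. u - L *\<^sub>R rvec j) \<in> borel_measurable (borel :: (real ^ 'n) measure)" by simp
      from measurable_sets[OF this cube_sets] show ?thesis by simp
    qed
    have "(\<lambda>u. u - L *\<^sub>R rvec j) -` cube L \<subseteq> cube (real k * L)"
      using cube_decomp(1)[OF L] that by auto
    then have "set_integrable lborel ((\<lambda>u. u - L *\<^sub>R rvec j) -` cube L) g"
      by (rule set_integrable_subset[OF g m])
    then show ?thesis unfolding set_integrable_def by (simp add: indicator_def[abs_def])
  qed
  have eq: "(\<lambda>u. indicator (cube L) (L *\<^sub>R rvec j + u - L *\<^sub>R rvec j) * g (L *\<^sub>R rvec j + u))
         = (\<lambda>u. indicator (cube L) u *\<^sub>R g (u + L *\<^sub>R rvec j))" for j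
    by (simp add: add.commute)
  show "set_integrable lborel (cube L) (\<lambda>u. g (u + L *\<^sub>R rvec j))" if "j \<in> ibox k" for j
  proof -
    have "integrable (distr lborel borel ((+) (L *\<^sub>R rvec j))) (\<lambda>u. indicator (cube L) (u - L *\<^sub>R rvec j) * g u)"
      using int[OF that] by (simp add: lborel_distr_plus)
    then have "integrable lborel (\<lambda>u. indicator (cube L) (L *\<^sub>R rvec j + u - L *\<^sub>R rvec j) * g (L *\<^sub>R rvec j + u))"
      by (rule integrable_distr[rotated]) simp
    then show ?thesis by (simp only: eq set_integrable_def)
  qed
  have "(LINT u:cube (real k * L)|lborel. g u) = (LINT u|lborel. (\<Sum>j\<in>ibox k. indicator (cube L) (u - L *\<^sub>R rvec j) * g u))"
    unfolding set_lebesgue_integral_def by (simp add: indicator_cube_decomp[OF L] sum_distrib_right)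
  also have "\<dots> = (\<Sum>j\<in>ibox k. LINT u|lborel. indicator (cube L) (u - L *\<^sub>R rvec j) * g u)"
    by (intro Bochner_Integration.integral_sum int)
  also have "\<dots> = (\<Sum>j\<in>ibox k. LINT u:cube L|lborel. g (u + L *\<^sub>R rvec j))"
  proof (intro sum.cong refl)
    fix j :: "int ^ 'n" assume "j \<in> ibox k"
    have "(LINT u|lborel. indicator (cube L) (u - L *\<^sub>R rvec j) * g u)
       = (\<integral>u. indicator (cube L) (u - L *\<^sub>R rvec j) * g u \<partial>distr lborel borel ((+) (L *\<^sub>R rvec j)))"
      by (simp add: lborel_distr_plus)
    also have "\<dots> = (LINT u|lborel. indicator (cube L) (L *\<^sub>R rvec j + u - L *\<^sub>R rvec j) * g (L *\<^sub>R rvec j + u))"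
      using borel_measurable_integrable[OF int[OF \<open>j \<in> ibox k\<close>]] by (intro integral_distr) auto
    finally show "(LINT u|lborel. indicator (cube L) (u - L *\<^sub>R rvec j) * g u) = (LINT u:cube L|lborel. g (u + L *\<^sub>R rvec j))"
      by (simp only: eq set_lebesgue_integral_def)
  qed
  finally show "(LINT u:cube (real k * L)|lborel. g u) = (\<Sum>j\<in>ibox k. LINT u:cube L|lborel. g (u + L *\<^sub>R rvec j))" .
qed

section \<open>Finite kernels and their mutual information\<close>

text \<open>A Markov kernel into a finite alphabet: \<open>w b x\<close> is the conditional
  probability of the output \<open>b\<close> given the input \<open>x\<close>.\<close>

definition kernel :: "'a measure \<Rightarrow> 'b set \<Rightarrow> ('b \<Rightarrow> 'a \<Rightarrow> real) \<Rightarrow> bool" where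
  "kernel \<mu> B w \<longleftrightarrow> finite B \<and> (\<forall>b\<in>B. w b \<in> borel_measurable \<mu> \<and> (\<forall>x\<in>space \<mu>. 0 \<le> w b x)) \<and>
     (\<forall>x\<in>space \<mu>. (\<Sum>b\<in>B. w b x) = 1)"

definition marg :: "'a measure \<Rightarrow> ('b \<Rightarrow> 'a \<Rightarrow> real) \<Rightarrow> 'b \<Rightarrow> real" where
  "marg \<mu> w b = (\<integral>x. w b x \<partial>\<mu>)"

text \<open>The mutual information, in bits, of input and output of the kernel: the Kullback-Leibler
  divergence of their joint law from the product of its marginals, with
  \<open>w b x / marg \<mu> w b\<close> as density. No joint probability space has to be
  built.\<close>

definition rate :: "'a measure \<Rightarrow> 'b set \<Rightarrow> ('b \<Rightarrow> 'a \<Rightarrow> real) \<Rightarrow> real" where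
  "rate \<mu> B w = (\<Sum>b\<in>B. \<integral>x. w b x * log 2 (w b x / marg \<mu> w b) \<partial>\<mu>)"

lemma kernelD:
  assumes "kernel \<mu> B w"
  shows "finite B" "b \<in> B \<Longrightarrow> w b \<in> borel_measurable \<mu>" "b \<in> B \<Longrightarrow> x \<in> space \<mu> \<Longrightarrow> 0 \<le> w b x"
    "x \<in> space \<mu> \<Longrightarrow> (\<Sum>b\<in>B. w b x) = 1" "b \<in> B \<Longrightarrow> x \<in> space \<mu> \<Longrightarrow> w b x \<le> 1"
proof -
  show *: "finite B" "b \<in> B \<Longrightarrow> w b \<in> borel_measurable \<mu>" "b \<in> B \<Longrightarrow> x \<in> space \<mu> \<Longrightarrow> 0 \<le> w b x"
    "x \<in> space \<mu> \<Longrightarrow> (\<Sum>b\<in>B. w b x) = 1" for b x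
    using assms by (auto simp: kernel_def)
  show "w b x \<le> 1" if "b \<in> B" "x \<in> space \<mu>"
    using member_le_sum[of b B "\<lambda>b. w b x"] * that by auto
qed

text \<open>From \<open>ln s \<le> s - 1\<close> at \<open>s = 1 / t\<close>. It keeps the integrand
  of \<open>rate\<close> bounded.\<close>

lemma abs_mult_ln_le:
  fixes t :: real
  assumes "0 \<le> t" "t \<le> 1"
  shows "\<bar>t * ln t\<bar> \<le> 1"
proof (cases "t = 0")
  case False
  then have t: "t > 0" using assms by simp
  have "ln (1 / t) \<le> 1 / t - 1" using t by (intro ln_le_minus_one) auto
  then have "t * - ln t \<le> t * (1 / t - 1)" using t by (intro mult_left_mono) (auto simp: ln_div)
  also have "\<dots> \<le> 1" using t by (simp add: field_simps)
  finally show ?thesis using t assms ln_le_zero_iff[of t] by (simp add: abs_mult)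
qed auto

context prob_space
begin

lemma kernel_integrable: "kernel M B w \<Longrightarrow> b \<in> B \<Longrightarrow> integrable M (w b)"
  by (rule integrable_const_bound[of _ 1]) (auto simp: kernelD)

lemma marg_nonneg: "kernel M B w \<Longrightarrow> b \<in> B \<Longrightarrow> 0 \<le> marg M w b"
  unfolding marg_def by (rule Bochner_Integration.integral_nonneg) (auto simp: kernelD)

lemma sum_marg: "kernel M B w \<Longrightarrow> (\<Sum>b\<in>B. marg M w b) = 1"
proof -
  assume k: "kernel M B w"
  have "(\<Sum>b\<in>B. marg M w b) = (\<integral>x. (\<Sum>b\<in>B. w b x) \<partial>M)"
    unfolding marg_def using kernel_integrable[OF k] by (subst Bochner_Integration.integral_sum) auto
  also have "\<dots> = (\<integral>x. 1 \<partial>M)" by (rule Bochner_Integration.integral_cong) (auto simp: kernelD[OF k])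
  finally show ?thesis by (simp add: prob_space)
qed

text \<open>A nonnegative function with integral zero vanishes almost everywhere. So the quotient in
  \<open>rate\<close> has a positive denominator wherever its weight is positive, and the value
  assigned to a division by zero does not distort the rate.\<close>

lemma kernel_AE_marg_pos:
  assumes "kernel M B w"
  shows "AE x in M. \<forall>b\<in>B. w b x > 0 \<longrightarrow> marg M w b > 0"
proof (rule AE_finite_allI[OF kernelD(1)[OF assms]])
  fix b assume b: "b \<in> B"
  show "AE x in M. w b x > 0 \<longrightarrow> marg M w b > 0"
  proof (cases "marg M w b = 0")
    case True
    then have "AE x in M. w b x = 0"
      using integral_nonneg_eq_0_iff_AE[OF kernel_integrable[OF assms b]] kernelD(3)[OF assms b]
      by (auto simp: marg_def)
    then show ?thesis by eventually_elim auto
  next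
    case False
    then show ?thesis using marg_nonneg[OF assms b] by auto
  qed
qed

lemma rate_integrable:
  assumes k: "kernel M B w" and b: "b \<in> B"
  shows "integrable M (\<lambda>x. w b x * log 2 (w b x / marg M w b))"
proof (rule integrable_const_bound)
  let ?p = "marg M w b"
  note [measurable] = kernelD(2)[OF k b]
  show "(\<lambda>x. w b x * log 2 (w b x / ?p)) \<in> borel_measurable M" by measurable
  show "AE x in M. norm (w b x * log 2 (w b x / ?p)) \<le> (1 + \<bar>ln ?p\<bar>) / ln 2"
  proof (rule AE_I2)
    fix x assume x: "x \<in> space M"
    have w: "0 \<le> w b x" "w b x \<le> 1" using kernelD[OF k] b x by auto
    show "norm (w b x * log 2 (w b x / ?p)) \<le> (1 + \<bar>ln ?p\<bar>) / ln 2"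
    proof (cases "w b x = 0 \<or> ?p = 0")
      \<comment> \<open>If \<open>w b x\<close> is zero, the product vanishes; if the marginal is
        zero, so are the quotient and, by convention, its logarithm.\<close>
      case True
      then show ?thesis by (auto simp: log_def)
    next
      case False
      then have "\<bar>w b x * ln (w b x / ?p)\<bar> = \<bar>w b x * ln (w b x) - w b x * ln ?p\<bar>"
        using w marg_nonneg[OF k b] by (simp add: ln_div algebra_simps)
      also have "\<dots> \<le> \<bar>w b x * ln (w b x)\<bar> + w b x * \<bar>ln ?p\<bar>" using w by (simp add: abs_mult abs_triangle_ineq4[THEN order_trans])
      also have "\<dots> \<le> 1 + 1 * \<bar>ln ?p\<bar>" by (intro add_mono abs_mult_ln_le mult_right_mono w) auto
      finally show ?thesis by (simp add: log_def abs_mult divide_right_mono)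
    qed
  qed
qed

end

text \<open>The pointwise form of the Donsker--Varadhan inequality, from \<open>ln t \<ge> 1 - 1 / t\<close>.\<close>

lemma log_ratio_ge:
  fixes w p c :: real
  assumes "0 \<le> w" "0 \<le> p" "0 \<le> c" "w > 0 \<longrightarrow> p > 0 \<and> c > 0"
  shows "w * log 2 c + (w - p * c) / ln 2 \<le> w * log 2 (w / p)"
proof (cases "w = 0")
  case True
  then show ?thesis using assms by (simp add: field_simps)
next
  case False
  then have w: "w > 0" "p > 0" "c > 0" using assms by auto
  have "ln (p * c / w) \<le> p * c / w - 1" using w by (intro ln_le_minus_one) auto
  then have "w * ln (p * c / w) \<le> w * (p * c / w - 1)" using w by (intro mult_left_mono) auto
  also have "\<dots> = p * c - w" using w by (simp add: field_simps)
  finally have "w * ln c + (w - p * c) \<le> w * ln (w / p)"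
    using w by (simp add: ln_div ln_mult algebra_simps)
  then have "(w * ln c + (w - p * c)) / ln 2 \<le> (w * ln (w / p)) / ln 2" by (intro divide_right_mono) auto
  then show ?thesis by (simp add: log_def add_divide_distrib)
qed

context prob_space
begin

text \<open>The Donsker-Varadhan inequality: a nonnegative test function \<open>c\<close> bounds the
  rate from below, with a correction that is nonnegative as soon as \<open>c\<close> has mean at
  most 1 under the product of the marginals. It is applied with \<open>c = 1\<close> for
  nonnegativity, with the density of a coarsened pair for data processing, and with an exponential
  of the distortion for the lower bound.\<close>

lemma rate_ge:
  assumes k: "kernel M B w"
    and c: "\<And>b. b \<in> B \<Longrightarrow> integrable M (c b)" "\<And>b x. b \<in> B \<Longrightarrow> x \<in> space M \<Longrightarrow> 0 \<le> c b x"
    and i: "\<And>b. b \<in> B \<Longrightarrow> integrable M (\<lambda>x. w b x * log 2 (c b x))"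
    and pos: "AE x in M. \<forall>b\<in>B. w b x > 0 \<longrightarrow> c b x > 0"
  shows "(\<Sum>b\<in>B. \<integral>x. w b x * log 2 (c b x) \<partial>M) + (1 - (\<Sum>b\<in>B. marg M w b * (\<integral>x. c b x \<partial>M))) / ln 2 \<le> rate M B w"
proof -
  have "(\<Sum>b\<in>B. \<integral>x. w b x * log 2 (c b x) \<partial>M) + (1 - (\<Sum>b\<in>B. marg M w b * (\<integral>x. c b x \<partial>M))) / ln 2
      = (\<Sum>b\<in>B. (\<integral>x. w b x * log 2 (c b x) \<partial>M) + (marg M w b - marg M w b * (\<integral>x. c b x \<partial>M)) / ln 2)"
    by (simp add: sum.distrib sum_marg[OF k] sum_subtractf flip: sum_divide_distrib)
  also have "\<dots> \<le> rate M B w"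
    unfolding rate_def
  proof (rule sum_mono)
    fix b assume b: "b \<in> B"
    have "(\<integral>x. w b x * log 2 (c b x) \<partial>M) + (marg M w b - marg M w b * (\<integral>x. c b x \<partial>M)) / ln 2
       = (\<integral>x. w b x * log 2 (c b x) + (w b x - marg M w b * c b x) / ln 2 \<partial>M)"
      using b i c(1) kernel_integrable[OF k] by (simp add: marg_def)
    also have "\<dots> \<le> (\<integral>x. w b x * log 2 (w b x / marg M w b) \<partial>M)"
    proof (rule integral_mono_AE)
      show "integrable M (\<lambda>x. w b x * log 2 (c b x) + (w b x - marg M w b * c b x) / ln 2)"
        using b i c(1) kernel_integrable[OF k] by simp
      show "AE x in M. w b x * log 2 (c b x) + (w b x - marg M w b * c b x) / ln 2 \<le> w b x * log 2 (w b x / marg M w b)"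
        using pos kernel_AE_marg_pos[OF k] AE_space
      proof eventually_elim
        case (elim x)
        then show ?case using b c(2) kernelD(3)[OF k] marg_nonneg[OF k]
          by (intro log_ratio_ge) auto
      qed
    qed (rule rate_integrable[OF k b])
    finally show "(\<integral>x. w b x * log 2 (c b x) \<partial>M) + (marg M w b - marg M w b * (\<integral>x. c b x \<partial>M)) / ln 2 \<le> (\<integral>x. w b x * log 2 (w b x / marg M w b) \<partial>M)" .
  qed
  finally show ?thesis .
qed

section \<open>Entropy and mutual information of simple functions\<close>

lemma simple_fun_sets:
  assumes "simple_function M q"
  shows "{x \<in> space M. q x = a} \<in> sets M"
proof -
  have "{x \<in> space M. q x = a} = q -` {a} \<inter> space M" by auto
  then show ?thesis using simple_functionD(2)[OF assms] by simp
qed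

lemma integral_simple_mult:
  fixes f :: "'c \<Rightarrow> real" and g :: "'a \<Rightarrow> real"
  assumes q: "simple_function M q" and A: "finite A" "q ` space M \<subseteq> A" and g: "integrable M g"
  shows "(\<integral>x. f (q x) * g x \<partial>M) = (\<Sum>a\<in>A. f a * (\<integral>x. indicator {x \<in> space M. q x = a} x * g x \<partial>M))"
    and "integrable M (\<lambda>x. f (q x) * g x)"
proof -
  have i: "integrable M (\<lambda>x. f a * (indicator {x \<in> space M. q x = a} x * g x))" for a
    using integrable_mult_indicator[OF simple_fun_sets[OF q, of a] g] by simp
  have eq: "f (q x) * g x = (\<Sum>a\<in>A. f a * (indicator {x \<in> space M. q x = a} x * g x))" if "x \<in> space M" for x
  proof -
    have "(\<Sum>a\<in>A. f a * (indicator {x \<in> space M. q x = a} x * g x)) = (\<Sum>a\<in>A. if a = q x then f a * g x else 0)"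
      using that by (intro sum.cong) (auto simp: indicator_def)
    also have "\<dots> = f (q x) * g x" using that A by auto
    finally show ?thesis by simp
  qed
  have "(\<integral>x. f (q x) * g x \<partial>M) = (\<integral>x. (\<Sum>a\<in>A. f a * (indicator {x \<in> space M. q x = a} x * g x)) \<partial>M)"
    by (intro Bochner_Integration.integral_cong refl eq)
  also have "\<dots> = (\<Sum>a\<in>A. f a * (\<integral>x. indicator {x \<in> space M. q x = a} x * g x \<partial>M))"
    using i by (subst Bochner_Integration.integral_sum) auto
  finally show "(\<integral>x. f (q x) * g x \<partial>M) = (\<Sum>a\<in>A. f a * (\<integral>x. indicator {x \<in> space M. q x = a} x * g x \<partial>M))" .
  have "integrable M (\<lambda>x. \<Sum>a\<in>A. f a * (indicator {x \<in> space M. q x = a} x * g x))"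
    using i by auto
  then show "integrable M (\<lambda>x. f (q x) * g x)"
    by (subst Bochner_Integration.integrable_cong[OF refl eq]) auto
qed

lemma integral_simple:
  fixes f :: "'c \<Rightarrow> real"
  assumes q: "simple_function M q" and A: "finite A" "q ` space M \<subseteq> A"
  shows "(\<integral>x. f (q x) \<partial>M) = (\<Sum>a\<in>A. f a * prob {x \<in> space M. q x = a})"
    and "integrable M (\<lambda>x. f (q x))"
proof -
  have "(\<integral>x. indicator {x \<in> space M. q x = a} x * 1 \<partial>M) = prob {x \<in> space M. q x = a}" for a
    using simple_fun_sets[OF q, of a] by simp
  then show "(\<integral>x. f (q x) \<partial>M) = (\<Sum>a\<in>A. f a * prob {x \<in> space M. q x = a})"
    using integral_simple_mult(1)[OF q A, of "\<lambda>_. 1" f] by simp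
  show "integrable M (\<lambda>x. f (q x))"
    using integral_simple_mult(2)[OF q A, of "\<lambda>_. 1" f] by simp
qed

lemma shannon_entropy_sum:
  assumes X: "simple_function M X" and A: "finite A" "X ` space M \<subseteq> A"
  shows "shannon_entropy M X = - (\<Sum>a\<in>A. prob {x \<in> space M. X x = a} * log 2 (prob {x \<in> space M. X x = a}))"
proof -
  have eq: "X -` {a} \<inter> space M = {x \<in> space M. X x = a}" for a by auto
  have "(\<Sum>a\<in>X ` space M. prob {x \<in> space M. X x = a} * log 2 (prob {x \<in> space M. X x = a}))
      = (\<Sum>a\<in>A. prob {x \<in> space M. X x = a} * log 2 (prob {x \<in> space M. X x = a}))"
  proof (rule sum.mono_neutral_left[OF A], intro ballI)
    fix a assume "a \<in> A - X ` space M"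
    then have "{x \<in> space M. X x = a} = {}" by auto
    then show "prob {x \<in> space M. X x = a} * log 2 (prob {x \<in> space M. X x = a}) = 0" by (simp only: measure_empty mult_zero_left)
  qed
  then show ?thesis using shannon_entropy_eq[OF prob_space_axioms X] by (simp add: eq)
qed

lemma prob_simple_sum:
  assumes Y: "simple_function M Y" and X: "simple_function M X" and B: "finite B" "Y ` space M \<subseteq> B"
  shows "prob {x \<in> space M. X x = a} = (\<Sum>b\<in>B. prob {x \<in> space M. X x = a \<and> Y x = b})"
proof -
  have s: "{x \<in> space M. X x = a \<and> Y x = b} \<in> sets M" for b
    using sets.Int[OF simple_fun_sets[OF X, of a] simple_fun_sets[OF Y, of b]]
    by (rule back_subst[of "\<lambda>A. A \<in> sets M"]) auto
  have "{x \<in> space M. X x = a} = (\<Union>b\<in>B. {x \<in> space M. X x = a \<and> Y x = b})" using B by auto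
  then have "prob {x \<in> space M. X x = a} = prob (\<Union>b\<in>B. {x \<in> space M. X x = a \<and> Y x = b})" by simp
  also have "\<dots> = (\<Sum>b\<in>B. prob {x \<in> space M. X x = a \<and> Y x = b})"
    using s by (intro finite_measure_finite_Union B) (auto simp: disjoint_family_on_def)
  finally show ?thesis .
qed

lemma finite_mutual_info_sum:
  assumes X: "simple_function M X" and A: "finite A" "X ` space M \<subseteq> A"
    and Y: "simple_function M Y" and B: "finite B" "Y ` space M \<subseteq> B"
  shows "finite_mutual_info M X Y = (\<Sum>a\<in>A. \<Sum>b\<in>B. prob {x \<in> space M. X x = a \<and> Y x = b} *
     log 2 (prob {x \<in> space M. X x = a \<and> Y x = b} / (prob {x \<in> space M. X x = a} * prob {x \<in> space M. Y x = b})))"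
proof -
  define r where "r a b = prob {x \<in> space M. X x = a \<and> Y x = b}" for a b
  have ra: "prob {x \<in> space M. X x = a} = (\<Sum>b\<in>B. r a b)" for a
    unfolding r_def by (rule prob_simple_sum[OF Y X B])
  have rb: "prob {x \<in> space M. Y x = b} = (\<Sum>a\<in>A. r a b)" for b
    using prob_simple_sum[OF X Y A, of b] by (simp add: r_def conj_commute)
  have r0: "r a b \<ge> 0" for a b by (simp add: r_def)
  have HX: "shannon_entropy M X = - (\<Sum>a\<in>A. \<Sum>b\<in>B. r a b * log 2 (\<Sum>b\<in>B. r a b))"
    using shannon_entropy_sum[OF X A] by (simp add: ra sum_distrib_right)
  have HY: "shannon_entropy M Y = - (\<Sum>a\<in>A. \<Sum>b\<in>B. r a b * log 2 (\<Sum>a\<in>A. r a b))"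
    using shannon_entropy_sum[OF Y B] by (simp add: rb sum_distrib_right) (rule sum.swap)
  have "simple_function M (\<lambda>x. (X x, Y x))" using X Y by auto
  moreover have "(\<lambda>x. (X x, Y x)) ` space M \<subseteq> A \<times> B" using A B by auto
  ultimately have HXY: "shannon_entropy M (\<lambda>x. (X x, Y x)) = - (\<Sum>a\<in>A. \<Sum>b\<in>B. r a b * log 2 (r a b))"
    using shannon_entropy_sum[of "\<lambda>x. (X x, Y x)" "A \<times> B"] A B
    by (simp add: sum.cartesian_product r_def case_prod_unfold prod_eq_iff)
  have "finite_mutual_info M X Y = (\<Sum>a\<in>A. \<Sum>b\<in>B. r a b * log 2 (r a b) - r a b * log 2 (\<Sum>b\<in>B. r a b) - r a b * log 2 (\<Sum>a\<in>A. r a b))"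
    unfolding finite_mutual_info_def HX HY HXY by (simp add: sum_subtractf)
  also have "\<dots> = (\<Sum>a\<in>A. \<Sum>b\<in>B. r a b * log 2 (r a b / ((\<Sum>b\<in>B. r a b) * (\<Sum>a\<in>A. r a b))))"
  proof (intro sum.cong refl)
    fix a b assume ab: "a \<in> A" "b \<in> B"
    show "r a b * log 2 (r a b) - r a b * log 2 (\<Sum>b\<in>B. r a b) - r a b * log 2 (\<Sum>a\<in>A. r a b)
        = r a b * log 2 (r a b / ((\<Sum>b\<in>B. r a b) * (\<Sum>a\<in>A. r a b)))"
    proof (cases "r a b = 0")
      case False
      then have p: "r a b > 0" using r0[of a b] by simp
      have "r a b \<le> (\<Sum>b\<in>B. r a b)" "r a b \<le> (\<Sum>a\<in>A. r a b)"
        using member_le_sum[OF ab(2), of "r a"] member_le_sum[OF ab(1), of "\<lambda>a. r a b"] r0 A B by auto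
      then have "(\<Sum>b\<in>B. r a b) > 0" "(\<Sum>a\<in>A. r a b) > 0" using p by auto
      then show ?thesis using p by (simp add: log_divide log_mult algebra_simps)
    qed simp
  qed
  finally show ?thesis by (simp add: ra rb r_def)
qed

end

text \<open>Data processing: \<open>(X, Y)\<close> has the law of the coarsening \<open>(q, g)\<close> of the kernel.\<close>

lemma finite_mutual_info_le_rate:
  assumes mu: "prob_space \<mu>" and P: "prob_space P" and k: "kernel \<mu> B w"
    and q: "simple_function \<mu> q" "finite A" "q ` space \<mu> \<subseteq> A"
    and g: "g ` B \<subseteq> E" "finite E"
    and X: "simple_function P X" "X ` space P \<subseteq> A" and Y: "simple_function P Y" "Y ` space P \<subseteq> E"
    and joint: "\<And>a e. a \<in> A \<Longrightarrow> e \<in> E \<Longrightarrow> measure P {x \<in> space P. X x = a \<and> Y x = e}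
       = (\<Sum>b\<in>{b \<in> B. g b = e}. \<integral>x. indicator {x \<in> space \<mu>. q x = a} x * w b x \<partial>\<mu>)"
  shows "finite_mutual_info P X Y \<le> rate \<mu> B w"
proof -
  interpret m: prob_space \<mu> by fact
  interpret P: prob_space P by fact
  define r where "r a e = measure P {x \<in> space P. X x = a \<and> Y x = e}" for a e
  define ra where "ra a = measure P {x \<in> space P. X x = a}" for a
  define re where "re e = measure P {x \<in> space P. Y x = e}" for e
  \<comment> \<open>The density of the coarsened pair relative to the product of its marginals; it
    depends on \<open>x\<close> and \<open>b\<close> only through \<open>q x\<close> and
    \<open>g b\<close>. It is the test function for \<open>rate_ge\<close>.\<close>
  define c where "c b x = r (q x) (g b) / (ra (q x) * re (g b))" for b x
  have fB: "finite B" using kernelD(1)[OF k] .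
  have nn: "r a e \<ge> 0" "ra a \<ge> 0" "re e \<ge> 0" for a e by (auto simp: r_def ra_def re_def)
  have ra_sum: "ra a = (\<Sum>e\<in>E. r a e)" for a
    unfolding ra_def r_def by (rule P.prob_simple_sum[OF Y(1) X(1) g(2) Y(2)])
  have re_sum: "re e = (\<Sum>a\<in>A. r a e)" for e
    using P.prob_simple_sum[OF X(1) Y(1) q(2) X(2), of e] by (simp add: r_def re_def conj_commute)
  have int_w: "integrable \<mu> (\<lambda>x. indicator {x \<in> space \<mu>. q x = a} x * w b x)" if "b \<in> B" for a b
    using integrable_mult_indicator[OF m.simple_fun_sets[OF q(1), of a] m.kernel_integrable[OF k that]] by simp
  have ra: "ra a = measure \<mu> {x \<in> space \<mu>. q x = a}" if "a \<in> A" for a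
  proof -
    have "ra a = (\<Sum>e\<in>E. \<Sum>b\<in>{b \<in> B. g b = e}. \<integral>x. indicator {x \<in> space \<mu>. q x = a} x * w b x \<partial>\<mu>)"
      unfolding ra_sum using that by (intro sum.cong refl) (simp add: r_def joint)
    also have "\<dots> = (\<Sum>b\<in>B. \<integral>x. indicator {x \<in> space \<mu>. q x = a} x * w b x \<partial>\<mu>)"
      by (rule sum.group[OF fB g(2,1)])
    also have "\<dots> = (\<integral>x. (\<Sum>b\<in>B. indicator {x \<in> space \<mu>. q x = a} x * w b x) \<partial>\<mu>)"
      using int_w by (subst Bochner_Integration.integral_sum) auto
    also have "\<dots> = (\<integral>x. indicator {x \<in> space \<mu>. q x = a} x \<partial>\<mu>)"
      by (intro Bochner_Integration.integral_cong refl) (simp add: kernelD(4)[OF k] flip: sum_distrib_left)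
    also have "\<dots> = measure \<mu> {x \<in> space \<mu>. q x = a}" using m.simple_fun_sets[OF q(1), of a] by simp
    finally show ?thesis .
  qed
  have re: "re e = (\<Sum>b\<in>{b \<in> B. g b = e}. marg \<mu> w b)" if "e \<in> E" for e
  proof -
    have "re e = (\<Sum>a\<in>A. \<Sum>b\<in>{b \<in> B. g b = e}. \<integral>x. indicator {x \<in> space \<mu>. q x = a} x * w b x \<partial>\<mu>)"
      unfolding re_sum using that by (intro sum.cong refl) (simp add: r_def joint)
    also have "\<dots> = (\<Sum>b\<in>{b \<in> B. g b = e}. \<Sum>a\<in>A. \<integral>x. indicator {x \<in> space \<mu>. q x = a} x * w b x \<partial>\<mu>)"
      by (rule sum.swap)
    also have "\<dots> = (\<Sum>b\<in>{b \<in> B. g b = e}. marg \<mu> w b)"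
      using m.integral_simple_mult(1)[OF q(1-3) m.kernel_integrable[OF k], of _ "\<lambda>_. 1"]
      by (intro sum.cong refl) (simp add: marg_def)
    finally show ?thesis .
  qed
  have qA: "q x \<in> A" if "x \<in> space \<mu>" for x using q(3) that by auto
  have gE: "g b \<in> E" if "b \<in> B" for b using g(1) that by auto
  have wlog: "(\<integral>x. w b x * log 2 (c b x) \<partial>\<mu>) = (\<Sum>a\<in>A. log 2 (r a (g b) / (ra a * re (g b))) * (\<integral>x. indicator {x \<in> space \<mu>. q x = a} x * w b x \<partial>\<mu>))"
     "integrable \<mu> (\<lambda>x. w b x * log 2 (c b x))" if "b \<in> B" for b
    using m.integral_simple_mult[OF q(1-3) m.kernel_integrable[OF k that], of "\<lambda>a. log 2 (r a (g b) / (ra a * re (g b)))"]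
    by (simp_all add: c_def mult.commute)
  have ic: "(\<integral>x. c b x \<partial>\<mu>) = (\<Sum>a\<in>A. r a (g b) / (ra a * re (g b)) * ra a)" "integrable \<mu> (c b)" if "b \<in> B" for b
    using m.integral_simple[OF q(1-3), of "\<lambda>a. r a (g b) / (ra a * re (g b))"]
    by (simp_all add: c_def[abs_def] ra)
  have "finite_mutual_info P X Y = (\<Sum>a\<in>A. \<Sum>e\<in>E. r a e * log 2 (r a e / (ra a * re e)))"
    unfolding r_def ra_def re_def by (rule P.finite_mutual_info_sum) (use assms in auto)
  also have "\<dots> = (\<Sum>a\<in>A. \<Sum>e\<in>E. \<Sum>b\<in>{b \<in> B. g b = e}. log 2 (r a (g b) / (ra a * re (g b))) * (\<integral>x. indicator {x \<in> space \<mu>. q x = a} x * w b x \<partial>\<mu>))"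
  proof (intro sum.cong refl)
    fix a e assume ae: "a \<in> A" "e \<in> E"
    have "r a e = (\<Sum>b\<in>{b \<in> B. g b = e}. \<integral>x. indicator {x \<in> space \<mu>. q x = a} x * w b x \<partial>\<mu>)"
      using joint[OF ae] by (simp add: r_def)
    then have "r a e * log 2 (r a e / (ra a * re e)) = (\<Sum>b\<in>{b \<in> B. g b = e}. \<integral>x. indicator {x \<in> space \<mu>. q x = a} x * w b x \<partial>\<mu>) * log 2 (r a e / (ra a * re e))" by simp
    also have "\<dots> = (\<Sum>b\<in>{b \<in> B. g b = e}. log 2 (r a (g b) / (ra a * re (g b))) * (\<integral>x. indicator {x \<in> space \<mu>. q x = a} x * w b x \<partial>\<mu>))"
      unfolding sum_distrib_right by (intro sum.cong refl) (auto simp: mult.commute)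
    finally show "r a e * log 2 (r a e / (ra a * re e)) = (\<Sum>b\<in>{b \<in> B. g b = e}. log 2 (r a (g b) / (ra a * re (g b))) * (\<integral>x. indicator {x \<in> space \<mu>. q x = a} x * w b x \<partial>\<mu>))" .
  qed
  also have "\<dots> = (\<Sum>b\<in>B. \<integral>x. w b x * log 2 (c b x) \<partial>\<mu>)"
  proof -
    have "(\<Sum>e\<in>E. \<Sum>b\<in>{b \<in> B. g b = e}. G b) = (\<Sum>b\<in>B. G b)" for G :: "'c \<Rightarrow> real"
      by (rule sum.group[OF fB g(2,1)])
    then show ?thesis by (simp only: wlog(1) cong: sum.cong) (rule sum.swap)
  qed
  finally have f1: "finite_mutual_info P X Y = (\<Sum>b\<in>B. \<integral>x. w b x * log 2 (c b x) \<partial>\<mu>)" .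
  have "(\<Sum>b\<in>B. marg \<mu> w b * (\<integral>x. c b x \<partial>\<mu>)) = (\<Sum>e\<in>E. \<Sum>b\<in>{b \<in> B. g b = e}. marg \<mu> w b * (\<Sum>a\<in>A. r a (g b) / (ra a * re (g b)) * ra a))"
    by (subst sum.group[OF fB g(2,1)]) (simp add: ic(1))
  also have "\<dots> = (\<Sum>e\<in>E. re e * (\<Sum>a\<in>A. r a e / (ra a * re e) * ra a))"
    by (intro sum.cong refl) (simp add: re sum_distrib_right)
  \<comment> \<open>An inequality is enough, and it covers the terms with a vanishing marginal,
    where division by zero makes the left side 0.\<close>
  also have "\<dots> \<le> (\<Sum>e\<in>E. \<Sum>a\<in>A. r a e)"
    unfolding sum_distrib_left by (intro sum_mono) (use nn in \<open>auto simp: divide_simps\<close>)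
  also have "\<dots> = (\<Sum>e\<in>E. re e)" by (simp add: re_sum)
  also have "\<dots> = (\<Sum>e\<in>E. \<Sum>b\<in>{b \<in> B. g b = e}. marg \<mu> w b)" by (simp add: re)
  also have "\<dots> = 1" using sum.group[OF fB g(2,1), of "marg \<mu> w"] m.sum_marg[OF k] by simp
  finally have f2: "(\<Sum>b\<in>B. marg \<mu> w b * (\<integral>x. c b x \<partial>\<mu>)) \<le> 1" .
  have c0: "c b x \<ge> 0" for b x by (simp add: c_def nn)
  \<comment> \<open>If the coarsened pair has probability 0 at \<open>(a, g b)\<close>, then the
    nonnegative \<open>w b\<close> has integral 0 over the cell of \<open>a\<close> and vanishes
    there almost everywhere.\<close>
  have "AE x in \<mu>. \<forall>b\<in>B. w b x > 0 \<longrightarrow> c b x > 0"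
  proof (rule AE_finite_allI[OF fB])
    fix b assume b: "b \<in> B"
    have "AE x in \<mu>. \<forall>a\<in>A. r a (g b) = 0 \<longrightarrow> indicator {x \<in> space \<mu>. q x = a} x * w b x = 0"
    proof (rule AE_finite_allI[OF q(2)])
      fix a assume a: "a \<in> A"
      show "AE x in \<mu>. r a (g b) = 0 \<longrightarrow> indicator {x \<in> space \<mu>. q x = a} x * w b x = 0"
      proof (cases "r a (g b) = 0")
        case True
        have "(\<integral>x. indicator {x \<in> space \<mu>. q x = a} x * w b' x \<partial>\<mu>) \<ge> 0" if "b' \<in> B" for b'
          using kernelD(3)[OF k that] by (intro Bochner_Integration.integral_nonneg) (auto simp: indicator_def)
        then have "\<forall>b'\<in>{b' \<in> B. g b' = g b}. (\<integral>x. indicator {x \<in> space \<mu>. q x = a} x * w b' x \<partial>\<mu>) = 0"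
          using True joint[OF a gE[OF b]] fB by (subst sum_nonneg_eq_0_iff[symmetric]) (auto simp: r_def)
        then have "(\<integral>x. indicator {x \<in> space \<mu>. q x = a} x * w b x \<partial>\<mu>) = 0" using b by auto
        then show ?thesis
          using integral_nonneg_eq_0_iff_AE[OF int_w[OF b, of a]] kernelD(3)[OF k b]
          by (auto simp: indicator_def)
      qed simp
    qed
    then show "AE x in \<mu>. w b x > 0 \<longrightarrow> c b x > 0"
      using AE_space
    proof eventually_elim
      case (elim x)
      show ?case
      proof
        assume "w b x > 0"
        then have "r (q x) (g b) \<noteq> 0" using elim qA by (auto simp: indicator_def)
        then have p: "r (q x) (g b) > 0" using nn(1)[of "q x" "g b"] by simp
        have "r (q x) (g b) \<le> ra (q x)" "r (q x) (g b) \<le> re (g b)"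
          unfolding ra_sum re_sum using nn qA elim(2) gE b g(2) q(2)
          by (auto intro!: member_le_sum[of "g b" E "r (q x)"] member_le_sum[of "q x" A "\<lambda>a. r a (g b)"])
        then show "c b x > 0" using p by (simp add: c_def)
      qed
    qed
  qed
  then have "(\<Sum>b\<in>B. \<integral>x. w b x * log 2 (c b x) \<partial>\<mu>) + (1 - (\<Sum>b\<in>B. marg \<mu> w b * (\<integral>x. c b x \<partial>\<mu>))) / ln 2 \<le> rate \<mu> B w"
    using wlog(2) ic(2) c0 by (intro m.rate_ge k) auto
  moreover have "(1 - (\<Sum>b\<in>B. marg \<mu> w b * (\<integral>x. c b x \<partial>\<mu>))) / ln 2 \<ge> 0" using f2 by simp
  ultimately show ?thesis using f1 by simp
qed

text \<open>The conditional law of \<open>Y\<close> given a finite quantisation \<open>q\<close> of \<open>X\<close>; on cells of measure zero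
  any law will do.\<close>

definition step_kernel :: "'w measure \<Rightarrow> ('w \<Rightarrow> 'a) \<Rightarrow> ('w \<Rightarrow> 'b) \<Rightarrow> ('a \<Rightarrow> 'c) \<Rightarrow> 'b \<Rightarrow> 'a \<Rightarrow> real" where
  "step_kernel P X Y q b x =
     (if measure P {\<omega> \<in> space P. q (X \<omega>) = q x} = 0 then measure P {\<omega> \<in> space P. Y \<omega> = b}
      else measure P {\<omega> \<in> space P. q (X \<omega>) = q x \<and> Y \<omega> = b} / measure P {\<omega> \<in> space P. q (X \<omega>) = q x})"

text \<open>Fed with the quantised input, the kernel reproduces its joint law with \<open>Y\<close>
  exactly. So if \<open>Y\<close> is itself the index of a partition cell, the rate is one member of
  the family whose supremum is the mutual information. The last claim turns integrals against the
  kernel into sums over cells under \<open>P\<close>.\<close>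

lemma step_kernel:
  assumes P: "prob_space P" and X: "X \<in> P \<rightarrow>\<^sub>M \<mu>" "distr P \<mu> X = \<mu>"
    and q: "simple_function \<mu> q" "finite A" "q ` space \<mu> \<subseteq> A"
    and Y: "simple_function P Y" "finite B" "Y ` space P \<subseteq> B"
  shows "kernel \<mu> B (step_kernel P X Y q)"
    and "rate \<mu> B (step_kernel P X Y q) = finite_mutual_info P (q \<circ> X) Y"
    and "b \<in> B \<Longrightarrow> (\<integral>x. step_kernel P X Y q b x * f (q x) \<partial>\<mu>) = (\<Sum>a\<in>A. measure P {\<omega> \<in> space P. q (X \<omega>) = a \<and> Y \<omega> = b} * f a)"
proof -
  interpret P: prob_space P by fact
  interpret m: prob_space \<mu> using P.prob_space_distr[OF X(1)] X(2) by simp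
  define r where "r a b = measure P {\<omega> \<in> space P. q (X \<omega>) = a \<and> Y \<omega> = b}" for a b
  define ra where "ra a = measure P {\<omega> \<in> space P. q (X \<omega>) = a}" for a
  define rb where "rb b = measure P {\<omega> \<in> space P. Y \<omega> = b}" for b
  have qX: "simple_function P (\<lambda>\<omega>. q (X \<omega>))"
    by (rule simple_function_comp[OF X(1) q(1)])
  have qXA: "(\<lambda>\<omega>. q (X \<omega>)) ` space P \<subseteq> A" using q(3) measurable_space[OF X(1)] by auto
  have nn: "r a e \<ge> 0" "ra a \<ge> 0" "rb e \<ge> 0" for a e by (auto simp: r_def ra_def rb_def)
  have ra_sum: "ra a = (\<Sum>e\<in>B. r a e)" for a
    unfolding ra_def r_def by (rule P.prob_simple_sum[OF Y(1) qX Y(2,3)])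
  have rb_sum: "rb e = (\<Sum>a\<in>A. r a e)" for e
    using P.prob_simple_sum[OF qX Y(1) q(2) qXA, of e] by (simp add: r_def rb_def conj_commute)
  have ra: "measure \<mu> {x \<in> space \<mu>. q x = a} = ra a" for a
  proof -
    have "measure \<mu> {x \<in> space \<mu>. q x = a} = measure (distr P \<mu> X) {x \<in> space \<mu>. q x = a}" by (simp add: X)
    also have "\<dots> = ra a"
      using measurable_space[OF X(1)] unfolding ra_def
      by (subst measure_distr[OF X(1) m.simple_fun_sets[OF q(1)]]) (auto intro!: arg_cong[of _ _ "measure P"])
    finally show ?thesis .
  qed
  define f0 where "f0 b a = (if ra a = 0 then rb b else r a b / ra a)" for b a
  have sk: "step_kernel P X Y q = (\<lambda>b x. f0 b (q x))"
    by (auto simp: step_kernel_def f0_def r_def ra_def rb_def fun_eq_iff)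
  have "(\<Sum>e\<in>B. rb e) = 1"
  proof -
    have "P.prob {\<omega> \<in> space P. True} = (\<Sum>b\<in>B. P.prob {\<omega> \<in> space P. () = () \<and> Y \<omega> = b})"
      using P.prob_simple_sum[OF Y(1) _ Y(2,3), of "\<lambda>_. ()" "()"] by simp
    then show ?thesis by (simp add: rb_def P.prob_space)
  qed
  then have s1: "(\<Sum>b\<in>B. f0 b a) = 1" for a
    by (cases "ra a = 0") (auto simp: f0_def ra_sum simp flip: sum_divide_distrib)
  show k: "kernel \<mu> B (step_kernel P X Y q)"
    unfolding kernel_def sk
    using s1 nn Y(2) m.integral_simple(2)[OF q, THEN borel_measurable_integrable] by (auto simp: f0_def)
  have r0: "r a b = 0" if "ra a = 0" "b \<in> B" for a b
    using that nn Y(2) by (simp add: ra_sum sum_nonneg_eq_0_iff)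
  have m: "(\<integral>x. f0 b (q x) * f (q x) \<partial>\<mu>) = (\<Sum>a\<in>A. r a b * f a)" if "b \<in> B" for b f
    using m.integral_simple(1)[OF q, of "\<lambda>a. f0 b a * f a"] r0 that
    by (auto simp: ra f0_def intro!: sum.cong)
  then show "b \<in> B \<Longrightarrow> (\<integral>x. step_kernel P X Y q b x * f (q x) \<partial>\<mu>) = (\<Sum>a\<in>A. measure P {\<omega> \<in> space P. q (X \<omega>) = a \<and> Y \<omega> = b} * f a)"
    by (simp add: sk r_def)
  have mg: "marg \<mu> (\<lambda>b x. f0 b (q x)) b = rb b" if "b \<in> B" for b
    using m[OF that, of "\<lambda>_. 1"] by (simp add: marg_def rb_sum)
  have "rate \<mu> B (step_kernel P X Y q) = (\<Sum>b\<in>B. \<integral>x. f0 b (q x) * log 2 (f0 b (q x) / rb b) \<partial>\<mu>)"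
    unfolding rate_def sk by (simp add: mg)
  also have "\<dots> = (\<Sum>b\<in>B. \<Sum>a\<in>A. r a b * log 2 (r a b / (ra a * rb b)))"
  proof (rule sum.cong[OF refl])
    fix b assume b: "b \<in> B"
    have "(\<integral>x. f0 b (q x) * log 2 (f0 b (q x) / rb b) \<partial>\<mu>) = (\<Sum>a\<in>A. r a b * log 2 (f0 b a / rb b))"
      using m[OF b, of "\<lambda>a. log 2 (f0 b a / rb b)"] by simp
    also have "\<dots> = (\<Sum>a\<in>A. r a b * log 2 (r a b / (ra a * rb b)))"
      using r0[OF _ b] by (intro sum.cong refl) (auto simp: f0_def)
    finally show "(\<integral>x. f0 b (q x) * log 2 (f0 b (q x) / rb b) \<partial>\<mu>) = (\<Sum>a\<in>A. r a b * log 2 (r a b / (ra a * rb b)))" .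
  qed
  also have "\<dots> = (\<Sum>a\<in>A. \<Sum>b\<in>B. r a b * log 2 (r a b / (ra a * rb b)))" by (rule sum.swap)
  also have "\<dots> = finite_mutual_info P (\<lambda>\<omega>. q (X \<omega>)) Y"
    unfolding r_def ra_def rb_def by (rule P.finite_mutual_info_sum[symmetric, OF qX q(2) qXA Y])
  finally show "rate \<mu> B (step_kernel P X Y q) = finite_mutual_info P (q \<circ> X) Y" by (simp add: comp_def)
qed

section \<open>Lipschitz actions and their codes\<close>

text \<open>Total boundedness supplies countable dense sets, a bound on the distance and finite
  partitions into small cells. The Lipschitz bounds, uniform over bounded sets of translations,
  allow a point to be replaced by a nearby one along a whole orbit segment, and
  \<open>T_meas\<close> makes orbits elements of the L1 space.\<close>

locale lip_action = Metric_space M d for M :: "'a set" and d +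
  fixes T :: "real ^ 'n \<Rightarrow> 'a \<Rightarrow> 'a"
  assumes M_ne: "M \<noteq> {}"
    and tb: "mtotally_bounded M"
    and T_in: "\<And>u x. x \<in> M \<Longrightarrow> T u x \<in> M"
    and T_add: "\<And>u v x. x \<in> M \<Longrightarrow> T (u + v) x = T u (T v x)"
    and T_zero: "\<And>x. x \<in> M \<Longrightarrow> T 0 x = x"
    and T_lip: "\<And>L. \<exists>C. \<forall>u x y. norm u \<le> L \<longrightarrow> x \<in> M \<longrightarrow> y \<in> M \<longrightarrow> d (T u x) (T u y) \<le> C * d x y"
    and T_meas: "\<And>x z. x \<in> M \<Longrightarrow> z \<in> M \<Longrightarrow> (\<lambda>u. d (T u x) z) \<in> borel_measurable borel"
begin

definition bd :: real where
  "bd = (SOME D. 0 < D \<and> (\<forall>x\<in>M. \<forall>y\<in>M. d x y \<le> D))"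

lemma bd: "0 < bd" "x \<in> M \<Longrightarrow> y \<in> M \<Longrightarrow> d x y \<le> bd"
proof -
  obtain B where "\<forall>x\<in>M. \<forall>y\<in>M. d x y \<le> B"
    using mtotally_bounded_imp_mbounded[OF tb] unfolding mbounded_alt by auto
  then have "\<exists>D. 0 < D \<and> (\<forall>x\<in>M. \<forall>y\<in>M. d x y \<le> D)"
    by (intro exI[of _ "max 1 B"]) (auto simp: le_max_iff_disj)
  from someI_ex[OF this] have *: "0 < bd \<and> (\<forall>x\<in>M. \<forall>y\<in>M. d x y \<le> bd)" unfolding bd_def .
  then show "0 < bd" "x \<in> M \<Longrightarrow> y \<in> M \<Longrightarrow> d x y \<le> bd" by auto
qed

text \<open>Chosen positive, so that radii can be divided by it.\<close>

definition lipc :: "real \<Rightarrow> real" where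
  "lipc L = (SOME C. 0 < C \<and> (\<forall>u\<in>cube L. \<forall>x\<in>M. \<forall>y\<in>M. d (T u x) (T u y) \<le> C * d x y))"

lemma lipc: "0 < lipc L" "u \<in> cube L \<Longrightarrow> x \<in> M \<Longrightarrow> y \<in> M \<Longrightarrow> d (T u x) (T u y) \<le> lipc L * d x y"
proof -
  obtain C where C: "\<And>u x y. norm u \<le> real CARD('n) * L \<Longrightarrow> x \<in> M \<Longrightarrow> y \<in> M \<Longrightarrow> d (T u x) (T u y) \<le> C * d x y"
    using T_lip[of "real CARD('n) * L"] by auto
  have "\<forall>u\<in>cube L. \<forall>x\<in>M. \<forall>y\<in>M. d (T u x) (T u y) \<le> max 1 C * d x y"
  proof (intro ballI)
    fix u :: "real ^ 'n" and x y assume "u \<in> cube L" "x \<in> M" "y \<in> M"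
    then have "d (T u x) (T u y) \<le> C * d x y" using C norm_le_cube by blast
    also have "\<dots> \<le> max 1 C * d x y" by (intro mult_right_mono) auto
    finally show "d (T u x) (T u y) \<le> max 1 C * d x y" .
  qed
  then have "\<exists>C. 0 < C \<and> (\<forall>u\<in>cube L. \<forall>x\<in>M. \<forall>y\<in>M. d (T u x) (T u y) \<le> C * d x y)"
    by (intro exI[of _ "max 1 C"]) auto
  from someI_ex[OF this] have *: "0 < lipc L \<and> (\<forall>u\<in>cube L. \<forall>x\<in>M. \<forall>y\<in>M. d (T u x) (T u y) \<le> lipc L * d x y)"
    unfolding lipc_def .
  then show "0 < lipc L" "u \<in> cube L \<Longrightarrow> x \<in> M \<Longrightarrow> y \<in> M \<Longrightarrow> d (T u x) (T u y) \<le> lipc L * d x y" by auto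
qed

lemma T_measurable: "T u \<in> borel_met M d \<rightarrow>\<^sub>M borel_met M d"
proof (rule measurable_into_borel_met[OF tb])
  show "T u \<in> space (borel_met M d) \<rightarrow> M" using T_in by simp
  fix z assume z: "z \<in> M"
  obtain C where C: "\<And>x y. x \<in> M \<Longrightarrow> y \<in> M \<Longrightarrow> d (T u x) (T u y) \<le> C * d x y"
    using T_lip[of "norm u"] by auto
  show "(\<lambda>x. d (T u x) z) \<in> borel_measurable (borel_met M d)"
  proof (rule lipschitz_borel_measurable[where C = C])
    fix x y assume xy: "x \<in> M" "y \<in> M"
    have "d (T u x) z \<le> d (T u x) (T u y) + d (T u y) z" "d (T u y) z \<le> d (T u y) (T u x) + d (T u x) z"
      using triangle T_in xy z by blast+
    then show "\<bar>d (T u x) z - d (T u y) z\<bar> \<le> C * d x y"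
      using C[OF xy] commute[of "T u x" "T u y"] by linarith
  qed
qed

section \<open>Orbits as points of the L1 space\<close>

abbreviation orb :: "'a \<Rightarrow> real ^ 'n \<Rightarrow> 'a" where "orb x \<equiv> \<lambda>u. T u x"

lemma orb_L1: "x \<in> M \<Longrightarrow> orb x \<in> L1_maps M d L"
  unfolding L1_maps_def
  using measurable_into_borel_met[OF tb, of "orb x" lborel] T_in T_meas
  by (intro measurable_restrict_space1) auto

lemma L1_maps_in: "f \<in> L1_maps M d L \<Longrightarrow> u \<in> cube L \<Longrightarrow> f u \<in> M"
  unfolding L1_maps_def using measurable_space[of f "restrict_space lborel (cube L)" "borel_met M d" u]
  by (simp add: space_restrict_space)

text \<open>The distance \<open>L1_dist\<close> on functions instead of classes, so that estimates
  can be made for concrete functions and carried over to representatives by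
  \<open>l1d_cong_AE\<close>.\<close>

definition l1d :: "real \<Rightarrow> (real ^ 'n \<Rightarrow> 'a) \<Rightarrow> (real ^ 'n \<Rightarrow> 'a) \<Rightarrow> real" where
  "l1d L f g = (LINT u:cube L|lborel. d (f u) (g u))"

lemma l1_integrable:
  fixes f g :: "real ^ 'n \<Rightarrow> 'a"
  assumes f: "f \<in> L1_maps M d L" and g: "g \<in> L1_maps M d L"
  shows "set_integrable lborel (cube L) (\<lambda>u. d (f u) (g u))"
proof -
  have m: "(\<lambda>u. d (f u) (g u)) \<in> borel_measurable (restrict_space lborel (cube L))"
    using f g unfolding L1_maps_def by (rule measurable_dist[OF tb])
  have "integrable (restrict_space lborel (cube L)) (\<lambda>u. d (f u) (g u))"
  proof (rule finite_measure.integrable_const_bound[where B = bd])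
    show "finite_measure (restrict_space lborel (cube L :: (real ^ 'n) set))"
    proof
      have "emeasure (lborel :: (real ^ 'n) measure) (cube L) < \<infinity>"
      proof (cases "L \<ge> 0")
        \<comment> \<open>A cube of negative side is empty.\<close>
        case False
        then have "cube L = ({} :: (real ^ 'n) set)" by (auto simp: cube_def)
        then show ?thesis by simp
      qed (simp add: emeasure_cube)
      then have "emeasure (restrict_space lborel (cube L)) (space (restrict_space lborel (cube L :: (real ^ 'n) set))) < \<infinity>"
        by (simp add: emeasure_restrict_space space_restrict_space)
      then show "emeasure (restrict_space lborel (cube L)) (space (restrict_space lborel (cube L :: (real ^ 'n) set))) \<noteq> \<infinity>"
        by (rule less_imp_neq)
    qed
    show "AE u in restrict_space lborel (cube L). norm (d (f u) (g u)) \<le> bd"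
      using bd(2)[OF L1_maps_in[OF f] L1_maps_in[OF g]] by (intro AE_I2) (auto simp: space_restrict_space)
  qed (rule m)
  then show ?thesis
    unfolding set_integrable_def by (subst (asm) integrable_restrict_space) auto
qed

lemma l1d_nonneg: "0 \<le> l1d L f g"
  unfolding l1d_def set_lebesgue_integral_def by (intro Bochner_Integration.integral_nonneg) auto

lemma l1d_commute: "l1d L f g = l1d L g f"
  by (simp add: l1d_def commute)

lemma l1d_triangle:
  assumes "f \<in> L1_maps M d L" "g \<in> L1_maps M d L" "h \<in> L1_maps M d L"
  shows "l1d L f h \<le> l1d L f g + l1d L g h"
proof -
  have "l1d L f h \<le> (LINT u:cube L|lborel. d (f u) (g u) + d (g u) (h u))"
    unfolding l1d_def using assms
    by (intro set_integral_mono set_integral_add l1_integrable triangle) (auto intro: L1_maps_in)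
  also have "\<dots> = l1d L f g + l1d L g h"
    unfolding l1d_def using assms by (intro set_integral_add l1_integrable)
  finally show ?thesis .
qed

lemma l1d_le:
  assumes L: "0 \<le> L" and f: "f \<in> L1_maps M d L" "g \<in> L1_maps M d L"
    and le: "\<And>u. u \<in> cube L \<Longrightarrow> d (f u) (g u) \<le> c"
  shows "l1d L f g \<le> c * L ^ CARD('n)"
proof -
  have "l1d L f g \<le> set_lebesgue_integral lborel (cube L :: (real ^ 'n) set) (\<lambda>u. c)"
    unfolding l1d_def using f le
    by (intro set_integral_mono l1_integrable)
       (auto simp: set_integrable_def emeasure_cube[OF L])
  also have "\<dots> = c * L ^ CARD('n)"
    by (simp add: set_lebesgue_integral_def measure_cube[OF L])
  finally show ?thesis .
qed

lemma l1d_cong_AE: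
  assumes f: "f \<in> L1_maps M d L" "g \<in> L1_maps M d L" "g' \<in> L1_maps M d L"
    and ae: "AE u in lborel. u \<in> cube L \<longrightarrow> g u = g' u"
  shows "l1d L f g = l1d L f g'"
  unfolding l1d_def set_lebesgue_integral_def
proof (rule integral_cong_AE)
  show "(\<lambda>u. indicat_real (cube L) u *\<^sub>R d (f u) (g u)) \<in> borel_measurable lborel"
    using l1_integrable[OF f(1,2)] unfolding set_integrable_def by (rule borel_measurable_integrable)
  show "(\<lambda>u. indicat_real (cube L) u *\<^sub>R d (f u) (g' u)) \<in> borel_measurable lborel"
    using l1_integrable[OF f(1,3)] unfolding set_integrable_def by (rule borel_measurable_integrable)
  show "AE u in lborel. indicat_real (cube L) u *\<^sub>R d (f u) (g u) = indicat_real (cube L) u *\<^sub>R d (f u) (g' u)"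
    using ae by eventually_elim (auto simp: indicator_def)
qed

definition cls :: "real \<Rightarrow> (real ^ 'n \<Rightarrow> 'a) \<Rightarrow> (real ^ 'n \<Rightarrow> 'a) set" where
  "cls L f = L1_rel M d L `` {f}"

lemma cls_in: "f \<in> L1_maps M d L \<Longrightarrow> cls L f \<in> L1_space M d L"
  unfolding cls_def L1_space_def by (rule quotientI)

lemma rep_L1: "F \<in> L1_space M d L \<Longrightarrow> L1_rep F \<in> L1_maps M d L"
  using L1_rep_in[of F M d L] in_quotient_imp_subset[OF equiv_L1_rel, of F M d L]
  unfolding L1_space_def by blast

lemma rep_cls:
  assumes "f \<in> L1_maps M d L"
  shows "AE u in lborel. u \<in> cube L \<longrightarrow> f u = L1_rep (cls L f) u"
proof -
  have "L1_rep (cls L f) \<in> L1_rel M d L `` {f}" using L1_rep_in[OF cls_in[OF assms]] unfolding cls_def .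
  then have "(f, L1_rep (cls L f)) \<in> L1_rel M d L" by (rule ImageE) simp
  then show ?thesis unfolding L1_rel_def by simp
qed

text \<open>Separation is the axiom with content: a vanishing integral gives equality almost
  everywhere, hence the same class. As a metric space, the L1 space inherits the facts about
  \<open>borel_met\<close>, in particular that Lipschitz functions are measurable.\<close>

lemma L1_metric: "Metric_space (L1_space M d L :: (real ^ 'n \<Rightarrow> 'a) set set) (L1_dist d L)"
proof
  fix F G H :: "(real ^ 'n \<Rightarrow> 'a) set"
  have eq: "L1_dist d L F G = l1d L (L1_rep F) (L1_rep G)" for F G
    by (simp add: L1_dist_def l1d_def)
  show "0 \<le> L1_dist d L F G" "L1_dist d L F G = L1_dist d L G F"
    by (auto simp: eq l1d_nonneg l1d_commute)
  show "L1_dist d L F H \<le> L1_dist d L F G + L1_dist d L G H"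
    if "F \<in> L1_space M d L" "G \<in> L1_space M d L" "H \<in> L1_space M d L"
    unfolding eq using that by (intro l1d_triangle rep_L1)
  show "L1_dist d L F G = 0 \<longleftrightarrow> F = G" if F: "F \<in> L1_space M d L" and G: "G \<in> L1_space M d L"
  proof
    assume "L1_dist d L F G = 0"
    then have 0: "(\<integral>u. indicator (cube L) u *\<^sub>R d (L1_rep F u) (L1_rep G u) \<partial>lborel) = 0"
      by (simp add: L1_dist_def set_lebesgue_integral_def)
    have "AE u in lborel. indicator (cube L) u *\<^sub>R d (L1_rep F u) (L1_rep G u) = 0"
      using integral_nonneg_eq_0_iff_AE[OF l1_integrable[OF rep_L1[OF F] rep_L1[OF G], unfolded set_integrable_def]] 0
      by simp
    then have "AE u in lborel. u \<in> cube L \<longrightarrow> L1_rep F u = L1_rep G u"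
    proof eventually_elim
      case (elim u)
      then show ?case
        using zero[OF L1_maps_in[OF rep_L1[OF F], of u] L1_maps_in[OF rep_L1[OF G], of u]] by auto
    qed
    then have "(L1_rep F, L1_rep G) \<in> L1_rel M d L"
      using rep_L1 F G by (auto simp: L1_rel_def)
    then show "F = G"
      using quotient_eq_iff[OF equiv_L1_rel] F G L1_rep_in[OF F] L1_rep_in[OF G]
      unfolding L1_space_def by blast
  next
    assume "F = G"
    moreover have "(\<lambda>u. indicator (cube L) u *\<^sub>R d (L1_rep G u) (L1_rep G u)) = (\<lambda>u. 0)"
      using L1_maps_in[OF rep_L1[OF G]] by (auto simp: fun_eq_iff indicator_def)
    ultimately show "L1_dist d L F G = 0" by (simp add: L1_dist_def set_lebesgue_integral_def)
  qed
qed

lemma space_L1_borel [simp]: "space (L1_borel M d L) = (L1_space M d L :: (real ^ 'n \<Rightarrow> 'a) set set)"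
  unfolding L1_borel_def by (rule Metric_space.space_borel_met[OF L1_metric])

text \<open>Not normalised by the volume; \<open>distortion_eq\<close> supplies the factor.\<close>

definition dst :: "real \<Rightarrow> 'a \<Rightarrow> (real ^ 'n \<Rightarrow> 'a) set \<Rightarrow> real" where
  "dst L x F = l1d L (orb x) (L1_rep F)"

lemma dst_cls: "x \<in> M \<Longrightarrow> f \<in> L1_maps M d L \<Longrightarrow> dst L x (cls L f) = l1d L (orb x) f"
  unfolding dst_def by (intro l1d_cong_AE[symmetric] orb_L1 rep_L1 cls_in rep_cls)

lemma dst_bounds:
  assumes "0 \<le> L" "x \<in> M" "F \<in> L1_space M d L"
  shows "0 \<le> dst L x F" "dst L x F \<le> bd * L ^ CARD('n)"
proof -
  show "0 \<le> dst L x F" unfolding dst_def by (rule l1d_nonneg)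
  have "d (T u x) (L1_rep F u) \<le> bd" if "u \<in> cube L" for u
    by (rule bd(2)[OF T_in[OF assms(2)] L1_maps_in[OF rep_L1[OF assms(3)] that]])
  then show "dst L x F \<le> bd * L ^ CARD('n)"
    unfolding dst_def by (rule l1d_le[OF assms(1) orb_L1[OF assms(2)] rep_L1[OF assms(3)]])
qed

lemma dst_lip1:
  assumes L: "0 \<le> L" and xy: "x \<in> M" "y \<in> M" and F: "F \<in> L1_space M d L"
    and le: "\<And>u. u \<in> cube L \<Longrightarrow> d (T u x) (T u y) \<le> c"
  shows "\<bar>dst L x F - dst L y F\<bar> \<le> c * L ^ CARD('n)"
proof -
  have "dst L x F \<le> l1d L (orb x) (orb y) + dst L y F"
    "dst L y F \<le> l1d L (orb y) (orb x) + dst L x F"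
    unfolding dst_def using xy F by (auto intro!: l1d_triangle orb_L1 rep_L1)
  moreover have "l1d L (orb x) (orb y) \<le> c * L ^ CARD('n)"
    using xy le by (intro l1d_le L orb_L1)
  ultimately show ?thesis using l1d_commute[of L "orb x" "orb y"] by linarith
qed

lemma dst_measurable1:
  assumes "0 \<le> L" "F \<in> L1_space M d L"
  shows "(\<lambda>x. dst L x F) \<in> borel_measurable (borel_met M d)"
proof (rule lipschitz_borel_measurable[where C = "lipc L * L ^ CARD('n)"])
  fix x y assume "x \<in> M" "y \<in> M"
  then have "\<bar>dst L x F - dst L y F\<bar> \<le> (lipc L * d x y) * L ^ CARD('n)"
    by (intro dst_lip1 assms lipc(2))
  then show "\<bar>dst L x F - dst L y F\<bar> \<le> lipc L * L ^ CARD('n) * d x y" by (simp add: mult_ac)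
qed

lemma dst_measurable2:
  assumes "x \<in> M"
  shows "dst L x \<in> borel_measurable (L1_borel M d L)"
  unfolding L1_borel_def
proof (rule Metric_space.lipschitz_borel_measurable[OF L1_metric, where C = 1])
  fix F G :: "(real ^ 'n \<Rightarrow> 'a) set" assume FG: "F \<in> L1_space M d L" "G \<in> L1_space M d L"
  have "dst L x F \<le> dst L x G + l1d L (L1_rep G) (L1_rep F)"
    "dst L x G \<le> dst L x F + l1d L (L1_rep F) (L1_rep G)"
    unfolding dst_def using assms FG by (auto intro!: l1d_triangle orb_L1 rep_L1)
  then show "\<bar>dst L x F - dst L x G\<bar> \<le> 1 * L1_dist d L F G"
    using l1d_commute[of L "L1_rep F" "L1_rep G"] by (simp add: L1_dist_def l1d_def)
qed

end

section \<open>Finite partitions and joint measurability of the distortion\<close>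

lemma cell_props:
  assumes "finite_measurable_partition S \<alpha>"
  shows "x \<in> space S \<Longrightarrow> cell \<alpha> x \<in> \<alpha>" "x \<in> space S \<Longrightarrow> x \<in> cell \<alpha> x"
    "A \<in> \<alpha> \<Longrightarrow> x \<in> A \<Longrightarrow> cell \<alpha> x = A" "simple_function S (cell \<alpha>)" "finite \<alpha>"
proof -
  have p: "partition_on (space S) \<alpha>" "finite \<alpha>" "\<alpha> \<subseteq> sets S"
    using assms by (auto simp: finite_measurable_partition_def)
  have uniq: "A = A'" if "A \<in> \<alpha>" "A' \<in> \<alpha>" "x \<in> A" "x \<in> A'" for A A' x
    using that p(1) unfolding partition_on_def disjoint_def by blast
  show c: "cell \<alpha> x = A" if "A \<in> \<alpha>" "x \<in> A" for A x
    unfolding cell_def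
  proof (rule the_equality)
    show "A' = A" if "A' \<in> \<alpha> \<and> x \<in> A'" for A'
      using uniq[of A' A x] that \<open>A \<in> \<alpha>\<close> \<open>x \<in> A\<close> by blast
  qed (use that in blast)
  have ex: "\<exists>A\<in>\<alpha>. x \<in> A" if "x \<in> space S" for x
    using that p(1) unfolding partition_on_def by auto
  show i: "cell \<alpha> x \<in> \<alpha>" "x \<in> cell \<alpha> x" if "x \<in> space S" for x
    using ex[OF that] c by auto
  show "finite \<alpha>" by fact
  show "simple_function S (cell \<alpha>)"
    unfolding simple_function_def
  proof (intro conjI ballI)
    show "finite (cell \<alpha> ` space S)" by (rule finite_subset[OF _ p(2)]) (use i in auto)
    fix A assume "A \<in> cell \<alpha> ` space S"
    then have A: "A \<in> \<alpha>" using i by auto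
    have "cell \<alpha> -` {A} \<inter> space S = A"
      using A p c i by (auto dest: sets.sets_into_space)
    then show "cell \<alpha> -` {A} \<inter> space S \<in> sets S" using A p by auto
  qed
qed

lemma partition_of_simple_function:
  assumes q: "simple_function S q"
  shows "\<exists>\<alpha>. finite_measurable_partition S \<alpha> \<and>
    (\<forall>A\<in>\<alpha>. A \<noteq> {} \<and> A \<subseteq> space S \<and> (\<forall>x\<in>A. \<forall>y\<in>A. q x = q y))"
proof (intro exI[of _ "(\<lambda>c. q -` {c} \<inter> space S) ` (q ` space S)"] conjI)
  show "finite_measurable_partition S ((\<lambda>c. q -` {c} \<inter> space S) ` (q ` space S))"
    unfolding finite_measurable_partition_def
    using simple_functionD[OF q] by (auto simp: partition_on_def disjoint_def)
qed auto

context lip_action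
begin

text \<open>A point is classified by the set of members of a finite net within distance
  \<open>r\<close>. This pattern is measurable and takes finitely many values, and points with equal
  patterns share a net point, so they are at most \<open>2 * r\<close> apart; \<open>r\<close> is
  chosen so that the Lipschitz bound turns this into \<open>\<delta>\<close>. A representative of
  each cell is picked by \<open>c\<close>.\<close>

lemma fine_partition:
  assumes "\<delta> > 0"
  obtains \<alpha> c where "finite_measurable_partition (borel_met M d) \<alpha>"
    "\<And>A. A \<in> \<alpha> \<Longrightarrow> c A \<in> M"
    "\<And>x u. x \<in> M \<Longrightarrow> u \<in> cube L \<Longrightarrow> d (T u x) (T u (c (cell \<alpha> x))) \<le> \<delta>"
proof -
  define r where "r = \<delta> / (2 * lipc L)"
  have r: "r > 0" using assms lipc(1) by (simp add: r_def)
  from tb[unfolded mtotally_bounded_def, rule_format, OF r]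
  obtain K where K: "finite K" "K \<subseteq> M" "M \<subseteq> (\<Union>x\<in>K. mball x r)" by (elim exE conjE)
  define q where "q x = {z \<in> K. d x z < r}" for x
  have "simple_function (borel_met M d) q"
    unfolding simple_function_def
  proof (intro conjI ballI)
    show "finite (q ` space (borel_met M d))"
      by (rule finite_subset[of _ "Pow K"]) (use K(1) in \<open>auto simp: q_def\<close>)
    fix Z assume "Z \<in> q ` space (borel_met M d)"
    then have Z: "Z \<subseteq> K" by (auto simp: q_def)
    have "q -` {Z} \<inter> space (borel_met M d) = {x \<in> space (borel_met M d). \<forall>z\<in>K. (z \<in> Z \<longrightarrow> d x z < r) \<and> (z \<notin> Z \<longrightarrow> r \<le> d x z)}"
    proof -
      have "q x = Z \<longleftrightarrow> (\<forall>z\<in>K. z \<in> Z \<longleftrightarrow> d x z < r)" for x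
        unfolding q_def using Z by blast
      moreover have "(z \<in> Z \<longleftrightarrow> d x z < r) \<longleftrightarrow> (z \<in> Z \<longrightarrow> d x z < r) \<and> (z \<notin> Z \<longrightarrow> r \<le> d x z)" for x z
        by linarith
      ultimately show ?thesis by auto
    qed
    also have "\<dots> \<in> sets (borel_met M d)"
    proof (rule sets.sets_Collect_finite_All[OF _ K(1)])
      fix z assume "z \<in> K"
      then have z: "z \<in> M" using K by auto
      note [measurable] = dist_borel_measurable[OF z]
      show "{x \<in> space (borel_met M d). (z \<in> Z \<longrightarrow> d x z < r) \<and> (z \<notin> Z \<longrightarrow> r \<le> d x z)} \<in> sets (borel_met M d)"
        by (cases "z \<in> Z") (simp_all del: space_borel_met)
    qed
    finally show "q -` {Z} \<inter> space (borel_met M d) \<in> sets (borel_met M d)" .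
  qed
  then have "\<exists>\<alpha>. finite_measurable_partition (borel_met M d) \<alpha> \<and>
      (\<forall>A\<in>\<alpha>. A \<noteq> {} \<and> A \<subseteq> M \<and> (\<forall>x\<in>A. \<forall>y\<in>A. q x = q y))"
    using partition_of_simple_function[of "borel_met M d" q] by (simp only: space_borel_met)
  then obtain \<alpha> where a': "finite_measurable_partition (borel_met M d) \<alpha> \<and>
      (\<forall>A\<in>\<alpha>. A \<noteq> {} \<and> A \<subseteq> M \<and> (\<forall>x\<in>A. \<forall>y\<in>A. q x = q y))"
    by (rule exE)
  have a: "finite_measurable_partition (borel_met M d) \<alpha>" using a' by (rule conjunct1)
  have a3: "A \<noteq> {} \<and> A \<subseteq> M \<and> (\<forall>x\<in>A. \<forall>y\<in>A. q x = q y)" if "A \<in> \<alpha>" for A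
    using conjunct2[OF a'] that by (rule bspec)
  define c where "c A = (SOME x. x \<in> A)" for A :: "'a set"
  have c: "c A \<in> A" if "A \<in> \<alpha>" for A
    unfolding c_def using a3[OF that] by (auto intro: someI)
  show ?thesis
  proof (rule that[OF a, of c])
    show "c A \<in> M" if "A \<in> \<alpha>" for A using c[OF that] a3[OF that] by auto
    fix x and u :: "real ^ 'n" assume x: "x \<in> M" and u: "u \<in> cube L"
    have cp: "cell \<alpha> x \<in> \<alpha>" "x \<in> cell \<alpha> x"
      using cell_props(1,2)[OF a, of x] x by simp_all
    have cM: "c (cell \<alpha> x) \<in> M" using c[OF cp(1)] a3[OF cp(1)] by auto
    have q_eq: "q x = q (c (cell \<alpha> x))"
      using conjunct2[OF conjunct2[OF a3[OF cp(1)]]] cp(2) c[OF cp(1)] by (meson bspec)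
    have "x \<in> (\<Union>x\<in>K. mball x r)" using x K(3) by (rule subsetD[rotated])
    then obtain z where "z \<in> K" "d z x < r" by (elim UN_E) (simp only: in_mball)
    then have z1: "z \<in> q x" using commute[of z x] by (simp add: q_def)
    then have z2: "z \<in> q (c (cell \<alpha> x))" using q_eq by simp
    have z: "z \<in> M" "d x z < r" "d (c (cell \<alpha> x)) z < r"
      using z1 z2 K(2) unfolding q_def by auto
    have "d x (c (cell \<alpha> x)) \<le> d x z + d z (c (cell \<alpha> x))" using triangle x z cM by blast
    also have "\<dots> \<le> 2 * r" using z by (simp add: commute)
    finally have "lipc L * d x (c (cell \<alpha> x)) \<le> lipc L * (2 * r)" using lipc(1)[of L] by (intro mult_left_mono) auto
    also have "\<dots> = \<delta>" using lipc(1)[of L] by (simp add: r_def)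
    finally show "d (T u x) (T u (c (cell \<alpha> x))) \<le> \<delta>" using lipc(2)[OF u x cM] by linarith
  qed
qed

text \<open>The distortion is Lipschitz in the point, uniformly in the map, and for a fixed point it
  is measurable in the map. Replacing the point by the representative of its cell in ever finer
  finite partitions thus exhibits it as a limit of measurable functions.\<close>

lemma dst_measurable:
  assumes L: "0 \<le> L" and X: "X \<in> P \<rightarrow>\<^sub>M borel_met M d" and Y: "Y \<in> P \<rightarrow>\<^sub>M L1_borel M d L"
  shows "(\<lambda>\<omega>. dst L (X \<omega>) (Y \<omega>)) \<in> borel_measurable P"
proof -
  have "\<forall>k::nat. \<exists>\<alpha> c. finite_measurable_partition (borel_met M d) \<alpha> \<and> (\<forall>A\<in>\<alpha>. c A \<in> M) \<and>
    (\<forall>x\<in>M. \<forall>u\<in>cube L. d (T u x) (T u (c (cell \<alpha> x))) \<le> 1 / Suc k)"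
  proof
    fix k :: nat
    have "0 < 1 / real (Suc k)" by simp
    then obtain \<alpha> c where "finite_measurable_partition (borel_met M d) \<alpha>" "\<And>A. A \<in> \<alpha> \<Longrightarrow> c A \<in> M"
       "\<And>x u. x \<in> M \<Longrightarrow> u \<in> cube L \<Longrightarrow> d (T u x) (T u (c (cell \<alpha> x))) \<le> 1 / Suc k"
      by (rule fine_partition[where L = L]) blast
    then show "\<exists>\<alpha> c. finite_measurable_partition (borel_met M d) \<alpha> \<and> (\<forall>A\<in>\<alpha>. c A \<in> M) \<and>
    (\<forall>x\<in>M. \<forall>u\<in>cube L. d (T u x) (T u (c (cell \<alpha> x))) \<le> 1 / Suc k)" by blast
  qed
  then obtain \<alpha> c where ac: "\<And>k. finite_measurable_partition (borel_met M d) (\<alpha> k)" "\<And>k A. A \<in> \<alpha> k \<Longrightarrow> c k A \<in> M"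
    "\<And>k x u. x \<in> M \<Longrightarrow> u \<in> cube L \<Longrightarrow> d (T u x) (T u (c k (cell (\<alpha> k) x))) \<le> 1 / Suc k"
    by metis
  have XM: "X \<omega> \<in> M" and YL: "Y \<omega> \<in> L1_space M d L" if "\<omega> \<in> space P" for \<omega>
    using measurable_space[OF X that] measurable_space[OF Y that] by auto
  define f where "f k \<omega> = dst L (c k (cell (\<alpha> k) (X \<omega>))) (Y \<omega>)" for k \<omega>
  have "f k \<in> borel_measurable P" for k
    unfolding f_def
  proof (rule measurable_compose_countable'[where g = "\<lambda>\<omega>. cell (\<alpha> k) (X \<omega>)" and I = "\<alpha> k" and f = "\<lambda>A \<omega>. dst L (c k A) (Y \<omega>)"])
    show "countable (\<alpha> k)" using cell_props(5)[OF ac(1)] by (rule countable_finite)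
    show "(\<lambda>\<omega>. dst L (c k A) (Y \<omega>)) \<in> borel_measurable P" if "A \<in> \<alpha> k" for A
      by (rule measurable_compose[OF Y dst_measurable2[OF ac(2)[OF that]]])
    have "simple_function P (\<lambda>\<omega>. cell (\<alpha> k) (X \<omega>))"
      by (rule simple_function_comp[OF X cell_props(4)[OF ac(1)]])
    moreover have "(\<lambda>\<omega>. cell (\<alpha> k) (X \<omega>)) \<in> space P \<rightarrow> \<alpha> k"
      using cell_props(1)[OF ac(1)] XM by auto
    ultimately show "(\<lambda>\<omega>. cell (\<alpha> k) (X \<omega>)) \<in> P \<rightarrow>\<^sub>M count_space (\<alpha> k)"
      by (subst measurable_count_space_eq_countable)
         (auto simp: countable_finite[OF cell_props(5)[OF ac(1)]] intro: simple_functionD(2))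
  qed
  then show ?thesis
  proof (rule borel_measurable_LIMSEQ_real[rotated])
    fix \<omega> assume w: "\<omega> \<in> space P"
    have cM: "c k (cell (\<alpha> k) (X \<omega>)) \<in> M" for k
      using ac(2) cell_props(1)[OF ac(1)] XM[OF w] by simp
    have "\<bar>f k \<omega> - dst L (X \<omega>) (Y \<omega>)\<bar> \<le> 1 / Suc k * L ^ CARD('n)" for k
      unfolding f_def abs_minus_commute[of "dst L (c k (cell (\<alpha> k) (X \<omega>))) (Y \<omega>)"]
      by (intro dst_lip1 L XM cM YL w ac(3))
    then have bnd: "norm (f k \<omega> - dst L (X \<omega>) (Y \<omega>)) \<le> 1 / Suc k * L ^ CARD('n)" for k
      by (simp only: real_norm_def)
    have "(\<lambda>k. 1 / Suc k * L ^ CARD('n)) \<longlonglongrightarrow> 0 * L ^ CARD('n)"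
      by (intro tendsto_mult_right LIMSEQ_Suc[OF lim_1_over_n])
    then have "(\<lambda>k. 1 / Suc k * L ^ CARD('n)) \<longlonglongrightarrow> 0" by (simp only: mult_zero_left)
    then have "(\<lambda>k. f k \<omega> - dst L (X \<omega>) (Y \<omega>)) \<longlonglongrightarrow> 0"
      by (rule Lim_null_comparison[rotated]) (intro always_eventually allI bnd)
    then show "(\<lambda>k. f k \<omega>) \<longlonglongrightarrow> dst L (X \<omega>) (Y \<omega>)" by (simp add: LIM_zero_iff)
  qed
qed

text \<open>Codes stand in for arbitrary channels: \<open>rate_distortion_L_le\<close> and
  \<open>code_of_rate_less\<close> pass between the two. The alphabet type \<open>'b\<close> is left
  free, since extending a code to a larger cube changes it.\<close>

definition code :: "'a measure \<Rightarrow> real \<Rightarrow> real \<Rightarrow> 'b set \<Rightarrow> ('b \<Rightarrow> 'a \<Rightarrow> real) \<Rightarrow> ('b \<Rightarrow> (real ^ 'n \<Rightarrow> 'a) set) \<Rightarrow> bool" where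
  "code \<mu> \<epsilon> L B w F \<longleftrightarrow> kernel \<mu> B w \<and> (\<forall>b\<in>B. F b \<in> L1_space M d L) \<and>
     (\<Sum>b\<in>B. \<integral>x. w b x * dst L x (F b) \<partial>\<mu>) < \<epsilon> * L ^ CARD('n)"

lemma distortion_eq: "distortion d T L P X Y = (\<integral>\<omega>. dst L (X \<omega>) (Y \<omega>) \<partial>P) / L ^ CARD('n)"
  by (simp add: distortion_def dst_def l1d_def)

text \<open>The code is realised as an explicit law on pairs of a point and a class of maps.
  Whatever partitions are then chosen, data processing bounds the information between their indices
  by the rate of the kernel, hence also the supremum.\<close>

lemma rate_distortion_L_le:
  fixes \<mu> :: "'a measure" and B :: "'b set"
  assumes mu: "prob_space \<mu>" "sets \<mu> = sets (borel_met M d)" and L: "0 < L" and c: "code \<mu> \<epsilon> L B w F"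
  shows "rate_distortion_L M d T \<mu> \<epsilon> L \<le> ereal (rate \<mu> B w)"
proof -
  interpret m: prob_space \<mu> by fact
  have k: "kernel \<mu> B w" and F: "\<And>b. b \<in> B \<Longrightarrow> F b \<in> L1_space M d L"
    and dist: "(\<Sum>b\<in>B. \<integral>x. w b x * dst L x (F b) \<partial>\<mu>) < \<epsilon> * L ^ CARD('n)"
    using c by (auto simp: code_def)
  note kD = kernelD[OF k]
  let ?BM = "borel_met M d" let ?BL = "L1_borel M d L"
  have spm: "space \<mu> = M" using sets_eq_imp_space_eq[OF mu(2)] by simp
  define N where "N = \<mu> \<Otimes>\<^sub>M count_space B"
  interpret cB: sigma_finite_measure "count_space B"
    by (rule sigma_finite_measure_count_space_finite[OF kD(1)])
  interpret mB: pair_sigma_finite \<mu> "count_space B" ..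
  have wm[measurable]: "(\<lambda>p. w (snd p) (fst p)) \<in> borel_measurable N"
    unfolding N_def
    by (rule measurable_compose_countable'[where g = snd and I = B and f = "\<lambda>b p. w b (fst p)"])
       (auto intro!: measurable_compose[OF measurable_fst] kD(2) countable_finite kD(1))
  \<comment> \<open>Letters are replaced by their reproductions. Distinct letters may share one;
    this is a coarsening of the output and can only lower the information.\<close>
  define h where "h p = (fst p, F (snd p))" for p :: "'a \<times> 'b"
  have Fm: "F \<in> count_space B \<rightarrow>\<^sub>M ?BL" using F by (auto simp: measurable_def)
  have hm[measurable]: "h \<in> N \<rightarrow>\<^sub>M ?BM \<Otimes>\<^sub>M ?BL"
    unfolding h_def N_def
    by (intro measurable_Pair measurable_compose[OF measurable_snd Fm])
       (simp add: measurable_cong_sets[OF refl mu(2)[symmetric]])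
  define P where "P = distr (density N (\<lambda>p. ennreal (w (snd p) (fst p)))) (?BM \<Otimes>\<^sub>M ?BL) h"
  have spN: "space N = M \<times> B" by (simp add: N_def space_pair_measure spm)
  have nnw: "AE p in N. 0 \<le> w (snd p) (fst p)"
    using kD(3) by (intro AE_I2) (auto simp: spN spm)
  have N1: "integrable N (\<lambda>p. w (snd p) (fst p) * g p) \<and> (\<integral>p. w (snd p) (fst p) * g p \<partial>N) = (\<Sum>b\<in>B. \<integral>x. w b x * g (x, b) \<partial>\<mu>)"
    if g: "g \<in> borel_measurable N" and bnd: "\<And>p. p \<in> space N \<Longrightarrow> \<bar>g p\<bar> \<le> K" for g K
  proof
    have fN: "finite_measure N"
    proof
      have "emeasure N (space N) = emeasure \<mu> (space \<mu>) * emeasure (count_space B) (space (count_space B))"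
        unfolding N_def space_pair_measure by (rule cB.emeasure_pair_measure_Times) auto
      also have "\<dots> = card B" using kD(1) m.emeasure_space_1 by (simp add: emeasure_count_space_finite)
      finally show "emeasure N (space N) \<noteq> \<infinity>" by simp
    qed
    show i: "integrable N (\<lambda>p. w (snd p) (fst p) * g p)"
    proof (rule finite_measure.integrable_const_bound[OF fN, where B = K])
      show "AE p in N. norm (w (snd p) (fst p) * g p) \<le> K"
      proof (rule AE_I2)
        fix p assume p: "p \<in> space N"
        then have "\<bar>w (snd p) (fst p)\<bar> \<le> 1" using kD(3,5) by (auto simp: spN spm)
        then show "norm (w (snd p) (fst p) * g p) \<le> K"
          using mult_mono[of "\<bar>w (snd p) (fst p)\<bar>" 1 "\<bar>g p\<bar>" K] bnd[OF p] by (simp add: abs_mult)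
      qed
    qed (use g in measurable)
    have "(\<integral>p. w (snd p) (fst p) * g p \<partial>N) = (\<integral>b. (\<integral>x. w b x * g (x, b) \<partial>\<mu>) \<partial>count_space B)"
      using mB.integral_snd[of "\<lambda>x b. w b x * g (x, b)"] i unfolding N_def by (simp add: case_prod_unfold)
    also have "\<dots> = (\<Sum>b\<in>B. \<integral>x. w b x * g (x, b) \<partial>\<mu>)"
      using kD(1) by (simp add: lebesgue_integral_count_space_finite)
    finally show "(\<integral>p. w (snd p) (fst p) * g p \<partial>N) = (\<Sum>b\<in>B. \<integral>x. w b x * g (x, b) \<partial>\<mu>)" .
  qed
  \<comment> \<open>Integrals of bounded functions against \<open>P\<close> are finite sums of
    integrals against \<open>\<mu>\<close>. Indicators then give the marginal law and the joint law
    of partition cells, and \<open>dst\<close> gives the distortion.\<close>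
  have P1: "(\<integral>\<omega>. g \<omega> \<partial>P) = (\<Sum>b\<in>B. \<integral>x. w b x * g (x, F b) \<partial>\<mu>)"
    if g: "g \<in> borel_measurable (?BM \<Otimes>\<^sub>M ?BL)" and bnd: "\<And>p. p \<in> M \<times> L1_space M d L \<Longrightarrow> \<bar>g p\<bar> \<le> K" for g :: "_ \<Rightarrow> real" and K
  proof -
    have gh: "(\<lambda>p. g (h p)) \<in> borel_measurable N" by (rule measurable_compose[OF hm g])
    have "(\<integral>\<omega>. g \<omega> \<partial>P) = (\<integral>p. g (h p) \<partial>density N (\<lambda>p. ennreal (w (snd p) (fst p))))"
      unfolding P_def using g by (intro integral_distr) auto
    also have "\<dots> = (\<integral>p. w (snd p) (fst p) * g (h p) \<partial>N)"
      using gh nnw by (subst integral_density) auto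
    also have "\<dots> = (\<Sum>b\<in>B. \<integral>x. w b x * g (x, F b) \<partial>\<mu>)"
      using N1[OF gh, of K] bnd F by (auto simp: spN h_def)
    finally show ?thesis .
  qed
  have prob: "prob_space P"
    unfolding P_def
  proof (rule prob_space.prob_space_distr)
    show "h \<in> density N (\<lambda>p. ennreal (w (snd p) (fst p))) \<rightarrow>\<^sub>M ?BM \<Otimes>\<^sub>M ?BL" by simp
    show "prob_space (density N (\<lambda>p. ennreal (w (snd p) (fst p))))"
    proof
      have "emeasure (density N (\<lambda>p. ennreal (w (snd p) (fst p)))) (space N) = (\<integral>\<^sup>+p. ennreal (w (snd p) (fst p)) \<partial>N)"
        by (subst emeasure_density) (auto intro!: nn_integral_cong simp: indicator_def)
      also have "\<dots> = ennreal (\<integral>p. w (snd p) (fst p) \<partial>N)"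
        using N1[of "\<lambda>_. 1" 1] nnw by (intro nn_integral_eq_integral) auto
      also have "(\<integral>p. w (snd p) (fst p) \<partial>N) = (\<Sum>b\<in>B. \<integral>x. w b x \<partial>\<mu>)"
        using N1[of "\<lambda>_. 1" 1] by simp
      also have "\<dots> = 1" using m.sum_marg[OF k] by (simp add: marg_def)
      finally show "emeasure (density N (\<lambda>p. ennreal (w (snd p) (fst p)))) (space (density N (\<lambda>p. ennreal (w (snd p) (fst p))))) = 1" by simp
    qed
  qed
  interpret P: prob_space P by fact
  have spP: "space P = M \<times> L1_space M d L" by (simp add: P_def space_pair_measure)
  have setsP: "sets P = sets (?BM \<Otimes>\<^sub>M ?BL)" by (simp add: P_def)
  have Xm: "fst \<in> P \<rightarrow>\<^sub>M ?BM" and Ym: "snd \<in> P \<rightarrow>\<^sub>M ?BL"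
    by (simp_all add: measurable_cong_sets[OF setsP refl])
  have dX: "distr P ?BM fst = \<mu>"
  proof (rule measure_eqI)
    show "sets (distr P ?BM fst) = sets \<mu>" by (simp add: mu)
    fix A assume A: "A \<in> sets (distr P ?BM fst)"
    then have A': "A \<in> sets ?BM" by simp
    interpret D: prob_space "distr P ?BM fst" by (rule P.prob_space_distr[OF Xm])
    have "measure (distr P ?BM fst) A = (\<integral>\<omega>. indicator A (fst \<omega>) \<partial>P)"
      using A' measurable_sets[OF Xm A'] by (simp add: measure_distr[OF Xm] flip: indicator_vimage)
    also have "\<dots> = (\<Sum>b\<in>B. \<integral>x. w b x * indicator A x \<partial>\<mu>)"
      using A' P1[of "\<lambda>\<omega>. indicator A (fst \<omega>)" 1] by (auto simp: indicator_def)
    also have "\<dots> = (\<integral>x. (\<Sum>b\<in>B. w b x * indicator A x) \<partial>\<mu>)"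
      using A' integrable_mult_indicator[OF _ m.kernel_integrable[OF k], of A]
      by (subst Bochner_Integration.integral_sum) (auto simp: mu mult.commute)
    also have "\<dots> = (\<integral>x. indicator A x \<partial>\<mu>)"
      by (intro Bochner_Integration.integral_cong refl) (simp add: kD(4) flip: sum_distrib_right)
    also have "\<dots> = measure \<mu> A" using A' mu by simp
    finally show "emeasure (distr P ?BM fst) A = emeasure \<mu> A"
      by (simp add: D.emeasure_eq_measure m.emeasure_eq_measure)
  qed
  have "(\<integral>\<omega>. dst L (fst \<omega>) (snd \<omega>) \<partial>P) = (\<Sum>b\<in>B. \<integral>x. w b x * dst L x (F b) \<partial>\<mu>)"
  proof -
    have "(\<lambda>\<omega>. dst L (fst \<omega>) (snd \<omega>)) \<in> borel_measurable (?BM \<Otimes>\<^sub>M ?BL)"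
      using L by (intro dst_measurable) auto
    then show ?thesis using dst_bounds[of L] L P1[of "\<lambda>\<omega>. dst L (fst \<omega>) (snd \<omega>)" "bd * L ^ CARD('n)"]
      by (auto simp: less_imp_le)
  qed
  then have dP: "distortion d T L P fst snd < \<epsilon>"
    using dist L by (simp add: distortion_eq divide_simps)
  have "rate_distortion_L M d T \<mu> \<epsilon> L \<le> mutual_info P ?BM ?BL fst snd"
    unfolding rate_distortion_L_def using prob Xm Ym dX dP by (intro Inf_lower) blast
  also have "\<dots> \<le> ereal (rate \<mu> B w)"
    unfolding mutual_info_def
  proof (rule Sup_least, safe)
    fix \<alpha> and \<beta> :: "(real ^ 'n \<Rightarrow> 'a) set set set" assume a: "finite_measurable_partition ?BM \<alpha>" and b: "finite_measurable_partition ?BL \<beta>"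
    note ca = cell_props[OF a] and cb = cell_props[OF b]
    have ss: "simple_function \<mu> (cell \<alpha>)"
      using ca(4) by (simp add: simple_function_def spm mu)
    show "ereal (finite_mutual_info P (cell \<alpha> \<circ> fst) (cell \<beta> \<circ> snd)) \<le> ereal (rate \<mu> B w)"
      unfolding ereal_less_eq
    proof (rule finite_mutual_info_le_rate[OF mu(1) prob k ss ca(5) _ _ cb(5), where g = "cell \<beta> \<circ> F"])
      show "simple_function P (cell \<alpha> \<circ> fst)" "simple_function P (cell \<beta> \<circ> snd)"
        using simple_function_comp[OF Xm ca(4)] simple_function_comp[OF Ym cb(4)] by (auto simp: comp_def)
      show "cell \<alpha> ` space \<mu> \<subseteq> \<alpha>" "(cell \<beta> \<circ> F) ` B \<subseteq> \<beta>" "(cell \<alpha> \<circ> fst) ` space P \<subseteq> \<alpha>" "(cell \<beta> \<circ> snd) ` space P \<subseteq> \<beta>"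
        using ca(1) cb(1) F by (auto simp: spm spP)
      fix A E assume AE: "A \<in> \<alpha>" "E \<in> \<beta>"
      have A: "A \<in> sets ?BM" and E: "E \<in> sets ?BL"
        using AE a b by (auto simp: finite_measurable_partition_def)
      note A = A sets.sets_into_space[OF A, unfolded space_borel_met]
      note E = E sets.sets_into_space[OF E, unfolded space_L1_borel]
      have cA: "cell \<alpha> x = A \<longleftrightarrow> x \<in> A" if "x \<in> M" for x
      proof
        show "cell \<alpha> x = A \<Longrightarrow> x \<in> A" using ca(2)[of x] that by simp
      qed (rule ca(3)[OF AE(1)])
      have cE: "cell \<beta> y = E \<longleftrightarrow> y \<in> E" if "y \<in> L1_space M d L" for y
      proof
        show "cell \<beta> y = E \<Longrightarrow> y \<in> E" using cb(2)[of y] that by simp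
      qed (rule cb(3)[OF AE(2)])
      have "{\<omega> \<in> space P. (cell \<alpha> \<circ> fst) \<omega> = A \<and> (cell \<beta> \<circ> snd) \<omega> = E} = A \<times> E"
      proof (intro equalityI subsetI)
        fix \<omega> assume "\<omega> \<in> {\<omega> \<in> space P. (cell \<alpha> \<circ> fst) \<omega> = A \<and> (cell \<beta> \<circ> snd) \<omega> = E}"
        then show "\<omega> \<in> A \<times> E" using cA[of "fst \<omega>"] cE[of "snd \<omega>"] by (auto simp: spP)
      next
        fix \<omega> assume w: "\<omega> \<in> A \<times> E"
        then have "fst \<omega> \<in> M" "snd \<omega> \<in> L1_space M d L" using A(2) E(2) by auto
        then show "\<omega> \<in> {\<omega> \<in> space P. (cell \<alpha> \<circ> fst) \<omega> = A \<and> (cell \<beta> \<circ> snd) \<omega> = E}"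
          using w cA[of "fst \<omega>"] cE[of "snd \<omega>"] by (auto simp: spP)
      qed
      then have "measure P {\<omega> \<in> space P. (cell \<alpha> \<circ> fst) \<omega> = A \<and> (cell \<beta> \<circ> snd) \<omega> = E} = (\<integral>\<omega>. indicator (A \<times> E) \<omega> \<partial>P)"
        using A E by (simp add: setsP)
      also have "\<dots> = (\<Sum>b\<in>B. \<integral>x. w b x * indicator (A \<times> E) (x, F b) \<partial>\<mu>)"
        using A E P1[of "indicator (A \<times> E)" 1] by (auto simp: indicator_def)
      also have "\<dots> = (\<Sum>b\<in>B. if cell \<beta> (F b) = E then \<integral>x. indicator {x \<in> space \<mu>. cell \<alpha> x = A} x * w b x \<partial>\<mu> else 0)"
      proof (intro sum.cong refl)
        fix b assume "b \<in> B"
        then have Fb: "F b \<in> E \<longleftrightarrow> cell \<beta> (F b) = E" using cE F by blast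
        have "(\<integral>x. w b x * indicator (A \<times> E) (x, F b) \<partial>\<mu>) = (\<integral>x. (if cell \<beta> (F b) = E then indicator {x \<in> space \<mu>. cell \<alpha> x = A} x * w b x else 0) \<partial>\<mu>)"
          using Fb cA by (intro Bochner_Integration.integral_cong refl) (simp add: indicator_def spm)
        then show "(\<integral>x. w b x * indicator (A \<times> E) (x, F b) \<partial>\<mu>) = (if cell \<beta> (F b) = E then \<integral>x. indicator {x \<in> space \<mu>. cell \<alpha> x = A} x * w b x \<partial>\<mu> else 0)"
          by simp
      qed
      also have "\<dots> = (\<Sum>b\<in>{b \<in> B. (cell \<beta> \<circ> F) b = E}. \<integral>x. indicator {x \<in> space \<mu>. cell \<alpha> x = A} x * w b x \<partial>\<mu>)"
        by (simp add: sum.inter_filter[OF kD(1)])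
      finally show "measure P {\<omega> \<in> space P. (cell \<alpha> \<circ> fst) \<omega> = A \<and> (cell \<beta> \<circ> snd) \<omega> = E}
        = (\<Sum>b\<in>{b \<in> B. (cell \<beta> \<circ> F) b = E}. \<integral>x. indicator {x \<in> space \<mu>. cell \<alpha> x = A} x * w b x \<partial>\<mu>)" .
    qed
  qed
  finally show ?thesis .
qed

text \<open>Both ends are quantised. \<open>X\<close> is replaced by its cell in a fine partition.
  Instead of covering the space of maps by small sets, \<open>Y\<close> is classified by its rounded
  distortions to the finitely many representatives \<open>c A\<close>, which determine the mean
  distortion up to small errors. The information between the two indices is one member of the
  supremum, and it is the rate of the step kernel.\<close>

lemma code_of_channel:
  assumes P: "prob_space P" and X: "X \<in> P \<rightarrow>\<^sub>M borel_met M d" and XD: "distr P (borel_met M d) X = \<mu>"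
    and Y: "Y \<in> P \<rightarrow>\<^sub>M L1_borel M d L" and dist: "distortion d T L P X Y < \<epsilon>" and L: "0 < L"
  obtains B :: "(real ^ 'n \<Rightarrow> 'a) set set set" and w F where "code \<mu> \<epsilon> L B w F"
    "ereal (rate \<mu> B w) \<le> mutual_info P (borel_met M d) (L1_borel M d L) X Y"
proof -
  interpret P: prob_space P by fact
  interpret m: prob_space \<mu> using P.prob_space_distr[OF X] XD by simp
  have sm: "sets \<mu> = sets (borel_met M d)" by (simp flip: XD)
  have spm: "space \<mu> = M" by (simp flip: XD)
  have XM: "X \<omega> \<in> M" and YL: "Y \<omega> \<in> L1_space M d L" if "\<omega> \<in> space P" for \<omega>
    using measurable_space[OF X that] measurable_space[OF Y that] by auto
  define E0 where "E0 = (\<integral>\<omega>. dst L (X \<omega>) (Y \<omega>) \<partial>P)"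
  have Ln: "L ^ CARD('n) > 0" using L by simp
  have E0: "E0 < \<epsilon> * L ^ CARD('n)" using dist L by (simp add: distortion_eq E0_def divide_simps)
  \<comment> \<open>A quarter of the slack: replacing \<open>x\<close> by its representative,
    rounding \<open>Y\<close>, and returning from the representative to \<open>X \<omega>\<close>
    cost at most \<open>\<eta>\<close> each, so three of the four quarters are spent.\<close>
  define \<eta> where "\<eta> = (\<epsilon> * L ^ CARD('n) - E0) / 4"
  have eta: "\<eta> > 0" using E0 by (simp add: \<eta>_def)
  then have "\<eta> / L ^ CARD('n) > 0" using Ln by simp
  then obtain \<alpha> c where a: "finite_measurable_partition (borel_met M d) \<alpha>" and c: "\<And>A. A \<in> \<alpha> \<Longrightarrow> c A \<in> M"
    and fine: "\<And>x u. x \<in> M \<Longrightarrow> u \<in> cube L \<Longrightarrow> d (T u x) (T u (c (cell \<alpha> x))) \<le> \<eta> / L ^ CARD('n)"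
    by (rule fine_partition[where L = L]) blast
  note ca = cell_props[OF a]
  have fine': "\<bar>dst L x F - dst L (c (cell \<alpha> x)) F\<bar> \<le> \<eta>" if "x \<in> M" "F \<in> L1_space M d L" for x F
    using dst_lip1[of L x "c (cell \<alpha> x)" F "\<eta> / L ^ CARD('n)"] that c ca(1) fine L by auto
  \<comment> \<open>The vector of rounded distortions; maps with the same vector have distortions to
    each representative that differ by less than \<open>\<eta>\<close>.\<close>
  define r where "r F = restrict (\<lambda>A. \<lfloor>dst L (c A) F / \<eta>\<rfloor>) \<alpha>" for F
  have "simple_function (L1_borel M d L) r"
    unfolding simple_function_def
  proof (intro conjI ballI)
    have "r ` space (L1_borel M d L) \<subseteq> (\<Pi>\<^sub>E A\<in>\<alpha>. {0..\<lfloor>bd * L ^ CARD('n) / \<eta>\<rfloor>})"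
      using c dst_bounds L eta by (auto simp: r_def less_imp_le intro!: floor_mono divide_right_mono)
    then show "finite (r ` space (L1_borel M d L))"
      by (rule finite_subset) (auto intro!: finite_PiE ca)
    fix b assume "b \<in> r ` space (L1_borel M d L)"
    then have b: "b \<in> extensional \<alpha>" by (auto simp: r_def)
    have "r -` {b} \<inter> space (L1_borel M d L) = {F \<in> space (L1_borel M d L). \<forall>A\<in>\<alpha>. \<lfloor>dst L (c A) F / \<eta>\<rfloor> = b A}"
    proof -
      have "r F = b \<longleftrightarrow> (\<forall>A\<in>\<alpha>. \<lfloor>dst L (c A) F / \<eta>\<rfloor> = b A)" for F
      proof
        assume "\<forall>A\<in>\<alpha>. \<lfloor>dst L (c A) F / \<eta>\<rfloor> = b A"
        then show "r F = b" by (intro extensionalityI[OF _ b]) (simp_all add: r_def)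
      qed (auto simp: r_def)
      then show ?thesis by auto
    qed
    also have "\<dots> \<in> sets (L1_borel M d L)"
    proof (rule sets.sets_Collect_finite_All[OF _ ca(5)])
      fix A assume "A \<in> \<alpha>"
      note [measurable] = dst_measurable2[OF c[OF this], of L]
      have "{F \<in> space (L1_borel M d L). \<lfloor>dst L (c A) F / \<eta>\<rfloor> = b A}
         = {F \<in> space (L1_borel M d L). of_int (b A) \<le> dst L (c A) F / \<eta> \<and> dst L (c A) F / \<eta> < of_int (b A) + 1}"
        by (auto simp: floor_eq_iff)
      also have "\<dots> \<in> sets (L1_borel M d L)" by (simp del: space_L1_borel)
      finally show "{F \<in> space (L1_borel M d L). \<lfloor>dst L (c A) F / \<eta>\<rfloor> = b A} \<in> sets (L1_borel M d L)" .
    qed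
    finally show "r -` {b} \<inter> space (L1_borel M d L) \<in> sets (L1_borel M d L)" .
  qed
  from partition_of_simple_function[OF this] obtain \<beta> where b: "finite_measurable_partition (L1_borel M d L) \<beta>"
    and b': "\<forall>A\<in>\<beta>. A \<noteq> {} \<and> A \<subseteq> L1_space M d L \<and> (\<forall>x\<in>A. \<forall>y\<in>A. r x = r y)"
    unfolding space_L1_borel by blast
  have b: "finite_measurable_partition (L1_borel M d L) \<beta>"
    "\<And>A x y. A \<in> \<beta> \<Longrightarrow> x \<in> A \<Longrightarrow> y \<in> A \<Longrightarrow> r x = r y" "\<And>A. A \<in> \<beta> \<Longrightarrow> A \<noteq> {} \<and> A \<subseteq> L1_space M d L"
    using b b' by blast+
  note cb = cell_props[OF b(1)]
  define F where "F B = (SOME x. x \<in> B)" for B :: "(real ^ 'n \<Rightarrow> 'a) set set"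
  have F: "F B \<in> B" "F B \<in> L1_space M d L" if "B \<in> \<beta>" for B
  proof -
    show "F B \<in> B" unfolding F_def using b(3)[OF that] by (auto intro: someI)
    then show "F B \<in> L1_space M d L" using b(3)[OF that] by auto
  qed
  have fineY: "dst L (c A) (F (cell \<beta> G)) \<le> dst L (c A) G + \<eta>" if "A \<in> \<alpha>" "G \<in> L1_space M d L" for A G
  proof -
    have "r G = r (F (cell \<beta> G))"
      using that cb(1,2) by (intro b(2)[of "cell \<beta> G"] F) auto
    then have "\<lfloor>dst L (c A) G / \<eta>\<rfloor> = \<lfloor>dst L (c A) (F (cell \<beta> G)) / \<eta>\<rfloor>"
      using that(1) by (metis (no_types, lifting) r_def restrict_apply')
    then have "dst L (c A) (F (cell \<beta> G)) / \<eta> < dst L (c A) G / \<eta> + 1"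
      by linarith
    then show ?thesis using eta by (simp add: field_simps)
  qed
  have q: "simple_function \<mu> (cell \<alpha>)" "cell \<alpha> ` space \<mu> \<subseteq> \<alpha>"
    using ca(4,1) by (auto simp: simple_function_def spm sm)
  have Yq: "simple_function P (cell \<beta> \<circ> Y)" "(cell \<beta> \<circ> Y) ` space P \<subseteq> \<beta>"
    using simple_function_comp[OF Y cb(4)] cb(1) YL by (auto simp: comp_def)
  have Xq: "simple_function P (cell \<alpha> \<circ> X)" "(cell \<alpha> \<circ> X) ` space P \<subseteq> \<alpha>"
    using simple_function_comp[OF X ca(4)] ca(1) XM by (auto simp: comp_def)
  have Xm: "X \<in> P \<rightarrow>\<^sub>M \<mu>" using X by (simp add: measurable_cong_sets[OF refl sm])
  have Xd: "distr P \<mu> X = \<mu>" using XD distr_cong[OF refl sm, of P X X] by simp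
  define w where "w = step_kernel P X (cell \<beta> \<circ> Y) (cell \<alpha>)"
  note sk = step_kernel[OF P Xm Xd q(1) ca(5) q(2) Yq(1) cb(5) Yq(2), folded w_def]
  have "(\<Sum>b\<in>\<beta>. \<integral>x. w b x * dst L x (F b) \<partial>\<mu>) \<le> (\<Sum>b\<in>\<beta>. \<integral>x. w b x * dst L (c (cell \<alpha> x)) (F b) + \<eta> * w b x \<partial>\<mu>)"
  proof (intro sum_mono integral_mono)
    fix b assume b: "b \<in> \<beta>"
    note wi = m.kernel_integrable[OF sk(1) b]
    have i2: "integrable \<mu> (\<lambda>x. w b x * dst L (c (cell \<alpha> x)) (F b))"
      using m.integral_simple_mult(2)[OF q(1) ca(5) q(2) wi, of "\<lambda>A. dst L (c A) (F b)"] by (simp add: mult.commute)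
    then show "integrable \<mu> (\<lambda>x. w b x * dst L (c (cell \<alpha> x)) (F b) + \<eta> * w b x)" using wi by simp
    show "integrable \<mu> (\<lambda>x. w b x * dst L x (F b))"
    proof (rule m.integrable_const_bound[of _ "bd * L ^ CARD('n)"])
      have "(\<lambda>x. dst L x (F b)) \<in> borel_measurable \<mu>"
        using dst_measurable1[of L "F b"] L F(2)[OF b] by (simp add: measurable_cong_sets[OF sm refl])
      then show "(\<lambda>x. w b x * dst L x (F b)) \<in> borel_measurable \<mu>" using wi by measurable
      show "AE x in \<mu>. norm (w b x * dst L x (F b)) \<le> bd * L ^ CARD('n)"
      proof (rule AE_I2)
        fix x assume x: "x \<in> space \<mu>"
        then show "norm (w b x * dst L x (F b)) \<le> bd * L ^ CARD('n)"
          using mult_mono[of "w b x" 1 "dst L x (F b)" "bd * L ^ CARD('n)"] kernelD(3,5)[OF sk(1) b x] dst_bounds[of L x "F b"] L F(2)[OF b]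
          by (auto simp: spm abs_mult)
      qed
    qed
    fix x assume x: "x \<in> space \<mu>"
    have "dst L x (F b) \<le> dst L (c (cell \<alpha> x)) (F b) + \<eta>"
      using fine'[of x "F b"] x F(2)[OF b] by (auto simp: spm)
    then have "w b x * dst L x (F b) \<le> w b x * (dst L (c (cell \<alpha> x)) (F b) + \<eta>)"
      using kernelD(3)[OF sk(1) b x] by (rule mult_left_mono)
    then show "w b x * dst L x (F b) \<le> w b x * dst L (c (cell \<alpha> x)) (F b) + \<eta> * w b x" by (simp add: algebra_simps)
  qed
  also have "\<dots> = (\<Sum>b\<in>\<beta>. (\<integral>x. w b x * dst L (c (cell \<alpha> x)) (F b) \<partial>\<mu>) + \<eta> * marg \<mu> w b)"
  proof (intro sum.cong refl)
    fix b assume b: "b \<in> \<beta>"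
    have i2: "integrable \<mu> (\<lambda>x. w b x * dst L (c (cell \<alpha> x)) (F b))"
      using m.integral_simple_mult(2)[OF q(1) ca(5) q(2) m.kernel_integrable[OF sk(1) b], of "\<lambda>A. dst L (c A) (F b)"] by (simp add: mult.commute)
    then show "(\<integral>x. w b x * dst L (c (cell \<alpha> x)) (F b) + \<eta> * w b x \<partial>\<mu>) = (\<integral>x. w b x * dst L (c (cell \<alpha> x)) (F b) \<partial>\<mu>) + \<eta> * marg \<mu> w b"
      using m.kernel_integrable[OF sk(1) b] by (simp add: marg_def)
  qed
  also have "\<dots> = (\<Sum>b\<in>\<beta>. \<Sum>a\<in>\<alpha>. measure P {\<omega> \<in> space P. cell \<alpha> (X \<omega>) = a \<and> (cell \<beta> \<circ> Y) \<omega> = b} * dst L (c a) (F b)) + \<eta>"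
    using m.sum_marg[OF sk(1)] by (simp add: sum.distrib sk(3)[of _ "\<lambda>a. dst L (c a) (F _)"] flip: sum_distrib_left)
  also have "\<dots> = (\<integral>\<omega>. dst L (c (cell \<alpha> (X \<omega>))) (F (cell \<beta> (Y \<omega>))) \<partial>P) + \<eta>"
  proof -
    have s: "simple_function P (\<lambda>\<omega>. ((cell \<beta> \<circ> Y) \<omega>, (cell \<alpha> \<circ> X) \<omega>))" using Xq Yq by blast
    have "(\<integral>\<omega>. dst L (c (cell \<alpha> (X \<omega>))) (F (cell \<beta> (Y \<omega>))) \<partial>P) = (\<integral>\<omega>. (\<lambda>p. dst L (c (snd p)) (F (fst p))) ((cell \<beta> \<circ> Y) \<omega>, (cell \<alpha> \<circ> X) \<omega>) \<partial>P)" by simp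
    also have "\<dots> = (\<Sum>p\<in>\<beta> \<times> \<alpha>. dst L (c (snd p)) (F (fst p)) * measure P {\<omega> \<in> space P. ((cell \<beta> \<circ> Y) \<omega>, (cell \<alpha> \<circ> X) \<omega>) = p})"
      by (rule P.integral_simple(1)[OF s]) (use ca(5) cb(5) Xq(2) Yq(2) in auto)
    finally show ?thesis by (simp add: sum.cartesian_product case_prod_unfold prod_eq_iff mult.commute conj_commute)
  qed
  also have "(\<integral>\<omega>. dst L (c (cell \<alpha> (X \<omega>))) (F (cell \<beta> (Y \<omega>))) \<partial>P) \<le> (\<integral>\<omega>. dst L (X \<omega>) (Y \<omega>) + 2 * \<eta> \<partial>P)"
  proof (rule integral_mono)
    have s: "simple_function P (\<lambda>\<omega>. ((cell \<beta> \<circ> Y) \<omega>, (cell \<alpha> \<circ> X) \<omega>))" using Xq Yq by blast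
    have "integrable P (\<lambda>\<omega>. (\<lambda>p. dst L (c (snd p)) (F (fst p))) ((cell \<beta> \<circ> Y) \<omega>, (cell \<alpha> \<circ> X) \<omega>))"
      by (rule P.integral_simple(2)[OF s, of "\<beta> \<times> \<alpha>"]) (use ca(5) cb(5) Xq(2) Yq(2) in auto)
    then show "integrable P (\<lambda>\<omega>. dst L (c (cell \<alpha> (X \<omega>))) (F (cell \<beta> (Y \<omega>))))" by simp
    have "integrable P (\<lambda>\<omega>. dst L (X \<omega>) (Y \<omega>))"
      using dst_bounds L XM YL
      by (intro P.integrable_const_bound[of _ "bd * L ^ CARD('n)"] dst_measurable X Y AE_I2) (auto simp: less_imp_le)
    then show "integrable P (\<lambda>\<omega>. dst L (X \<omega>) (Y \<omega>) + 2 * \<eta>)" by simp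
    fix \<omega> assume w: "\<omega> \<in> space P"
    have "dst L (c (cell \<alpha> (X \<omega>))) (F (cell \<beta> (Y \<omega>))) \<le> dst L (c (cell \<alpha> (X \<omega>))) (Y \<omega>) + \<eta>"
      using ca(1) XM[OF w] YL[OF w] by (intro fineY) auto
    also have "\<dots> \<le> dst L (X \<omega>) (Y \<omega>) + 2 * \<eta>" using fine'[OF XM[OF w] YL[OF w]] by linarith
    finally show "dst L (c (cell \<alpha> (X \<omega>))) (F (cell \<beta> (Y \<omega>))) \<le> dst L (X \<omega>) (Y \<omega>) + 2 * \<eta>" .
  qed
  also have "(\<integral>\<omega>. dst L (X \<omega>) (Y \<omega>) + 2 * \<eta> \<partial>P) = E0 + 2 * \<eta>"
  proof -
    have "integrable P (\<lambda>\<omega>. dst L (X \<omega>) (Y \<omega>))"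
      using dst_bounds L XM YL
      by (intro P.integrable_const_bound[of _ "bd * L ^ CARD('n)"] dst_measurable X Y AE_I2) (auto simp: less_imp_le)
    then show ?thesis by (simp add: E0_def P.prob_space)
  qed
  finally have "(\<Sum>b\<in>\<beta>. \<integral>x. w b x * dst L x (F b) \<partial>\<mu>) \<le> E0 + 2 * \<eta> + \<eta>" by simp
  also have "\<dots> < \<epsilon> * L ^ CARD('n)" using eta by (simp add: \<eta>_def field_simps)
  finally have "code \<mu> \<epsilon> L \<beta> w F" unfolding code_def using sk(1) F by auto
  moreover have "ereal (rate \<mu> \<beta> w) \<le> mutual_info P (borel_met M d) (L1_borel M d L) X Y"
    unfolding mutual_info_def sk(2) using a b(1) by (intro Sup_upper) auto
  ultimately show ?thesis by (rule that)
qed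

end

section \<open>Product codes and existence of the rate distortion function\<close>

text \<open>Under a product distribution the other coordinates sum to 1. The function
  \<open>h\<close> is absorbed into the factor at \<open>v0\<close>, so that the sum of products
  still factorises.\<close>

lemma sum_PiE_marginal:
  fixes W :: "'v \<Rightarrow> 'b \<Rightarrow> real"
  assumes V: "finite V" "v0 \<in> V" and B: "finite B" and s: "\<And>v. v \<in> V \<Longrightarrow> (\<Sum>b\<in>B. W v b) = 1"
  shows "(\<Sum>\<beta>\<in>Pi\<^sub>E V (\<lambda>_. B). (\<Prod>v\<in>V. W v (\<beta> v)) * h (\<beta> v0)) = (\<Sum>b\<in>B. W v0 b * h b)"
proof -
  define f where "f v b = W v b * (if v = v0 then h b else 1)" for v b
  have "(\<Prod>v\<in>V. W v (\<beta> v)) * h (\<beta> v0) = (\<Prod>v\<in>V. f v (\<beta> v))" for \<beta>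
    using V by (simp add: f_def prod.distrib prod.delta)
  then have "(\<Sum>\<beta>\<in>Pi\<^sub>E V (\<lambda>_. B). (\<Prod>v\<in>V. W v (\<beta> v)) * h (\<beta> v0)) = (\<Prod>v\<in>V. \<Sum>b\<in>B. f v b)"
    using V B by (simp add: prod_sum_PiE)
  also have "\<dots> = (\<Prod>v\<in>V. if v = v0 then (\<Sum>b\<in>B. W v b * h b) else 1)"
    using s by (intro prod.cong refl) (auto simp: f_def)
  also have "\<dots> = (\<Sum>b\<in>B. W v0 b * h b)" using V by (simp add: prod.delta)
  finally show ?thesis .
qed

context prob_space
begin

lemma kernel_prod:
  assumes V: "finite V" and k: "\<And>v. v \<in> V \<Longrightarrow> kernel M B (W v)" and B: "finite B"
  shows "kernel M (Pi\<^sub>E V (\<lambda>_. B)) (\<lambda>\<beta> x. \<Prod>v\<in>V. W v (\<beta> v) x)"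
  unfolding kernel_def
proof (intro conjI ballI)
  show "finite (Pi\<^sub>E V (\<lambda>_. B))" using V B by (intro finite_PiE)
  fix \<beta> assume b: "\<beta> \<in> Pi\<^sub>E V (\<lambda>_. B)"
  then have b': "\<beta> v \<in> B" if "v \<in> V" for v using that by auto
  show "(\<lambda>x. \<Prod>v\<in>V. W v (\<beta> v) x) \<in> borel_measurable M"
    using kernelD(2)[OF k] b' by (intro borel_measurable_prod) auto
  show "0 \<le> (\<Prod>v\<in>V. W v (\<beta> v) x)" if "x \<in> space M" for x
    using kernelD(3)[OF k] b' that by (intro prod_nonneg) auto
next
  fix x assume "x \<in> space M"
  then have "(\<Prod>v\<in>V. \<Sum>b\<in>B. W v b x) = 1" using kernelD(4)[OF k] by (intro prod.neutral) auto
  then show "(\<Sum>\<beta>\<in>Pi\<^sub>E V (\<lambda>_. B). \<Prod>v\<in>V. W v (\<beta> v) x) = 1" using V B by (simp add: prod_sum_PiE)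
qed

lemma rate_nonneg:
  assumes "kernel M B w"
  shows "0 \<le> rate M B w"
proof -
  have "(\<Sum>b\<in>B. \<integral>x. w b x * log 2 1 \<partial>M) + (1 - (\<Sum>b\<in>B. marg M w b * (\<integral>x. 1 \<partial>M))) / ln 2 \<le> rate M B w"
    by (rule rate_ge[OF assms]) auto
  then show ?thesis by (simp add: prob_space sum_marg[OF assms])
qed

text \<open>Outputs that are independent given the input: the divergence of the joint output law
  from the product \<open>q\<close> of its marginals is nonnegative, so replacing the marginal of
  \<open>\<beta>\<close> by \<open>q \<beta>\<close> in the logarithm can only raise the rate, and
  with \<open>q\<close> the logarithm splits into a sum over \<open>v\<close>.\<close>

lemma rate_prod_le:
  assumes V: "finite V" and k: "\<And>v. v \<in> V \<Longrightarrow> kernel M B (W v)" and B: "finite B"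
  shows "rate M (Pi\<^sub>E V (\<lambda>_. B)) (\<lambda>\<beta> x. \<Prod>v\<in>V. W v (\<beta> v) x) \<le> (\<Sum>v\<in>V. rate M B (W v))"
proof -
  define w where "w \<beta> x = (\<Prod>v\<in>V. W v (\<beta> v) x)" for \<beta> x
  define B' where "B' = Pi\<^sub>E V (\<lambda>_. B)"
  define q where "q \<beta> = (\<Prod>v\<in>V. marg M (W v) (\<beta> v))" for \<beta>
  define G where "G v b x = W v b x * log 2 (W v b x / marg M (W v) b)" for v b x
  have kw: "kernel M B' w"
    unfolding B'_def w_def by (rule kernel_prod[OF V k B])
  have bB: "\<beta> v \<in> B" if "\<beta> \<in> B'" "v \<in> V" for \<beta> v using that by (auto simp: B'_def)
  have q0: "q \<beta> \<ge> 0" if "\<beta> \<in> B'" for \<beta>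
    unfolding q_def using marg_nonneg[OF k] bB[OF that] by (intro prod_nonneg) auto
  have qs: "(\<Sum>\<beta>\<in>B'. q \<beta>) = 1"
  proof -
    have "(\<Sum>\<beta>\<in>B'. q \<beta>) = (\<Prod>v\<in>V. \<Sum>b\<in>B. marg M (W v) b)"
      unfolding B'_def q_def using V B by (simp add: prod_sum_PiE)
    then show ?thesis using sum_marg[OF k] by simp
  qed
  define t where "t \<beta> v x = w \<beta> x * log 2 (W v (\<beta> v) x / marg M (W v) (\<beta> v))" for \<beta> v x
  have ti: "integrable M (t \<beta> v)" if "\<beta> \<in> B'" "v \<in> V" for \<beta> v
  proof (rule Bochner_Integration.integrable_bound[OF rate_integrable[OF k[OF that(2)] bB[OF that]]])
    have "w \<beta> \<in> borel_measurable M" "W v (\<beta> v) \<in> borel_measurable M"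
      using kernelD(2)[OF kw] kernelD(2)[OF k] bB that by auto
    then show "t \<beta> v \<in> borel_measurable M" unfolding t_def by measurable
    show "AE x in M. norm (t \<beta> v x) \<le> norm (W v (\<beta> v) x * log 2 (W v (\<beta> v) x / marg M (W v) (\<beta> v)))"
    proof (rule AE_I2)
      fix x assume x: "x \<in> space M"
      have W: "0 \<le> W v' (\<beta> v') x" "W v' (\<beta> v') x \<le> 1" if "v' \<in> V" for v'
        using kernelD(3,5)[OF k[OF that]] bB[OF \<open>\<beta> \<in> B'\<close> that] x by auto
      have "w \<beta> x = W v (\<beta> v) x * (\<Prod>v\<in>V - {v}. W v (\<beta> v) x)"
        unfolding w_def using V that by (simp add: prod.remove)
      also have "\<dots> \<le> W v (\<beta> v) x * 1"
        using W that by (intro mult_left_mono prod_le_1) auto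
      finally have "\<bar>w \<beta> x\<bar> \<le> \<bar>W v (\<beta> v) x\<bar>"
        using kernelD(3)[OF kw that(1) x] by simp
      then show "norm (t \<beta> v x) \<le> norm (W v (\<beta> v) x * log 2 (W v (\<beta> v) x / marg M (W v) (\<beta> v)))"
        unfolding t_def real_norm_def abs_mult by (intro mult_right_mono) auto
    qed
  qed
  have aeW: "AE x in M. \<forall>v\<in>V. \<forall>b\<in>B. W v b x > 0 \<longrightarrow> marg M (W v) b > 0"
    using kernel_AE_marg_pos[OF k] by (intro AE_finite_allI[OF V]) auto
  have "rate M B' w \<le> (\<Sum>\<beta>\<in>B'. (\<Sum>v\<in>V. \<integral>x. t \<beta> v x \<partial>M) + (q \<beta> - marg M w \<beta>) / ln 2)"
    unfolding rate_def
  proof (rule sum_mono)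
    fix \<beta> assume b: "\<beta> \<in> B'"
    let ?p = "marg M w \<beta>"
    have "(\<integral>x. w \<beta> x * log 2 (w \<beta> x / ?p) \<partial>M) \<le> (\<integral>x. (\<Sum>v\<in>V. t \<beta> v x) + w \<beta> x * ((q \<beta> / ?p - 1) / ln 2) \<partial>M)"
    proof (rule integral_mono_AE[OF rate_integrable[OF kw b]])
      show "integrable M (\<lambda>x. (\<Sum>v\<in>V. t \<beta> v x) + w \<beta> x * ((q \<beta> / ?p - 1) / ln 2))"
        using ti[OF b] kernel_integrable[OF kw b] by auto
      show "AE x in M. w \<beta> x * log 2 (w \<beta> x / ?p) \<le> (\<Sum>v\<in>V. t \<beta> v x) + w \<beta> x * ((q \<beta> / ?p - 1) / ln 2)"
        using aeW kernel_AE_marg_pos[OF kw] AE_space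
      proof eventually_elim
        case (elim x)
        show ?case
        proof (cases "w \<beta> x = 0")
          case True
          then show ?thesis by (simp add: t_def)
        next
          case False
          have Wp: "W v (\<beta> v) x > 0" if "v \<in> V" for v
            using False that V kernelD(3)[OF k[OF that] bB[OF b that] elim(3)]
            by (auto simp: w_def order_less_le)
          have mp: "marg M (W v) (\<beta> v) > 0" if "v \<in> V" for v
            using elim(1) that bB[OF b that] Wp[OF that] by blast
          have wp: "w \<beta> x > 0" unfolding w_def using Wp by (intro prod_pos) auto
          have pp: "?p > 0" using elim(2) b wp by blast
          have qp: "q \<beta> > 0" unfolding q_def using mp by (intro prod_pos) auto
          have "ln (w \<beta> x) = (\<Sum>v\<in>V. ln (W v (\<beta> v) x))" "ln (q \<beta>) = (\<Sum>v\<in>V. ln (marg M (W v) (\<beta> v)))"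
            unfolding w_def q_def using Wp mp by (intro ln_prod; force simp: V)+
          moreover have "(\<Sum>v\<in>V. ln (W v (\<beta> v) x / marg M (W v) (\<beta> v))) = (\<Sum>v\<in>V. ln (W v (\<beta> v) x) - ln (marg M (W v) (\<beta> v)))"
          proof (intro sum.cong refl)
            fix v assume "v \<in> V"
            then show "ln (W v (\<beta> v) x / marg M (W v) (\<beta> v)) = ln (W v (\<beta> v) x) - ln (marg M (W v) (\<beta> v))"
              using Wp[of v] mp[of v] by (simp add: ln_div)
          qed
          ultimately have "ln (w \<beta> x) - ln (q \<beta>) = (\<Sum>v\<in>V. ln (W v (\<beta> v) x / marg M (W v) (\<beta> v)))"
            by (simp add: sum_subtractf)
          moreover have "ln (w \<beta> x / ?p) = (ln (w \<beta> x) - ln (q \<beta>)) + ln (q \<beta> / ?p)"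
            using wp pp qp by (simp add: ln_div)
          moreover have "ln (q \<beta> / ?p) \<le> q \<beta> / ?p - 1" using pp qp by (intro ln_le_minus_one) auto
          ultimately have "ln (w \<beta> x / ?p) \<le> (\<Sum>v\<in>V. ln (W v (\<beta> v) x / marg M (W v) (\<beta> v))) + (q \<beta> / ?p - 1)" by simp
          then have "log 2 (w \<beta> x / ?p) \<le> (\<Sum>v\<in>V. log 2 (W v (\<beta> v) x / marg M (W v) (\<beta> v))) + (q \<beta> / ?p - 1) / ln 2"
            unfolding log_def by (simp add: divide_right_mono flip: sum_divide_distrib add_divide_distrib)
          then have "w \<beta> x * log 2 (w \<beta> x / ?p) \<le> w \<beta> x * ((\<Sum>v\<in>V. log 2 (W v (\<beta> v) x / marg M (W v) (\<beta> v))) + (q \<beta> / ?p - 1) / ln 2)"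
            using wp by (intro mult_left_mono) auto
          then show ?thesis by (simp only: t_def sum_distrib_left distrib_left)
        qed
      qed
    qed
    also have "\<dots> = (\<Sum>v\<in>V. \<integral>x. t \<beta> v x \<partial>M) + ?p * ((q \<beta> / ?p - 1) / ln 2)"
      using ti[OF b] kernel_integrable[OF kw b] by (simp add: marg_def)
    \<comment> \<open>Equality unless the marginal \<open>?p\<close> is 0, where the left side is 0
      and the right side is nonnegative.\<close>
    also have "?p * ((q \<beta> / ?p - 1) / ln 2) \<le> (q \<beta> - ?p) / ln 2"
      using q0[OF b] marg_nonneg[OF kw b] by (cases "?p = 0") (auto simp: field_simps)
    finally show "(\<integral>x. w \<beta> x * log 2 (w \<beta> x / ?p) \<partial>M) \<le> (\<Sum>v\<in>V. \<integral>x. t \<beta> v x \<partial>M) + (q \<beta> - ?p) / ln 2" by simp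
  qed
  also have "\<dots> = (\<Sum>v\<in>V. \<integral>x. (\<Sum>\<beta>\<in>B'. t \<beta> v x) \<partial>M)"
    using ti by (simp add: sum.distrib qs sum_marg[OF kw] sum_subtractf sum.swap[of _ B' V] flip: sum_divide_distrib)
  also have "\<dots> = (\<Sum>v\<in>V. \<integral>x. (\<Sum>b\<in>B. G v b x) \<partial>M)"
  proof (intro sum.cong refl Bochner_Integration.integral_cong)
    fix v x assume v: "v \<in> V" and x: "x \<in> space M"
    show "(\<Sum>\<beta>\<in>B'. t \<beta> v x) = (\<Sum>b\<in>B. G v b x)"
      unfolding t_def G_def w_def B'_def
      using sum_PiE_marginal[OF V v B, of "\<lambda>v b. W v b x" "\<lambda>b. log 2 (W v b x / marg M (W v) b)"] kernelD(4)[OF k] x by simp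
  qed
  also have "\<dots> = (\<Sum>v\<in>V. rate M B (W v))"
    unfolding rate_def G_def using rate_integrable[OF k] by (intro sum.cong refl Bochner_Integration.integral_sum) auto
  finally show ?thesis unfolding w_def B'_def .
qed

end

context lip_action
begin

section \<open>Independent use of one code on the tiles of a large cube\<close>

lemma invariantD:
  assumes "\<mu> \<in> invariant_measures M d T"
  shows "prob_space \<mu>" "sets \<mu> = sets (borel_met M d)" "space \<mu> = M" "distr \<mu> (borel_met M d) (T u) = \<mu>"
  using assms sets_eq_imp_space_eq[of \<mu> "borel_met M d"] by (auto simp: invariant_measures_def)

lemma T_measurable_inv:
  assumes "\<mu> \<in> invariant_measures M d T"
  shows "T u \<in> \<mu> \<rightarrow>\<^sub>M borel_met M d" "T u \<in> \<mu> \<rightarrow>\<^sub>M \<mu>"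
  using T_measurable[of u] invariantD(2)[OF assms] by (simp_all cong: measurable_cong_sets)

lemma invariant_integral:
  fixes g :: "'a \<Rightarrow> real"
  assumes mu: "\<mu> \<in> invariant_measures M d T" and g: "g \<in> borel_measurable \<mu>"
  shows "(\<integral>x. g (T u x) \<partial>\<mu>) = (\<integral>x. g x \<partial>\<mu>)"
proof -
  have "g \<in> borel_measurable (borel_met M d)"
    using g invariantD(2)[OF mu] by (simp cong: measurable_cong_sets)
  then have "(\<integral>x. g x \<partial>distr \<mu> (borel_met M d) (T u)) = (\<integral>x. g (T u x) \<partial>\<mu>)"
    by (rule integral_distr[OF T_measurable_inv(1)[OF mu]])
  then show ?thesis using invariantD(4)[OF mu, of u] by simp
qed

lemma shift_kernel:
  assumes mu: "\<mu> \<in> invariant_measures M d T" and k: "kernel \<mu> B w"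
  shows "kernel \<mu> B (\<lambda>b x. w b (T u x))" "rate \<mu> B (\<lambda>b x. w b (T u x)) = rate \<mu> B w"
proof -
  show "kernel \<mu> B (\<lambda>b x. w b (T u x))"
    using k measurable_compose[OF T_measurable_inv(2)[OF mu], of _ borel u] T_in invariantD(3)[OF mu]
    unfolding kernel_def by auto
  have m: "marg \<mu> (\<lambda>b x. w b (T u x)) b = marg \<mu> w b" if "b \<in> B" for b
    unfolding marg_def by (rule invariant_integral[OF mu kernelD(2)[OF k that]])
  show "rate \<mu> B (\<lambda>b x. w b (T u x)) = rate \<mu> B w"
    unfolding rate_def
  proof (intro sum.cong refl)
    fix b assume b: "b \<in> B"
    note [measurable] = kernelD(2)[OF k b]
    have "(\<lambda>x. w b x * log 2 (w b x / marg \<mu> w b)) \<in> borel_measurable \<mu>" by measurable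
    from invariant_integral[OF mu this, of u]
    show "(\<integral>x. w b (T u x) * log 2 (w b (T u x) / marg \<mu> (\<lambda>b x. w b (T u x)) b) \<partial>\<mu>) = (\<integral>x. w b x * log 2 (w b x / marg \<mu> w b) \<partial>\<mu>)"
      by (simp add: m[OF b])
  qed
qed

text \<open>Off the tiled cube the function takes a fixed value \<open>x0\<close>, so one function
  serves every \<open>L\<close>. Measurability is tested on distances to a fixed point, which are
  sums over the tiles of an indicator times a distance.\<close>

lemma glue_L1:
  fixes f :: "int ^ 'n \<Rightarrow> real ^ 'n \<Rightarrow> 'a"
  assumes L0: "0 < L0" and f: "\<And>j. j \<in> ibox k \<Longrightarrow> f j \<in> L1_maps M d L0"
  shows "\<exists>g. (\<forall>L. g \<in> L1_maps M d L) \<and> (\<forall>j\<in>ibox k. \<forall>t\<in>cube L0. g (t + L0 *\<^sub>R rvec j) = f j t)"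
proof -
  obtain x0 where x0: "x0 \<in> M" using M_ne by auto
  define J where "J u = (THE j. j \<in> ibox k \<and> u - L0 *\<^sub>R rvec j \<in> cube L0)" for u :: "real ^ 'n"
  define g where "g u = (if u \<in> cube (real k * L0) then f (J u) (u - L0 *\<^sub>R rvec (J u)) else x0)" for u
  have J: "J u = j" if "j \<in> ibox k" "u - L0 *\<^sub>R rvec j \<in> cube L0" for u j
    unfolding J_def using that cube_decomp(2)[OF L0] by (intro the_equality) auto
  have g1: "g u = f j (u - L0 *\<^sub>R rvec j)" if "j \<in> ibox k" "u - L0 *\<^sub>R rvec j \<in> cube L0" for u j
    using J[OF that] cube_decomp(1)[OF L0] that by (auto simp: g_def)
  have gM: "g u \<in> M" for u
  proof (cases "u \<in> cube (real k * L0)")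
    case True
    then obtain j where "j \<in> ibox k" "u - L0 *\<^sub>R rvec j \<in> cube L0" using cube_decomp(1)[OF L0] by blast
    then show ?thesis using g1 L1_maps_in[OF f] by simp
  qed (simp add: g_def x0)
  have gm: "g \<in> lborel \<rightarrow>\<^sub>M borel_met M d"
  proof (rule measurable_into_borel_met[OF tb])
    show "g \<in> space lborel \<rightarrow> M" using gM by auto
    fix z assume z: "z \<in> M"
    have "(\<lambda>u. \<Sum>j\<in>ibox k. indicator (cube L0) (u - L0 *\<^sub>R rvec j) * d (f j (u - L0 *\<^sub>R rvec j)) z) \<in> borel_measurable (borel :: (real ^ 'n) measure)"
    proof (rule borel_measurable_sum)
      fix j :: "int ^ 'n" assume j: "j \<in> ibox k"
      have "(\<lambda>t. d (f j t) z) \<in> borel_measurable (restrict_space lborel (cube L0))"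
        using measurable_compose[OF f[OF j, unfolded L1_maps_def] dist_borel_measurable[OF z]] .
      then have m: "(\<lambda>t. indicator (cube L0) t * d (f j t) z) \<in> borel_measurable (borel :: (real ^ 'n) measure)"
        by (subst (asm) borel_measurable_restrict_space_iff) auto
      have "(\<lambda>u. u - L0 *\<^sub>R rvec j) \<in> borel \<rightarrow>\<^sub>M (borel :: (real ^ 'n) measure)" by simp
      from measurable_compose[OF this m]
      show "(\<lambda>u. indicator (cube L0) (u - L0 *\<^sub>R rvec j) * d (f j (u - L0 *\<^sub>R rvec j)) z) \<in> borel_measurable borel" .
    qed
    then have "(\<lambda>u. (\<Sum>j\<in>ibox k. indicator (cube L0) (u - L0 *\<^sub>R rvec j) * d (f j (u - L0 *\<^sub>R rvec j)) z) + (1 - indicator (cube (real k * L0)) u) * d x0 z) \<in> borel_measurable (borel :: (real ^ 'n) measure)"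
      by measurable
    also have "(\<lambda>u. (\<Sum>j\<in>ibox k. indicator (cube L0) (u - L0 *\<^sub>R rvec j) * d (f j (u - L0 *\<^sub>R rvec j)) z) + (1 - indicator (cube (real k * L0)) u) * d x0 z) = (\<lambda>u. d (g u) z)"
    proof
      fix u :: "real ^ 'n"
      have "(\<Sum>j\<in>ibox k. indicator (cube L0) (u - L0 *\<^sub>R rvec j) * d (f j (u - L0 *\<^sub>R rvec j)) z) = (\<Sum>j\<in>ibox k. indicator (cube L0) (u - L0 *\<^sub>R rvec j) * d (g u) z)"
        using g1 by (intro sum.cong refl) (auto simp: indicator_def)
      also have "\<dots> = indicator (cube (real k * L0)) u * d (g u) z"
        by (simp add: indicator_cube_decomp[OF L0] sum_distrib_right)
      finally show "(\<Sum>j\<in>ibox k. indicator (cube L0) (u - L0 *\<^sub>R rvec j) * d (f j (u - L0 *\<^sub>R rvec j)) z) + (1 - indicator (cube (real k * L0)) u) * d x0 z = d (g u) z"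
        by (auto simp: indicator_def g_def)
    qed
    finally show "(\<lambda>u. d (g u) z) \<in> borel_measurable lborel" by simp
  qed
  have "g (t + L0 *\<^sub>R rvec j) = f j t" if "j \<in> ibox k" "t \<in> cube L0" for j t
    using g1[of j "t + L0 *\<^sub>R rvec j"] that by simp
  moreover have "g \<in> L1_maps M d L" for L
    unfolding L1_maps_def by (rule measurable_restrict_space1[OF gm])
  ultimately show ?thesis by blast
qed

text \<open>On a tile the orbit of \<open>x\<close> is the orbit of a translate of \<open>x\<close>
  over the small cube. The part of the large cube outside the tiles is charged with the bound
  \<open>bd\<close> on all distances.\<close>

lemma l1d_glue_le:
  assumes L0: "0 < L0" and f: "\<And>j. j \<in> ibox k \<Longrightarrow> f j \<in> L1_maps M d L0" and x: "x \<in> M"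
    and g: "\<And>L. g \<in> L1_maps M d L" "\<And>j t. j \<in> ibox k \<Longrightarrow> t \<in> cube L0 \<Longrightarrow> g (t + L0 *\<^sub>R rvec j) = f j t"
    and L: "real k * L0 \<le> L"
  shows "l1d L (orb x) g \<le> (\<Sum>j\<in>ibox k. l1d L0 (orb (T (L0 *\<^sub>R rvec j) x)) (f j)) + bd * (L ^ CARD('n) - (real k * L0) ^ CARD('n))"
proof -
  let ?K = "cube (real k * L0) :: (real ^ 'n) set" and ?C = "cube L :: (real ^ 'n) set"
  have K0: "0 \<le> real k * L0" using L0 by simp
  then have LL: "0 \<le> L" using L by simp
  have sub: "?K \<subseteq> ?C" using L by (auto simp: cube_def intro: less_le_trans)
  define h where "h u = d (T u x) (g u)" for u
  have i: "set_integrable lborel (cube L) h" for L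
    unfolding h_def by (rule l1_integrable[OF orb_L1[OF x] g(1)])
  have iD: "set_integrable lborel (?C - ?K) h"
    by (rule set_integrable_subset[OF i[of L]]) auto
  have "l1d L (orb x) g = (LINT u:?K \<union> (?C - ?K)|lborel. h u)"
    using sub by (simp add: l1d_def h_def Un_absorb1)
  also have "\<dots> = (LINT u:?K|lborel. h u) + (LINT u:?C - ?K|lborel. h u)"
    by (rule set_integral_Un[OF _ i iD]) auto
  also have "(LINT u:?C - ?K|lborel. h u) \<le> set_lebesgue_integral lborel (?C - ?K) (\<lambda>u. bd)"
  proof (rule set_integral_mono[OF iD])
    have "emeasure lborel (?C - ?K) \<le> emeasure lborel ?C" by (intro emeasure_mono) auto
    also have "\<dots> < \<infinity>" by (simp add: emeasure_cube[OF LL])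
    finally show "set_integrable lborel (?C - ?K) (\<lambda>u. bd)"
      by (simp add: set_integrable_def)
    show "h u \<le> bd" if "u \<in> ?C - ?K" for u
      unfolding h_def using that by (intro bd(2) T_in x L1_maps_in[OF g(1)]) auto
  qed
  also have "\<dots> = bd * (L ^ CARD('n) - (real k * L0) ^ CARD('n))"
  proof -
    have "measure lborel (?C - ?K) = measure lborel ?C - measure lborel ?K"
      using sub by (intro measure_Diff) (auto simp: emeasure_cube[OF LL])
    then show ?thesis by (simp add: set_lebesgue_integral_def measure_cube[OF LL] measure_cube[OF K0])
  qed
  also have "(LINT u:?K|lborel. h u) = (\<Sum>j\<in>ibox k. LINT u:cube L0|lborel. h (u + L0 *\<^sub>R rvec j))"
    by (rule set_integral_cube_decomp(1)[OF L0 i])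
  also have "\<dots> = (\<Sum>j\<in>ibox k. l1d L0 (orb (T (L0 *\<^sub>R rvec j) x)) (f j))"
    unfolding l1d_def
    by (intro sum.cong refl set_lebesgue_integral_cong) (auto simp: h_def g(2) T_add[OF x])
  finally show ?thesis by simp
qed

text \<open>Each tile is coded separately by the same code, applied to the point translated to that
  tile, with outputs independent given the point. By invariance of \<open>\<mu>\<close> every tile
  has the rate and the mean distortion of the original code, and \<open>rate_prod_le\<close> adds up
  the rates.\<close>

lemma code_extend:
  fixes B :: "'b set"
  assumes mu: "\<mu> \<in> invariant_measures M d T" and L0: "0 < L0" and c: "code \<mu> \<epsilon> L0 B w F"
    and L: "real k * L0 \<le> L"
    and lt: "real k ^ CARD('n) * (\<Sum>b\<in>B. \<integral>x. w b x * dst L0 x (F b) \<partial>\<mu>) + bd * (L ^ CARD('n) - (real k * L0) ^ CARD('n)) < \<epsilon> * L ^ CARD('n)"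
  shows "\<exists>(B' :: (int ^ 'n \<Rightarrow> 'b) set) w' F'. code \<mu> \<epsilon> L B' w' F' \<and> rate \<mu> B' w' \<le> real k ^ CARD('n) * rate \<mu> B w"
proof -
  interpret m: prob_space \<mu> using invariantD(1)[OF mu] .
  note spm = invariantD(3)[OF mu]
  have k: "kernel \<mu> B w" and F: "\<And>b. b \<in> B \<Longrightarrow> F b \<in> L1_space M d L0" using c by (auto simp: code_def)
  note kD = kernelD[OF k]
  have LL: "0 \<le> L" using L L0 by (meson mult_nonneg_nonneg of_nat_0_le_iff order.trans less_imp_le)
  define W where "W j b x = w b (T (L0 *\<^sub>R rvec j) x)" for j :: "int ^ 'n" and b x
  have kW: "kernel \<mu> B (W j)" and rW: "rate \<mu> B (W j) = rate \<mu> B w" for j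
    unfolding W_def by (rule shift_kernel[OF mu k])+
  define B' where "B' = Pi\<^sub>E (ibox k :: (int ^ 'n) set) (\<lambda>_. B)"
  define w' where "w' \<beta> x = (\<Prod>j\<in>ibox k. W j (\<beta> j) x)" for \<beta> x
  have kw: "kernel \<mu> B' w'"
    unfolding B'_def w'_def by (rule m.kernel_prod[OF finite_ibox kW kD(1)])
  have "rate \<mu> B' w' \<le> (\<Sum>j\<in>(ibox k :: (int ^ 'n) set). rate \<mu> B (W j))"
    unfolding B'_def w'_def by (rule m.rate_prod_le[OF finite_ibox kW kD(1)])
  then have r: "rate \<mu> B' w' \<le> real k ^ CARD('n) * rate \<mu> B w" by (simp add: rW)
  have bB: "\<beta> j \<in> B" if "\<beta> \<in> B'" "j \<in> ibox k" for \<beta> j using that by (auto simp: B'_def)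
  have "\<exists>g. (\<forall>L. g \<in> L1_maps M d L) \<and> (\<forall>j\<in>ibox k. \<forall>t\<in>cube L0. g (t + L0 *\<^sub>R rvec j) = L1_rep (F (\<beta> j)) t)"
    if "\<beta> \<in> B'" for \<beta>
    by (rule glue_L1[OF L0 rep_L1[OF F[OF bB[OF that]]]])
  then obtain g where g: "\<And>\<beta> L. \<beta> \<in> B' \<Longrightarrow> g \<beta> \<in> L1_maps M d L"
    "\<And>\<beta> j t. \<beta> \<in> B' \<Longrightarrow> j \<in> ibox k \<Longrightarrow> t \<in> cube L0 \<Longrightarrow> g \<beta> (t + L0 *\<^sub>R rvec j) = L1_rep (F (\<beta> j)) t"
    by metis
  define F' where "F' \<beta> = cls L (g \<beta>)" for \<beta>
  have F': "F' \<beta> \<in> L1_space M d L" if "\<beta> \<in> B'" for \<beta> unfolding F'_def by (rule cls_in[OF g(1)[OF that]])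
  define R where "R = bd * (L ^ CARD('n) - (real k * L0) ^ CARD('n))"
  define D where "D j b x = dst L0 (T (L0 *\<^sub>R rvec j) x) (F b)" for j :: "int ^ 'n" and b x
  have Dm: "D j b \<in> borel_measurable \<mu>" if "b \<in> B" for j b
    unfolding D_def using dst_measurable1[of L0 "F b"] L0 F[OF that]
    by (intro measurable_compose[OF T_measurable_inv(1)[OF mu]]) auto
  have dle: "dst L x (F' \<beta>) \<le> (\<Sum>j\<in>ibox k. D j (\<beta> j) x) + R" if "\<beta> \<in> B'" "x \<in> M" for \<beta> x
  proof -
    have "dst L x (F' \<beta>) = l1d L (orb x) (g \<beta>)"
      unfolding F'_def by (rule dst_cls[OF that(2) g(1)[OF that(1)]])
    also have "\<dots> \<le> (\<Sum>j\<in>ibox k. D j (\<beta> j) x) + R"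
      unfolding R_def D_def dst_def using g[OF that(1)] F bB[OF that(1)]
      by (intro l1d_glue_le[OF L0 rep_L1 that(2) _ _ L]) auto
    finally show ?thesis .
  qed
  have bndD: "0 \<le> D j b x" "D j b x \<le> bd * L0 ^ CARD('n)" if "b \<in> B" "x \<in> M" for j b x
    unfolding D_def using dst_bounds[of L0 _ "F b"] F[OF that(1)] T_in[OF that(2)] L0 by auto
  have int: "integrable \<mu> (\<lambda>x. v x * h x)" if "v \<in> borel_measurable \<mu>" "\<And>x. x \<in> M \<Longrightarrow> 0 \<le> v x \<and> v x \<le> 1" "h \<in> borel_measurable \<mu>" "\<And>x. x \<in> M \<Longrightarrow> 0 \<le> h x \<and> h x \<le> K" for v h :: "'a \<Rightarrow> real" and K
  proof (rule m.integrable_const_bound[of _ K])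
    show "AE x in \<mu>. norm (v x * h x) \<le> K"
    proof (rule AE_I2)
      fix x assume "x \<in> space \<mu>"
      then show "norm (v x * h x) \<le> K"
        using mult_mono[of "v x" 1 "h x" K] that(2,4)[of x] by (auto simp: spm abs_mult)
    qed
  qed (use that in measurable)
  have w'b: "0 \<le> w' \<beta> x \<and> w' \<beta> x \<le> 1" if "\<beta> \<in> B'" "x \<in> M" for \<beta> x
    using kernelD(3,5)[OF kw that(1)] that(2) spm by auto
  have i1: "integrable \<mu> (\<lambda>x. w' \<beta> x * D j (\<beta> j) x)" if "\<beta> \<in> B'" "j \<in> ibox k" for \<beta> j
    using that kernelD(2)[OF kw] Dm w'b bB bndD by (intro int[of _ _ "bd * L0 ^ CARD('n)"]) auto
  have "(\<Sum>\<beta>\<in>B'. \<integral>x. w' \<beta> x * dst L x (F' \<beta>) \<partial>\<mu>) \<le> (\<Sum>\<beta>\<in>B'. \<integral>x. (\<Sum>j\<in>ibox k. w' \<beta> x * D j (\<beta> j) x) + R * w' \<beta> x \<partial>\<mu>)"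
  proof (intro sum_mono integral_mono)
    fix \<beta> assume b: "\<beta> \<in> B'"
    have "(\<lambda>x. dst L x (F' \<beta>)) \<in> borel_measurable \<mu>"
      using dst_measurable1[OF LL F'[OF b]] invariantD(2)[OF mu] by (simp cong: measurable_cong_sets)
    then show "integrable \<mu> (\<lambda>x. w' \<beta> x * dst L x (F' \<beta>))"
      using kernelD(2)[OF kw b] w'b b dst_bounds[OF LL _ F'[OF b]] by (intro int[of _ _ "bd * L ^ CARD('n)"]) auto
    show "integrable \<mu> (\<lambda>x. (\<Sum>j\<in>ibox k. w' \<beta> x * D j (\<beta> j) x) + R * w' \<beta> x)"
      using i1[OF b] m.kernel_integrable[OF kw b] by auto
    fix x assume "x \<in> space \<mu>"
    then have "w' \<beta> x * dst L x (F' \<beta>) \<le> w' \<beta> x * ((\<Sum>j\<in>ibox k. D j (\<beta> j) x) + R)"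
      using dle[OF b] w'b[OF b] spm by (intro mult_left_mono) auto
    then show "w' \<beta> x * dst L x (F' \<beta>) \<le> (\<Sum>j\<in>ibox k. w' \<beta> x * D j (\<beta> j) x) + R * w' \<beta> x"
      by (simp add: sum_distrib_left algebra_simps)
  qed
  also have "\<dots> = (\<Sum>\<beta>\<in>B'. (\<Sum>j\<in>ibox k. \<integral>x. w' \<beta> x * D j (\<beta> j) x \<partial>\<mu>) + R * marg \<mu> w' \<beta>)"
    using i1 m.kernel_integrable[OF kw] by (intro sum.cong refl) (simp add: marg_def)
  also have "\<dots> = (\<Sum>j\<in>ibox k. \<Sum>\<beta>\<in>B'. \<integral>x. w' \<beta> x * D j (\<beta> j) x \<partial>\<mu>) + R"
    by (simp add: sum.distrib m.sum_marg[OF kw] sum.swap[of _ B' "ibox k"] flip: sum_distrib_left)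
  also have "(\<Sum>j\<in>ibox k. \<Sum>\<beta>\<in>B'. \<integral>x. w' \<beta> x * D j (\<beta> j) x \<partial>\<mu>) = (\<Sum>j\<in>(ibox k :: (int ^ 'n) set). \<Sum>b\<in>B. \<integral>x. w b x * dst L0 x (F b) \<partial>\<mu>)"
  proof (intro sum.cong refl)
    fix j :: "int ^ 'n" assume j: "j \<in> ibox k"
    have i2: "integrable \<mu> (\<lambda>x. W j b x * D j b x)" if "b \<in> B" for b
      using kernelD(2,3,5)[OF kW that] Dm[OF that] bndD[OF that] spm
      by (intro int[of _ _ "bd * L0 ^ CARD('n)"]) auto
    have "(\<Sum>\<beta>\<in>B'. \<integral>x. w' \<beta> x * D j (\<beta> j) x \<partial>\<mu>) = (\<integral>x. (\<Sum>\<beta>\<in>B'. w' \<beta> x * D j (\<beta> j) x) \<partial>\<mu>)"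
      using i1 j by (subst Bochner_Integration.integral_sum) auto
    \<comment> \<open>The distortion on tile \<open>j\<close> involves the letter of that tile
      alone, so the letters of all other tiles sum out to 1.\<close>
    also have "\<dots> = (\<integral>x. (\<Sum>b\<in>B. W j b x * D j b x) \<partial>\<mu>)"
    proof (intro Bochner_Integration.integral_cong refl)
      fix x assume "x \<in> space \<mu>"
      then show "(\<Sum>\<beta>\<in>B'. w' \<beta> x * D j (\<beta> j) x) = (\<Sum>b\<in>B. W j b x * D j b x)"
        unfolding B'_def w'_def using kernelD(4)[OF kW]
        by (intro sum_PiE_marginal[OF finite_ibox j kD(1), where W = "\<lambda>j b. W j b x" and h = "\<lambda>b. D j b x"]) auto
    qed
    also have "\<dots> = (\<Sum>b\<in>B. \<integral>x. W j b x * D j b x \<partial>\<mu>)"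
      using i2 by (subst Bochner_Integration.integral_sum) auto
    also have "\<dots> = (\<Sum>b\<in>B. \<integral>x. w b x * dst L0 x (F b) \<partial>\<mu>)"
    proof (intro sum.cong refl)
      fix b assume b: "b \<in> B"
      have "(\<lambda>x. dst L0 x (F b)) \<in> borel_measurable \<mu>"
        using dst_measurable1[of L0 "F b"] L0 F[OF b] invariantD(2)[OF mu] by (simp cong: measurable_cong_sets)
      then have "(\<lambda>x. w b x * dst L0 x (F b)) \<in> borel_measurable \<mu>" using kD(2)[OF b] by measurable
      from invariant_integral[OF mu this, of "L0 *\<^sub>R rvec j"]
      show "(\<integral>x. W j b x * D j b x \<partial>\<mu>) = (\<integral>x. w b x * dst L0 x (F b) \<partial>\<mu>)" unfolding W_def D_def .
    qed
    finally show "(\<Sum>\<beta>\<in>B'. \<integral>x. w' \<beta> x * D j (\<beta> j) x \<partial>\<mu>) = (\<Sum>b\<in>B. \<integral>x. w b x * dst L0 x (F b) \<partial>\<mu>)" .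
  qed
  also have "\<dots> + R < \<epsilon> * L ^ CARD('n)" using lt by (simp add: R_def)
  finally have "code \<mu> \<epsilon> L B' w' F'" unfolding code_def using kw F' by auto
  then show ?thesis using r by blast
qed

section \<open>Convergence of the rate distortion function\<close>

lemma floor_ratio_tendsto:
  assumes "0 < L0"
  shows "((\<lambda>L. real (nat \<lfloor>L / L0\<rfloor>) * L0 / L) \<longlongrightarrow> 1) at_top"
proof (rule tendsto_sandwich)
  show "\<forall>\<^sub>F L in at_top. 1 - L0 / L \<le> real (nat \<lfloor>L / L0\<rfloor>) * L0 / L"
    using eventually_gt_at_top[of 0]
  proof eventually_elim
    case (elim L)
    have "L / L0 - 1 \<le> real (nat \<lfloor>L / L0\<rfloor>)" by linarith
    then have "(L / L0 - 1) * L0 \<le> real (nat \<lfloor>L / L0\<rfloor>) * L0" using assms by (intro mult_right_mono) auto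
    then have "(L / L0 - 1) * L0 / L \<le> real (nat \<lfloor>L / L0\<rfloor>) * L0 / L" using elim by (intro divide_right_mono) auto
    moreover have "(L / L0 - 1) * L0 / L = 1 - L0 / L" using elim assms by (simp add: field_simps)
    ultimately show ?case by simp
  qed
  show "\<forall>\<^sub>F L in at_top. real (nat \<lfloor>L / L0\<rfloor>) * L0 / L \<le> 1"
    using eventually_gt_at_top[of 0]
  proof eventually_elim
    case (elim L)
    have "real (nat \<lfloor>L / L0\<rfloor>) \<le> L / L0" using elim assms by simp
    then have "real (nat \<lfloor>L / L0\<rfloor>) * L0 \<le> L" using assms by (simp add: field_simps)
    then show ?case using elim by simp
  qed
  have "((\<lambda>L. 1 - L0 / L) \<longlongrightarrow> 1 - 0) at_top"
    by (intro tendsto_diff tendsto_const real_tendsto_divide_at_top[OF tendsto_const filterlim_ident])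
  then show "((\<lambda>L. 1 - L0 / L) \<longlongrightarrow> 1) at_top" by simp
qed simp

text \<open>The tiles fill a fraction of the volume tending to 1. With distortion \<open>D\<close>
  on the tiles and at most \<open>bd\<close> elsewhere, the mean is a convex combination tending to
  \<open>D\<close>, so the strict inequality \<open>D < \<epsilon>\<close> absorbs the boundary once
  \<open>L\<close> is large.\<close>

lemma rate_distortion_L_eventually_le:
  fixes B :: "'b set"
  assumes mu: "\<mu> \<in> invariant_measures M d T" and L0: "0 < L0" and c: "code \<mu> \<epsilon> L0 B w F"
  shows "\<forall>\<^sub>F L in at_top. rate_distortion_L M d T \<mu> \<epsilon> L / ereal (L ^ CARD('n)) \<le> ereal (rate \<mu> B w / L0 ^ CARD('n))"
proof -
  define D where "D = (\<Sum>b\<in>B. \<integral>x. w b x * dst L0 x (F b) \<partial>\<mu>) / L0 ^ CARD('n)"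
  have L0n: "L0 ^ CARD('n) > 0" using L0 by simp
  have De: "D < \<epsilon>" using c L0n by (simp add: code_def D_def divide_simps)
  have rn: "0 \<le> rate \<mu> B w"
    using c unfolding code_def by (intro prob_space.rate_nonneg[OF invariantD(1)[OF mu]]) simp
  have "((\<lambda>L. (real (nat \<lfloor>L / L0\<rfloor>) * L0 / L) ^ CARD('n) * (D - bd) + bd) \<longlongrightarrow> 1 ^ CARD('n) * (D - bd) + bd) at_top"
    by (intro tendsto_intros floor_ratio_tendsto L0)
  then have "\<forall>\<^sub>F L in at_top. (real (nat \<lfloor>L / L0\<rfloor>) * L0 / L) ^ CARD('n) * (D - bd) + bd < \<epsilon>"
    using De by (intro order_tendstoD(2)) auto
  then show ?thesis using eventually_gt_at_top[of 0]
  proof eventually_elim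
    case (elim L)
    define k where "k = nat \<lfloor>L / L0\<rfloor>"
    have Ln: "L ^ CARD('n) > 0" using elim by simp
    have kL: "real k \<le> L / L0" using elim L0 by (simp add: k_def)
    then have kL': "real k * L0 \<le> L" using L0 by (simp add: field_simps)
    have "((real k * L0 / L) ^ CARD('n) * (D - bd) + bd) * L ^ CARD('n) < \<epsilon> * L ^ CARD('n)"
      using elim(1) Ln unfolding k_def by (intro mult_strict_right_mono)
    also have "((real k * L0 / L) ^ CARD('n) * (D - bd) + bd) * L ^ CARD('n) = (real k * L0) ^ CARD('n) * (D - bd) + bd * L ^ CARD('n)"
      unfolding power_divide[of _ L] using elim(2) by (simp add: distrib_right)
    also have "\<dots> = real k ^ CARD('n) * (\<Sum>b\<in>B. \<integral>x. w b x * dst L0 x (F b) \<partial>\<mu>) + bd * (L ^ CARD('n) - (real k * L0) ^ CARD('n))"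
      using L0 by (simp add: D_def power_mult_distrib algebra_simps)
    finally obtain B' :: "(int ^ 'n \<Rightarrow> 'b) set" and w' F' where
      c': "code \<mu> \<epsilon> L B' w' F'" "rate \<mu> B' w' \<le> real k ^ CARD('n) * rate \<mu> B w"
      using code_extend[OF mu L0 c kL'] by blast
    have "rate_distortion_L M d T \<mu> \<epsilon> L \<le> ereal (rate \<mu> B' w')"
      by (rule rate_distortion_L_le[OF invariantD(1,2)[OF mu] elim(2) c'(1)])
    also have "\<dots> \<le> ereal ((L / L0) ^ CARD('n) * rate \<mu> B w)"
      using c'(2) mult_right_mono[OF power_mono[OF kL, of "CARD('n)"] rn] by simp
    finally have "rate_distortion_L M d T \<mu> \<epsilon> L / ereal (L ^ CARD('n)) \<le> ereal ((L / L0) ^ CARD('n) * rate \<mu> B w) / ereal (L ^ CARD('n))"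
      using Ln by (intro ereal_divide_right_mono) auto
    also have "\<dots> = ereal (rate \<mu> B w / L0 ^ CARD('n))"
      using Ln L0n elim(2) by (simp add: power_divide)
    finally show ?case .
  qed
qed

lemma code_of_rate_less:
  assumes L: "0 < L" and lt: "rate_distortion_L M d T \<mu> \<epsilon> L < z"
  obtains B :: "(real ^ 'n \<Rightarrow> 'a) set set set" and w F where "code \<mu> \<epsilon> L B w F" "ereal (rate \<mu> B w) < z"
proof -
  from lt obtain P :: "('a \<times> (real ^ 'n \<Rightarrow> 'a) set) measure" and X Y where
    P: "prob_space P" "X \<in> P \<rightarrow>\<^sub>M borel_met M d" "distr P (borel_met M d) X = \<mu>"
      "Y \<in> P \<rightarrow>\<^sub>M L1_borel M d L" "distortion d T L P X Y < \<epsilon>"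
      "mutual_info P (borel_met M d) (L1_borel M d L) X Y < z"
    unfolding rate_distortion_L_def Inf_less_iff by blast
  obtain B :: "(real ^ 'n \<Rightarrow> 'a) set set set" and w F where "code \<mu> \<epsilon> L B w F"
    "ereal (rate \<mu> B w) \<le> mutual_info P (borel_met M d) (L1_borel M d L) X Y"
    by (rule code_of_channel[OF P(1-5) L])
  then show ?thesis using P(6) that by (meson le_less_trans)
qed

text \<open>Fekete's argument: a quotient below \<open>a\<close> at one side length comes from a
  code, and this code keeps the quotient below \<open>a\<close> at all large side lengths. So the
  limit exists and is the infimum, which gives the \<open>Lim\<close> in the definition its
  meaning.\<close>

lemma rate_distortion_tendsto:
  assumes mu: "\<mu> \<in> invariant_measures M d T"
  shows "((\<lambda>L. rate_distortion_L M d T \<mu> \<epsilon> L / ereal (L ^ CARD('n))) \<longlongrightarrow> rate_distortion M d T \<mu> \<epsilon>) at_top"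
    and "0 < L0 \<Longrightarrow> rate_distortion M d T \<mu> \<epsilon> \<le> rate_distortion_L M d T \<mu> \<epsilon> L0 / ereal (L0 ^ CARD('n))"
proof -
  define f where "f L = rate_distortion_L M d T \<mu> \<epsilon> L / ereal (L ^ CARD('n))" for L
  define I where "I = (INF L\<in>{0<..}. f L)"
  have lim: "(f \<longlongrightarrow> I) at_top"
  proof (rule order_tendstoI)
    fix a assume a: "a < I"
    show "\<forall>\<^sub>F L in at_top. a < f L"
      using eventually_gt_at_top[of 0]
    proof eventually_elim
      case (elim L)
      have "I \<le> f L" unfolding I_def using elim by (intro INF_lower) auto
      then show ?case using a by simp
    qed
  next
    fix a assume a: "I < a"
    then obtain L0 where L0: "L0 > 0" "f L0 < a" unfolding I_def by (auto simp: Inf_less_iff)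
    have L0n: "L0 ^ CARD('n) > 0" using L0 by simp
    have "rate_distortion_L M d T \<mu> \<epsilon> L0 < ereal (L0 ^ CARD('n)) * a"
      using L0(2) L0n unfolding f_def by (simp add: ereal_divide_less_iff mult.commute)
    then obtain B :: "(real ^ 'n \<Rightarrow> 'a) set set set" and w F where
      c: "code \<mu> \<epsilon> L0 B w F" "ereal (rate \<mu> B w) < ereal (L0 ^ CARD('n)) * a"
      by (rule code_of_rate_less[OF L0(1)])
    have "ereal (rate \<mu> B w / L0 ^ CARD('n)) < a"
    proof (cases a)
      case (real r)
      then show ?thesis using c(2) L0n by (simp add: field_simps)
    qed (use c(2) L0n a in auto)
    with rate_distortion_L_eventually_le[OF mu L0(1) c(1)]
    show "\<forall>\<^sub>F L in at_top. f L < a" unfolding f_def by (auto elim: eventually_mono)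
  qed
  have eq: "rate_distortion M d T \<mu> \<epsilon> = I"
    unfolding rate_distortion_def using tendsto_Lim[OF _ lim] by (simp add: f_def[abs_def])
  show "((\<lambda>L. rate_distortion_L M d T \<mu> \<epsilon> L / ereal (L ^ CARD('n))) \<longlongrightarrow> rate_distortion M d T \<mu> \<epsilon>) at_top"
    using lim eq by (simp add: f_def[abs_def])
  show "rate_distortion M d T \<mu> \<epsilon> \<le> rate_distortion_L M d T \<mu> \<epsilon> L0 / ereal (L0 ^ CARD('n))" if "0 < L0"
    using that unfolding eq I_def f_def[symmetric] by (intro INF_lower) auto
qed

end

section \<open>Covers\<close>

context lip_action
begin

section \<open>The dynamical metric\<close>

lemma zero_in_cube: "0 < L \<Longrightarrow> (0 :: real ^ 'n) \<in> cube L"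
  by (simp add: cube_def)

lemma dyn_dist_upper:
  assumes "x \<in> M" "y \<in> M" "u \<in> cube L"
  shows "d (T u x) (T u y) \<le> dyn_dist M d T L x y"
  unfolding dyn_dist_def using assms bd(2) T_in
  by (auto intro!: cSUP_upper bdd_aboveI2[where M = bd])

lemma dyn_dist_least:
  assumes "0 < L" "x \<in> M" "y \<in> M" "\<And>u. u \<in> cube L \<Longrightarrow> d (T u x) (T u y) \<le> c"
  shows "dyn_dist M d T L x y \<le> c"
  unfolding dyn_dist_def using assms zero_in_cube[OF assms(1)]
  by (auto intro!: cSUP_least)

lemma dyn_dist_metric:
  assumes L: "0 < L"
  shows "Metric_space M (dyn_dist M d T L)"
proof
  fix x y z
  show "0 \<le> dyn_dist M d T L x y"
  proof (cases "x \<in> M \<and> y \<in> M")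
    case True
    then show ?thesis using dyn_dist_upper[of x y 0 L] zero_in_cube[OF L] nonneg[of "T 0 x" "T 0 y"] by linarith
  qed (auto simp: dyn_dist_def)
  show "dyn_dist M d T L x y = dyn_dist M d T L y x"
    unfolding dyn_dist_def by (simp add: commute)
  show "dyn_dist M d T L x y = 0 \<longleftrightarrow> x = y" if "x \<in> M" "y \<in> M"
  proof
    assume "dyn_dist M d T L x y = 0"
    then have "d x y \<le> 0" using dyn_dist_upper[of x y 0 L] zero_in_cube[OF L] T_zero that by simp
    then show "x = y" using nonneg[of x y] zero[OF that] by linarith
  next
    assume "x = y"
    then have "dyn_dist M d T L x y \<le> 0" using that T_in by (intro dyn_dist_least[OF L]) auto
    moreover have "0 \<le> d (T 0 x) (T 0 y)" by simp
    ultimately show "dyn_dist M d T L x y = 0"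
      using dyn_dist_upper[OF that zero_in_cube[OF L]] by linarith
  qed
  show "dyn_dist M d T L x z \<le> dyn_dist M d T L x y + dyn_dist M d T L y z" if "x \<in> M" "y \<in> M" "z \<in> M"
  proof (rule dyn_dist_least[OF L that(1,3)])
    fix u :: "real ^ 'n" assume u: "u \<in> cube L"
    have "d (T u x) (T u z) \<le> d (T u x) (T u y) + d (T u y) (T u z)" using triangle T_in that by blast
    also have "\<dots> \<le> dyn_dist M d T L x y + dyn_dist M d T L y z"
      using that u by (intro add_mono dyn_dist_upper)
    finally show "d (T u x) (T u z) \<le> dyn_dist M d T L x y + dyn_dist M d T L y z" .
  qed
qed

lemma dyn_dist_lip:
  assumes L: "0 < L" and "x \<in> M" "y \<in> M"
  shows "dyn_dist M d T L x y \<le> lipc L * d x y"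
  using assms by (intro dyn_dist_least lipc(2))

text \<open>Fattening makes covering sets open, so that nothing need be known about their measurability.\<close>

definition fat :: "real \<Rightarrow> real \<Rightarrow> 'a set \<Rightarrow> 'a set" where
  "fat L \<eta> C = {x \<in> M. \<exists>c\<in>C. dyn_dist M d T L c x < \<eta>}"

lemma fat_superset: "0 < L \<Longrightarrow> 0 < \<eta> \<Longrightarrow> C \<subseteq> M \<Longrightarrow> C \<subseteq> fat L \<eta> C"
proof
  fix x assume *: "0 < L" "0 < \<eta>" "C \<subseteq> M" "x \<in> C"
  then have "dyn_dist M d T L x x = 0" using Metric_space.zero[OF dyn_dist_metric, of L x x] by auto
  then show "x \<in> fat L \<eta> C" using * by (auto simp: fat_def intro!: bexI[of _ x])
qed

lemma openin_dyn_fat: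
  assumes L: "0 < L" and C: "C \<subseteq> M"
  shows "openin (Metric_space.mtopology M (dyn_dist M d T L)) (fat L \<eta> C)"
proof -
  interpret D: Metric_space M "dyn_dist M d T L" by (rule dyn_dist_metric[OF L])
  have "fat L \<eta> C = (\<Union>c\<in>C. D.mball c \<eta>)" using C unfolding fat_def by auto blast
  then show ?thesis by auto
qed

text \<open>The dynamical metric is at most a multiple of \<open>d\<close>, so a small
  \<open>d\<close>-ball stays inside. Openness for \<open>d\<close> makes fattened cells Borel;
  openness for the dynamical metric is what \<open>covering_number\<close> demands.\<close>

lemma openin_fat:
  assumes L: "0 < L" and C: "C \<subseteq> M"
  shows "openin mtopology (fat L \<eta> C)"
  unfolding openin_mtopology
proof (intro conjI allI impI)
  interpret D: Metric_space M "dyn_dist M d T L" by (rule dyn_dist_metric[OF L])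
  fix x assume "x \<in> fat L \<eta> C"
  then obtain c where x: "x \<in> M" and c: "c \<in> C" "dyn_dist M d T L c x < \<eta>" by (auto simp: fat_def)
  define r where "r = (\<eta> - dyn_dist M d T L c x) / lipc L"
  have r: "r > 0" using c lipc(1)[of L] by (simp add: r_def)
  have "mball x r \<subseteq> fat L \<eta> C"
  proof
    fix y assume "y \<in> mball x r"
    then have y: "y \<in> M" "d x y < r" by auto
    have "dyn_dist M d T L c y \<le> dyn_dist M d T L c x + dyn_dist M d T L x y"
      using D.triangle c C x y by blast
    also have "dyn_dist M d T L x y \<le> lipc L * d x y" by (rule dyn_dist_lip[OF L x y(1)])
    also have "lipc L * d x y < lipc L * r" using y lipc(1)[of L] by simp
    also have "lipc L * r = \<eta> - dyn_dist M d T L c x" using lipc(1)[of L] by (simp add: r_def)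
    finally show "y \<in> fat L \<eta> C" using y c by (auto simp: fat_def)
  qed
  then show "\<exists>r>0. mball x r \<subseteq> fat L \<eta> C" using r by blast
qed (auto simp: fat_def)

lemma fat_diam:
  assumes L: "0 < L" and C: "C \<subseteq> M" "\<And>x y u. x \<in> C \<Longrightarrow> y \<in> C \<Longrightarrow> u \<in> cube L \<Longrightarrow> d (T u x) (T u y) \<le> \<eta>"
    and x: "x \<in> fat L \<delta> C" and y: "y \<in> fat L \<delta> C"
  shows "dyn_dist M d T L x y \<le> \<eta> + 2 * \<delta>"
proof -
  interpret D: Metric_space M "dyn_dist M d T L" by (rule dyn_dist_metric[OF L])
  obtain a where a: "a \<in> C" "a \<in> M" "dyn_dist M d T L a x < \<delta>" "x \<in> M" using x C by (auto simp: fat_def)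
  obtain b where b: "b \<in> C" "b \<in> M" "dyn_dist M d T L b y < \<delta>" "y \<in> M" using y C by (auto simp: fat_def)
  have "dyn_dist M d T L x y \<le> dyn_dist M d T L x a + dyn_dist M d T L a y" using D.triangle a b by blast
  moreover have "dyn_dist M d T L a y \<le> dyn_dist M d T L a b + dyn_dist M d T L b y" using D.triangle a b by blast
  moreover have "dyn_dist M d T L a b \<le> \<eta>" using a b C by (intro dyn_dist_least[OF L]) auto
  ultimately show ?thesis using a b D.commute[of x a] by linarith
qed

text \<open>Cells are arbitrary sets with a weak bound on their diameters, and only \<open>S\<close>
  has to be covered. Such families are easy to write down; fattening turns them into open covers
  with a strict bound.\<close>

definition dcover :: "real \<Rightarrow> real \<Rightarrow> 'a set \<Rightarrow> 'a set set \<Rightarrow> bool" where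
  "dcover L \<eta> S \<C> \<longleftrightarrow> finite \<C> \<and> S \<subseteq> \<Union>\<C> \<and>
     (\<forall>C\<in>\<C>. C \<subseteq> M \<and> (\<forall>x\<in>C. \<forall>y\<in>C. \<forall>u\<in>cube L. d (T u x) (T u y) \<le> \<eta>))"

abbreviation cov_pred :: "real \<Rightarrow> real \<Rightarrow> 'a set set \<Rightarrow> bool" where
  "cov_pred L \<epsilon> \<U> \<equiv> M \<subseteq> \<Union>\<U> \<and>
        (\<forall>U\<in>\<U>. openin (Metric_space.mtopology M (dyn_dist M d T L)) U \<and>
                (SUP x\<in>U. SUP y\<in>U. ennreal (dyn_dist M d T L x y)) < ennreal \<epsilon>)"

lemma covering_number_le_card:
  assumes "finite \<U>" "cov_pred L \<epsilon> \<U>"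
  shows "covering_number M (dyn_dist M d T L) \<epsilon> \<le> card \<U>"
  unfolding covering_number_def using assms by (intro Least_le) blast

lemma dcover_fat:
  assumes L: "0 < L" and e: "0 \<le> \<eta>" "\<eta> < \<epsilon>" and c: "dcover L \<eta> M \<C>"
  shows "cov_pred L \<epsilon> (fat L ((\<epsilon> - \<eta>) / 4) ` \<C>)"
proof (intro conjI ballI)
  \<comment> \<open>Fattening by \<open>?\<delta>\<close> enlarges diameters by at most
    \<open>2 * ?\<delta>\<close>, half of the gap between \<open>\<eta>\<close> and
    \<open>\<epsilon>\<close>, so the bound stays strict.\<close>
  let ?\<delta> = "(\<epsilon> - \<eta>) / 4"
  have d: "?\<delta> > 0" using e by simp
  have C: "C \<subseteq> M" if "C \<in> \<C>" for C using c that by (auto simp: dcover_def)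
  show "M \<subseteq> \<Union> (fat L ?\<delta> ` \<C>)"
  proof
    fix x assume "x \<in> M"
    then obtain C where "C \<in> \<C>" "x \<in> C" using c unfolding dcover_def by auto
    then show "x \<in> \<Union> (fat L ?\<delta> ` \<C>)" using fat_superset[OF L d C, of C] by auto
  qed
  fix U assume "U \<in> fat L ?\<delta> ` \<C>"
  then obtain C where U: "U = fat L ?\<delta> C" "C \<in> \<C>" by auto
  show "openin (Metric_space.mtopology M (dyn_dist M d T L)) U"
    unfolding U by (rule openin_dyn_fat[OF L C[OF U(2)]])
  have "dyn_dist M d T L x y \<le> \<eta> + 2 * ?\<delta>" if "x \<in> U" "y \<in> U" for x y
    using that c U(2) unfolding U(1) dcover_def by (intro fat_diam[OF L C[OF U(2)]]) auto
  then have "(SUP x\<in>U. SUP y\<in>U. ennreal (dyn_dist M d T L x y)) \<le> ennreal (\<eta> + 2 * ?\<delta>)"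
    by (intro SUP_least ennreal_leI) auto
  also have "\<dots> < ennreal \<epsilon>" using e by (intro ennreal_lessI) (auto simp: field_simps)
  finally show "(SUP x\<in>U. SUP y\<in>U. ennreal (dyn_dist M d T L x y)) < ennreal \<epsilon>" .
qed

lemma covering_number_le:
  assumes "0 < L" "0 \<le> \<eta>" "\<eta> < \<epsilon>" "dcover L \<eta> M \<C>"
  shows "covering_number M (dyn_dist M d T L) \<epsilon> \<le> card \<C>"
proof -
  have "finite \<C>" using assms(4) by (simp add: dcover_def)
  then have "covering_number M (dyn_dist M d T L) \<epsilon> \<le> card (fat L ((\<epsilon> - \<eta>) / 4) ` \<C>)"
    by (intro covering_number_le_card dcover_fat assms) auto
  also have "\<dots> \<le> card \<C>" using \<open>finite \<C>\<close> by (rule card_image_le)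
  finally show ?thesis .
qed

lemma dcover_ex:
  assumes L: "0 < L" and e: "0 < \<eta>"
  shows "\<exists>\<C>. dcover L \<eta> M \<C>"
proof -
  define r where "r = \<eta> / (2 * lipc L)"
  have r: "r > 0" using e lipc(1)[of L] by (simp add: r_def)
  obtain K where K: "finite K \<and> K \<subseteq> M \<and> M \<subseteq> (\<Union>x\<in>K. mball x r)"
    using tb[unfolded mtotally_bounded_def, rule_format, OF r] by (rule exE)
  have "d (T u x) (T u y) \<le> \<eta>" if "z \<in> K" "x \<in> mball z r" "y \<in> mball z r" "u \<in> cube L" for x y z u
  proof -
    have xy: "x \<in> M" "y \<in> M" "z \<in> M" "d z x < r" "d z y < r" using that by auto
    have "d x y \<le> d x z + d z y" using triangle xy by blast
    also have "\<dots> \<le> 2 * r" using xy commute[of x z] by linarith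
    finally have "lipc L * d x y \<le> lipc L * (2 * r)" using lipc(1)[of L] by (intro mult_left_mono) auto
    also have "\<dots> = \<eta>" using lipc(1)[of L] by (simp add: r_def)
    finally show ?thesis using lipc(2)[OF that(4) xy(1,2)] by linarith
  qed
  then have "dcover L \<eta> M ((\<lambda>z. mball z r) ` K)" using K unfolding dcover_def by auto
  then show ?thesis by blast
qed

text \<open>The \<open>LEAST\<close> in the definition is attained only if some finite cover exists;
  total boundedness and the Lipschitz bound provide one.\<close>

lemma covering_number_witness:
  assumes "0 < L" "0 < \<epsilon>"
  obtains \<U> where "finite \<U>" "card \<U> = covering_number M (dyn_dist M d T L) \<epsilon>" "cov_pred L \<epsilon> \<U>"
proof -
  obtain \<C> where c: "dcover L (\<epsilon> / 2) M \<C>" using dcover_ex[of L "\<epsilon> / 2"] assms by auto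
  then have "finite \<C>" by (simp add: dcover_def)
  have "\<exists>n. \<exists>\<U>. finite \<U> \<and> card \<U> = n \<and> cov_pred L \<epsilon> \<U>"
    using dcover_fat[OF assms(1) _ _ c, of \<epsilon>] assms \<open>finite \<C>\<close>
    by (intro exI[of _ "card (fat L ((\<epsilon> - \<epsilon> / 2) / 4) ` \<C>)"] exI[of _ "fat L ((\<epsilon> - \<epsilon> / 2) / 4) ` \<C>"] conjI) auto
  from LeastI_ex[OF this] have "\<exists>\<U>. finite \<U> \<and> card \<U> = covering_number M (dyn_dist M d T L) \<epsilon> \<and> cov_pred L \<epsilon> \<U>"
    unfolding covering_number_def .
  then show ?thesis using that by blast
qed

lemma covering_number_pos:
  assumes "0 < L" "0 < \<epsilon>"
  shows "1 \<le> covering_number M (dyn_dist M d T L) \<epsilon>"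
proof -
  obtain \<U> where U: "finite \<U>" "card \<U> = covering_number M (dyn_dist M d T L) \<epsilon>" "cov_pred L \<epsilon> \<U>"
    by (rule covering_number_witness[OF assms])
  then have "\<U> \<noteq> {}" using M_ne by auto
  then show ?thesis using U card_gt_0_iff[of \<U>] by simp
qed

text \<open>The large cube is a union of \<open>k^d\<close> translates of the small one. Pulling a
  cover for the small cube back along these translations and intersecting one member per translate
  yields a cover for the large cube.\<close>

lemma covering_number_power_le:
  assumes L0: "0 < L0" "L0 \<le> L" "L \<le> real k * L0" and e: "0 < \<epsilon>"
  shows "covering_number M (dyn_dist M d T L) \<epsilon> \<le> covering_number M (dyn_dist M d T L0) \<epsilon> ^ (k ^ CARD('n))"
proof -
  have L: "0 < L" using L0 by simp
  interpret D: Metric_space M "dyn_dist M d T L" by (rule dyn_dist_metric[OF L])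
  interpret D0: Metric_space M "dyn_dist M d T L0" by (rule dyn_dist_metric[OF L0(1)])
  obtain \<U> where U: "finite \<U>" "card \<U> = covering_number M (dyn_dist M d T L0) \<epsilon>" "cov_pred L0 \<epsilon> \<U>"
    by (rule covering_number_witness[OF L0(1) e])
  \<comment> \<open>The shifts are clamped at \<open>L - L0\<close>, so that the last translates
    overlap their neighbours instead of leaving the large cube. The dynamical metric of the large
    cube then dominates that of every translate, which makes the pulled-back sets open.\<close>
  define s :: "int ^ 'n \<Rightarrow> real ^ 'n" where "s j = (\<chi> i. min (L0 * of_int (j $ i)) (L - L0))" for j
  have s1: "u + s j \<in> cube L" if "j \<in> ibox k" "u \<in> cube L0" for u j
    using that L0 by (auto simp: cube_def ibox_def s_def min_def intro: add_nonneg_nonneg)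
       (smt (verit, best))+
  have s2: "\<exists>j\<in>ibox k. u - s j \<in> cube L0" if u: "u \<in> cube L" for u
  proof -
    have "u \<in> cube (real k * L0)" using u L0 by (auto simp: cube_def intro: less_le_trans)
    then obtain j where j: "j \<in> ibox k" "u - L0 *\<^sub>R rvec j \<in> cube L0" using cube_decomp(1)[OF L0(1)] by blast
    have "u - s j \<in> cube L0"
      unfolding cube_def mem_Collect_eq
    proof
      fix i
      have "0 \<le> u $ i - L0 * of_int (j $ i)" "u $ i - L0 * of_int (j $ i) < L0" "u $ i < L"
        using j(2) u by (auto simp: cube_def)
      then show "0 \<le> (u - s j) $ i \<and> (u - s j) $ i < L0" by (auto simp: s_def min_def)
    qed
    then show ?thesis using j by blast
  qed
  have dd: "dyn_dist M d T L0 (T (s j) x) (T (s j) y) \<le> dyn_dist M d T L x y" if "j \<in> ibox k" "x \<in> M" "y \<in> M" for j x y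
  proof (rule dyn_dist_least[OF L0(1) T_in[OF that(2)] T_in[OF that(3)]])
    fix u :: "real ^ 'n" assume "u \<in> cube L0"
    then show "d (T u (T (s j) x)) (T u (T (s j) y)) \<le> dyn_dist M d T L x y"
      using dyn_dist_upper[OF that(2,3) s1[OF that(1), of u]] T_add that by simp
  qed
  define V where "V f = {x \<in> M. \<forall>j\<in>ibox k. T (s j) x \<in> f j}" for f
  define PP where "PP = Pi\<^sub>E (ibox k :: (int ^ 'n) set) (\<lambda>_. \<U>)"
  have fP: "finite PP" unfolding PP_def using U(1) by (intro finite_PiE) auto
  have "cov_pred L \<epsilon> (V ` PP)"
  proof (intro conjI ballI subsetI)
    fix x assume x: "x \<in> M"
    have "\<forall>j. \<exists>W\<in>\<U>. T (s j) x \<in> W" using U(3) T_in[OF x] by blast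
    then obtain f where "\<And>j. f j \<in> \<U>" "\<And>j. T (s j) x \<in> f j" by metis
    then have "restrict f (ibox k) \<in> PP" "x \<in> V (restrict f (ibox k))" using x by (auto simp: PP_def V_def)
    then show "x \<in> \<Union> (V ` PP)" by blast
  next
    fix W assume "W \<in> V ` PP"
    then obtain f where f: "W = V f" "f \<in> PP" by auto
    have fU: "f j \<in> \<U>" if "j \<in> ibox k" for j using f that by (auto simp: PP_def)
    show "openin D.mtopology W"
      unfolding D.openin_mtopology
    proof (intro conjI allI impI)
      show "W \<subseteq> M" by (auto simp: f V_def)
      fix x assume x: "x \<in> W"
      then have xM: "x \<in> M" by (auto simp: f V_def)
      have "\<forall>j\<in>ibox k. \<exists>r>0. D0.mball (T (s j) x) r \<subseteq> f j"
      proof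
        fix j :: "int ^ 'n" assume j: "j \<in> ibox k"
        then have "openin D0.mtopology (f j)" "T (s j) x \<in> f j" using U(3) fU[OF j] x by (auto simp: f V_def)
        then show "\<exists>r>0. D0.mball (T (s j) x) r \<subseteq> f j" unfolding D0.openin_mtopology by blast
      qed
      then obtain r where r: "\<And>j. j \<in> ibox k \<Longrightarrow> r j > 0" "\<And>j. j \<in> ibox k \<Longrightarrow> D0.mball (T (s j) x) (r j) \<subseteq> f j" by metis
      define R where "R = Min (insert 1 (r ` (ibox k :: (int ^ 'n) set)))"
      have R: "R > 0" "\<And>j. j \<in> ibox k \<Longrightarrow> R \<le> r j" using r(1) by (auto simp: R_def Min_gr_iff)
      have "D.mball x R \<subseteq> W"
      proof
        fix y assume "y \<in> D.mball x R"
        then have y: "y \<in> M" "dyn_dist M d T L x y < R" by auto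
        have "T (s j) y \<in> f j" if j: "j \<in> ibox k" for j
          using dd[OF j xM y(1)] y(2) R(2)[OF j] r(2)[OF j] T_in[OF xM] T_in[OF y(1)] by fastforce
        then show "y \<in> W" using y by (auto simp: f V_def)
      qed
      then show "\<exists>r>0. D.mball x r \<subseteq> W" using R by blast
    qed
    define dm where "dm W = (SUP x\<in>W. SUP y\<in>W. ennreal (dyn_dist M d T L0 x y))" for W
    \<comment> \<open>A finite maximum of diameters below \<open>\<epsilon>\<close> is still
      strictly below \<open>\<epsilon>\<close>, whereas a pointwise bound alone would leave the
      supremum possibly equal to it.\<close>
    define Dm where "Dm = Max (insert 0 (dm ` f ` (ibox k :: (int ^ 'n) set)))"
    have Dm: "Dm < ennreal \<epsilon>" "\<And>j. j \<in> ibox k \<Longrightarrow> dm (f j) \<le> Dm"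
      using U(3) fU e by (auto simp: Dm_def dm_def Max_less_iff)
    then obtain c where c: "Dm = ennreal c" "c \<ge> 0" by (cases Dm) auto
    have "dyn_dist M d T L x y \<le> c" if x: "x \<in> W" and y: "y \<in> W" for x y
    proof (rule dyn_dist_least[OF L])
      show xy: "x \<in> M" "y \<in> M" using x y by (auto simp: f V_def)
      fix u :: "real ^ 'n" assume "u \<in> cube L"
      then obtain j where j: "j \<in> ibox k" "u - s j \<in> cube L0" using s2 by blast
      have "d (T u x) (T u y) = d (T (u - s j) (T (s j) x)) (T (u - s j) (T (s j) y))"
        using T_add[of _ "u - s j" "s j"] xy by simp
      also have "\<dots> \<le> dyn_dist M d T L0 (T (s j) x) (T (s j) y)"
        by (intro dyn_dist_upper T_in xy j)
      finally have "ennreal (d (T u x) (T u y)) \<le> ennreal (dyn_dist M d T L0 (T (s j) x) (T (s j) y))" by (rule ennreal_leI)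
      also have "\<dots> \<le> dm (f j)" unfolding dm_def using x y j(1)
        by (intro SUP_upper2[of "T (s j) x"] SUP_upper2[of "T (s j) y"]) (auto simp: f V_def)
      also have "\<dots> \<le> ennreal c" using Dm(2)[OF j(1)] c by simp
      finally show "d (T u x) (T u y) \<le> c" using c(2) by (simp add: ennreal_le_iff)
    qed
    then have "(SUP x\<in>W. SUP y\<in>W. ennreal (dyn_dist M d T L x y)) \<le> ennreal c"
      by (intro SUP_least ennreal_leI)
    then show "(SUP x\<in>W. SUP y\<in>W. ennreal (dyn_dist M d T L x y)) < ennreal \<epsilon>"
      using Dm(1) c by simp
  qed
  then have "covering_number M (dyn_dist M d T L) \<epsilon> \<le> card (V ` PP)"
    using fP by (intro covering_number_le_card) auto
  also have "\<dots> \<le> card PP" by (rule card_image_le[OF fP])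
  also have "\<dots> = covering_number M (dyn_dist M d T L0) \<epsilon> ^ (k ^ CARD('n))"
    unfolding PP_def by (simp add: card_PiE U(2))
  finally show ?thesis .
qed

section \<open>Convergence of the covering growth\<close>

lemma ceiling_ratio_tendsto:
  assumes "0 < L0"
  shows "((\<lambda>L. real (nat \<lceil>L / L0\<rceil>) * L0 / L) \<longlongrightarrow> 1) at_top"
proof (rule tendsto_sandwich)
  show "\<forall>\<^sub>F L in at_top. real (nat \<lceil>L / L0\<rceil>) * L0 / L \<le> 1 + L0 / L"
    using eventually_gt_at_top[of 0]
  proof eventually_elim
    case (elim L)
    have "L / L0 > 0" using elim assms by simp
    then have "real (nat \<lceil>L / L0\<rceil>) \<le> L / L0 + 1" by linarith
    then have "real (nat \<lceil>L / L0\<rceil>) * L0 \<le> (L / L0 + 1) * L0" using assms by (intro mult_right_mono) auto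
    then have "real (nat \<lceil>L / L0\<rceil>) * L0 / L \<le> (L / L0 + 1) * L0 / L" using elim by (intro divide_right_mono) auto
    moreover have "(L / L0 + 1) * L0 / L = 1 + L0 / L" using elim assms by (simp add: field_simps)
    ultimately show ?case by simp
  qed
  show "\<forall>\<^sub>F L in at_top. 1 \<le> real (nat \<lceil>L / L0\<rceil>) * L0 / L"
    using eventually_gt_at_top[of 0]
  proof eventually_elim
    case (elim L)
    have "L / L0 \<le> real (nat \<lceil>L / L0\<rceil>)" by linarith
    then have "L \<le> real (nat \<lceil>L / L0\<rceil>) * L0" using assms by (simp add: field_simps)
    then show ?case using elim by simp
  qed
  have "((\<lambda>L. 1 + L0 / L) \<longlongrightarrow> 1 + 0) at_top"
    by (intro tendsto_add tendsto_const real_tendsto_divide_at_top[OF tendsto_const filterlim_ident])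
  then show "((\<lambda>L. 1 + L0 / L) \<longlongrightarrow> 1) at_top" by simp
qed simp

text \<open>Fekete's argument again: the exponent in \<open>covering_number_power_le\<close> is
  asymptotically the ratio of the volumes, so the limit exists and equals the infimum over all side
  lengths.\<close>

lemma covering_growth_bounds:
  assumes e: "0 < \<epsilon>"
  shows "0 \<le> covering_growth M d T \<epsilon>"
    and "0 < L0 \<Longrightarrow> covering_growth M d T \<epsilon> \<le> ereal (log 2 (real (covering_number M (dyn_dist M d T L0) \<epsilon>)) / L0 ^ CARD('n))"
proof -
  define l where "l L = log 2 (real (covering_number M (dyn_dist M d T L) \<epsilon>))" for L
  define f where "f L = ereal (l L / L ^ CARD('n))" for L
  define I where "I = (INF L\<in>{0<..}. f L)"
  have l0: "0 \<le> l L" if "0 < L" for L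
    unfolding l_def using covering_number_pos[OF that e] by (simp add: zero_le_log_cancel_iff)
  have lim: "(f \<longlongrightarrow> I) at_top"
  proof (rule order_tendstoI)
    fix a assume a: "a < I"
    show "\<forall>\<^sub>F L in at_top. a < f L"
      using eventually_gt_at_top[of 0]
    proof eventually_elim
      case (elim L)
      have "I \<le> f L" unfolding I_def using elim by (intro INF_lower) auto
      then show ?case using a by simp
    qed
  next
    fix a assume a: "I < a"
    then obtain L0 where L0: "L0 > 0" "f L0 < a" unfolding I_def by (auto simp: Inf_less_iff)
    have "((\<lambda>L. ereal ((real (nat \<lceil>L / L0\<rceil>) * L0 / L) ^ CARD('n) * (l L0 / L0 ^ CARD('n)))) \<longlongrightarrow> ereal (1 ^ CARD('n) * (l L0 / L0 ^ CARD('n)))) at_top"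
      by (intro tendsto_intros ceiling_ratio_tendsto L0)
    then have "\<forall>\<^sub>F L in at_top. ereal ((real (nat \<lceil>L / L0\<rceil>) * L0 / L) ^ CARD('n) * (l L0 / L0 ^ CARD('n))) < a"
      using L0(2) by (intro order_tendstoD(2)) (auto simp: f_def)
    then show "\<forall>\<^sub>F L in at_top. f L < a"
      using eventually_ge_at_top[of L0]
    proof eventually_elim
      case (elim L)
      define k where "k = nat \<lceil>L / L0\<rceil>"
      have L: "L > 0" using elim L0 by simp
      have "L / L0 \<le> real k" unfolding k_def by linarith
      then have kL: "L \<le> real k * L0" using L0 by (simp add: field_simps)
      have "real (covering_number M (dyn_dist M d T L) \<epsilon>) \<le> real (covering_number M (dyn_dist M d T L0) \<epsilon>) ^ (k ^ CARD('n))"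
        using covering_number_power_le[OF L0(1) elim(2) kL e] by (simp flip: of_nat_power)
      then have "l L \<le> log 2 (real (covering_number M (dyn_dist M d T L0) \<epsilon>) ^ (k ^ CARD('n)))"
        unfolding l_def using covering_number_pos[OF L e] by (intro log_mono) auto
      also have "\<dots> = real (k ^ CARD('n)) * l L0"
        unfolding l_def using covering_number_pos[OF L0(1) e] by (intro log_nat_power) auto
      finally have "l L / L ^ CARD('n) \<le> real (k ^ CARD('n)) * l L0 / L ^ CARD('n)"
        using L by (intro divide_right_mono) auto
      also have "\<dots> = (real k * L0 / L) ^ CARD('n) * (l L0 / L0 ^ CARD('n))"
        using L0(1) by (simp add: power_divide power_mult_distrib)
      finally have "f L \<le> ereal ((real k * L0 / L) ^ CARD('n) * (l L0 / L0 ^ CARD('n)))" by (simp add: f_def)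
      then show ?case using elim(1) unfolding k_def by simp
    qed
  qed
  have eq: "covering_growth M d T \<epsilon> = I"
    unfolding covering_growth_def using tendsto_Lim[OF _ lim] by (simp add: f_def[abs_def] l_def)
  show "0 \<le> covering_growth M d T \<epsilon>"
    unfolding eq I_def using l0 by (intro INF_greatest) (auto simp: f_def intro!: divide_nonneg_pos)
  show "covering_growth M d T \<epsilon> \<le> ereal (log 2 (real (covering_number M (dyn_dist M d T L0) \<epsilon>)) / L0 ^ CARD('n))" if "0 < L0"
    using that unfolding eq I_def f_def[symmetric] l_def[symmetric] by (intro INF_lower) auto
qed

text \<open>
  A point is encoded by the first cell containing it, the smaller cover coming first: that cover
  then receives at least half of the mass.
\<close>

lemma rate_distortion_mix_le_ordered:
  assumes mu: "prob_space \<mu>" "sets \<mu> = sets (borel_met M d)"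
    and nu: "prob_space \<nu>1" "sets \<nu>1 = sets (borel_met M d)" "prob_space \<nu>2" "sets \<nu>2 = sets (borel_met M d)"
    and mix: "\<And>A. A \<in> sets \<mu> \<Longrightarrow> measure \<mu> A = (measure \<nu>1 A + measure \<nu>2 A) / 2"
    and L: "0 < L" and e: "0 \<le> \<eta>" "\<eta> < \<epsilon>"
    and cov: "dcover L \<eta> S1 \<C>1" "dcover L \<eta> S2 \<C>2"
    and full: "\<And>U. openin mtopology U \<Longrightarrow> S1 \<subseteq> U \<Longrightarrow> measure \<nu>1 U = 1"
      "\<And>U. openin mtopology U \<Longrightarrow> S2 \<subseteq> U \<Longrightarrow> measure \<nu>2 U = 1"
    and le: "card \<C>1 \<le> card \<C>2"
  shows "rate_distortion_L M d T \<mu> \<epsilon> L \<le> ereal (1 + (log 2 (card \<C>1) + log 2 (card \<C>2)) / 2)"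
proof -
  interpret m: prob_space \<mu> by fact
  interpret n1: prob_space \<nu>1 by fact
  interpret n2: prob_space \<nu>2 by fact
  have spm: "space \<mu> = M" "space \<nu>1 = M" "space \<nu>2 = M"
    using sets_eq_imp_space_eq[OF mu(2)] sets_eq_imp_space_eq[OF nu(2)] sets_eq_imp_space_eq[OF nu(4)] by auto
  define \<delta> where "\<delta> = (\<epsilon> - \<eta>) / 4"
  have dl: "\<delta> > 0" "\<eta> + 2 * \<delta> < \<epsilon>" using e by (auto simp: \<delta>_def field_simps)
  define N1 where "N1 = card \<C>1"
  define N2 where "N2 = card \<C>2"
  define N where "N = N1 + N2"
  have fin: "finite \<C>1" "finite \<C>2" using cov by (auto simp: dcover_def)
  obtain e1 where e1: "bij_betw e1 {0..<N1} \<C>1" using ex_bij_betw_nat_finite[OF fin(1)] N1_def by auto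
  obtain e2 where e2: "bij_betw e2 {0..<N2} \<C>2" using ex_bij_betw_nat_finite[OF fin(2)] N2_def by auto
  define C where "C i = (if i < N1 then e1 i else e2 (i - N1))" for i
  have C: "C i \<subseteq> M" "\<And>x y u. x \<in> C i \<Longrightarrow> y \<in> C i \<Longrightarrow> u \<in> cube L \<Longrightarrow> d (T u x) (T u y) \<le> \<eta>" if "i < N" for i
  proof -
    have "C i \<in> \<C>1 \<union> \<C>2"
      using that bij_betwE[OF e1] bij_betwE[OF e2] by (auto simp: C_def N_def)
    then have "C i \<subseteq> M \<and> (\<forall>x\<in>C i. \<forall>y\<in>C i. \<forall>u\<in>cube L. d (T u x) (T u y) \<le> \<eta>)"
      using cov unfolding dcover_def by (metis UnE)
    then show "C i \<subseteq> M" "\<And>x y u. x \<in> C i \<Longrightarrow> y \<in> C i \<Longrightarrow> u \<in> cube L \<Longrightarrow> d (T u x) (T u y) \<le> \<eta>" by auto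
  qed
  \<comment> \<open>Index \<open>N\<close> is a catch-all cell that makes the code total. It turns
    out to have probability 0, because the fattened covers carry both measures.\<close>
  define S where "S i = (if i < N then fat L \<delta> (C i) else M)" for i
  have So: "openin mtopology (S i)" for i unfolding S_def using openin_fat[OF L C(1)] by auto
  have SM: "S i \<subseteq> M" for i using openin_subset[OF So] by simp
  have Sm: "S i \<in> sets \<mu>" for i using openin_borel_met[OF So] mu(2) by simp
  define I where "I x = (LEAST i. x \<in> S i)" for x
  have I: "x \<in> S (I x)" "I x \<le> N" if "x \<in> M" for x
  proof -
    have "x \<in> S N" using that by (simp add: S_def)
    then show "x \<in> S (I x)" "I x \<le> N" unfolding I_def by (auto intro: LeastI Least_le)
  qed
  define A where "A i = {x \<in> M. I x = i}" for i
  have Aeq: "A i = S i - (\<Union>j<i. S j)" for i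
  proof (intro equalityI subsetI)
    fix x assume "x \<in> A i"
    then show "x \<in> S i - (\<Union>j<i. S j)"
      using I[of x] by (auto simp: A_def I_def dest: not_less_Least)
  next
    fix x assume x: "x \<in> S i - (\<Union>j<i. S j)"
    then have "I x = i" unfolding I_def by (intro Least_equality) (auto simp: not_less[symmetric])
    then show "x \<in> A i" using x SM by (auto simp: A_def)
  qed
  have Am: "A i \<in> sets \<mu>" for i unfolding Aeq using Sm by auto
  \<comment> \<open>The code is deterministic, so its rate is the entropy of the cell probabilities
    \<open>p\<close>.\<close>
  define w where "w i x = (indicator (A i) x :: real)" for i x
  define p where "p i = measure \<mu> (A i)" for i
  have k: "kernel \<mu> {..N} w"
    unfolding kernel_def
  proof (intro conjI ballI)
    fix x assume "x \<in> space \<mu>"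
    then have x: "x \<in> M" by (simp add: spm)
    have "(\<Sum>i\<le>N. w i x) = (\<Sum>i\<le>N. if i = I x then 1 else 0)"
      using x by (intro sum.cong refl) (auto simp: w_def A_def indicator_def)
    then show "(\<Sum>i\<le>N. w i x) = 1" using I(2)[OF x] by simp
  qed (use Am in \<open>auto simp: w_def[abs_def]\<close>)
  have pm: "marg \<mu> w i = p i" for i
    using Am[of i] by (simp add: marg_def w_def p_def)
  have p0: "p i \<ge> 0" for i by (simp add: p_def)
  have cs: "(\<Union>i<N1. S i) \<supseteq> S1" "(\<Union>i\<in>{N1..<N}. S i) \<supseteq> S2"
  proof -
    show "(\<Union>i<N1. S i) \<supseteq> S1"
    proof
      fix x assume "x \<in> S1"
      then obtain D where "D \<in> \<C>1" "x \<in> D" using cov(1) unfolding dcover_def by auto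
      then obtain i where i: "i < N1" "x \<in> C i" using bij_betw_imp_surj_on[OF e1] by (auto simp: C_def)
      then have "x \<in> S i" using fat_superset[OF L dl(1) C(1), of i] by (auto simp: S_def N_def)
      then show "x \<in> (\<Union>i<N1. S i)" using i by auto
    qed
    show "(\<Union>i\<in>{N1..<N}. S i) \<supseteq> S2"
    proof
      fix x assume "x \<in> S2"
      then obtain D where D: "D \<in> \<C>2" "x \<in> D" using cov(2) unfolding dcover_def by auto
      then obtain i where "i < N2" "D = e2 i" using bij_betw_imp_surj_on[OF e2] by auto
      then have i: "N1 + i < N" "x \<in> C (N1 + i)" using D by (auto simp: C_def N_def)
      then have "x \<in> S (N1 + i)" using fat_superset[OF L dl(1) C(1), of "N1 + i"] by (auto simp: S_def)
      then show "x \<in> (\<Union>i\<in>{N1..<N}. S i)" using i(1) by force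
    qed
  qed
  have f1: "measure \<nu>1 (\<Union>i<N1. S i) = 1" using So cs by (intro full) auto
  have f2: "measure \<nu>2 (\<Union>i\<in>{N1..<N}. S i) = 1" using So cs by (intro full) auto
  have mono: "measure \<nu>1 U \<le> measure \<nu>1 V" "measure \<nu>2 U \<le> measure \<nu>2 V" if "U \<subseteq> V" "V \<in> sets \<mu>" for U V
    using that nu mu by (auto intro!: n1.finite_measure_mono n2.finite_measure_mono)
  have UA: "(\<Union>i<n. A i) = (\<Union>i<n. S i)" for n
  proof (intro equalityI subsetI)
    fix x assume "x \<in> (\<Union>i<n. S i)"
    then obtain i where i: "i < n" "x \<in> S i" by auto
    then have "I x \<le> i" unfolding I_def by (intro Least_le)
    then show "x \<in> (\<Union>i<n. A i)" using i SM by (intro UN_I[of "I x"]) (auto simp: A_def)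
  qed (auto simp: Aeq)
  have dis: "disjoint_family_on A J" for J by (auto simp: disjoint_family_on_def A_def)
  have sp: "(\<Sum>i<n. p i) = measure \<mu> (\<Union>i<n. S i)" for n
    unfolding p_def using Am dis by (subst UA[symmetric], subst m.finite_measure_finite_Union) auto
  \<comment> \<open>The first \<open>N1\<close> cells form an open set containing \<open>S1\<close>,
    so it has full measure under \<open>\<nu>1\<close> and at least half of the mass under
    \<open>\<mu>\<close>.\<close>
  have s1: "(\<Sum>i<N1. p i) \<ge> 1 / 2"
    unfolding sp using mix[of "\<Union>i<N1. S i"] f1 Sm by (auto simp: intro!: sets.finite_UN)
  have UN1: "measure \<mu> (\<Union>i<N. S i) = 1"
  proof -
    have UNm: "(\<Union>i<N. S i) \<in> sets \<mu>" using Sm by auto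
    have "measure \<nu>1 (\<Union>i<N1. S i) \<le> measure \<nu>1 (\<Union>i<N. S i)"
      by (rule mono(1)[OF UN_mono UNm]) (auto simp: N_def)
    then have "measure \<nu>1 (\<Union>i<N. S i) = 1" by (intro antisym n1.prob_le_1) (simp add: f1)
    moreover have "measure \<nu>2 (\<Union>i\<in>{N1..<N}. S i) \<le> measure \<nu>2 (\<Union>i<N. S i)"
      by (rule mono(2)[OF UN_mono UNm]) auto
    then have "measure \<nu>2 (\<Union>i<N. S i) = 1" by (intro antisym n2.prob_le_1) (simp add: f2)
    ultimately show ?thesis
      using mix[OF UNm] by simp
  qed
  then have sN: "(\<Sum>i<N. p i) = 1" using sp by simp
  moreover have "(\<Sum>i\<le>N. p i) = 1" using m.sum_marg[OF k] by (simp add: pm)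
  ultimately have pN: "p N = 0" by (simp add: lessThan_Suc_atMost[symmetric])
  have Npos: "N1 \<ge> 1" "N2 \<ge> 1"
    using f1 f2 by (auto simp: N_def intro!: Suc_leI gr0I)
  obtain x0 where x0: "x0 \<in> M" using M_ne by auto
  define z where "z i = (if A i = {} then x0 else (SOME x. x \<in> A i))" for i
  have zA: "z i \<in> A i" if "A i \<noteq> {}" for i using that someI_ex[of "\<lambda>x. x \<in> A i"] by (auto simp: z_def)
  have zM: "z i \<in> M" for i using zA[of i] x0 by (cases "A i = {}") (auto simp: z_def A_def)
  define F where "F i = cls L (orb (z i))" for i
  have F: "F i \<in> L1_space M d L" for i unfolding F_def by (rule cls_in[OF orb_L1[OF zM]])
  have ds: "dst L x (F i) \<le> (\<eta> + 2 * \<delta>) * L ^ CARD('n)" if "x \<in> A i" "i < N" for x i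
  proof -
    have x: "x \<in> M" "x \<in> S i" using that(1) SM[of i] unfolding Aeq by auto
    have "z i \<in> S i" using zA[of i] that(1) Aeq[of i] by blast
    then have "dyn_dist M d T L x (z i) \<le> \<eta> + 2 * \<delta>"
      using x that C[OF that(2)] by (intro fat_diam[OF L, of "C i"]) (auto simp: S_def)
    then have "d (T u x) (T u (z i)) \<le> \<eta> + 2 * \<delta>" if "u \<in> cube L" for u
      using dyn_dist_upper[OF x(1) zM that] by (rule order_trans[rotated])
    then show ?thesis
      unfolding F_def dst_cls[OF x(1) orb_L1[OF zM]] using L
      by (intro l1d_le orb_L1 x zM) auto
  qed
  have dm: "(\<lambda>x. dst L x (F i)) \<in> borel_measurable \<mu>" for i
    using dst_measurable1[of L "F i"] L F mu(2) by (simp cong: measurable_cong_sets)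
  have Di: "(\<integral>x. w i x * dst L x (F i) \<partial>\<mu>) \<le> (\<integral>x. w i x * K \<partial>\<mu>)" if K: "\<And>x. x \<in> A i \<Longrightarrow> dst L x (F i) \<le> K" for i K
  proof (rule integral_mono)
    show "integrable \<mu> (\<lambda>x. w i x * dst L x (F i))"
    proof (rule m.integrable_const_bound[of _ "bd * L ^ CARD('n)"])
      show "AE x in \<mu>. norm (w i x * dst L x (F i)) \<le> bd * L ^ CARD('n)"
        using dst_bounds[of L _ "F i"] L F bd(1) by (intro AE_I2) (auto simp: w_def indicator_def spm)
      show "(\<lambda>x. w i x * dst L x (F i)) \<in> borel_measurable \<mu>"
        using dm[of i] Am[of i] unfolding w_def by measurable
    qed
    have "integrable \<mu> (w i)"
      unfolding w_def using Am[of i] by (intro integrable_real_indicator) (auto simp: m.emeasure_eq_measure)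
    then show "integrable \<mu> (\<lambda>x. w i x * K)" by simp
    show "w i x * dst L x (F i) \<le> w i x * K" if "x \<in> space \<mu>" for x using K[of x] by (auto simp: w_def indicator_def)
  qed
  have wK: "(\<integral>x. w i x * K \<partial>\<mu>) = p i * K" for i and K :: real using pm[of i] by (simp add: marg_def)
  have "(\<Sum>i\<le>N. \<integral>x. w i x * dst L x (F i) \<partial>\<mu>) \<le> (\<Sum>i\<le>N. p i * ((\<eta> + 2 * \<delta>) * L ^ CARD('n)))"
  proof (rule sum_mono)
    fix i assume "i \<in> {..N}"
    show "(\<integral>x. w i x * dst L x (F i) \<partial>\<mu>) \<le> p i * ((\<eta> + 2 * \<delta>) * L ^ CARD('n))"
    proof (cases "i < N")
      case True
      show ?thesis using Di[of i "(\<eta> + 2 * \<delta>) * L ^ CARD('n)", OF ds[OF _ True]] by (simp only: wK)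
    next
      case False
      then have i: "i = N" using \<open>i \<in> {..N}\<close> by auto
      have "(\<integral>x. w i x * dst L x (F i) \<partial>\<mu>) \<le> (\<integral>x. w i x * (bd * L ^ CARD('n)) \<partial>\<mu>)"
        using dst_bounds(2)[of L _ "F i"] L F by (intro Di) (auto simp: A_def)
      also have "\<dots> = 0" using pN i by (simp only: wK mult_zero_left)
      finally show ?thesis using pN i by simp
    qed
  qed
  also have "\<dots> = (\<eta> + 2 * \<delta>) * L ^ CARD('n)"
    using \<open>(\<Sum>i\<le>N. p i) = 1\<close> by (simp flip: sum_distrib_right)
  also have "\<dots> < \<epsilon> * L ^ CARD('n)" using dl L by simp
  finally have c: "code \<mu> \<epsilon> L {..N} w F" unfolding code_def using k F by auto
  \<comment> \<open>The reference distribution: half of the mass spread evenly over each cover. It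
    corresponds to code words of one bit for the cover and \<open>log 2 N1\<close> or
    \<open>log 2 N2\<close> bits for the cell, and the entropy of \<open>p\<close> is at most the
    mean code length.\<close>
  define q where "q i = 1 / (2 * real (if i < N1 then N1 else N2))" for i
  have q0: "q i > 0" for i using Npos by (simp add: q_def)
  have ivl: "{..<N} = {..<N1} \<union> {N1..<N}" "{..<N1} \<inter> {N1..<N} = {}" by (auto simp: N_def)
  have split: "(\<Sum>i<N. h i) = (\<Sum>i<N1. h i) + (\<Sum>i\<in>{N1..<N}. h i)" for h :: "nat \<Rightarrow> real"
    unfolding ivl(1) using ivl(2) by (intro sum.union_disjoint) auto
  have qs: "(\<Sum>i<N. q i) = 1"
  proof -
    have "(\<Sum>i<N1. q i) = (\<Sum>i<N1. 1 / (2 * real N1))" "(\<Sum>i\<in>{N1..<N}. q i) = (\<Sum>i\<in>{N1..<N}. 1 / (2 * real N2))"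
      by (intro sum.cong refl; simp add: q_def)+
    then show ?thesis unfolding split using Npos by (simp add: N_def)
  qed
  have "rate \<mu> {..N} w = (\<Sum>i\<le>N. p i * log 2 (1 / p i))"
    unfolding rate_def
  proof (intro sum.cong refl)
    fix i
    have "(\<integral>x. w i x * log 2 (w i x / marg \<mu> w i) \<partial>\<mu>) = (\<integral>x. w i x * log 2 (1 / p i) \<partial>\<mu>)"
      unfolding pm by (intro Bochner_Integration.integral_cong refl) (auto simp: w_def indicator_def)
    then show "(\<integral>x. w i x * log 2 (w i x / marg \<mu> w i) \<partial>\<mu>) = p i * log 2 (1 / p i)" by (simp only: wK)
  qed
  also have "\<dots> = (\<Sum>i<N. p i * log 2 (1 / p i))" using pN by (simp add: lessThan_Suc_atMost[symmetric])
  also have "\<dots> \<le> (\<Sum>i<N. p i * log 2 (1 / q i) + (q i - p i) / ln 2)"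
  proof (rule sum_mono)
    fix i
    show "p i * log 2 (1 / p i) \<le> p i * log 2 (1 / q i) + (q i - p i) / ln 2"
    proof (cases "p i = 0")
      case False
      then have pp: "p i > 0" using p0[of i] by simp
      have "(p i - q i) / ln 2 \<le> p i * log 2 (p i / q i)"
        using log_ratio_ge[of "p i" "q i" 1] pp q0[of i] by simp
      also have "\<dots> = p i * log 2 (1 / q i) - p i * log 2 (1 / p i)"
        using pp q0[of i] by (simp add: log_divide algebra_simps)
      finally show ?thesis by (simp add: diff_divide_distrib)
    qed (use q0[of i] in simp)
  qed
  also have "\<dots> = (\<Sum>i<N. p i * log 2 (1 / q i))"
    by (simp add: sum.distrib sum_subtractf qs sN flip: sum_divide_distrib)
  also have "\<dots> = (\<Sum>i<N1. p i * (1 + log 2 N1)) + (\<Sum>i\<in>{N1..<N}. p i * (1 + log 2 N2))"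
    unfolding split using Npos by (intro arg_cong2[where f = "(+)"] sum.cong refl) (auto simp: q_def log_mult)
  also have "\<dots> = (\<Sum>i<N1. p i) * (1 + log 2 N1) + (1 - (\<Sum>i<N1. p i)) * (1 + log 2 N2)"
  proof -
    have "(\<Sum>i\<in>{N1..<N}. p i) = 1 - (\<Sum>i<N1. p i)" using sN unfolding split by linarith
    then show ?thesis by (simp only: sum_distrib_right[symmetric])
  qed
  also have "\<dots> = 1 + log 2 N2 - (\<Sum>i<N1. p i) * (log 2 N2 - log 2 N1)" by (simp add: algebra_simps)
  \<comment> \<open>Here the order of the covers enters: the cheaper cells carry at least half of
    the mass, and the difference of the logarithms is nonnegative.\<close>
  also have "\<dots> \<le> 1 + log 2 N2 - 1 / 2 * (log 2 N2 - log 2 N1)"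
  proof -
    have "0 \<le> log 2 N2 - log 2 N1" using le Npos by (simp add: N1_def N2_def)
    then show ?thesis using mult_right_mono[OF s1] by simp
  qed
  finally have "rate \<mu> {..N} w \<le> 1 + (log 2 N1 + log 2 N2) / 2" by (simp add: field_simps)
  then have "ereal (rate \<mu> {..N} w) \<le> ereal (1 + (log 2 N1 + log 2 N2) / 2)" by simp
  then show ?thesis using rate_distortion_L_le[OF mu L c] unfolding N1_def N2_def by (rule order_trans[rotated])
qed

text \<open>The bound is symmetric in the two covers, so their order is no restriction.\<close>

lemma rate_distortion_mix_le:
  assumes mu: "prob_space \<mu>" "sets \<mu> = sets (borel_met M d)"
    and nu: "prob_space \<nu>1" "sets \<nu>1 = sets (borel_met M d)" "prob_space \<nu>2" "sets \<nu>2 = sets (borel_met M d)"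
    and mix: "\<And>A. A \<in> sets \<mu> \<Longrightarrow> measure \<mu> A = (measure \<nu>1 A + measure \<nu>2 A) / 2"
    and L: "0 < L" and e: "0 \<le> \<eta>" "\<eta> < \<epsilon>"
    and cov: "dcover L \<eta> S1 \<C>1" "dcover L \<eta> S2 \<C>2"
    and full: "\<And>U. openin mtopology U \<Longrightarrow> S1 \<subseteq> U \<Longrightarrow> measure \<nu>1 U = 1"
      "\<And>U. openin mtopology U \<Longrightarrow> S2 \<subseteq> U \<Longrightarrow> measure \<nu>2 U = 1"
  shows "rate_distortion_L M d T \<mu> \<epsilon> L \<le> ereal (1 + (log 2 (card \<C>1) + log 2 (card \<C>2)) / 2)"
proof (cases "card \<C>1 \<le> card \<C>2")
  case True
  show ?thesis by (rule rate_distortion_mix_le_ordered[OF assms True])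
next
  case False
  then have le: "card \<C>2 \<le> card \<C>1" by simp
  have "measure \<mu> A = (measure \<nu>2 A + measure \<nu>1 A) / 2" if "A \<in> sets \<mu>" for A
    using mix[OF that] by simp
  from rate_distortion_mix_le_ordered[OF mu nu(3,4,1,2) this L e cov(2,1) full(2,1) le]
  show ?thesis by (simp add: add.commute)
qed

text \<open>The test function in \<open>rate_ge\<close> is
  \<open>exp (K - s * dst L x (F b))\<close>. By the moment bound its mean is at most 1 for every
  reproduction, whatever the code, and its mean logarithm is \<open>K\<close> minus \<open>s\<close>
  times the mean distortion; \<open>ln 2\<close> converts to bits.\<close>

lemma rate_ge_exp:
  assumes mu: "prob_space \<mu>" "sets \<mu> = sets (borel_met M d)" and L: "0 < L" and s: "0 \<le> s"
    and c: "code \<mu> \<epsilon> L B w F"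
    and mom: "\<And>F. F \<in> L1_space M d L \<Longrightarrow> (\<integral>x. exp (- s * dst L x F) \<partial>\<mu>) \<le> exp (- K)"
  shows "(K - s * \<epsilon> * L ^ CARD('n)) / ln 2 \<le> rate \<mu> B w"
proof -
  interpret m: prob_space \<mu> by fact
  have spm: "space \<mu> = M" using sets_eq_imp_space_eq[OF mu(2)] by simp
  have k: "kernel \<mu> B w" and F: "\<And>b. b \<in> B \<Longrightarrow> F b \<in> L1_space M d L"
    and dist: "(\<Sum>b\<in>B. \<integral>x. w b x * dst L x (F b) \<partial>\<mu>) < \<epsilon> * L ^ CARD('n)"
    using c by (auto simp: code_def)
  have dm: "(\<lambda>x. dst L x (F b)) \<in> borel_measurable \<mu>" if "b \<in> B" for b
    using dst_measurable1[of L "F b"] L F[OF that] mu(2) by (simp cong: measurable_cong_sets)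
  have db: "0 \<le> dst L x (F b)" "dst L x (F b) \<le> bd * L ^ CARD('n)" if "b \<in> B" "x \<in> M" for b x
    using dst_bounds[of L x "F b"] F L that by auto
  define c where "c b x = exp (K - s * dst L x (F b))" for b x
  have ci: "integrable \<mu> (c b)" if "b \<in> B" for b
  proof (rule m.integrable_const_bound[of _ "exp K"])
    show "AE x in \<mu>. norm (c b x) \<le> exp K" using db[OF that] s by (intro AE_I2) (auto simp: c_def spm)
    show "c b \<in> borel_measurable \<mu>" unfolding c_def using dm[OF that] by measurable
  qed
  have wd: "integrable \<mu> (\<lambda>x. w b x * dst L x (F b))" if "b \<in> B" for b
  proof (rule m.integrable_const_bound[of _ "bd * L ^ CARD('n)"])
    show "AE x in \<mu>. norm (w b x * dst L x (F b)) \<le> bd * L ^ CARD('n)"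
    proof (rule AE_I2)
      fix x assume "x \<in> space \<mu>"
      then show "norm (w b x * dst L x (F b)) \<le> bd * L ^ CARD('n)"
        using mult_mono[of "w b x" 1 "dst L x (F b)" "bd * L ^ CARD('n)"] kernelD(3,5)[OF k that, of x] db[OF that, of x]
        by (auto simp: spm abs_mult)
    qed
    show "(\<lambda>x. w b x * dst L x (F b)) \<in> borel_measurable \<mu>" using dm[OF that] kernelD(2)[OF k that] by measurable
  qed
  have eq: "w b x * log 2 (c b x) = (K * w b x - s * (w b x * dst L x (F b))) / ln 2" for b x
    by (simp add: c_def log_def algebra_simps)
  have wc: "integrable \<mu> (\<lambda>x. w b x * log 2 (c b x))" if "b \<in> B" for b
    unfolding eq using wd[OF that] m.kernel_integrable[OF k that] by auto
  have "(\<integral>x. c b x \<partial>\<mu>) \<le> 1" if "b \<in> B" for b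
  proof -
    have "(\<integral>x. c b x \<partial>\<mu>) = exp K * (\<integral>x. exp (- s * dst L x (F b)) \<partial>\<mu>)"
      by (simp add: c_def exp_diff exp_minus field_simps flip: integral_mult_right_zero)
    also have "\<dots> \<le> exp K * exp (- K)" by (intro mult_left_mono mom F that) auto
    finally show ?thesis by (simp add: exp_minus)
  qed
  then have "(\<Sum>b\<in>B. marg \<mu> w b * (\<integral>x. c b x \<partial>\<mu>)) \<le> (\<Sum>b\<in>B. marg \<mu> w b * 1)"
    using m.marg_nonneg[OF k] by (intro sum_mono mult_left_mono) auto
  then have s1: "(\<Sum>b\<in>B. marg \<mu> w b * (\<integral>x. c b x \<partial>\<mu>)) \<le> 1" using m.sum_marg[OF k] by simp
  have "(\<Sum>b\<in>B. \<integral>x. w b x * log 2 (c b x) \<partial>\<mu>) = (\<Sum>b\<in>B. (K * marg \<mu> w b - s * (\<integral>x. w b x * dst L x (F b) \<partial>\<mu>)) / ln 2)"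
    unfolding eq marg_def using wd m.kernel_integrable[OF k] by (intro sum.cong refl) simp
  also have "\<dots> = (K - s * (\<Sum>b\<in>B. \<integral>x. w b x * dst L x (F b) \<partial>\<mu>)) / ln 2"
    using m.sum_marg[OF k] by (simp add: sum_subtractf flip: sum_divide_distrib sum_distrib_left)
  also have "\<dots> \<ge> (K - s * (\<epsilon> * L ^ CARD('n))) / ln 2"
    using dist s by (intro divide_right_mono diff_mono mult_left_mono) auto
  finally have "(K - s * \<epsilon> * L ^ CARD('n)) / ln 2 \<le> (\<Sum>b\<in>B. \<integral>x. w b x * log 2 (c b x) \<partial>\<mu>)" by (simp add: mult.assoc)
  also have "\<dots> \<le> rate \<mu> B w"
  proof -
    have "(\<Sum>b\<in>B. \<integral>x. w b x * log 2 (c b x) \<partial>\<mu>) + (1 - (\<Sum>b\<in>B. marg \<mu> w b * (\<integral>x. c b x \<partial>\<mu>))) / ln 2 \<le> rate \<mu> B w"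
      by (intro m.rate_ge k ci wc) (auto simp: c_def)
    moreover have "(1 - (\<Sum>b\<in>B. marg \<mu> w b * (\<integral>x. c b x \<partial>\<mu>))) / ln 2 \<ge> 0" using s1 by simp
    ultimately show ?thesis by linarith
  qed
  finally show ?thesis .
qed

text \<open>The limit in \<open>L\<close> is known to exist, so it may be taken along integers. For
  these the moment estimate can cut the cube into unit cells.\<close>

lemma rate_distortion_ge:
  assumes mu: "\<mu> \<in> invariant_measures M d T" and s: "0 \<le> s"
    and mom: "\<And>(L :: nat) F. 0 < L \<Longrightarrow> F \<in> L1_space M d (real L) \<Longrightarrow> (\<integral>x. exp (- s * dst (real L) x F) \<partial>\<mu>) \<le> exp (- K * real L ^ CARD('n))"
  shows "ereal ((K - s * \<epsilon>) / ln 2) \<le> rate_distortion M d T \<mu> \<epsilon>"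
proof -
  have "ereal ((K - s * \<epsilon>) / ln 2) \<le> rate_distortion_L M d T \<mu> \<epsilon> (real L) / ereal (real L ^ CARD('n))" if L: "0 < L" for L :: nat
  proof -
    have "ereal ((K * real L ^ CARD('n) - s * \<epsilon> * real L ^ CARD('n)) / ln 2) \<le> rate_distortion_L M d T \<mu> \<epsilon> (real L)"
    proof (rule ccontr)
      assume "\<not> ?thesis"
      then have "rate_distortion_L M d T \<mu> \<epsilon> (real L) < ereal ((K * real L ^ CARD('n) - s * \<epsilon> * real L ^ CARD('n)) / ln 2)" by simp
      then obtain B :: "(real ^ 'n \<Rightarrow> 'a) set set set" and w F where
        c: "code \<mu> \<epsilon> (real L) B w F" "ereal (rate \<mu> B w) < ereal ((K * real L ^ CARD('n) - s * \<epsilon> * real L ^ CARD('n)) / ln 2)"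
        using L by (elim code_of_rate_less[rotated]) auto
      have "(K * real L ^ CARD('n) - s * \<epsilon> * real L ^ CARD('n)) / ln 2 \<le> rate \<mu> B w"
        using L mom[OF L] by (intro rate_ge_exp[OF invariantD(1,2)[OF mu] _ s c(1)]) auto
      then show False using c(2) by simp
    qed
    then have "ereal ((K * real L ^ CARD('n) - s * \<epsilon> * real L ^ CARD('n)) / ln 2) / ereal (real L ^ CARD('n)) \<le> rate_distortion_L M d T \<mu> \<epsilon> (real L) / ereal (real L ^ CARD('n))"
      using L by (intro ereal_divide_right_mono) auto
    moreover have "ereal ((K * real L ^ CARD('n) - s * \<epsilon> * real L ^ CARD('n)) / ln 2) / ereal (real L ^ CARD('n)) = ereal ((K - s * \<epsilon>) / ln 2)"
      using L by (simp add: field_simps)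
    ultimately show ?thesis by simp
  qed
  then have "\<forall>\<^sub>F L in sequentially. ereal ((K - s * \<epsilon>) / ln 2) \<le> rate_distortion_L M d T \<mu> \<epsilon> (real L) / ereal (real L ^ CARD('n))"
    by (intro eventually_mono[OF eventually_gt_at_top[of 0]])
  moreover have "((\<lambda>L. rate_distortion_L M d T \<mu> \<epsilon> (real L) / ereal (real L ^ CARD('n))) \<longlongrightarrow> rate_distortion M d T \<mu> \<epsilon>) sequentially"
    by (rule filterlim_compose[OF rate_distortion_tendsto(1)[OF mu] filterlim_real_sequentially])
  ultimately show ?thesis by (intro tendsto_lowerbound) auto
qed

end

section \<open>An exponential weight\<close>

text \<open>A product of Laplace densities. Its logarithm is Lipschitz, so a translation changes the
  weight by a bounded factor, which a Gaussian weight would not offer; the total mass 1 allows the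
  use of Jensen's inequality.\<close>

definition expw :: "real ^ 'n \<Rightarrow> real" where
  "expw u = (\<Prod>i\<in>UNIV. exp (- \<bar>u $ i\<bar>) / 2)"

definition wmeas :: "(real ^ 'n) measure" where
  "wmeas = density lborel (\<lambda>u. ennreal (expw u))"

lemma expw_pos: "0 < expw u"
  unfolding expw_def by (intro prod_pos) auto

lemma expw_measurable [measurable]: "expw \<in> borel_measurable borel"
  unfolding expw_def by measurable

lemma sets_wmeas [measurable_cong, simp]: "sets wmeas = sets borel"
  by (simp add: wmeas_def)

lemma space_wmeas [simp]: "space wmeas = UNIV"
  by (simp add: wmeas_def)

lemma nn_integral_exp_abs: "(\<integral>\<^sup>+t. ennreal (exp (- \<bar>t\<bar>) / 2) \<partial>lborel) = 1"
proof -
  let ?e = "\<lambda>t::real. ennreal (exponential_density 1 t)"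
  have e1: "(\<integral>\<^sup>+t. ?e t \<partial>lborel) = 1"
    using prob_space.emeasure_space_1[OF prob_space_exponential_density[of 1]]
    by (simp add: emeasure_density)
  have "(\<integral>\<^sup>+t. ?e t \<partial>lborel) = (\<integral>\<^sup>+t. ?e (- t) \<partial>lborel)"
    using nn_integral_real_affine[of ?e "-1" 0] by simp
  then have e2: "(\<integral>\<^sup>+t. ?e (- t) \<partial>lborel) = 1" using e1 by simp
  have "AE t in lborel. ennreal (exp (- \<bar>t\<bar>) / 2) = ennreal (1/2) * ?e t + ennreal (1/2) * ?e (- t)"
    using AE_lborel_singleton[of "0::real"]
  proof eventually_elim
    case (elim t)
    have nn: "0 \<le> 1/2 * exponential_density 1 s" for s :: real by (simp add: exponential_density_def)
    have "exp (- \<bar>t\<bar>) / 2 = 1/2 * exponential_density 1 t + 1/2 * exponential_density 1 (- t)"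
      using elim by (auto simp: exponential_density_def abs_if)
    also have "ennreal \<dots> = ennreal (1/2 * exponential_density 1 t) + ennreal (1/2 * exponential_density 1 (- t))"
      by (rule ennreal_plus[OF nn nn])
    also have "\<dots> = ennreal (1/2) * ?e t + ennreal (1/2) * ?e (- t)"
      by (intro arg_cong2[where f = "(+)"] ennreal_mult) (auto simp: exponential_density_def)
    finally show ?case .
  qed
  then have "(\<integral>\<^sup>+t. ennreal (exp (- \<bar>t\<bar>) / 2) \<partial>lborel) = (\<integral>\<^sup>+t. ennreal (1/2) * ?e t + ennreal (1/2) * ?e (- t) \<partial>lborel)"
    by (rule nn_integral_cong_AE)
  also have "\<dots> = ennreal (1/2) + ennreal (1/2)"
    by (simp add: nn_integral_add nn_integral_cmult e1 e2)
  also have "\<dots> = ennreal (1/2 + 1/2)" by (rule ennreal_plus[symmetric]) auto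
  finally show ?thesis by simp
qed

lemma prod_Basis_cart:
  fixes u :: "real ^ 'n" and g :: "real \<Rightarrow> 'b::comm_monoid_mult"
  shows "(\<Prod>b\<in>Basis. g (u \<bullet> b)) = (\<Prod>i\<in>UNIV. g (u $ i))"
proof -
  have B: "(Basis :: (real ^ 'n) set) = (\<lambda>i. axis i 1) ` UNIV" by (auto simp: Basis_vec_def)
  have inj: "inj (\<lambda>i::'n. axis i (1::real))" by (auto simp: inj_def axis_eq_axis)
  show ?thesis unfolding B by (subst prod.reindex[OF inj]) (simp add: inner_axis)
qed

lemma prob_space_wmeas: "prob_space (wmeas :: (real ^ 'n) measure)"
proof
  have "emeasure (wmeas :: (real ^ 'n) measure) UNIV = (\<integral>\<^sup>+u. ennreal (expw (u :: real ^ 'n)) \<partial>lborel)"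
    by (simp add: wmeas_def emeasure_density)
  also have "\<dots> = (\<integral>\<^sup>+u. (\<Prod>b\<in>Basis. ennreal (exp (- \<bar>(u :: real ^ 'n) \<bullet> b\<bar>) / 2)) \<partial>lborel)"
    by (simp add: prod_Basis_cart[where g = "\<lambda>t. ennreal (exp (- \<bar>t\<bar>) / 2)"] expw_def prod_ennreal)
  also have "\<dots> = (\<Prod>b\<in>(Basis :: (real ^ 'n) set). (\<integral>\<^sup>+t. ennreal (exp (- \<bar>t\<bar>) / 2) \<partial>lborel))"
    by (rule nn_integral_lborel_prod) auto
  also have "\<dots> = 1" by (simp add: nn_integral_exp_abs)
  finally show "emeasure (wmeas :: (real ^ 'n) measure) (space wmeas) = 1" by simp
qed

definition nrm1 :: "real ^ 'n \<Rightarrow> real" where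
  "nrm1 v = (\<Sum>i\<in>UNIV. \<bar>v $ i\<bar>)"

lemma expw_shift: "expw (u - v) \<le> exp (nrm1 v) * expw u"
proof -
  have "expw (u - v) \<le> (\<Prod>i\<in>UNIV. exp (\<bar>v $ i\<bar>) * (exp (- \<bar>u $ i\<bar>) / 2))"
    unfolding expw_def by (intro prod_mono) (auto simp flip: exp_add)
  also have "\<dots> = exp (nrm1 v) * expw u"
    unfolding prod.distrib expw_def nrm1_def by (simp add: exp_sum)
  finally show ?thesis .
qed

text \<open>The Harnack-type property that makes the translation action Lipschitz.\<close>

lemma nn_integral_wmeas_shift:
  assumes g[measurable]: "g \<in> borel_measurable borel"
  shows "(\<integral>\<^sup>+u. g (u + v) \<partial>wmeas) \<le> ennreal (exp (nrm1 v)) * (\<integral>\<^sup>+u. g u \<partial>wmeas)"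
proof -
  have "(\<integral>\<^sup>+u. g (u + v) \<partial>wmeas) = (\<integral>\<^sup>+u. ennreal (expw (v + u - v)) * g (v + u) \<partial>lborel)"
    unfolding wmeas_def by (subst nn_integral_density) (auto simp: add.commute)
  also have "\<dots> = (\<integral>\<^sup>+u. ennreal (expw (u - v)) * g u \<partial>distr lborel borel ((+) v))"
    by (subst nn_integral_distr) auto
  also have "\<dots> = (\<integral>\<^sup>+u. ennreal (expw (u - v)) * g u \<partial>lborel)" by (simp add: lborel_distr_plus)
  also have "\<dots> \<le> (\<integral>\<^sup>+u. ennreal (exp (nrm1 v)) * (ennreal (expw u) * g u) \<partial>lborel)"
  proof (rule nn_integral_mono)
    fix u :: "real ^ 'a"
    have "ennreal (expw (u - v)) \<le> ennreal (exp (nrm1 v)) * ennreal (expw u)"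
      using expw_shift[of u v] expw_pos[of u] by (simp add: less_imp_le flip: ennreal_mult)
    then show "ennreal (expw (u - v)) * g u \<le> ennreal (exp (nrm1 v)) * (ennreal (expw u) * g u)"
      by (simp add: mult_right_mono flip: mult.assoc)
  qed
  also have "\<dots> = ennreal (exp (nrm1 v)) * (\<integral>\<^sup>+u. g u \<partial>wmeas)"
    unfolding wmeas_def by (subst nn_integral_density) (auto simp: nn_integral_cmult)
  finally show ?thesis .
qed

lemma AE_wmeas: "AE u in lborel. P u \<Longrightarrow> AE u in wmeas. P u"
  unfolding wmeas_def by (subst AE_density) (auto elim: eventually_mono)

lemma wmeas_pos:
  assumes A: "A \<in> sets borel" and pos: "emeasure lborel A > 0"
  shows "emeasure wmeas A > 0"
proof (rule ccontr)
  assume "\<not> ?thesis"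
  then have "AE u in wmeas. u \<notin> A" using A by (subst AE_iff_measurable[of A]) auto
  then have "AE u in lborel. u \<notin> A"
    unfolding wmeas_def by (subst (asm) AE_density) (auto simp: expw_pos)
  then have "emeasure lborel A = 0" using A by (subst (asm) AE_iff_measurable[of A]) auto
  then show False using pos by simp
qed

lemma fvec_measurable [measurable]: "fvec \<in> borel \<rightarrow>\<^sub>M count_space (UNIV :: (int ^ 'n) set)"
proof (subst measurable_count_space_eq_countable, safe)
  fix j :: "int ^ 'n"
  have "fvec -` {j} \<inter> space borel = (\<Inter>i\<in>UNIV. {u. of_int (j $ i) \<le> u $ i} \<inter> {u. u $ i < of_int (j $ i) + 1})"
    by (auto simp: vec_eq_iff floor_eq_iff)
  also have "\<dots> \<in> sets borel" by (intro sets.finite_INT) auto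
  finally show "fvec -` {j} \<inter> space borel \<in> sets borel" .
qed auto

lemma fvec_add_rvec: "fvec (u + rvec j) = fvec u + j"
  by (simp add: vec_eq_iff)

text \<open>The exceptional points lie on countably many hyperplanes. These are the places where the
  floor, and hence a function of the suspension, may jump.\<close>

lemma AE_not_Ints_component:
  fixes v :: "real ^ 'n"
  shows "AE u in lborel. \<forall>i. (u + v) $ i \<notin> (\<int> :: real set)"
proof -
  have "AE u in (lborel :: (real ^ 'n) measure). (u + v) $ i \<noteq> of_int m" for i and m :: int
  proof -
    have "{u :: real ^ 'n. (axis i 1) \<bullet> u = of_int m - v $ i} \<in> null_sets lebesgue"
      using negligible_hyperplane[of "axis i (1::real)" "of_int m - v $ i"] by (simp add: negligible_iff_null_sets axis_eq_0_iff)
    moreover have "{u :: real ^ 'n. (axis i 1) \<bullet> u = of_int m - v $ i} \<in> sets borel" by measurable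
    ultimately have "{u :: real ^ 'n. (axis i 1) \<bullet> u = of_int m - v $ i} \<in> null_sets lborel"
      by (auto simp: null_sets_def)
    then have "AE u in (lborel :: (real ^ 'n) measure). u \<notin> {u. (axis i 1) \<bullet> u = of_int m - v $ i}" by (rule AE_not_in)
    then show ?thesis by eventually_elim (auto simp: inner_axis' )
  qed
  then have "AE u in (lborel :: (real ^ 'n) measure). \<forall>i. \<forall>m::int. (u + v) $ i \<noteq> of_int m"
    by (simp add: AE_all_countable)
  then show ?thesis by eventually_elim (auto elim!: Ints_cases)
qed

section \<open>The suspension\<close>

text \<open>
  A point is an array \<open>x\<close> of numbers in \<open>[0,1]\<close>, one for each unit cell, together with the
  phase \<open>\<phi>\<close>; it represents the function \<open>u \<mapsto> x (\<lfloor>u + \<phi>\<rfloor>)\<close>, which is translated by the action.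
  The encoding \<open>mk\<close> of points must identify the pairs that represent the same function in this way.
\<close>

locale suspension =
  fixes mk :: "(int ^ 'n \<Rightarrow> real) \<Rightarrow> real ^ 'n \<Rightarrow> 'a"
    and sym :: "'a \<Rightarrow> int ^ 'n \<Rightarrow> real" and ph :: "'a \<Rightarrow> real ^ 'n"
  assumes sym_mk: "sym (mk x \<phi>) j = x (j + fvec \<phi>)"
    and ph_mk: "ph (mk x \<phi>) = \<phi> - rvec (fvec \<phi>)"
    and mk_eq: "sym (mk x \<phi>) = sym (mk y \<psi>) \<Longrightarrow> ph (mk x \<phi>) = ph (mk y \<psi>) \<Longrightarrow> mk x \<phi> = mk y \<psi>"
begin

definition pts :: "'a set" where
  "pts = {mk x \<phi> | x \<phi>. \<forall>j. 0 \<le> x j \<and> x j \<le> 1}"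

definition val :: "'a \<Rightarrow> real ^ 'n \<Rightarrow> real" where
  "val p u = sym p (fvec (u + ph p))"

text \<open>The phase as a point of the torus, so that it varies continuously when a coordinate
  passes through an integer.\<close>

definition cph :: "'a \<Rightarrow> 'n \<Rightarrow> complex" where
  "cph p i = cis (2 * pi * ph p $ i)"

text \<open>The torus term separates points that represent the same function, such as constant
  arrays with different phases.\<close>

definition ddist :: "'a \<Rightarrow> 'a \<Rightarrow> real" where
  "ddist p q = (\<integral>u. \<bar>val p u - val q u\<bar> \<partial>wmeas) + (\<Sum>i\<in>UNIV. norm (cph p i - cph q i))"

definition tr :: "real ^ 'n \<Rightarrow> 'a \<Rightarrow> 'a" where
  "tr v p = mk (sym p) (ph p + v)"

lemma val_mk: "val (mk x \<phi>) u = x (fvec (u + \<phi>))"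
proof -
  have "fvec (u + (\<phi> - rvec (fvec \<phi>))) + fvec \<phi> = fvec (u + (\<phi> - rvec (fvec \<phi>)) + rvec (fvec \<phi>))"
    by (rule fvec_add_rvec[symmetric])
  then show ?thesis by (simp add: val_def sym_mk ph_mk)
qed

lemma cph_mk: "cph (mk x \<phi>) i = cis (2 * pi * \<phi> $ i)"
proof -
  have "cis (2 * pi * (\<phi> $ i - of_int \<lfloor>\<phi> $ i\<rfloor>)) = cis (2 * pi * \<phi> $ i) / cis (2 * pi * of_int \<lfloor>\<phi> $ i\<rfloor>)"
    by (simp add: cis_divide algebra_simps)
  also have "cis (2 * pi * of_int \<lfloor>\<phi> $ i\<rfloor>) = 1" by (simp add: cis_multiple_2pi)
  finally show ?thesis by (simp add: cph_def ph_mk)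
qed

text \<open>The defining identification of the suspension: an integer move of the phase can be
  traded for a move of the array. Both the normal form of points and the periodicity of the random
  points in the phase rest on it.\<close>

lemma mk_shift: "mk (\<lambda>j. x (j + m)) \<psi> = mk x (\<psi> + rvec m)"
  by (rule mk_eq) (auto simp: sym_mk ph_mk fvec_add_rvec algebra_simps fun_eq_iff vec_eq_iff)

lemma tr_mk: "tr v (mk x \<phi>) = mk x (\<phi> + v)"
proof -
  have "tr v (mk x \<phi>) = mk (\<lambda>j. x (j + fvec \<phi>)) (\<phi> - rvec (fvec \<phi>) + v)"
    by (simp add: tr_def sym_mk[abs_def] ph_mk)
  also have "\<dots> = mk x (\<phi> - rvec (fvec \<phi>) + v + rvec (fvec \<phi>))" by (rule mk_shift)
  finally show ?thesis by simp
qed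

lemma mk_in_pts: "(\<And>j. 0 \<le> x j \<and> x j \<le> 1) \<Longrightarrow> mk x \<phi> \<in> pts"
  by (auto simp: pts_def)

lemma ptsE:
  assumes "p \<in> pts"
  obtains x \<phi> where "p = mk x \<phi>" "\<And>j. 0 \<le> x j \<and> x j \<le> 1" "\<And>i. 0 \<le> \<phi> $ i \<and> \<phi> $ i < 1"
proof -
  obtain x \<phi> where p: "p = mk x \<phi>" "\<And>j. 0 \<le> x j \<and> x j \<le> 1" using assms by (auto simp: pts_def)
  have "mk x \<phi> = mk (\<lambda>j. x (j + fvec \<phi>)) (\<phi> - rvec (fvec \<phi>))" by (subst mk_shift) simp
  moreover have "0 \<le> (\<phi> - rvec (fvec \<phi>)) $ i \<and> (\<phi> - rvec (fvec \<phi>)) $ i < 1" for i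
    by simp linarith
  ultimately show ?thesis using that[of "\<lambda>j. x (j + fvec \<phi>)" "\<phi> - rvec (fvec \<phi>)"] p by auto
qed

lemma val_measurable [measurable]: "val p \<in> borel_measurable borel"
proof -
  have "(\<lambda>u. fvec (u + ph p)) \<in> borel \<rightarrow>\<^sub>M count_space UNIV" by measurable
  then have "(\<lambda>u. sym p (fvec (u + ph p))) \<in> borel_measurable borel"
    by (rule measurable_compose) simp
  then show ?thesis by (simp add: val_def[abs_def])
qed

lemma val_bounds: "p \<in> pts \<Longrightarrow> 0 \<le> val p u \<and> val p u \<le> 1"
  by (elim ptsE) (simp add: val_mk)

lemma val_diff_le: "p \<in> pts \<Longrightarrow> q \<in> pts \<Longrightarrow> \<bar>val p u - val q u\<bar> \<le> 1"
  using val_bounds[of p u] val_bounds[of q u] by auto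

lemma val_integrable:
  assumes "p \<in> pts" "q \<in> pts"
  shows "integrable wmeas (\<lambda>u. \<bar>val p u - val q u\<bar>)"
proof -
  interpret W: prob_space "wmeas :: (real ^ 'n) measure" by (rule prob_space_wmeas)
  show ?thesis using val_diff_le[OF assms]
    by (intro W.integrable_const_bound[of _ 1]) (auto simp: measurable_cong_sets[OF sets_wmeas refl])
qed

lemma ddist_commute: "ddist p q = ddist q p"
  by (simp add: ddist_def abs_minus_commute norm_minus_commute)

lemma ddist_nonneg: "0 \<le> ddist p q"
  unfolding ddist_def by (intro add_nonneg_nonneg sum_nonneg Bochner_Integration.integral_nonneg) auto

text \<open>For separation, the torus term forces equal phases, since both can be taken in
  \<open>[0,1)\<close>. With equal phases the functions are constant on common unit cells of
  positive weight, so equality almost everywhere forces equal arrays.\<close>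

lemma metric: "Metric_space pts ddist"
proof
  show "0 \<le> ddist p q" "ddist p q = ddist q p" for p q by (rule ddist_nonneg ddist_commute)+
  show "ddist p r \<le> ddist p q + ddist q r" if "p \<in> pts" "q \<in> pts" "r \<in> pts" for p q r
  proof -
    have "(\<integral>u. \<bar>val p u - val r u\<bar> \<partial>wmeas) \<le> (\<integral>u. \<bar>val p u - val q u\<bar> + \<bar>val q u - val r u\<bar> \<partial>wmeas)"
      using that by (intro integral_mono Bochner_Integration.integrable_add val_integrable) auto
    also have "\<dots> = (\<integral>u. \<bar>val p u - val q u\<bar> \<partial>wmeas) + (\<integral>u. \<bar>val q u - val r u\<bar> \<partial>wmeas)"
      using that by (intro Bochner_Integration.integral_add val_integrable)
    finally have 1: "(\<integral>u. \<bar>val p u - val r u\<bar> \<partial>wmeas) \<le> (\<integral>u. \<bar>val p u - val q u\<bar> \<partial>wmeas) + (\<integral>u. \<bar>val q u - val r u\<bar> \<partial>wmeas)" .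
    have "(\<Sum>i\<in>UNIV. norm (cph p i - cph r i)) \<le> (\<Sum>i\<in>UNIV. norm (cph p i - cph q i) + norm (cph q i - cph r i))"
      by (intro sum_mono) (metis dist_norm dist_triangle)
    then have 2: "(\<Sum>i\<in>UNIV. norm (cph p i - cph r i)) \<le> (\<Sum>i\<in>UNIV. norm (cph p i - cph q i)) + (\<Sum>i\<in>UNIV. norm (cph q i - cph r i))"
      by (simp add: sum.distrib)
    show ?thesis using 1 2 by (simp add: ddist_def)
  qed
  show "ddist p q = 0 \<longleftrightarrow> p = q" if p: "p \<in> pts" and q: "q \<in> pts" for p q
  proof
    assume 0: "ddist p q = 0"
    obtain x \<phi> where x: "p = mk x \<phi>" "\<And>j. 0 \<le> x j \<and> x j \<le> 1" "\<And>i. 0 \<le> \<phi> $ i \<and> \<phi> $ i < 1" using p by (rule ptsE) blast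
    obtain y \<psi> where y: "q = mk y \<psi>" "\<And>j. 0 \<le> y j \<and> y j \<le> 1" "\<And>i. 0 \<le> \<psi> $ i \<and> \<psi> $ i < 1" using q by (rule ptsE) blast
    have i0: "(\<integral>u. \<bar>val p u - val q u\<bar> \<partial>wmeas) \<ge> 0" by simp
    have s0: "(\<Sum>i\<in>UNIV. norm (cph p i - cph q i)) \<ge> 0" by (simp add: sum_nonneg)
    have I: "(\<integral>u. \<bar>val p u - val q u\<bar> \<partial>wmeas) = 0" and S: "(\<Sum>i\<in>UNIV. norm (cph p i - cph q i)) = 0"
      using 0 i0 s0 unfolding ddist_def by linarith+
    have "\<phi> $ i = \<psi> $ i" for i
    proof -
      have "cph p i = cph q i" using S by (simp add: sum_nonneg_eq_0_iff)
      then have "cis (2 * pi * \<phi> $ i) / cis (2 * pi * \<psi> $ i) = 1" by (simp add: x(1) y(1) cph_mk)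
      then have "cis (2 * pi * (\<phi> $ i - \<psi> $ i)) = 1" by (simp add: cis_divide right_diff_distrib)
      then have "cos (2 * pi * (\<phi> $ i - \<psi> $ i)) = 1" by (simp add: complex_eq_iff)
      then obtain n :: int where "2 * pi * (\<phi> $ i - \<psi> $ i) = of_int n * 2 * pi" by (auto simp: cos_one_2pi_int)
      then have "\<phi> $ i - \<psi> $ i = of_int n" by simp
      moreover have "\<bar>\<phi> $ i - \<psi> $ i\<bar> < 1" using x(3)[of i] y(3)[of i] by auto
      ultimately have "\<bar>real_of_int n\<bar> < 1" by simp
      then have "n = 0" by linarith
      then show ?thesis using \<open>\<phi> $ i - \<psi> $ i = of_int n\<close> by simp
    qed
    then have ph: "\<phi> = \<psi>" by (simp add: vec_eq_iff)
    have ae: "AE u in wmeas. \<bar>val p u - val q u\<bar> = 0"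
      using I integral_nonneg_eq_0_iff_AE[OF val_integrable[OF p q]] by simp
    have "x j = y j" for j
    proof (rule ccontr)
      assume ne: "x j \<noteq> y j"
      \<comment> \<open>The arguments \<open>u\<close> at which the entry \<open>j\<close> is read:
        a translate of the unit cube, hence of positive weight.\<close>
      let ?A = "(\<lambda>u. u + \<phi> - rvec j) -` (cube 1) :: (real ^ 'n) set"
      have "(\<lambda>u. u + \<phi> - rvec j) \<in> borel \<rightarrow>\<^sub>M (borel :: (real ^ 'n) measure)" by measurable
      from measurable_sets[OF this cube_sets[of 1]] have A: "?A \<in> sets borel" by simp
      have "emeasure lborel (cube 1 :: (real ^ 'n) set) = emeasure (distr lborel borel ((+) (\<phi> - rvec j))) (cube 1)"
        by (simp add: lborel_distr_plus)
      also have "\<dots> = emeasure lborel ?A"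
        by (subst emeasure_distr) (auto intro!: arg_cong[of _ _ "emeasure lborel"] simp: algebra_simps)
      finally have "emeasure wmeas ?A > 0" by (intro wmeas_pos A) (simp add: emeasure_cube)
      moreover have "AE u in wmeas. u \<notin> ?A"
        using ae
      proof eventually_elim
        case (elim u)
        have "fvec (u + \<phi>) = j" if "u \<in> ?A"
          using that by (auto simp: vec_eq_iff cube_def floor_eq_iff diff_less_eq add.commute)
        then show ?case using elim ne by (auto simp: x(1) y(1) val_mk ph)
      qed
      then have "emeasure wmeas ?A = 0" using A by (subst (asm) AE_iff_measurable[of ?A]) auto
      ultimately show False by simp
    qed
    then have "x = y" by auto
    then show "p = q" using x y ph by simp
  qed (simp add: ddist_def)
qed

section \<open>The translation action and compactness\<close>

sublocale Metric_space pts ddist by (rule metric)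

lemma tr_in: "p \<in> pts \<Longrightarrow> tr v p \<in> pts"
  by (elim ptsE) (auto simp: tr_mk intro: mk_in_pts)

lemma tr_add: "p \<in> pts \<Longrightarrow> tr (u + v) p = tr u (tr v p)"
  by (elim ptsE) (simp add: tr_mk add_ac)

lemma tr_zero: "p \<in> pts \<Longrightarrow> tr 0 p = p"
  by (elim ptsE) (simp add: tr_mk)

lemma val_tr: "p \<in> pts \<Longrightarrow> val (tr v p) u = val p (u + v)"
  by (elim ptsE) (simp add: tr_mk val_mk add_ac)

lemma cph_tr: "p \<in> pts \<Longrightarrow> cph (tr v p) i = cph p i * cis (2 * pi * v $ i)"
  by (elim ptsE) (simp add: tr_mk cph_mk cis_mult algebra_simps)

lemma nrm1_nonneg: "0 \<le> nrm1 v" by (simp add: nrm1_def sum_nonneg)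

text \<open>The action rotates both torus points by the same angle, so that term is unchanged; the
  integral grows at most by the factor by which a translation distorts the weight.\<close>

lemma tr_lip:
  assumes p: "p \<in> pts" and q: "q \<in> pts"
  shows "ddist (tr v p) (tr v q) \<le> exp (nrm1 v) * ddist p q"
proof -
  interpret W: prob_space "wmeas :: (real ^ 'n) measure" by (rule prob_space_wmeas)
  define g where "g u = \<bar>val p u - val q u\<bar>" for u
  have g0: "0 \<le> g u" for u by (simp add: g_def)
  have gm[measurable]: "g \<in> borel_measurable borel" unfolding g_def by measurable
  have gi: "integrable wmeas g" using val_integrable[OF p q] by (simp add: g_def[abs_def])
  have gi': "integrable wmeas (\<lambda>u. g (u + v))"
    using val_integrable[OF tr_in[OF p, of v] tr_in[OF q, of v]] by (simp add: g_def[abs_def] val_tr p q)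
  have "ennreal (\<integral>u. g (u + v) \<partial>wmeas) = (\<integral>\<^sup>+u. ennreal (g (u + v)) \<partial>wmeas)"
    by (rule nn_integral_eq_integral[symmetric, OF gi']) (auto simp: g_def)
  also have "\<dots> \<le> ennreal (exp (nrm1 v)) * (\<integral>\<^sup>+u. ennreal (g u) \<partial>wmeas)"
    by (rule nn_integral_wmeas_shift) measurable
  also have "(\<integral>\<^sup>+u. ennreal (g u) \<partial>wmeas) = ennreal (\<integral>u. g u \<partial>wmeas)"
    by (rule nn_integral_eq_integral[OF gi]) (auto simp: g_def)
  also have "ennreal (exp (nrm1 v)) * ennreal (\<integral>u. g u \<partial>wmeas) = ennreal (exp (nrm1 v) * (\<integral>u. g u \<partial>wmeas))"
    by (rule ennreal_mult[symmetric]) (auto simp: g_def)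
  finally have 1: "(\<integral>u. g (u + v) \<partial>wmeas) \<le> exp (nrm1 v) * (\<integral>u. g u \<partial>wmeas)"
    using Bochner_Integration.integral_nonneg[of wmeas g, OF g0] by (subst (asm) ennreal_le_iff) auto
  have "(\<Sum>i\<in>UNIV. norm (cph (tr v p) i - cph (tr v q) i)) = (\<Sum>i\<in>UNIV. norm (cph p i - cph q i))"
    by (intro sum.cong refl) (simp add: cph_tr p q norm_mult flip: left_diff_distrib)
  also have "\<dots> \<le> exp (nrm1 v) * (\<Sum>i\<in>UNIV. norm (cph p i - cph q i))"
    using mult_right_mono[of 1 "exp (nrm1 v)" "\<Sum>i\<in>UNIV. norm (cph p i - cph q i)"] nrm1_nonneg[of v]
    by (simp add: sum_nonneg)
  finally have 2: "(\<Sum>i\<in>UNIV. norm (cph (tr v p) i - cph (tr v q) i)) \<le> exp (nrm1 v) * (\<Sum>i\<in>UNIV. norm (cph p i - cph q i))" .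
  have "ddist (tr v p) (tr v q) = (\<integral>u. g (u + v) \<partial>wmeas) + (\<Sum>i\<in>UNIV. norm (cph (tr v p) i - cph (tr v q) i))"
    by (simp add: ddist_def val_tr p q g_def)
  also have "\<dots> \<le> exp (nrm1 v) * (\<integral>u. g u \<partial>wmeas) + exp (nrm1 v) * (\<Sum>i\<in>UNIV. norm (cph p i - cph q i))"
    by (rule add_mono[OF 1 2])
  also have "\<dots> = exp (nrm1 v) * ddist p q"
    unfolding ddist_def g_def by (rule distrib_left[symmetric])
  finally show ?thesis .
qed

text \<open>At an argument off the integer hyperplanes the cell index is eventually constant, so the
  functions converge there, and dominated convergence gives convergence of the integrals.
  Compactness and continuity of the action both follow from this one statement.\<close>

lemma ddist_mk_tendsto:
  assumes x: "\<And>n j. 0 \<le> xs n j \<and> xs n j \<le> 1" and x': "\<And>j. 0 \<le> x j \<and> x j \<le> 1"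
    and lx: "\<And>j. (\<lambda>n. xs n j) \<longlonglongrightarrow> x j" and lp: "\<phi>s \<longlonglongrightarrow> \<phi>"
  shows "(\<lambda>n. ddist (mk (xs n) (\<phi>s n)) (mk x \<phi>)) \<longlonglongrightarrow> 0"
proof -
  interpret W: prob_space "wmeas :: (real ^ 'n) measure" by (rule prob_space_wmeas)
  have pn: "mk (xs n) (\<phi>s n) \<in> pts" for n by (rule mk_in_pts[OF x])
  have p: "mk x \<phi> \<in> pts" by (rule mk_in_pts[OF x'])
  have "AE u in wmeas. \<forall>i. (u + \<phi>) $ i \<notin> (\<int> :: real set)" by (rule AE_wmeas[OF AE_not_Ints_component])
  then have "AE u in wmeas. (\<lambda>n. \<bar>val (mk (xs n) (\<phi>s n)) u - val (mk x \<phi>) u\<bar>) \<longlonglongrightarrow> 0"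
  proof eventually_elim
    case (elim u)
    have "\<forall>\<^sub>F n in sequentially. \<lfloor>(u + \<phi>s n) $ i\<rfloor> = \<lfloor>(u + \<phi>) $ i\<rfloor>" for i
    proof -
      have l: "(\<lambda>n. (u + \<phi>s n) $ i) \<longlonglongrightarrow> (u + \<phi>) $ i" by (intro tendsto_intros lp)
      have "of_int \<lfloor>(u + \<phi>) $ i\<rfloor> \<noteq> (u + \<phi>) $ i" using elim by (metis Ints_of_int)
      then have "of_int \<lfloor>(u + \<phi>) $ i\<rfloor> < (u + \<phi>) $ i" by (simp add: order_less_le)
      then have "\<forall>\<^sub>F n in sequentially. of_int \<lfloor>(u + \<phi>) $ i\<rfloor> < (u + \<phi>s n) $ i"
        by (rule order_tendstoD(1)[OF l])
      moreover have "(u + \<phi>) $ i < of_int \<lfloor>(u + \<phi>) $ i\<rfloor> + 1" by simp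
      then have "\<forall>\<^sub>F n in sequentially. (u + \<phi>s n) $ i < of_int \<lfloor>(u + \<phi>) $ i\<rfloor> + 1"
        by (rule order_tendstoD(2)[OF l])
      ultimately show ?thesis by eventually_elim (simp add: floor_eq_iff)
    qed
    then have "\<forall>\<^sub>F n in sequentially. \<forall>i. \<lfloor>(u + \<phi>s n) $ i\<rfloor> = \<lfloor>(u + \<phi>) $ i\<rfloor>" by (simp add: eventually_all_finite)
    then have "\<forall>\<^sub>F n in sequentially. xs n (fvec (u + \<phi>)) = val (mk (xs n) (\<phi>s n)) u"
      by eventually_elim (simp add: val_mk vec_eq_iff arg_cong[of _ _ "xs _"])
    moreover have "(\<lambda>n. xs n (fvec (u + \<phi>))) \<longlonglongrightarrow> x (fvec (u + \<phi>))" by (rule lx)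
    ultimately have "(\<lambda>n. val (mk (xs n) (\<phi>s n)) u) \<longlonglongrightarrow> val (mk x \<phi>) u"
      unfolding val_mk[of x \<phi>] by (rule Lim_transform_eventually[rotated])
    then have "(\<lambda>n. \<bar>val (mk (xs n) (\<phi>s n)) u - val (mk x \<phi>) u\<bar>) \<longlonglongrightarrow> \<bar>val (mk x \<phi>) u - val (mk x \<phi>) u\<bar>"
      by (intro tendsto_intros)
    then show ?case by simp
  qed
  then have "(\<lambda>n. \<integral>u. \<bar>val (mk (xs n) (\<phi>s n)) u - val (mk x \<phi>) u\<bar> \<partial>wmeas) \<longlonglongrightarrow> (\<integral>u. 0 \<partial>(wmeas :: (real ^ 'n) measure))"
    using val_diff_le[OF pn p]
    by (intro integral_dominated_convergence[where w = "\<lambda>_. 1"]) (auto simp: measurable_cong_sets[OF sets_wmeas refl])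
  moreover have "(\<lambda>n. \<Sum>i\<in>UNIV. norm (cph (mk (xs n) (\<phi>s n)) i - cph (mk x \<phi>) i)) \<longlonglongrightarrow> (\<Sum>i\<in>(UNIV :: 'n set). norm (cis (2 * pi * \<phi> $ i) - cis (2 * pi * \<phi> $ i)))"
    unfolding cph_mk by (intro tendsto_intros tendsto_cis lp)
  ultimately have "(\<lambda>n. ddist (mk (xs n) (\<phi>s n)) (mk x \<phi>)) \<longlonglongrightarrow> 0 + 0"
    unfolding ddist_def by (intro tendsto_add) auto
  then show ?thesis by simp
qed

text \<open>The space is a sequentially continuous image of arrays over \<open>[0,1]\<close> times a
  closed box of phases. A limit phase may have a coordinate 1, which is harmless because
  \<open>mk\<close> accepts every phase.\<close>

lemma compact: "compact_space mtopology"
  unfolding compact_space_sequentially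
proof (intro allI impI)
  fix \<sigma> :: "nat \<Rightarrow> 'a" assume s: "range \<sigma> \<subseteq> pts"
  have "\<exists>x \<phi>. \<sigma> n = mk x \<phi> \<and> (\<forall>j. 0 \<le> x j \<and> x j \<le> 1) \<and> (\<forall>i. 0 \<le> \<phi> $ i \<and> \<phi> $ i < 1)" for n
  proof -
    have "\<sigma> n \<in> pts" using s by auto
    then show ?thesis by (rule ptsE) blast
  qed
  then obtain xs \<phi>s where xs: "\<And>n. \<sigma> n = mk (xs n) (\<phi>s n)" "\<And>n j. 0 \<le> xs n j \<and> xs n j \<le> 1" "\<And>n i. 0 \<le> \<phi>s n $ i \<and> \<phi>s n $ i < 1"
    by metis
  let ?K = "Pi\<^sub>E UNIV (\<lambda>_. {0..1}) :: (int ^ 'n \<Rightarrow> real) set"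
  have "compactin (product_topology (\<lambda>_. euclidean) UNIV) ?K"
    by (subst compactin_PiE) auto
  then have "compact ?K" by (simp add: euclidean_product_topology)
  then have "compact (?K \<times> (cbox 0 1 :: (real ^ 'n) set))" by (intro compact_Times compact_cbox)
  then have sc: "seq_compact (?K \<times> (cbox 0 1 :: (real ^ 'n) set))" by (rule compact_imp_seq_compact)
  have "\<forall>n. (xs n, \<phi>s n) \<in> ?K \<times> cbox 0 1"
    using xs by (auto simp: mem_box_cart less_imp_le)
  from seq_compactE[OF sc this] obtain l r where l: "l \<in> ?K \<times> cbox 0 1" "strict_mono r" "((\<lambda>n. (xs n, \<phi>s n)) \<circ> r) \<longlonglongrightarrow> l" .
  obtain x \<phi> where xl: "l = (x, \<phi>)" by (cases l)
  have x: "0 \<le> x j \<and> x j \<le> 1" for j using l(1) by (auto simp: xl)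
  have "(\<lambda>n. fst (((\<lambda>n. (xs n, \<phi>s n)) \<circ> r) n)) \<longlonglongrightarrow> fst l" by (rule tendsto_fst[OF l(3)])
  then have "(\<lambda>n. xs (r n)) \<longlonglongrightarrow> x" by (simp add: xl comp_def)
  then have lx: "(\<lambda>n. xs (r n) j) \<longlonglongrightarrow> x j" for j
    using continuous_on_tendsto_compose[of UNIV "\<lambda>x. x j" "\<lambda>n. xs (r n)" x sequentially] by simp
  have "(\<lambda>n. snd (((\<lambda>n. (xs n, \<phi>s n)) \<circ> r) n)) \<longlonglongrightarrow> snd l" by (rule tendsto_snd[OF l(3)])
  then have lp: "(\<lambda>n. \<phi>s (r n)) \<longlonglongrightarrow> \<phi>" by (simp add: xl comp_def)
  have "(\<lambda>n. ddist (mk (xs (r n)) (\<phi>s (r n))) (mk x \<phi>)) \<longlonglongrightarrow> 0"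
    by (rule ddist_mk_tendsto[OF xs(2) x lx lp])
  then have "limitin mtopology (\<sigma> \<circ> r) (mk x \<phi>) sequentially"
    unfolding limitin_metric_dist_null
    using mk_in_pts[of x \<phi>] x by (auto simp: xs(1) comp_def intro!: always_eventually mk_in_pts[OF xs(2)])
  then show "\<exists>l r. l \<in> pts \<and> strict_mono r \<and> limitin mtopology (\<sigma> \<circ> r) l sequentially"
    using l(2) mk_in_pts[of x \<phi>] x by blast
qed

end

context suspension
begin

section \<open>Continuity of the action\<close>

lemma tr_tendsto:
  assumes p: "p \<in> pts"
  shows "((\<lambda>u. ddist (tr u p) (tr u0 p)) \<longlongrightarrow> 0) (at u0)"
  unfolding tendsto_at_iff_sequentially
proof (intro allI impI)
  fix X :: "nat \<Rightarrow> real ^ 'n" assume X: "X \<longlonglongrightarrow> u0"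
  obtain x \<phi> where x: "p = mk x \<phi>" "\<And>j. 0 \<le> x j \<and> x j \<le> 1" using p by (rule ptsE) blast
  have "(\<lambda>n. ddist (mk x (\<phi> + X n)) (mk x (\<phi> + u0))) \<longlonglongrightarrow> 0"
    by (rule ddist_mk_tendsto[where xs = "\<lambda>_. x"]) (use x(2) X in \<open>auto intro!: tendsto_intros\<close>)
  then show "((\<lambda>u. ddist (tr u p) (tr u0 p)) \<circ> X) \<longlonglongrightarrow> 0" by (simp add: x(1) tr_mk comp_def)
qed

lemma tr_continuous:
  assumes p: "p \<in> pts" and e: "0 < e"
  shows "\<exists>r>0. \<forall>u. dist u u0 < r \<longrightarrow> ddist (tr u p) (tr u0 p) < e"
proof -
  have "\<forall>\<^sub>F u in at u0. ddist (tr u p) (tr u0 p) < e"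
    using tr_tendsto[OF p, of u0] e by (rule order_tendstoD(2))
  then obtain r where r: "r > 0" "\<And>u. u \<noteq> u0 \<Longrightarrow> dist u u0 < r \<Longrightarrow> ddist (tr u p) (tr u0 p) < e"
    unfolding eventually_at by blast
  have "ddist (tr u0 p) (tr u0 p) = 0" using tr_in[OF p, of u0] by simp
  then show ?thesis using r e by (intro exI[of _ r]) (metis)
qed

lemma nrm1_le: "nrm1 v \<le> real CARD('n) * norm (v :: real ^ 'n)"
  unfolding nrm1_def using sum_mono[of UNIV "\<lambda>i. \<bar>v $ i\<bar>" "\<lambda>_. norm v"] component_le_norm_cart[of v] by simp

lemma tr_dist_le:
  assumes "p \<in> pts" "q \<in> pts"
  shows "ddist (tr u p) (tr u0 q) \<le> exp (real CARD('n) * norm u) * ddist p q + ddist (tr u q) (tr u0 q)"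
proof -
  have "ddist (tr u p) (tr u0 q) \<le> ddist (tr u p) (tr u q) + ddist (tr u q) (tr u0 q)"
    using triangle tr_in assms by blast
  moreover have "ddist (tr u p) (tr u q) \<le> exp (nrm1 u) * ddist p q" by (rule tr_lip[OF assms])
  moreover have "exp (nrm1 u) * ddist p q \<le> exp (real CARD('n) * norm u) * ddist p q"
    using nrm1_le[of u] ddist_nonneg[of p q] by (intro mult_right_mono) auto
  ultimately show ?thesis by linarith
qed

text \<open>Joint continuity follows from continuity in the translation at a fixed point together
  with the Lipschitz bound in the point, whose constant \<open>C\<close> is uniform over the
  translations near \<open>u0\<close>.\<close>

lemma continuous: "continuous_action pts ddist tr"
  unfolding continuous_action_def
proof (intro conjI ballI allI)
  show "tr 0 x = x" if "x \<in> pts" for x by (rule tr_zero[OF that])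
  show "tr (u + v) x = tr u (tr v x)" if "x \<in> pts" for u v x by (rule tr_add[OF that])
  show "continuous_map (prod_topology euclidean mtopology) mtopology (\<lambda>(u, x). tr u x)"
    unfolding continuous_map_to_metric
  proof (intro ballI allI impI)
    fix z and e :: real assume z: "z \<in> topspace (prod_topology (euclidean :: (real ^ 'n) topology) mtopology)" and e: "e > 0"
    obtain u0 p where zp: "z = (u0, p)" "p \<in> pts" using z by (cases z) auto
    obtain r where r: "r > 0" "\<And>u. dist u u0 < r \<Longrightarrow> ddist (tr u p) (tr u0 p) < e / 2"
      using tr_continuous[OF zp(2), of "e / 2" u0] e by auto
    define C where "C = exp (real CARD('n) * (norm u0 + r))"
    have C: "C > 0" by (simp add: C_def)
    let ?U = "ball u0 r \<times> mball p (e / (2 * C))"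
    have "openin (prod_topology euclidean mtopology) ?U"
      by (simp add: openin_prod_Times_iff flip: open_openin)
    moreover have "z \<in> ?U" using zp r e C by auto
    moreover have "\<forall>y\<in>?U. (case y of (u, x) \<Rightarrow> tr u x) \<in> mball (case z of (u, x) \<Rightarrow> tr u x) e"
    proof
      fix y assume y: "y \<in> ?U"
      obtain u q where yq: "y = (u, q)" "dist u u0 < r" "q \<in> pts" "ddist p q < e / (2 * C)"
        using y by (cases y) (auto simp: dist_commute)
      have "norm u \<le> norm u0 + r" using yq(2) norm_triangle_sub[of u u0] by (simp add: dist_norm)
      then have "exp (real CARD('n) * norm u) \<le> C" unfolding C_def by (simp add: mult_left_mono)
      then have "exp (real CARD('n) * norm u) * ddist q p \<le> C * ddist q p"
        using ddist_nonneg by (intro mult_right_mono) auto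
      also have "\<dots> < C * (e / (2 * C))" using yq(4) C by (intro mult_strict_left_mono) (auto simp: ddist_commute)
      also have "\<dots> = e / 2" using C by simp
      finally have "ddist (tr u q) (tr u0 p) < e"
        using tr_dist_le[OF yq(3) zp(2), of u u0] r(2)[OF yq(2)] by linarith
      then show "(case y of (u, x) \<Rightarrow> tr u x) \<in> mball (case z of (u, x) \<Rightarrow> tr u x) e"
        using tr_in yq zp by (auto simp: ddist_commute)
    qed
    ultimately show "\<exists>U. openin (prod_topology (euclidean :: (real ^ 'n) topology) mtopology) U \<and> z \<in> U \<and> (\<forall>y\<in>U. (case y of (u, x) \<Rightarrow> tr u x) \<in> mball (case z of (u, x) \<Rightarrow> tr u x) e)"
      by blast
  qed
qed

sublocale lip_action pts ddist tr
proof
  have "mk (\<lambda>_. 0) 0 \<in> pts" by (rule mk_in_pts) simp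
  then show "pts \<noteq> {}" by auto
  show "mtotally_bounded pts"
    using compactin_imp_mtotally_bounded[of pts] compact by (simp add: compact_space_def)
  show "tr u x \<in> pts" if "x \<in> pts" for u x by (rule tr_in[OF that])
  show "tr (u + v) x = tr u (tr v x)" if "x \<in> pts" for u v x by (rule tr_add[OF that])
  show "tr 0 x = x" if "x \<in> pts" for x by (rule tr_zero[OF that])
  show "\<exists>C. \<forall>u x y. norm u \<le> L \<longrightarrow> x \<in> pts \<longrightarrow> y \<in> pts \<longrightarrow> ddist (tr u x) (tr u y) \<le> C * ddist x y" for L
  proof (intro exI[of _ "exp (real CARD('n) * L)"] allI impI)
    fix u :: "real ^ 'n" and x y assume u: "norm u \<le> L" and xy: "x \<in> pts" "y \<in> pts"
    have "ddist (tr u y) (tr u y) = 0" using tr_in[OF xy(2), of u] by simp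
    then have "ddist (tr u x) (tr u y) \<le> exp (real CARD('n) * norm u) * ddist x y"
      using tr_dist_le[OF xy, of u u] by linarith
    also have "\<dots> \<le> exp (real CARD('n) * L) * ddist x y"
      using u ddist_nonneg by (intro mult_right_mono) (auto simp: mult_left_mono)
    finally show "ddist (tr u x) (tr u y) \<le> exp (real CARD('n) * L) * ddist x y" .
  qed
  show "(\<lambda>u. ddist (tr u x) z) \<in> borel_measurable borel" if xz: "x \<in> pts" "z \<in> pts" for x z
  proof (rule borel_measurable_continuous_onI)
    show "continuous_on UNIV (\<lambda>u. ddist (tr u x) z)"
      unfolding continuous_on_iff
    proof (intro ballI allI impI)
      fix u0 :: "real ^ 'n" and e :: real assume "e > 0"
      then obtain r where r: "r > 0" "\<And>u. dist u u0 < r \<Longrightarrow> ddist (tr u x) (tr u0 x) < e"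
        using tr_continuous[OF xz(1)] by blast
      have "dist (ddist (tr u x) z) (ddist (tr u0 x) z) \<le> ddist (tr u x) (tr u0 x)" for u
        using triangle[OF tr_in[OF xz(1)] tr_in[OF xz(1)] xz(2), of u u0] triangle[OF tr_in[OF xz(1)] tr_in[OF xz(1)] xz(2), of u0 u]
          ddist_commute[of "tr u x" "tr u0 x"] by (simp add: dist_real_def abs_le_iff)
      then show "\<exists>d>0. \<forall>x'\<in>UNIV. dist x' u0 < d \<longrightarrow> dist (ddist (tr x' x) z) (ddist (tr u0 x) z) < e"
        using r le_less_trans by blast
    qed
  qed
qed

end

section \<open>Small cells\<close>

lemma norm_cis_diff_le: "norm (cis a - cis b) \<le> \<bar>a - b\<bar>"
proof -
  have "cis a - cis b = cis b * (exp (\<i> * of_real (a - b)) - 1)"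
    by (simp add: cis_conv_exp algebra_simps flip: exp_add)
  then have "norm (cis a - cis b) = 2 * \<bar>sin ((a - b) / 2)\<bar>"
    by (simp only: norm_mult norm_cis dist_exp_i_1 mult_1)
  also have "\<dots> \<le> \<bar>a - b\<bar>" using abs_sin_x_le_abs_x[of "(a - b) / 2"] by simp
  finally show ?thesis .
qed

text \<open>The arguments whose cell index in direction \<open>i\<close> may change when the phase
  moves by at most \<open>\<delta>\<close> from \<open>a\<close>: an integer is crossed.\<close>

definition jump :: "'n::finite \<Rightarrow> real \<Rightarrow> real \<Rightarrow> (real ^ 'n) set" where
  "jump i \<delta> a = {v. \<lfloor>v $ i + a\<rfloor> \<noteq> \<lfloor>v $ i + a + \<delta>\<rfloor>}"

lemma jump_sets [measurable]:
  fixes i :: "'n::finite"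
  shows "jump i \<delta> a \<in> sets borel"
proof -
  have "Measurable.pred (borel :: (real ^ 'n) measure) (\<lambda>v. \<lfloor>v $ i + a\<rfloor> \<noteq> \<lfloor>v $ i + a + \<delta>\<rfloor>)" by measurable
  then show ?thesis by (simp add: jump_def pred_def)
qed

text \<open>\<open>N\<close> translates of a jump set are disjoint, and all have comparable weight.\<close>

lemma measure_jump_le:
  fixes N :: nat and i :: "'n::finite"
  assumes N: "0 < N"
  shows "measure wmeas (jump i (1 / N) a) \<le> 3 / N"
proof -
  interpret W: prob_space "wmeas :: (real ^ 'n) measure" by (rule prob_space_wmeas)
  \<comment> \<open>The set of index \<open>j\<close> is that of index 0 moved by
    \<open>j / N\<close> along one axis. As the move is at most 1, weights agree up to the factor
    \<open>exp 1 \<le> 3\<close>.\<close>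
  let ?J = "\<lambda>j::nat. jump i (1 / N) (a + j / N)"
  have J: "?J j \<in> sets wmeas" for j by simp
  have le: "measure wmeas (?J 0) \<le> 3 * measure wmeas (?J j)" if "j < N" for j
  proof -
    define t where "t = real j / N"
    have t: "0 \<le> t" "t \<le> 1" using that N by (auto simp: t_def)
    define v :: "real ^ 'n" where "v = (- t) *\<^sub>R axis i 1"
    have "nrm1 v = (\<Sum>k\<in>UNIV. if k = i then t else 0)"
      unfolding nrm1_def v_def using t by (intro sum.cong) (auto simp: axis_def)
    then have nv: "nrm1 v = t" by simp
    have "emeasure wmeas (?J 0) = (\<integral>\<^sup>+u. indicator (?J j) (u + v) \<partial>wmeas)"
    proof -
      have "indicator (?J 0) u = (indicator (?J j) (u + v) :: ennreal)" for u
        by (auto simp: indicator_def jump_def v_def t_def algebra_simps)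
      then show ?thesis by (simp flip: nn_integral_indicator)
    qed
    also have "\<dots> \<le> ennreal (exp t) * (\<integral>\<^sup>+u. indicator (?J j) u \<partial>wmeas)"
      unfolding nv[symmetric] by (rule nn_integral_wmeas_shift) measurable
    also have "\<dots> = ennreal (exp t * measure wmeas (?J j))"
      by (simp add: W.emeasure_eq_measure ennreal_mult')
    also have "\<dots> \<le> ennreal (3 * measure wmeas (?J j))"
      using t exp_le by (intro ennreal_leI mult_right_mono) (auto intro: order_trans[of "exp t" "exp 1"])
    finally show ?thesis by (simp add: W.emeasure_eq_measure)
  qed
  have "disjoint_family_on ?J {..<N}"
    unfolding disjoint_family_on_def
  proof (intro ballI impI)
    \<comment> \<open>Over \<open>N\<close> consecutive steps of length \<open>1 / N\<close> the
      floor grows by exactly 1 in total, so at most one of the steps can jump.\<close>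
    have *: "?J j \<inter> ?J k = {}" if jk: "j < k" "k < N" for j k
    proof (rule ccontr)
      assume "?J j \<inter> ?J k \<noteq> {}"
      then obtain v where v: "v \<in> ?J j" "v \<in> ?J k" by auto
      define t where "t l = v $ i + a + real l / N" for l
      have tm: "\<lfloor>t l\<rfloor> \<le> \<lfloor>t m\<rfloor>" if "l \<le> m" for l m
        unfolding t_def using that N by (intro floor_mono) (auto simp: divide_right_mono)
      have tS: "t (Suc l) = t l + 1 / N" for l by (simp add: t_def add_divide_distrib)
      have "\<lfloor>t j\<rfloor> \<noteq> \<lfloor>t (Suc j)\<rfloor>" "\<lfloor>t k\<rfloor> \<noteq> \<lfloor>t (Suc k)\<rfloor>"
        using v unfolding jump_def tS by (auto simp: t_def add_ac)
      then have "\<lfloor>t j\<rfloor> + 1 \<le> \<lfloor>t (Suc j)\<rfloor>" "\<lfloor>t k\<rfloor> + 1 \<le> \<lfloor>t (Suc k)\<rfloor>"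
        using tm[of j "Suc j"] tm[of k "Suc k"] by auto
      moreover have "\<lfloor>t (Suc j)\<rfloor> \<le> \<lfloor>t k\<rfloor>" "\<lfloor>t 0\<rfloor> \<le> \<lfloor>t j\<rfloor>" "\<lfloor>t (Suc k)\<rfloor> \<le> \<lfloor>t N\<rfloor>"
        using jk by (intro tm; simp)+
      moreover have "t N = t 0 + 1" using N by (simp add: t_def)
      then have "\<lfloor>t N\<rfloor> = \<lfloor>t 0\<rfloor> + 1" by simp
      ultimately show False by linarith
    qed
    fix j k assume "j \<in> {..<N}" "k \<in> {..<N}" "j \<noteq> k"
    then show "?J j \<inter> ?J k = {}" using *[of j k] *[of k j] by (cases "j < k") auto
  qed
  then have "(\<Sum>j<N. measure wmeas (?J j)) = measure wmeas (\<Union>j<N. ?J j)"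
    by (intro W.finite_measure_finite_Union[symmetric]) auto
  also have "\<dots> \<le> 1" by (rule W.prob_le_1)
  finally have s: "(\<Sum>j<N. measure wmeas (?J j)) \<le> 1" .
  have "real N * measure wmeas (?J 0) = (\<Sum>j<N. measure wmeas (?J 0))" by simp
  also have "\<dots> \<le> (\<Sum>j<N. 3 * measure wmeas (?J j))" by (intro sum_mono le) auto
  also have "\<dots> \<le> 3" using s by (simp flip: sum_distrib_left)
  finally show ?thesis using N by (simp add: field_simps)
qed

lemma wmeas_tail:
  assumes "0 < \<eta>"
  shows "\<exists>r::nat. measure wmeas {v :: real ^ 'n. \<exists>i. real r < \<bar>v $ i\<bar>} \<le> \<eta>"
proof -
  interpret W: prob_space "wmeas :: (real ^ 'n) measure" by (rule prob_space_wmeas)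
  let ?A = "\<lambda>r::nat. {v :: real ^ 'n. \<exists>i. real r < \<bar>v $ i\<bar>}"
  have Aeq: "?A r = (\<Union>i\<in>UNIV. {v. real r < \<bar>v $ i\<bar>})" for r by auto
  have s: "?A r \<in> sets borel" for r unfolding Aeq by (intro sets.finite_UN) auto
  have "(\<lambda>r. measure wmeas (?A r)) \<longlonglongrightarrow> measure wmeas (\<Inter>r. ?A r)"
  proof (rule W.finite_Lim_measure_decseq)
    show "range ?A \<subseteq> sets wmeas" using s by auto
    show "decseq ?A"
      unfolding decseq_def
    proof (intro allI impI subsetI)
      fix m n :: nat and v assume "m \<le> n" "v \<in> ?A n"
      then obtain i where "real n < \<bar>v $ i\<bar>" by auto
      then have "real m < \<bar>v $ i\<bar>" using \<open>m \<le> n\<close> by linarith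
      then show "v \<in> ?A m" by auto
    qed
  qed
  moreover have "(\<Inter>r. ?A r) = {}"
  proof (rule ccontr)
    assume "(\<Inter>r. ?A r) \<noteq> {}"
    then obtain v where v: "\<And>r. v \<in> ?A r" by auto
    obtain r :: nat where "norm v \<le> real r" using real_arch_simple by blast
    moreover obtain i where "real r < \<bar>v $ i\<bar>" using v[of r] by auto
    ultimately show False using component_le_norm_cart[of v i] by linarith
  qed
  ultimately have "(\<lambda>r. measure wmeas (?A r)) \<longlonglongrightarrow> 0" by simp
  then have "\<forall>\<^sub>F r in sequentially. measure wmeas (?A r) < \<eta>" using assms by (rule order_tendstoD(2))
  then show ?thesis by (meson eventually_sequentially less_imp_le order_refl)
qed

context suspension
begin

definition pts_over :: "real set \<Rightarrow> 'a set" where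
  "pts_over S = {mk x \<phi> | x \<phi>. (\<forall>j. x j \<in> S) \<and> (\<forall>i. 0 \<le> \<phi> $ i \<and> \<phi> $ i < 1)}"

lemma pts_eq_pts_over: "pts = pts_over {0..1}"
proof
  show "pts \<subseteq> pts_over {0..1}"
  proof
    fix p assume "p \<in> pts"
    then show "p \<in> pts_over {0..1}" by (rule ptsE) (auto simp: pts_over_def)
  qed
qed (auto simp: pts_over_def pts_def)

text \<open>The sites that can be read from a window of radius \<open>r\<close> moved by a vector of
  \<open>cube (real L)\<close>. The additional 1 in the upper bound accounts for the phase in
  \<open>[0,1)\<close>.\<close>

definition wbox :: "nat \<Rightarrow> nat \<Rightarrow> (int ^ 'n) set" where
  "wbox r L = {j. \<forall>i. - int r \<le> j $ i \<and> j $ i < int (L + r + 1)}"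

text \<open>Off the tail of the weight and off the jump sets, both points read the same site of the
  window and differ by at most \<open>\<eta>\<close>; elsewhere the difference is at most 1. Each
  coordinate contributes \<open>3 / N\<close> for its jump set and \<open>7 / N\<close>, a bound for
  \<open>2 * pi / N\<close>, for its torus distance, which makes the constant 10.\<close>

lemma ddist_cell:
  fixes N L r :: nat
  assumes xy: "\<And>j. 0 \<le> x j \<and> x j \<le> 1" "\<And>j. 0 \<le> y j \<and> y j \<le> 1" "\<And>j. j \<in> wbox r L \<Longrightarrow> \<bar>x j - y j\<bar> \<le> \<eta>" and e: "0 \<le> \<eta>"
    and N: "0 < N" and c: "\<And>i. c i \<le> \<phi> $ i \<and> \<phi> $ i < c i + 1 / N" "\<And>i. c i \<le> \<psi> $ i \<and> \<psi> $ i < c i + 1 / N"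
    and p: "\<And>i. 0 \<le> \<phi> $ i \<and> \<phi> $ i < 1" and u: "u \<in> cube (real L)"
  shows "ddist (tr u (mk x \<phi>)) (tr u (mk y \<psi>)) \<le> \<eta> + measure wmeas {v :: real ^ 'n. \<exists>i. real r < \<bar>v $ i\<bar>} + 10 * real CARD('n) / N"
proof -
  interpret W: prob_space "wmeas :: (real ^ 'n) measure" by (rule prob_space_wmeas)
  let ?R = "{v :: real ^ 'n. \<exists>i. real r < \<bar>v $ i\<bar>}"
  let ?J = "\<lambda>i. jump i (1 / N) (u $ i + c i) :: (real ^ 'n) set"
  have Rs: "?R \<in> sets borel"
  proof -
    have "?R = (\<Union>i\<in>UNIV. {v. real r < \<bar>v $ i\<bar>})" by auto
    then show ?thesis by (simp only:) (intro sets.finite_UN, auto)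
  qed
  have pt: "\<bar>val (tr u (mk x \<phi>)) v - val (tr u (mk y \<psi>)) v\<bar> \<le> \<eta> + indicator ?R v + (\<Sum>i\<in>UNIV. indicator (?J i) v)" for v
  proof -
    have eq: "val (tr u (mk x \<phi>)) v = x (fvec (v + (\<phi> + u)))" "val (tr u (mk y \<psi>)) v = y (fvec (v + (\<psi> + u)))"
      by (simp_all add: tr_mk val_mk)
    have b1: "\<bar>val (tr u (mk x \<phi>)) v - val (tr u (mk y \<psi>)) v\<bar> \<le> 1"
      unfolding eq using xy(1)[of "fvec (v + (\<phi> + u))"] xy(2)[of "fvec (v + (\<psi> + u))"] by auto
    have s0: "0 \<le> (\<Sum>i\<in>UNIV. indicator (?J i) v :: real)" by (intro sum_nonneg) auto
    show ?thesis
    proof (cases "v \<in> ?R \<or> (\<exists>i. v \<in> ?J i)")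
      case True
      then show ?thesis
      proof
        assume "v \<in> ?R"
        then show ?thesis using b1 s0 e by simp
      next
        assume "\<exists>i. v \<in> ?J i"
        then obtain i where i: "v \<in> ?J i" by auto
        have "indicator (?J i) v \<le> (\<Sum>i\<in>UNIV. indicator (?J i) v :: real)"
          by (rule member_le_sum) auto
        then show ?thesis using b1 i e by (simp add: indicator_def split: if_splits)
      qed
    next
      case False
      have feq: "fvec (v + (\<phi> + u)) = fvec (v + (\<psi> + u))"
        unfolding vec_eq_iff
      proof
        fix i
        have "v \<notin> ?J i" using False by auto
        then have f: "\<lfloor>v $ i + (u $ i + c i)\<rfloor> = \<lfloor>v $ i + (u $ i + c i) + 1 / N\<rfloor>" by (simp add: jump_def)
        have "\<lfloor>v $ i + (u $ i + c i)\<rfloor> \<le> \<lfloor>v $ i + (\<phi> $ i + u $ i)\<rfloor>" "\<lfloor>v $ i + (\<phi> $ i + u $ i)\<rfloor> \<le> \<lfloor>v $ i + (u $ i + c i) + 1 / N\<rfloor>"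
          "\<lfloor>v $ i + (u $ i + c i)\<rfloor> \<le> \<lfloor>v $ i + (\<psi> $ i + u $ i)\<rfloor>" "\<lfloor>v $ i + (\<psi> $ i + u $ i)\<rfloor> \<le> \<lfloor>v $ i + (u $ i + c i) + 1 / N\<rfloor>"
          using c[of i] by (intro floor_mono; linarith)+
        then show "fvec (v + (\<phi> + u)) $ i = fvec (v + (\<psi> + u)) $ i" using f by simp
      qed
      have "fvec (v + (\<phi> + u)) \<in> wbox r L"
        unfolding wbox_def
      proof (intro CollectI allI)
        fix i
        have "\<bar>v $ i\<bar> \<le> real r" using False by (auto simp: not_less)
        moreover have "0 \<le> u $ i" "u $ i < real L" using u by (auto simp: cube_def)
        ultimately have "- real r \<le> (v + (\<phi> + u)) $ i" "(v + (\<phi> + u)) $ i < real (L + r + 1)"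
          using p[of i] by auto
        then show "- int r \<le> fvec (v + (\<phi> + u)) $ i \<and> fvec (v + (\<phi> + u)) $ i < int (L + r + 1)"
          by (simp only: fvec_nth le_floor_iff floor_less_iff) simp
      qed
      then show ?thesis unfolding eq feq[symmetric] using xy(3)[of "fvec (v + (\<phi> + u))"] s0
        by (auto intro: order_trans)
    qed
  qed
  have pts: "tr u (mk x \<phi>) \<in> pts" "tr u (mk y \<psi>) \<in> pts" by (intro tr_in mk_in_pts xy)+
  have iJ: "integrable wmeas (\<lambda>v. indicator (?J i) v :: real)" for i
    by (intro integrable_real_indicator) (auto simp: W.emeasure_eq_measure)
  have iR: "integrable wmeas (\<lambda>v. indicator ?R v :: real)"
    using Rs by (intro integrable_real_indicator) (auto simp: W.emeasure_eq_measure)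
  have "(\<integral>v. \<bar>val (tr u (mk x \<phi>)) v - val (tr u (mk y \<psi>)) v\<bar> \<partial>wmeas) \<le> (\<integral>v. \<eta> + indicator ?R v + (\<Sum>i\<in>UNIV. indicator (?J i) v) \<partial>wmeas)"
    using iJ iR pt by (intro integral_mono val_integrable pts) auto
  also have "\<dots> = \<eta> + measure wmeas ?R + (\<Sum>i\<in>UNIV. measure wmeas (?J i))"
    using iJ iR Rs by (simp add: W.prob_space[unfolded space_wmeas])
  also have "(\<Sum>i\<in>UNIV. measure wmeas (?J i)) \<le> (\<Sum>i\<in>(UNIV :: 'n set). 3 / N)"
    by (intro sum_mono measure_jump_le N)
  finally have 1: "(\<integral>v. \<bar>val (tr u (mk x \<phi>)) v - val (tr u (mk y \<psi>)) v\<bar> \<partial>wmeas) \<le> \<eta> + measure wmeas ?R + 3 * real CARD('n) / N" by (simp add: mult.commute)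
  have "(\<Sum>i\<in>UNIV. norm (cph (tr u (mk x \<phi>)) i - cph (tr u (mk y \<psi>)) i)) \<le> (\<Sum>i\<in>(UNIV :: 'n set). 7 / N)"
  proof (rule sum_mono)
    fix i :: 'n
    have "norm (cph (tr u (mk x \<phi>)) i - cph (tr u (mk y \<psi>)) i) \<le> \<bar>2 * pi * (\<phi> + u) $ i - 2 * pi * (\<psi> + u) $ i\<bar>"
      unfolding tr_mk cph_mk by (rule norm_cis_diff_le)
    also have "\<dots> = 2 * pi * \<bar>\<phi> $ i - \<psi> $ i\<bar>" by (simp add: abs_mult flip: right_diff_distrib)
    also have "\<dots> \<le> 7 * (1 / N)" using c[of i] pi_less_4 pi_approx by (intro mult_mono) auto
    finally show "norm (cph (tr u (mk x \<phi>)) i - cph (tr u (mk y \<psi>)) i) \<le> 7 / N" by simp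
  qed
  also have "\<dots> = 7 * real CARD('n) / N" by (simp add: mult.commute)
  finally have 2: "(\<Sum>i\<in>UNIV. norm (cph (tr u (mk x \<phi>)) i - cph (tr u (mk y \<psi>)) i)) \<le> 7 * real CARD('n) / N" .
  have "3 * real CARD('n) / N + 7 * real CARD('n) / N = 10 * real CARD('n) / N"
    by (simp flip: add_divide_distrib)
  then show ?thesis using 1 2 unfolding ddist_def by linarith
qed

text \<open>A cell prescribes the array on the window up to \<open>\<eta>\<close> and the phase up
  to \<open>1 / N\<close>. Diameters are at most \<open>4 * \<eta>\<close>: twice
  \<open>\<eta>\<close> for the values, once for the tail and once for the phase. Neither the number
  of phase cells nor the radius of the window depends on \<open>L\<close>; naming the radius by
  \<open>SOME\<close> in the statement makes this visible.\<close>

lemma cover_pts_over: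
  assumes S: "S \<subseteq> {0..1}" and Q: "finite Q" "\<And>x. x \<in> S \<Longrightarrow> \<exists>q\<in>Q. \<bar>x - q\<bar> \<le> \<eta>" and e: "0 < \<eta>"
  shows "\<exists>\<C>. dcover (real L) (4 * \<eta>) (pts_over S) \<C> \<and>
    card \<C> \<le> nat \<lceil>10 * real CARD('n) / \<eta>\<rceil> ^ CARD('n) * card Q ^ ((L + 2 * (SOME r. measure wmeas {v :: real ^ 'n. \<exists>i. real r < \<bar>v $ i\<bar>} \<le> \<eta>) + 1) ^ CARD('n))"
proof -
  define r where "r = (SOME r. measure wmeas {v :: real ^ 'n. \<exists>i. real r < \<bar>v $ i\<bar>} \<le> \<eta>)"
  have r: "measure wmeas {v :: real ^ 'n. \<exists>i. real r < \<bar>v $ i\<bar>} \<le> \<eta>"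
    unfolding r_def by (rule someI_ex[OF wmeas_tail[OF e]])
  define N where "N = nat \<lceil>10 * real CARD('n) / \<eta>\<rceil>"
  have "10 * real CARD('n) / \<eta> \<le> real N" unfolding N_def by linarith
  moreover have "10 * real CARD('n) / \<eta> > 0" using e by simp
  ultimately have N0: "real N > 0" by linarith
  have "10 * real CARD('n) \<le> real N * \<eta>"
    using \<open>10 * real CARD('n) / \<eta> \<le> real N\<close> e by (simp add: pos_divide_le_eq)
  then have N1: "10 * real CARD('n) / N \<le> \<eta>"
    using N0 by (simp add: pos_divide_le_eq mult.commute)
  have N: "0 < N" using N0 by simp
  define cell where "cell = (\<lambda>(\<rho>, \<kappa>). {mk x \<phi> | x \<phi>. (\<forall>j. x j \<in> S) \<and> (\<forall>j\<in>wbox r L. \<bar>x j - \<rho> j\<bar> \<le> \<eta>) \<and> (\<forall>i. 0 \<le> \<phi> $ i \<and> \<phi> $ i < 1 \<and> real (\<kappa> i) / N \<le> \<phi> $ i \<and> \<phi> $ i < real (\<kappa> i) / N + 1 / N)})"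
  define I where "I = Pi\<^sub>E (wbox r L) (\<lambda>_. Q) \<times> Pi\<^sub>E (UNIV :: 'n set) (\<lambda>_. {..<N})"
  have wb: "finite (wbox r L)" "card (wbox r L) = (L + 2 * r + 1) ^ CARD('n)"
  proof -
    show "finite (wbox r L)" unfolding wbox_def by (rule finite_card_int_box) simp
    have "nat (int (L + r + 1) - - int r) = L + 2 * r + 1" by simp
    then show "card (wbox r L) = (L + 2 * r + 1) ^ CARD('n)"
      unfolding wbox_def by (subst finite_card_int_box(2)) auto
  qed
  have fI: "finite I" unfolding I_def using wb Q(1) by (intro finite_cartesian_product finite_PiE) auto
  have cI: "card I = card Q ^ ((L + 2 * r + 1) ^ CARD('n)) * N ^ CARD('n)"
    unfolding I_def by (simp add: card_cartesian_product card_PiE wb)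
  have "dcover (real L) (4 * \<eta>) (pts_over S) (cell ` I)"
    unfolding dcover_def
  proof (intro conjI ballI)
    show "finite (cell ` I)" using fI by simp
    show "pts_over S \<subseteq> \<Union> (cell ` I)"
    proof
      fix p assume "p \<in> pts_over S"
      then obtain x \<phi> where x: "p = mk x \<phi>" "\<And>j. x j \<in> S" "\<And>i. 0 \<le> \<phi> $ i \<and> \<phi> $ i < 1" by (auto simp: pts_over_def)
      have "\<forall>j. \<exists>q\<in>Q. \<bar>x j - q\<bar> \<le> \<eta>" using Q(2) x(2) by blast
      then obtain \<rho> where \<rho>: "\<And>j. \<rho> j \<in> Q" "\<And>j. \<bar>x j - \<rho> j\<bar> \<le> \<eta>" by metis
      define \<kappa> where "\<kappa> i = nat \<lfloor>\<phi> $ i * N\<rfloor>" for i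
      have k: "real (\<kappa> i) / N \<le> \<phi> $ i" "\<phi> $ i < real (\<kappa> i) / N + 1 / N" "\<kappa> i < N" for i
      proof -
        have "0 \<le> \<phi> $ i * N" using x(3)[of i] by simp
        then have rk: "real (\<kappa> i) = of_int \<lfloor>\<phi> $ i * N\<rfloor>" by (simp add: \<kappa>_def)
        have "real (\<kappa> i) \<le> \<phi> $ i * N" "\<phi> $ i * N < real (\<kappa> i) + 1" unfolding rk by linarith+
        then show "real (\<kappa> i) / N \<le> \<phi> $ i" "\<phi> $ i < real (\<kappa> i) / N + 1 / N" using N0 by (simp_all add: field_simps)
        have "\<phi> $ i * N < 1 * real N" using x(3)[of i] N0 by (intro mult_strict_right_mono) auto
        then have "real (\<kappa> i) < real N" using \<open>real (\<kappa> i) \<le> \<phi> $ i * N\<close> by linarith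
        then show "\<kappa> i < N" by simp
      qed
      have "(restrict \<rho> (wbox r L), \<kappa>) \<in> I" using \<rho>(1) k(3) by (auto simp: I_def)
      moreover have "p \<in> cell (restrict \<rho> (wbox r L), \<kappa>)"
        using x \<rho>(2) k(1,2) by (auto simp: cell_def intro!: exI[of _ x] exI[of _ \<phi>])
      ultimately show "p \<in> \<Union> (cell ` I)" by blast
    qed
    fix C assume "C \<in> cell ` I"
    then obtain \<rho> \<kappa> where C: "C = cell (\<rho>, \<kappa>)" by auto
    have S01: "0 \<le> x \<and> x \<le> 1" if "x \<in> S" for x using S that by auto
    show "C \<subseteq> pts" unfolding C cell_def using S01 by (auto intro!: mk_in_pts)
    fix p q and u :: "real ^ 'n" assume pq: "p \<in> C" "q \<in> C" and u: "u \<in> cube (real L)"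
    obtain x \<phi> where x: "p = mk x \<phi>" "\<And>j. x j \<in> S" "\<And>j. j \<in> wbox r L \<Longrightarrow> \<bar>x j - \<rho> j\<bar> \<le> \<eta>" "\<And>i. 0 \<le> \<phi> $ i \<and> \<phi> $ i < 1"
        "\<And>i. real (\<kappa> i) / N \<le> \<phi> $ i \<and> \<phi> $ i < real (\<kappa> i) / N + 1 / N"
      using pq(1) unfolding C cell_def by auto
    obtain y \<psi> where y: "q = mk y \<psi>" "\<And>j. y j \<in> S" "\<And>j. j \<in> wbox r L \<Longrightarrow> \<bar>y j - \<rho> j\<bar> \<le> \<eta>"
        "\<And>i. real (\<kappa> i) / N \<le> \<psi> $ i \<and> \<psi> $ i < real (\<kappa> i) / N + 1 / N"
      using pq(2) unfolding C cell_def by auto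
    have "\<bar>x j - y j\<bar> \<le> 2 * \<eta>" if "j \<in> wbox r L" for j using x(3)[OF that] y(3)[OF that] by linarith
    then have "ddist (tr u p) (tr u q) \<le> 2 * \<eta> + measure wmeas {v :: real ^ 'n. \<exists>i. real r < \<bar>v $ i\<bar>} + 10 * real CARD('n) / N"
      unfolding x(1) y(1) using e by (intro ddist_cell[OF S01[OF x(2)] S01[OF y(2)] _ _ N x(5) y(4) x(4) u]) auto
    also have "\<dots> \<le> 4 * \<eta>" using r N1 by simp
    finally show "ddist (tr u p) (tr u q) \<le> 4 * \<eta>" .
  qed
  moreover have "card (cell ` I) \<le> N ^ CARD('n) * card Q ^ ((L + 2 * r + 1) ^ CARD('n))"
    using card_image_le[OF fI, of cell] by (simp add: cI mult.commute)
  ultimately show ?thesis unfolding N_def r_def by blast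
qed

end

section \<open>Binary expansions with prescribed zero digits\<close>

definition coin :: "(nat \<Rightarrow> bool) measure" where
  "coin = Pi\<^sub>M UNIV (\<lambda>_. measure_pmf (bernoulli_pmf (1 / 2)))"

definition dig :: "nat set \<Rightarrow> (nat \<Rightarrow> bool) \<Rightarrow> nat \<Rightarrow> real" where
  "dig A b k = (if k \<in> A \<and> b k then 1 else 0)"

definition xi :: "nat set \<Rightarrow> (nat \<Rightarrow> bool) \<Rightarrow> real" where
  "xi A b = (\<Sum>k. dig A b k / 2 ^ Suc k)"

definition psum :: "nat set \<Rightarrow> nat \<Rightarrow> (nat \<Rightarrow> bool) \<Rightarrow> real" where
  "psum A n b = (\<Sum>k<n. dig A b k / 2 ^ Suc k)"

lemma prob_space_coin: "prob_space coin"
  unfolding coin_def by (intro prob_space_PiM measure_pmf.prob_space_axioms)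

lemma space_coin [simp]: "space coin = UNIV"
  by (simp add: coin_def space_PiM PiE_UNIV_domain)

lemma dig_bounds: "0 \<le> dig A b k" "dig A b k \<le> 1" by (auto simp: dig_def)

lemma half_sums: "(\<lambda>k. (1::real) / 2 ^ Suc k) sums 1"
  using power_half_series by (simp add: power_divide)

lemma dig_summable: "summable (\<lambda>k. dig A b k / 2 ^ Suc k)"
  by (rule summable_comparison_test'[OF sums_summable[OF half_sums], of 0])
     (simp add: dig_bounds divide_right_mono del: power_Suc)

lemma xi_psum:
  shows "psum A n b \<le> xi A b" "xi A b \<le> psum A n b + 1 / 2 ^ n"
proof -
  have s: "xi A b = (\<Sum>k. dig A b (k + n) / 2 ^ Suc (k + n)) + psum A n b"
    unfolding xi_def psum_def by (rule suminf_split_initial_segment[OF dig_summable])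
  have sm: "summable (\<lambda>k. dig A b (k + n) / 2 ^ Suc (k + n))"
    using summable_ignore_initial_segment[OF dig_summable, of A b n] .
  have t: "(\<lambda>k. (1::real) / 2 ^ n * (1 / 2 ^ Suc k)) sums (1 / 2 ^ n * 1)"
    by (rule sums_mult[OF half_sums])
  have "0 \<le> (\<Sum>k. dig A b (k + n) / 2 ^ Suc (k + n))"
    by (rule suminf_nonneg[OF sm]) (simp add: dig_bounds)
  then show "psum A n b \<le> xi A b" using s by simp
  have "(\<Sum>k. dig A b (k + n) / 2 ^ Suc (k + n)) \<le> (\<Sum>k. (1::real) / 2 ^ n * (1 / 2 ^ Suc k))"
  proof (rule suminf_le[OF _ sm sums_summable[OF t]])
    fix k
    have "dig A b (k + n) / 2 ^ Suc (k + n) \<le> 1 / 2 ^ Suc (k + n)"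
      by (intro divide_right_mono dig_bounds) auto
    also have "(1::real) / 2 ^ Suc (k + n) = 1 / 2 ^ n * (1 / 2 ^ Suc k)" by (simp add: power_add)
    finally show "dig A b (k + n) / 2 ^ Suc (k + n) \<le> 1 / 2 ^ n * (1 / 2 ^ Suc k)" .
  qed
  also have "\<dots> = 1 / 2 ^ n" by (simp only: sums_unique[OF t, symmetric] mult_1_right)
  finally show "xi A b \<le> psum A n b + 1 / 2 ^ n" using s by simp
qed

lemma xi_bounds: "0 \<le> xi A b" "xi A b \<le> 1"
  using xi_psum[where A = A and n = 0 and b = b] by (auto simp: psum_def)

definition cnt :: "nat set \<Rightarrow> nat \<Rightarrow> nat" where
  "cnt A n = card (A \<inter> {..<n})"

lemma card_range_psum: "finite (range (psum A n))" "card (range (psum A n)) \<le> 2 ^ cnt A n"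
proof -
  have eq: "psum A n b = (\<Sum>k<n. (if k \<in> A \<inter> {..<n} \<inter> Collect b then 1 else 0) / 2 ^ Suc k)" for b
    unfolding psum_def dig_def by (intro sum.cong) auto
  have sub: "range (psum A n) \<subseteq> (\<lambda>B. \<Sum>k<n. (if k \<in> B then 1 else 0) / 2 ^ Suc k) ` Pow (A \<inter> {..<n})"
  proof (intro image_subsetI)
    fix b
    show "psum A n b \<in> (\<lambda>B. \<Sum>k<n. (if k \<in> B then 1 else 0) / 2 ^ Suc k) ` Pow (A \<inter> {..<n})"
      by (rule image_eqI[where x = "A \<inter> {..<n} \<inter> Collect b"]) (rule eq, auto)
  qed
  show "finite (range (psum A n))" by (rule finite_subset[OF sub]) auto
  have "card (range (psum A n)) \<le> card (Pow (A \<inter> {..<n}))"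
    by (rule order_trans[OF card_mono[OF _ sub] card_image_le]) auto
  then show "card (range (psum A n)) \<le> 2 ^ cnt A n" by (subst (asm) card_Pow) (auto simp: cnt_def)
qed

text \<open>Scaled by \<open>2 ^ n\<close>, the truncated sum is an integer with the given binary
  digits: parity reveals the last digit, induction the others.\<close>

lemma psum_digits_unique:
  assumes "psum A n b = psum A n b'" "k < n" "k \<in> A"
  shows "b k = b' k"
proof -
  define Z where "Z n b = 2 ^ n * psum A n b" for n b
  have ZS: "Z (Suc n) b = 2 * Z n b + dig A b n" for n b
    by (simp add: Z_def psum_def algebra_simps)
  have "\<exists>m::int. Z n b = of_int m" for n b
  proof (induction n)
    case 0
    then show ?case by (simp add: Z_def psum_def exI[of _ 0])
  next
    case (Suc n)
    then obtain m :: int where "Z n b = of_int m" by auto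
    then have "Z (Suc n) b = of_int (2 * m + (if n \<in> A \<and> b n then 1 else 0))" by (simp add: ZS dig_def)
    then show ?case by blast
  qed
  then obtain z where z: "\<And>n b. Z n b = of_int (z n b :: int)" by metis
  have zS: "z (Suc n) b = 2 * z n b + (if n \<in> A \<and> b n then 1 else 0)" for n b
  proof -
    have "real_of_int (z (Suc n) b) = of_int (2 * z n b + (if n \<in> A \<and> b n then 1 else 0))"
      using ZS[of n b] by (simp add: z dig_def split: if_splits)
    then show ?thesis by (simp only: of_int_eq_iff)
  qed
  have "z n b = z n b' \<Longrightarrow> \<forall>k<n. k \<in> A \<longrightarrow> b k = b' k" for n
  proof (induction n)
    case (Suc n)
    have "z n b = z n b' \<and> (n \<in> A \<longrightarrow> b n = b' n)"
      using Suc.prems unfolding zS by (auto split: if_splits) presburger+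
    then show ?case using Suc.IH by (auto simp: less_Suc_eq)
  qed simp
  moreover have "z n b = z n b'" using assms(1) z[of n b] z[of n b'] by (simp add: Z_def)
  ultimately show ?thesis using assms(2,3) by blast
qed

lemma dig_measurable [measurable]: "(\<lambda>b. dig A b k) \<in> borel_measurable coin"
proof -
  have "(\<lambda>b. b k) \<in> coin \<rightarrow>\<^sub>M measure_pmf (bernoulli_pmf (1 / 2))"
    unfolding coin_def by (rule measurable_component_singleton) simp
  then have "(\<lambda>b. b k) \<in> coin \<rightarrow>\<^sub>M count_space UNIV" by (simp cong: measurable_cong_sets)
  then have "(\<lambda>b. (if k \<in> A \<and> b k then 1 else 0 :: real)) \<in> borel_measurable coin"
    by (rule measurable_compose) simp
  then show ?thesis by (simp add: dig_def)
qed

lemma psum_measurable [measurable]: "psum A n \<in> borel_measurable coin"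
  unfolding psum_def[abs_def] by measurable

lemma xi_measurable [measurable]: "xi A \<in> borel_measurable coin"
  unfolding xi_def[abs_def] by measurable

text \<open>By uniqueness of digits, the truncated value fixes the \<open>cnt A n\<close> coins at
  the positions of \<open>A\<close> below \<open>n\<close>, which are independent and fair.\<close>

lemma prob_psum_le: "measure coin {b. psum A n b = s} \<le> 1 / 2 ^ cnt A n"
proof (cases "\<exists>b. psum A n b = s")
  case False
  then have "{b. psum A n b = s} = {}" by auto
  then show ?thesis by (simp only: measure_empty) simp
next
  case True
  then obtain b0 where b0: "psum A n b0 = s" by auto
  interpret P: product_prob_space "\<lambda>_. measure_pmf (bernoulli_pmf (1 / 2))" "UNIV :: nat set"
    by unfold_locales
  interpret C: prob_space coin by (rule prob_space_coin)
  let ?J = "A \<inter> {..<n}"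
  let ?E = "{b \<in> space coin. \<forall>k\<in>?J. b k \<in> {b0 k}}"
  have "emeasure coin ?E = (\<Prod>k\<in>?J. emeasure (measure_pmf (bernoulli_pmf (1 / 2))) {b0 k})"
    unfolding coin_def by (rule P.emeasure_PiM_Collect) auto
  also have "\<dots> = (\<Prod>k\<in>?J. ennreal (1 / 2))"
    by (intro prod.cong refl) (simp add: emeasure_pmf_single pmf_bernoulli_half)
  also have "\<dots> = ennreal ((1 / 2) ^ cnt A n)" by (subst prod_ennreal) (auto simp: cnt_def)
  finally have "measure coin ?E = (1 / 2) ^ cnt A n" by (simp add: C.emeasure_eq_measure)
  moreover have "measure coin {b. psum A n b = s} \<le> measure coin ?E"
  proof (rule C.finite_measure_mono)
    show "{b. psum A n b = s} \<subseteq> ?E"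
    proof
      fix b assume "b \<in> {b. psum A n b = s}"
      then have "psum A n b = psum A n b0" by (simp add: b0)
      then have "b k = b0 k" if "k \<in> ?J" for k using psum_digits_unique[of A n b b0 k] that by auto
      then show "b \<in> ?E" by simp
    qed
    show "?E \<in> C.events"
    proof (rule sets.sets_Collect_finite_All)
      fix k
      have "(\<lambda>b. b k) \<in> coin \<rightarrow>\<^sub>M measure_pmf (bernoulli_pmf (1 / 2))"
        unfolding coin_def by (rule measurable_component_singleton) simp
      from measurable_sets[OF this, of "{b0 k}"]
      have "(\<lambda>b. b k) -` {b0 k} \<inter> space coin \<in> C.events" by simp
      moreover have "(\<lambda>b. b k) -` {b0 k} \<inter> space coin = {b \<in> space coin. b k \<in> {b0 k}}" by auto
      ultimately show "{b \<in> space coin. b k \<in> {b0 k}} \<in> C.events" by simp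
    qed simp
  qed
  ultimately show ?thesis by (simp add: power_divide)
qed

lemma psum_grid: "\<exists>m::int. psum A n b = of_int m / 2 ^ n"
proof (induction n)
  case 0
  then show ?case by (simp add: psum_def exI[of _ 0])
next
  case (Suc n)
  then obtain m :: int where "psum A n b = of_int m / 2 ^ n" by auto
  then have "psum A (Suc n) b = of_int (2 * m + (if n \<in> A \<and> b n then 1 else 0)) / 2 ^ Suc n"
    by (simp add: psum_def dig_def field_simps)
  then show ?case by blast
qed

text \<open>If \<open>xi A b\<close> is near \<open>c\<close>, its truncation is a multiple of
  \<open>1 / 2 ^ n\<close> in an interval of three grid steps. It is therefore among four values,
  each of probability at most \<open>1 / 2 ^ cnt A n\<close>.\<close>

lemma prob_xi_near_le: "measure coin {b. \<bar>xi A b - c\<bar> < 1 / 2 ^ n} \<le> 4 / 2 ^ cnt A n"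
proof -
  interpret C: prob_space coin by (rule prob_space_coin)
  define m0 where "m0 = \<lfloor>2 ^ n * c\<rfloor>"
  let ?G = "\<lambda>m::int. {b. psum A n b = of_int m / 2 ^ n}"
  have sub: "{b. \<bar>xi A b - c\<bar> < 1 / 2 ^ n} \<subseteq> (\<Union>m\<in>{m0 - 2<..m0 + 2}. ?G m)"
  proof
    fix b assume b: "b \<in> {b. \<bar>xi A b - c\<bar> < 1 / 2 ^ n}"
    obtain m :: int where m: "psum A n b = of_int m / 2 ^ n" using psum_grid by blast
    have "of_int m / 2 ^ n < c + 1 / 2 ^ n" "c - 2 / 2 ^ n < of_int m / 2 ^ n"
      using xi_psum[where A = A and n = n and b = b] b unfolding m by (auto simp: abs_less_iff)
    then have "of_int m < (c + 1 / 2 ^ n) * 2 ^ n" "(c - 2 / 2 ^ n) * 2 ^ n < of_int m"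
      by (simp_all add: pos_divide_less_eq pos_less_divide_eq)
    then have "of_int m < 2 ^ n * c + 1" "2 ^ n * c - 2 < of_int m"
    proof -
      have "(c + 1 / 2 ^ n) * 2 ^ n = 2 ^ n * c + 1" "(c - 2 / 2 ^ n) * 2 ^ n = 2 ^ n * c - 2"
        by (simp_all add: field_simps)
      then show "of_int m < 2 ^ n * c + 1" "2 ^ n * c - 2 < of_int m"
        using \<open>of_int m < (c + 1 / 2 ^ n) * 2 ^ n\<close> \<open>(c - 2 / 2 ^ n) * 2 ^ n < of_int m\<close> by linarith+
    qed
    then have "m0 - 2 < m" "m \<le> m0 + 2" unfolding m0_def by linarith+
    then show "b \<in> (\<Union>m\<in>{m0 - 2<..m0 + 2}. ?G m)" using m by auto
  qed
  have G: "?G m \<in> C.events" for m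
  proof -
    have "{b \<in> space coin. psum A n b = of_int m / 2 ^ n} \<in> C.events" by measurable
    then show ?thesis by simp
  qed
  have "measure coin {b. \<bar>xi A b - c\<bar> < 1 / 2 ^ n} \<le> measure coin (\<Union>m\<in>{m0 - 2<..m0 + 2}. ?G m)"
    using G by (intro C.finite_measure_mono[OF sub] sets.finite_UN) auto
  also have "\<dots> \<le> (\<Sum>m\<in>{m0 - 2<..m0 + 2}. measure coin (?G m))"
    using G by (intro C.finite_measure_subadditive_finite) auto
  also have "\<dots> \<le> (\<Sum>m\<in>{m0 - 2<..m0 + 2}. 1 / 2 ^ cnt A n)" by (intro sum_mono prob_psum_le)
  also have "\<dots> = 4 / 2 ^ cnt A n" by simp
  finally show ?thesis .
qed

text \<open>Within distance \<open>1 / 2 ^ n\<close> of \<open>c\<close> the integrand is at most 1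
  and the probability is small; outside, the integrand itself is small.\<close>

lemma exp_moment_xi:
  assumes s: "0 \<le> s"
  shows "(\<integral>\<^sup>+b. ennreal (exp (- s * \<bar>xi A b - c\<bar>)) \<partial>coin) \<le> ennreal (4 / 2 ^ cnt A n + exp (- s / 2 ^ n))"
proof -
  interpret C: prob_space coin by (rule prob_space_coin)
  let ?E = "{b. \<bar>xi A b - c\<bar> < 1 / 2 ^ n}"
  have E: "?E \<in> C.events"
  proof -
    have "{b \<in> space coin. \<bar>xi A b - c\<bar> < 1 / 2 ^ n} \<in> C.events" by measurable
    then show ?thesis by simp
  qed
  have "(\<integral>\<^sup>+b. ennreal (exp (- s * \<bar>xi A b - c\<bar>)) \<partial>coin) \<le> (\<integral>\<^sup>+b. indicator ?E b + ennreal (exp (- s / 2 ^ n)) \<partial>coin)"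
  proof (rule nn_integral_mono)
    fix b
    show "ennreal (exp (- s * \<bar>xi A b - c\<bar>)) \<le> indicator ?E b + ennreal (exp (- s / 2 ^ n))"
    proof (cases "b \<in> ?E")
      case True
      have "ennreal (exp (- s * \<bar>xi A b - c\<bar>)) \<le> ennreal 1" using s by (intro ennreal_leI) auto
      then show ?thesis using True by (simp add: add_increasing2)
    next
      case False
      then have "s * (1 / 2 ^ n) \<le> s * \<bar>xi A b - c\<bar>" using s by (intro mult_left_mono) auto
      then show ?thesis using False by (auto intro!: ennreal_leI)
    qed
  qed
  also have "\<dots> = emeasure coin ?E + ennreal (exp (- s / 2 ^ n))"
    using E C.emeasure_space_1 by (simp add: nn_integral_add)
  also have "\<dots> = ennreal (measure coin ?E + exp (- s / 2 ^ n))"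
    by (simp add: C.emeasure_eq_measure)
  also have "\<dots> \<le> ennreal (4 / 2 ^ cnt A n + exp (- s / 2 ^ n))"
    using prob_xi_near_le[of A c n] by (intro ennreal_leI) auto
  finally show ?thesis .
qed

section \<open>The invariant measures\<close>

definition coins :: "(int ^ 'n \<Rightarrow> nat \<Rightarrow> bool) measure" where
  "coins = Pi\<^sub>M UNIV (\<lambda>_. coin)"

text \<open>A density on the whole space rather than a restricted space, so that its measurable sets
  are the Borel sets and translated phases stay in its domain.\<close>

definition unif :: "(real ^ 'n) measure" where
  "unif = density lborel (indicator (cube 1))"

lemma prob_space_coins: "prob_space coins"
  unfolding coins_def by (intro prob_space_PiM prob_space_coin)

lemma space_coins [simp]: "space coins = UNIV"
  by (simp add: coins_def space_PiM PiE_UNIV_domain)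

lemma coins_component [measurable]: "(\<lambda>b. b j) \<in> coins \<rightarrow>\<^sub>M coin"
  unfolding coins_def by (rule measurable_component_singleton) simp

lemma sets_unif [measurable_cong, simp]: "sets unif = sets borel"
  by (simp add: unif_def)

lemma space_unif [simp]: "space unif = UNIV"
  by (simp add: unif_def)

lemma prob_space_unif: "prob_space (unif :: (real ^ 'n) measure)"
proof
  have "emeasure (unif :: (real ^ 'n) measure) UNIV = (\<integral>\<^sup>+u. indicator (cube 1) u \<partial>(lborel :: (real ^ 'n) measure))"
    by (simp add: unif_def emeasure_density)
  also have "\<dots> = 1" by (simp add: emeasure_cube)
  finally show "emeasure (unif :: (real ^ 'n) measure) (space unif) = 1" by simp
qed

lemma AE_unif_cube: "AE u in unif. u \<in> cube 1"
  unfolding unif_def by (subst AE_density) (auto simp: indicator_def)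

lemma distr_coins_shift:
  "distr coins coins (\<lambda>b j. b (j + m)) = (coins :: (int ^ 'n \<Rightarrow> nat \<Rightarrow> bool) measure)"
proof -
  have "inj_on (\<lambda>j. j + m) (UNIV :: (int ^ 'n) set)" by (auto simp: inj_on_def)
  from distr_PiM_reindex[OF prob_space_coin this, of UNIV]
  show ?thesis by (simp add: coins_def restrict_UNIV)
qed

lemma coins_shift_measurable [measurable]: "(\<lambda>b j. b (j + m)) \<in> coins \<rightarrow>\<^sub>M coins"
  unfolding coins_def
  by (rule measurable_PiM_single') (auto simp: PiE_UNIV_domain space_PiM intro!: measurable_component_singleton)

lemma nn_integral_coins_shift:
  assumes "g \<in> borel_measurable coins"
  shows "(\<integral>\<^sup>+b. g (\<lambda>j. b (j + m)) \<partial>coins) = (\<integral>\<^sup>+b. g b \<partial>coins)"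
proof -
  have "(\<integral>\<^sup>+b. g b \<partial>distr coins coins (\<lambda>b j. b (j + m))) = (\<integral>\<^sup>+b. g (\<lambda>j. b (j + m)) \<partial>coins)"
    using assms by (intro nn_integral_distr) auto
  then show ?thesis by (simp only: distr_coins_shift)
qed

lemma nn_integral_coins_prod:
  fixes J :: "(int ^ 'n) set"
  assumes J: "finite J" and f: "\<And>j. j \<in> J \<Longrightarrow> f j \<in> borel_measurable coin"
  shows "(\<integral>\<^sup>+b. (\<Prod>j\<in>J. f j (b j)) \<partial>coins) = (\<Prod>j\<in>J. \<integral>\<^sup>+b. f j b \<partial>coin)"
proof -
  interpret C: prob_space coin by (rule prob_space_coin)
  interpret P: product_prob_space "\<lambda>_::int ^ 'n. coin" UNIV by unfold_locales
  have "(\<integral>\<^sup>+b. (\<Prod>j\<in>J. f j (b j)) \<partial>coins) = (\<integral>\<^sup>+b. (\<Prod>j\<in>J. f j (restrict b J j)) \<partial>coins)"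
    by (intro nn_integral_cong prod.cong) auto
  also have "\<dots> = (\<integral>\<^sup>+b. (\<Prod>j\<in>J. f j (b j)) \<partial>distr coins (Pi\<^sub>M J (\<lambda>_. coin)) (\<lambda>b. restrict b J))"
  proof (rule nn_integral_distr[where f = "\<lambda>b. \<Prod>j\<in>J. f j (b j)" and T = "\<lambda>b. restrict b J", symmetric])
    show "(\<lambda>b. restrict b J) \<in> coins \<rightarrow>\<^sub>M Pi\<^sub>M J (\<lambda>_. coin)"
      unfolding coins_def by (rule measurable_restrict_subset) simp
    have "(\<lambda>b. \<Prod>j\<in>J. f j (b j)) \<in> borel_measurable (Pi\<^sub>M J (\<lambda>_. coin))"
      using f by (intro borel_measurable_prod_ennreal measurable_compose[OF measurable_component_singleton]) auto
    then show "(\<lambda>b. \<Prod>j\<in>J. f j (b j)) \<in> borel_measurable (distr coins (Pi\<^sub>M J (\<lambda>_. coin)) (\<lambda>b. restrict b J))"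
      by simp
  qed
  also have "\<dots> = (\<integral>\<^sup>+b. (\<Prod>j\<in>J. f j (b j)) \<partial>Pi\<^sub>M J (\<lambda>_. coin))"
    unfolding coins_def by (subst P.distr_PiM_restrict_finite[OF J]) auto
  also have "(\<integral>\<^sup>+b. (\<Prod>j\<in>J. f j (b j)) \<partial>Pi\<^sub>M J (\<lambda>_. coin)) = (\<Prod>j\<in>J. \<integral>\<^sup>+b. f j b \<partial>coin)"
    using f by (intro P.product_nn_integral_prod J) auto
  finally show ?thesis .
qed

lemma prod_mono_ennreal:
  fixes f g :: "'i \<Rightarrow> ennreal"
  assumes "\<And>j. j \<in> J \<Longrightarrow> f j \<le> g j"
  shows "prod f J \<le> prod g J"
  using assms by (induction J rule: infinite_finite_induct) (auto intro: mult_mono)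

lemma nn_integral_lborel_translate:
  fixes a :: "real ^ 'n"
  assumes "f \<in> borel_measurable borel"
  shows "(\<integral>\<^sup>+u. f (u + a) \<partial>lborel) = (\<integral>\<^sup>+u. f u \<partial>lborel)"
proof -
  have "(\<integral>\<^sup>+u. f u \<partial>distr lborel borel ((+) a)) = (\<integral>\<^sup>+u. f (a + u) \<partial>lborel)"
    using assms by (intro nn_integral_distr) auto
  then show ?thesis by (simp add: lborel_distr_plus add.commute)
qed

lemma sub_rvec_in_cube: "u - rvec m \<in> cube 1 \<longleftrightarrow> m = fvec u"
proof -
  have "(0 \<le> u $ i - real_of_int (m $ i) \<and> u $ i - real_of_int (m $ i) < 1) \<longleftrightarrow> m $ i = \<lfloor>u $ i\<rfloor>" for i
    using floor_eq_iff[of "u $ i" "m $ i"] by (auto simp: diff_less_eq add.commute)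
  then show ?thesis by (simp add: cube_def vec_eq_iff)
qed

text \<open>Tonelli over the unit cells: the unit cube and its translate are both fundamental domains.\<close>

lemma nn_integral_periodic:
  fixes h :: "real ^ 'n \<Rightarrow> ennreal"
  assumes h[measurable]: "h \<in> borel_measurable borel" and per: "\<And>u m. h (u + rvec m) = h u"
  shows "(\<integral>\<^sup>+u. h (u + v) \<partial>unif) = (\<integral>\<^sup>+u. h u \<partial>unif)"
proof -
  let ?C = "cube 1 :: (real ^ 'n) set"
  let ?I = "\<lambda>u. indicator ?C u :: ennreal"
  have cs: "(\<lambda>u. ?I (u + a)) \<in> borel_measurable borel" for a by measurable
  have c1: "(\<integral>\<^sup>+m. ?I (u - rvec m) \<partial>count_space UNIV) = 1" for u
  proof -
    have "?I (u - rvec m) = indicator {fvec u} m" for m by (auto simp: indicator_def sub_rvec_in_cube)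
    then show ?thesis by simp
  qed
  have c2: "(\<integral>\<^sup>+m. ?I (u + rvec m - v) \<partial>count_space UNIV) = 1" for u
  proof -
    have e: "u + rvec m - v = (u - v) - rvec (- m)" for m by (simp add: vec_eq_iff)
    have "- m = fvec (u - v) \<longleftrightarrow> m = - fvec (u - v)" for m by (metis minus_minus)
    then have "?I (u + rvec m - v) = indicator {- fvec (u - v)} m" for m
      unfolding e indicator_def sub_rvec_in_cube by simp
    then show ?thesis by simp
  qed
  have "(\<integral>\<^sup>+u. h (u + v) \<partial>unif) = (\<integral>\<^sup>+u. ?I (u + v - v) * h (u + v) \<partial>lborel)"
    unfolding unif_def by (subst nn_integral_density) auto
  also have "\<dots> = (\<integral>\<^sup>+u. ?I (u - v) * h u \<partial>lborel)"
    by (rule nn_integral_lborel_translate[where f = "\<lambda>u. ?I (u - v) * h u"]) measurable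
  \<comment> \<open>The constant 1 is inserted as the sum of the indicators of all integer
    translates of the unit cube. Translating each summand back moves the sum to the other indicator,
    while \<open>h\<close> is unchanged by periodicity.\<close>
  also have "\<dots> = (\<integral>\<^sup>+u. (\<integral>\<^sup>+m. ?I (u - v) * h u * ?I (u - rvec m) \<partial>count_space UNIV) \<partial>lborel)"
    by (intro nn_integral_cong) (simp add: nn_integral_cmult c1)
  also have "\<dots> = (\<integral>\<^sup>+m. (\<integral>\<^sup>+u. ?I (u - v) * h u * ?I (u - rvec m) \<partial>lborel) \<partial>count_space UNIV)"
    by (rule nn_integral_count_space_nn_integral) auto
  also have "\<dots> = (\<integral>\<^sup>+m. (\<integral>\<^sup>+u. ?I (u + rvec m - v) * h u * ?I u \<partial>lborel) \<partial>count_space UNIV)"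
  proof (rule nn_integral_cong)
    fix m :: "int ^ 'n"
    have "(\<integral>\<^sup>+u. ?I (u - v) * h u * ?I (u - rvec m) \<partial>lborel) = (\<integral>\<^sup>+u. ?I (u + rvec m - v) * h (u + rvec m) * ?I (u + rvec m - rvec m) \<partial>lborel)"
      by (rule nn_integral_lborel_translate[where f = "\<lambda>u. ?I (u - v) * h u * ?I (u - rvec m)", symmetric]) measurable
    then show "(\<integral>\<^sup>+u. ?I (u - v) * h u * ?I (u - rvec m) \<partial>lborel) = (\<integral>\<^sup>+u. ?I (u + rvec m - v) * h u * ?I u \<partial>lborel)"
      by (simp add: per)
  qed
  also have "\<dots> = (\<integral>\<^sup>+u. (\<integral>\<^sup>+m. ?I (u + rvec m - v) * h u * ?I u \<partial>count_space UNIV) \<partial>lborel)"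
    by (rule nn_integral_count_space_nn_integral[symmetric]) auto
  also have "\<dots> = (\<integral>\<^sup>+u. h u * ?I u \<partial>lborel)"
    by (intro nn_integral_cong) (simp add: nn_integral_multc c2)
  also have "\<dots> = (\<integral>\<^sup>+u. h u \<partial>unif)"
    unfolding unif_def by (subst nn_integral_density) (auto simp: mult.commute)
  finally show ?thesis .
qed

text \<open>Jensen's inequality, obtained from the tangent line of the exponential at the mean
  \<open>?m\<close>.\<close>

lemma (in prob_space) exp_expectation_le:
  fixes X :: "'a \<Rightarrow> real"
  assumes X: "X \<in> borel_measurable M" and b: "\<And>x. x \<in> space M \<Longrightarrow> \<bar>X x\<bar> \<le> K"
  shows "ennreal (exp (- s * expectation X)) \<le> (\<integral>\<^sup>+x. ennreal (exp (- s * X x)) \<partial>M)"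
proof -
  let ?m = "- s * expectation X"
  have iX: "integrable M X" using X b by (intro integrable_const_bound[of _ K]) auto
  have iE: "integrable M (\<lambda>x. exp (- s * X x))"
  proof (rule integrable_const_bound[of _ "exp (\<bar>s\<bar> * K)"])
    show "AE x in M. norm (exp (- s * X x)) \<le> exp (\<bar>s\<bar> * K)"
    proof (rule AE_I2)
      fix x assume "x \<in> space M"
      have "- s * X x \<le> \<bar>s\<bar> * \<bar>X x\<bar>" by (metis abs_ge_minus_self abs_mult mult_minus_left)
      also have "\<dots> \<le> \<bar>s\<bar> * K" using b[OF \<open>x \<in> space M\<close>] by (intro mult_left_mono) auto
      finally show "norm (exp (- s * X x)) \<le> exp (\<bar>s\<bar> * K)" by simp
    qed
  qed (use X in measurable)
  have "exp ?m = (\<integral>x. exp ?m * (1 + (- s * X x - ?m)) \<partial>M)"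
    using iX by (simp add: prob_space)
  also have "\<dots> \<le> (\<integral>x. exp (- s * X x) \<partial>M)"
  proof (rule integral_mono[OF _ iE])
    show "integrable M (\<lambda>x. exp ?m * (1 + (- s * X x - ?m)))" using iX by simp
    fix x
    have "exp ?m * (1 + (- s * X x - ?m)) \<le> exp ?m * exp (- s * X x - ?m)"
      by (intro mult_left_mono exp_ge_add_one_self) auto
    then show "exp ?m * (1 + (- s * X x - ?m)) \<le> exp (- s * X x)" by (simp flip: exp_add)
  qed
  finally have "ennreal (exp ?m) \<le> ennreal (\<integral>x. exp (- s * X x) \<partial>M)" by (rule ennreal_leI)
  also have "\<dots> = (\<integral>\<^sup>+x. ennreal (exp (- s * X x)) \<partial>M)"
    by (rule nn_integral_eq_integral[symmetric, OF iE]) auto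
  finally show ?thesis .
qed

context suspension
begin

section \<open>The random points and their law\<close>

definition pm :: "nat set \<Rightarrow> (int ^ 'n \<Rightarrow> nat \<Rightarrow> bool) \<times> (real ^ 'n) \<Rightarrow> 'a" where
  "pm A \<omega> = mk (\<lambda>j. xi A (fst \<omega> j)) (snd \<omega>)"

definition nu :: "nat set \<Rightarrow> 'a measure" where
  "nu A = distr (coins \<Otimes>\<^sub>M unif) (borel_met pts ddist) (pm A)"

lemma pm_in: "pm A \<omega> \<in> pts"
  unfolding pm_def by (rule mk_in_pts) (simp add: xi_bounds)

text \<open>The index of the coin sequence is itself random, but takes countably many
  values.\<close>

lemma xi_cell_measurable:
  assumes b[measurable]: "b \<in> N \<rightarrow>\<^sub>M coins" and g[measurable]: "g \<in> N \<rightarrow>\<^sub>M borel"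
  shows "(\<lambda>\<omega>. xi A (b \<omega> (fvec (g \<omega>) + j))) \<in> borel_measurable N"
proof (rule measurable_compose_countable'[where g = "\<lambda>\<omega>. fvec (g \<omega>)" and I = UNIV and f = "\<lambda>m \<omega>. xi A (b \<omega> (m + j))"])
  show "(\<lambda>\<omega>. xi A (b \<omega> (m + j))) \<in> borel_measurable N" for m
    using measurable_compose[OF measurable_compose[OF b coins_component] xi_measurable] .
qed auto

text \<open>Tested on distances to a fixed point: the function part is an integral over
  \<open>wmeas\<close> of a jointly measurable integrand, and the torus part is continuous in the
  phase.\<close>

lemma pm_measurable [measurable]: "pm A \<in> coins \<Otimes>\<^sub>M borel \<rightarrow>\<^sub>M borel_met pts ddist"
proof (rule measurable_into_borel_met[OF tb])
  interpret W: prob_space "wmeas :: (real ^ 'n) measure" by (rule prob_space_wmeas)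
  show "pm A \<in> space (coins \<Otimes>\<^sub>M borel) \<rightarrow> pts" using pm_in by auto
  fix z assume z: "z \<in> pts"
  have 1: "(\<lambda>p. xi A (fst (fst p) (fvec (snd p + snd (fst p)) + 0))) \<in> borel_measurable ((coins \<Otimes>\<^sub>M borel) \<Otimes>\<^sub>M (wmeas :: (real ^ 'n) measure))"
    by (rule xi_cell_measurable) measurable
  have 2: "(\<lambda>p. val z (snd p)) \<in> borel_measurable ((coins \<Otimes>\<^sub>M borel) \<Otimes>\<^sub>M (wmeas :: (real ^ 'n) measure))"
    by (rule measurable_compose[OF _ val_measurable]) measurable
  have 3: "(\<lambda>(\<omega>, u). \<bar>xi A (fst \<omega> (fvec (u + snd \<omega>))) - val z u\<bar>) \<in> borel_measurable ((coins \<Otimes>\<^sub>M borel) \<Otimes>\<^sub>M (wmeas :: (real ^ 'n) measure))"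
    using 1 2 unfolding case_prod_unfold add_0_right by (intro borel_measurable_abs borel_measurable_diff)
  have 4: "(\<lambda>\<omega>. \<integral>u. \<bar>xi A (fst \<omega> (fvec (u + snd \<omega>))) - val z u\<bar> \<partial>wmeas) \<in> borel_measurable (coins \<Otimes>\<^sub>M borel)"
    by (rule W.borel_measurable_lebesgue_integral[OF 3])
  have 5: "(\<lambda>\<omega>. \<Sum>i\<in>UNIV. norm (cis (2 * pi * snd \<omega> $ i) - cph z i)) \<in> borel_measurable (coins \<Otimes>\<^sub>M borel)"
  proof (intro borel_measurable_sum)
    fix i :: 'n
    have "continuous_on UNIV (\<lambda>u :: real ^ 'n. norm (cis (2 * pi * u $ i) - cph z i))"
      by (intro continuous_intros)
    then have "(\<lambda>u :: real ^ 'n. norm (cis (2 * pi * u $ i) - cph z i)) \<in> borel_measurable borel"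
      by (rule borel_measurable_continuous_onI)
    then show "(\<lambda>\<omega>. norm (cis (2 * pi * snd \<omega> $ i) - cph z i)) \<in> borel_measurable (coins \<Otimes>\<^sub>M borel)"
      by (rule measurable_compose[OF measurable_snd])
  qed
  show "(\<lambda>\<omega>. ddist (pm A \<omega>) z) \<in> borel_measurable (coins \<Otimes>\<^sub>M borel)"
    unfolding ddist_def pm_def val_mk cph_mk by (rule borel_measurable_add[OF 4 5])
qed

lemma pm_measurable': "pm A \<in> coins \<Otimes>\<^sub>M unif \<rightarrow>\<^sub>M borel_met pts ddist"
  using pm_measurable[of A] by (simp add: measurable_cong_sets[OF sets_pair_measure_cong[OF refl sets_unif] refl])

lemma prob_space_nu: "prob_space (nu A)"
proof -
  interpret C: prob_space coins by (rule prob_space_coins)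
  interpret U: prob_space unif by (rule prob_space_unif)
  interpret CU: pair_prob_space coins unif ..
  show ?thesis unfolding nu_def by (rule CU.prob_space_distr[OF pm_measurable'])
qed

lemma sets_nu [simp]: "sets (nu A) = sets (borel_met pts ddist)"
  by (simp add: nu_def)

lemma tr_pm: "tr v (pm A (b, \<phi>)) = pm A (b, \<phi> + v)"
  by (simp add: pm_def tr_mk)

lemma tr_pm': "tr v (pm A \<omega>) = pm A (fst \<omega>, snd \<omega> + v)"
  using tr_pm[of v A "fst \<omega>" "snd \<omega>"] by simp

lemma nn_integral_nu:
  assumes g: "g \<in> borel_measurable (borel_met pts ddist)"
  shows "(\<integral>\<^sup>+p. g p \<partial>nu A) = (\<integral>\<^sup>+\<phi>. \<integral>\<^sup>+b. g (pm A (b, \<phi>)) \<partial>coins \<partial>unif)"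
    and "(\<lambda>\<phi>. \<integral>\<^sup>+b. g (pm A (b, \<phi>)) \<partial>coins) \<in> borel_measurable borel"
    and "(\<lambda>b. g (pm A (b, \<phi>))) \<in> borel_measurable coins"
proof -
  interpret C: prob_space "coins :: (int ^ 'n \<Rightarrow> nat \<Rightarrow> bool) measure" by (rule prob_space_coins)
  interpret U: prob_space "unif :: (real ^ 'n) measure" by (rule prob_space_unif)
  interpret CU: pair_sigma_finite "coins :: (int ^ 'n \<Rightarrow> nat \<Rightarrow> bool) measure" "unif :: (real ^ 'n) measure" ..
  have gm: "(\<lambda>\<omega>. g (pm A \<omega>)) \<in> borel_measurable (coins \<Otimes>\<^sub>M borel)"
    by (rule measurable_compose[OF pm_measurable g])
  have gm': "(\<lambda>\<omega>. g (pm A \<omega>)) \<in> borel_measurable (coins \<Otimes>\<^sub>M unif)"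
    by (rule measurable_compose[OF pm_measurable' g])
  have "(\<integral>\<^sup>+p. g p \<partial>nu A) = (\<integral>\<^sup>+\<omega>. g (pm A \<omega>) \<partial>(coins \<Otimes>\<^sub>M unif))"
    unfolding nu_def using g by (intro nn_integral_distr pm_measurable') auto
  also have "\<dots> = (\<integral>\<^sup>+\<phi>. \<integral>\<^sup>+b. g (pm A (b, \<phi>)) \<partial>coins \<partial>unif)"
    by (rule CU.nn_integral_snd[symmetric, OF gm'])
  finally show "(\<integral>\<^sup>+p. g p \<partial>nu A) = (\<integral>\<^sup>+\<phi>. \<integral>\<^sup>+b. g (pm A (b, \<phi>)) \<partial>coins \<partial>unif)" .
  have "(\<lambda>(\<phi>, b). g (pm A (b, \<phi>))) \<in> borel_measurable (borel \<Otimes>\<^sub>M coins)"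
    using measurable_compose[OF measurable_pair_swap' gm] by (simp add: case_prod_unfold)
  then show "(\<lambda>\<phi>. \<integral>\<^sup>+b. g (pm A (b, \<phi>)) \<partial>coins) \<in> borel_measurable borel"
    by (rule C.borel_measurable_nn_integral)
  show "(\<lambda>b. g (pm A (b, \<phi>))) \<in> borel_measurable coins"
    by (rule measurable_compose[OF _ gm]) simp
qed

lemma pm_periodic: "pm A (b, \<phi> + rvec m) = pm A (\<lambda>j. b (j + m), \<phi>)"
  using mk_shift[of "\<lambda>j. xi A (b j)" m \<phi>] by (simp add: pm_def)

text \<open>After averaging over the coins, the dependence on the phase is periodic, because an
  integer move of the phase merely permutes independent, identically distributed cells. The average
  of a periodic function over the unit cube does not change under a real translation.\<close>

lemma nu_invariant: "nu A \<in> invariant_measures pts ddist tr"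
  unfolding invariant_measures_def
proof (intro CollectI conjI allI)
  show "prob_space (nu A)" by (rule prob_space_nu)
  show "sets (nu A) = sets (borel_met pts ddist)" by (rule sets_nu)
  fix v :: "real ^ 'n"
  have T: "tr v \<in> nu A \<rightarrow>\<^sub>M borel_met pts ddist"
    using T_measurable[of v] by (simp cong: measurable_cong_sets)
  show "distr (nu A) (borel_met pts ddist) (tr v) = nu A"
  proof (rule measure_eqI)
    fix E assume "E \<in> sets (distr (nu A) (borel_met pts ddist) (tr v))"
    then have E: "E \<in> sets (borel_met pts ddist)" by simp
    define g :: "'a \<Rightarrow> ennreal" where "g = indicator E"
    have g: "g \<in> borel_measurable (borel_met pts ddist)" using E by (simp add: g_def)
    have g': "(\<lambda>p. g (tr v p)) \<in> borel_measurable (borel_met pts ddist)"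
      by (rule measurable_compose[OF T_measurable g])
    define h where "h \<phi> = (\<integral>\<^sup>+b. g (pm A (b, \<phi>)) \<partial>coins)" for \<phi>
    have hm: "h \<in> borel_measurable borel" unfolding h_def[abs_def] by (rule nn_integral_nu(2)[OF g])
    have hp: "h (\<phi> + rvec m) = h \<phi>" for \<phi> m
      unfolding h_def pm_periodic
      by (rule nn_integral_coins_shift[where g = "\<lambda>b. g (pm A (b, \<phi>))"]) (rule nn_integral_nu(3)[OF g])
    have "emeasure (distr (nu A) (borel_met pts ddist) (tr v)) E = (\<integral>\<^sup>+p. g p \<partial>distr (nu A) (borel_met pts ddist) (tr v))"
      using E by (simp add: g_def)
    also have "\<dots> = (\<integral>\<^sup>+p. g (tr v p) \<partial>nu A)"
      using g by (intro nn_integral_distr T) auto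
    also have "\<dots> = (\<integral>\<^sup>+\<phi>. h (\<phi> + v) \<partial>unif)"
      unfolding nn_integral_nu(1)[OF g'] h_def by (simp add: tr_pm)
    also have "\<dots> = (\<integral>\<^sup>+\<phi>. h \<phi> \<partial>unif)" by (rule nn_integral_periodic[OF hm hp])
    also have "\<dots> = (\<integral>\<^sup>+p. g p \<partial>nu A)" unfolding nn_integral_nu(1)[OF g] h_def ..
    also have "\<dots> = emeasure (nu A) E" using E by (simp add: g_def)
    finally show "emeasure (distr (nu A) (borel_met pts ddist) (tr v)) E = emeasure (nu A) E" .
  qed simp
qed

text \<open>Phases lie in the unit cube almost surely, and then the random point is over
  \<open>range (xi A)\<close>. The statement concerns open supersets, which are measurable, as the
  mixture bound requires.\<close>

lemma nu_full:
  assumes U: "openin mtopology U" and sub: "pts_over (range (xi A)) \<subseteq> U"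
  shows "measure (nu A) U = 1"
proof -
  interpret N: prob_space "nu A" by (rule prob_space_nu)
  interpret C: prob_space "coins :: (int ^ 'n \<Rightarrow> nat \<Rightarrow> bool) measure" by (rule prob_space_coins)
  interpret Un: prob_space "unif :: (real ^ 'n) measure" by (rule prob_space_unif)
  have Us: "U \<in> sets (borel_met pts ddist)" by (rule openin_borel_met[OF U])
  have "emeasure (nu A) U = (\<integral>\<^sup>+p. indicator U p \<partial>nu A)" using Us by simp
  also have "\<dots> = (\<integral>\<^sup>+\<phi>. \<integral>\<^sup>+b. indicator U (pm A (b, \<phi>)) \<partial>coins \<partial>unif)"
    using Us by (intro nn_integral_nu(1)) auto
  also have "\<dots> = (\<integral>\<^sup>+\<phi>. 1 \<partial>(unif :: (real ^ 'n) measure))"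
  proof (rule nn_integral_cong_AE)
    show "AE \<phi> in unif. (\<integral>\<^sup>+b. indicator U (pm A (b, \<phi>)) \<partial>coins) = 1"
      using AE_unif_cube
    proof eventually_elim
      case (elim \<phi>)
      have "pm A (b, \<phi>) \<in> U" for b
      proof -
        have "pm A (b, \<phi>) \<in> pts_over (range (xi A))"
          using elim unfolding pts_over_def pm_def cube_def by auto
        then show ?thesis using sub by auto
      qed
      then show ?case using C.emeasure_space_1 by simp
    qed
  qed
  also have "\<dots> = 1" using Un.emeasure_space_1 by simp
  finally show ?thesis by (simp add: N.emeasure_eq_measure)
qed

section \<open>The exponential moment of the distortion\<close>

text \<open>Jensen's inequality over \<open>wmeas\<close> moves the exponential inside the weighted
  integral. For a fixed argument \<open>v\<close> and a fixed phase, the \<open>L^d\<close> integer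
  translates read distinct cells, so the expectation over the coins is a product, each factor being
  the moment of a single random number about some constant.\<close>

lemma exp_moment_site:
  fixes y :: "int ^ 'n \<Rightarrow> 'a" and \<theta> :: "real ^ 'n"
  assumes s: "0 \<le> s" and q: "\<And>c. (\<integral>\<^sup>+b. ennreal (exp (- s * \<bar>xi A b - c\<bar>)) \<partial>coin) \<le> q"
    and y: "\<And>j. j \<in> ibox L \<Longrightarrow> y j \<in> pts"
  shows "(\<integral>\<^sup>+\<omega>. ennreal (exp (- s * (\<Sum>j\<in>ibox L. ddist (tr (\<theta> + rvec j) (pm A \<omega>)) (y j)))) \<partial>(coins \<Otimes>\<^sub>M unif)) \<le> q ^ (L ^ CARD('n))"
proof -
  interpret W: prob_space "wmeas :: (real ^ 'n) measure" by (rule prob_space_wmeas)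
  interpret C: prob_space "coins :: (int ^ 'n \<Rightarrow> nat \<Rightarrow> bool) measure" by (rule prob_space_coins)
  interpret U: prob_space "unif :: (real ^ 'n) measure" by (rule prob_space_unif)
  interpret CU: pair_prob_space "coins :: (int ^ 'n \<Rightarrow> nat \<Rightarrow> bool) measure" "unif :: (real ^ 'n) measure" ..
  interpret CW: pair_sigma_finite "coins \<Otimes>\<^sub>M unif :: ((int ^ 'n \<Rightarrow> nat \<Rightarrow> bool) \<times> (real ^ 'n)) measure" "wmeas :: (real ^ 'n) measure" ..
  \<comment> \<open>The function part of the distances, evaluated at a single argument
    \<open>v\<close>.\<close>
  define Z where "Z \<omega> v = (\<Sum>j\<in>ibox L. \<bar>xi A (fst \<omega> (fvec (v + (snd \<omega> + \<theta>)) + j)) - val (y j) v\<bar>)" for \<omega> :: "(int ^ 'n \<Rightarrow> nat \<Rightarrow> bool) \<times> (real ^ 'n)" and v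
  have pj: "tr (\<theta> + rvec j) (pm A \<omega>) = mk (\<lambda>j. xi A (fst \<omega> j)) (snd \<omega> + \<theta> + rvec j)" for \<omega> j
    by (simp add: pm_def tr_mk add.assoc)
  have v1: "val (tr (\<theta> + rvec j) (pm A \<omega>)) v = xi A (fst \<omega> (fvec (v + (snd \<omega> + \<theta>)) + j))" for j \<omega> v
  proof -
    have "v + (snd \<omega> + \<theta> + rvec j) = (v + (snd \<omega> + \<theta>)) + rvec j" by (simp add: add_ac)
    then show ?thesis unfolding pj val_mk by (simp only: fvec_add_rvec)
  qed
  have ZI: "(\<integral>v. Z \<omega> v \<partial>wmeas) \<le> (\<Sum>j\<in>ibox L. ddist (tr (\<theta> + rvec j) (pm A \<omega>)) (y j))" for \<omega>
  proof -
    have i: "integrable wmeas (\<lambda>v. \<bar>val (tr (\<theta> + rvec j) (pm A \<omega>)) v - val (y j) v\<bar>)" if "j \<in> ibox L" for j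
      by (intro val_integrable tr_in pm_in y that)
    have "(\<integral>v. Z \<omega> v \<partial>wmeas) = (\<Sum>j\<in>ibox L. \<integral>v. \<bar>val (tr (\<theta> + rvec j) (pm A \<omega>)) v - val (y j) v\<bar> \<partial>wmeas)"
      using i unfolding Z_def v1[symmetric] by (rule Bochner_Integration.integral_sum)
    \<comment> \<open>The torus term of the metric is dropped.\<close>
    also have "\<dots> \<le> (\<Sum>j\<in>ibox L. ddist (tr (\<theta> + rvec j) (pm A \<omega>)) (y j))"
      unfolding ddist_def by (intro sum_mono) (simp add: sum_nonneg)
    finally show ?thesis .
  qed
  have Zm: "(\<lambda>p. Z (fst p) (snd p)) \<in> borel_measurable ((coins \<Otimes>\<^sub>M unif) \<Otimes>\<^sub>M wmeas)"
    unfolding Z_def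
  proof (intro borel_measurable_sum borel_measurable_abs borel_measurable_diff)
    fix j :: "int ^ 'n"
    show "(\<lambda>p. xi A (fst (fst p) (fvec (snd p + (snd (fst p) + \<theta>)) + j))) \<in> borel_measurable ((coins \<Otimes>\<^sub>M unif) \<Otimes>\<^sub>M wmeas)"
      by (rule xi_cell_measurable) measurable
    show "(\<lambda>p. val (y j) (snd p)) \<in> borel_measurable ((coins \<Otimes>\<^sub>M unif) \<Otimes>\<^sub>M wmeas)"
      by (rule measurable_compose[OF _ val_measurable]) measurable
  qed
  have Zb: "\<bar>Z \<omega> v\<bar> \<le> real (card (ibox L :: (int ^ 'n) set))" for \<omega> v
  proof -
    have "\<bar>Z \<omega> v\<bar> \<le> (\<Sum>j\<in>(ibox L :: (int ^ 'n) set). 1)"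
      unfolding Z_def v1[symmetric]
      by (rule order_trans[OF sum_abs]) (intro sum_mono, simp, intro val_diff_le tr_in pm_in y)
    then show ?thesis by simp
  qed
  have Zm1: "Z \<omega> \<in> borel_measurable wmeas" for \<omega>
  proof -
    have "(\<lambda>v. (\<omega>, v)) \<in> wmeas \<rightarrow>\<^sub>M (coins \<Otimes>\<^sub>M unif) \<Otimes>\<^sub>M wmeas"
      by (rule measurable_Pair1') (simp add: space_pair_measure)
    from measurable_compose[OF this Zm] show ?thesis by simp
  qed
  have Zexp: "(\<lambda>p. ennreal (exp (- s * Z (fst p) (snd p)))) \<in> borel_measurable ((coins \<Otimes>\<^sub>M unif) \<Otimes>\<^sub>M wmeas)"
    using Zm by measurable
  have "(\<integral>\<^sup>+\<omega>. ennreal (exp (- s * (\<Sum>j\<in>ibox L. ddist (tr (\<theta> + rvec j) (pm A \<omega>)) (y j)))) \<partial>(coins \<Otimes>\<^sub>M unif))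
      \<le> (\<integral>\<^sup>+\<omega>. (\<integral>\<^sup>+v. ennreal (exp (- s * Z \<omega> v)) \<partial>wmeas) \<partial>(coins \<Otimes>\<^sub>M unif))"
  proof (rule nn_integral_mono)
    fix \<omega> :: "(int ^ 'n \<Rightarrow> nat \<Rightarrow> bool) \<times> (real ^ 'n)"
    have "s * (\<integral>v. Z \<omega> v \<partial>wmeas) \<le> s * (\<Sum>j\<in>ibox L. ddist (tr (\<theta> + rvec j) (pm A \<omega>)) (y j))"
      using s ZI by (intro mult_left_mono)
    then have "ennreal (exp (- s * (\<Sum>j\<in>ibox L. ddist (tr (\<theta> + rvec j) (pm A \<omega>)) (y j)))) \<le> ennreal (exp (- s * (\<integral>v. Z \<omega> v \<partial>wmeas)))"
      by (intro ennreal_leI) simp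
    also have "\<dots> \<le> (\<integral>\<^sup>+v. ennreal (exp (- s * Z \<omega> v)) \<partial>wmeas)"
      by (rule W.exp_expectation_le[OF Zm1 Zb])
    finally show "ennreal (exp (- s * (\<Sum>j\<in>ibox L. ddist (tr (\<theta> + rvec j) (pm A \<omega>)) (y j)))) \<le> (\<integral>\<^sup>+v. ennreal (exp (- s * Z \<omega> v)) \<partial>wmeas)" .
  qed
  also have "\<dots> = (\<integral>\<^sup>+v. (\<integral>\<^sup>+\<omega>. ennreal (exp (- s * Z \<omega> v)) \<partial>(coins \<Otimes>\<^sub>M unif)) \<partial>wmeas)"
    by (rule CW.Fubini'[symmetric]) (use Zexp in \<open>simp add: case_prod_unfold\<close>)
  also have "\<dots> \<le> (\<integral>\<^sup>+v. q ^ (L ^ CARD('n)) \<partial>(wmeas :: (real ^ 'n) measure))"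
  proof (rule nn_integral_mono)
    fix v :: "real ^ 'n"
    have m: "(\<lambda>\<omega>. ennreal (exp (- s * Z \<omega> v))) \<in> borel_measurable (coins \<Otimes>\<^sub>M unif)"
    proof -
      have "(\<lambda>\<omega>. (\<omega>, v)) \<in> coins \<Otimes>\<^sub>M unif \<rightarrow>\<^sub>M (coins \<Otimes>\<^sub>M unif) \<Otimes>\<^sub>M wmeas"
        by (rule measurable_Pair2') simp
      from measurable_compose[OF this Zexp] show ?thesis by simp
    qed
    have "(\<integral>\<^sup>+\<omega>. ennreal (exp (- s * Z \<omega> v)) \<partial>(coins \<Otimes>\<^sub>M unif)) = (\<integral>\<^sup>+\<phi>. \<integral>\<^sup>+b. ennreal (exp (- s * Z (b, \<phi>) v)) \<partial>coins \<partial>unif)"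
      by (rule CU.nn_integral_snd[symmetric, OF m])
    also have "\<dots> \<le> (\<integral>\<^sup>+\<phi>. q ^ (L ^ CARD('n)) \<partial>(unif :: (real ^ 'n) measure))"
    proof (rule nn_integral_mono)
      fix \<phi> :: "real ^ 'n"
      define m where "m = fvec (v + (\<phi> + \<theta>))"
      \<comment> \<open>With \<open>v\<close> and the phase fixed, the reproduction enters only
        through the number \<open>val (y j) v\<close>, so the moment bound, being uniform in
        \<open>c\<close>, applies to any reproduction.\<close>
      define f where "f j b = ennreal (exp (- s * \<bar>xi A b - val (y j) v\<bar>))" for j b
      have fm: "f j \<in> borel_measurable coin" for j unfolding f_def[abs_def] by measurable
      have Zf: "ennreal (exp (- s * Z (b, \<phi>) v)) = (\<Prod>j\<in>ibox L. f j (b (j + m)))" for b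
        by (simp add: Z_def f_def m_def sum_distrib_left sum_negf[symmetric] exp_sum prod_ennreal add.commute)
      have "(\<integral>\<^sup>+b. ennreal (exp (- s * Z (b, \<phi>) v)) \<partial>coins) = (\<integral>\<^sup>+b. (\<Prod>j\<in>ibox L. f j (b (j + m))) \<partial>coins)"
        by (simp only: Zf)
      also have "\<dots> = (\<integral>\<^sup>+b. (\<Prod>j\<in>ibox L. f j (b j)) \<partial>coins)"
        using fm by (intro nn_integral_coins_shift[where g = "\<lambda>b. \<Prod>j\<in>ibox L. f j (b j)"] borel_measurable_prod_ennreal measurable_compose[OF coins_component]) auto
      also have "\<dots> = (\<Prod>j\<in>ibox L. \<integral>\<^sup>+b. f j b \<partial>coin)"
        by (rule nn_integral_coins_prod[OF finite_ibox fm])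
      also have "\<dots> \<le> (\<Prod>j\<in>(ibox L :: (int ^ 'n) set). q)"
        unfolding f_def by (intro prod_mono_ennreal q)
      finally show "(\<integral>\<^sup>+b. ennreal (exp (- s * Z (b, \<phi>) v)) \<partial>coins) \<le> q ^ (L ^ CARD('n))" by simp
    qed
    also have "\<dots> = q ^ (L ^ CARD('n))" using U.emeasure_space_1 by simp
    finally show "(\<integral>\<^sup>+\<omega>. ennreal (exp (- s * Z \<omega> v)) \<partial>(coins \<Otimes>\<^sub>M unif)) \<le> q ^ (L ^ CARD('n))" .
  qed
  also have "\<dots> = q ^ (L ^ CARD('n))" using W.emeasure_space_1 by simp
  finally show ?thesis .
qed

text \<open>The distortion is the mean, over an offset \<open>\<theta>\<close> in the unit cube, of
  the sums treated in \<open>exp_moment_site\<close>. A second use of Jensen's inequality, now over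
  \<open>unif\<close>, and Tonelli's theorem reduce the claim to a fixed offset.\<close>

lemma exp_moment_dst:
  assumes s: "0 \<le> s" and q0: "0 \<le> q" and q: "\<And>c. (\<integral>\<^sup>+b. ennreal (exp (- s * \<bar>xi A b - c\<bar>)) \<partial>coin) \<le> ennreal q"
    and L: "0 < L" and F: "F \<in> L1_space pts ddist (real L)"
  shows "(\<integral>p. exp (- s * dst (real L) p F) \<partial>nu A) \<le> q ^ (L ^ CARD('n))"
proof (rule integral_real_bounded)
  interpret C: prob_space "coins :: (int ^ 'n \<Rightarrow> nat \<Rightarrow> bool) measure" by (rule prob_space_coins)
  interpret U: prob_space "unif :: (real ^ 'n) measure" by (rule prob_space_unif)
  interpret CU: pair_prob_space "coins :: (int ^ 'n \<Rightarrow> nat \<Rightarrow> bool) measure" "unif :: (real ^ 'n) measure" ..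
  interpret CUU: pair_sigma_finite "coins \<Otimes>\<^sub>M unif :: ((int ^ 'n \<Rightarrow> nat \<Rightarrow> bool) \<times> (real ^ 'n)) measure" "unif :: (real ^ 'n) measure" ..
  show "0 \<le> q ^ (L ^ CARD('n))" using q0 by simp
  let ?f = "L1_rep F"
  have f: "?f \<in> L1_maps pts ddist (real L)" by (rule rep_L1[OF F])
  obtain z0 where z0: "z0 \<in> pts" using M_ne by auto
  \<comment> \<open>The representative is unspecified off the cube. There it is replaced by a
    constant, which makes it a Borel map on the whole space.\<close>
  define f' where "f' u = (if u \<in> cube (real L) then ?f u else z0)" for u
  have f'in: "f' u \<in> pts" for u using L1_maps_in[OF f] z0 by (simp add: f'_def)
  have f'm[measurable]: "f' \<in> borel \<rightarrow>\<^sub>M borel_met pts ddist"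
  proof (rule measurable_into_borel_met[OF tb])
    show "f' \<in> space borel \<rightarrow> pts" using f'in by auto
    fix z assume z: "z \<in> pts"
    have "(\<lambda>t. ddist (?f t) z) \<in> borel_measurable (restrict_space lborel (cube (real L)))"
      using measurable_compose[OF f[unfolded L1_maps_def] dist_borel_measurable[OF z]] .
    then have m: "(\<lambda>t. indicator (cube (real L)) t * ddist (?f t) z) \<in> borel_measurable (borel :: (real ^ 'n) measure)"
      by (subst (asm) borel_measurable_restrict_space_iff) auto
    have "(\<lambda>t. indicator (cube (real L)) t * ddist (?f t) z + (1 - indicator (cube (real L)) t) * ddist z0 z) \<in> borel_measurable (borel :: (real ^ 'n) measure)"
      using m by measurable
    moreover have "(\<lambda>t. indicator (cube (real L)) t * ddist (?f t) z + (1 - indicator (cube (real L)) t) * ddist z0 z) = (\<lambda>t. ddist (f' t) z)"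
      by (auto simp: f'_def indicator_def)
    ultimately show "(\<lambda>t. ddist (f' t) z) \<in> borel_measurable borel" by simp
  qed
  define X where "X \<omega> \<theta> = (\<Sum>j\<in>ibox L. ddist (tr (\<theta> + rvec j) (pm A \<omega>)) (f' (\<theta> + rvec j)))" for \<omega> :: "(int ^ 'n \<Rightarrow> nat \<Rightarrow> bool) \<times> (real ^ 'n)" and \<theta>
  have Xm: "(\<lambda>p. X (fst p) (snd p)) \<in> borel_measurable ((coins \<Otimes>\<^sub>M unif) \<Otimes>\<^sub>M unif)"
    unfolding X_def
  proof (intro borel_measurable_sum measurable_dist[OF tb])
    fix j :: "int ^ 'n"
    have "(\<lambda>p. (fst (fst p), snd (fst p) + (snd p + rvec j))) \<in> (coins \<Otimes>\<^sub>M unif) \<Otimes>\<^sub>M unif \<rightarrow>\<^sub>M coins \<Otimes>\<^sub>M (borel :: (real ^ 'n) measure)"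
      by measurable
    from measurable_compose[OF this pm_measurable]
    show "(\<lambda>p. tr (snd p + rvec j) (pm A (fst p))) \<in> (coins \<Otimes>\<^sub>M unif) \<Otimes>\<^sub>M unif \<rightarrow>\<^sub>M borel_met pts ddist"
      by (simp only: tr_pm')
    have "(\<lambda>p. snd p + rvec j) \<in> (coins \<Otimes>\<^sub>M unif) \<Otimes>\<^sub>M unif \<rightarrow>\<^sub>M (borel :: (real ^ 'n) measure)" by measurable
    from measurable_compose[OF this f'm]
    show "(\<lambda>p. f' (snd p + rvec j)) \<in> (coins \<Otimes>\<^sub>M unif) \<Otimes>\<^sub>M unif \<rightarrow>\<^sub>M borel_met pts ddist" .
  qed
  have Xb: "\<bar>X \<omega> \<theta>\<bar> \<le> (\<Sum>j\<in>(ibox L :: (int ^ 'n) set). bd)" for \<omega> \<theta>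
    unfolding X_def by (rule order_trans[OF sum_abs]) (intro sum_mono, simp add: bd(2) tr_in pm_in f'in ddist_nonneg)
  have Xm1: "X \<omega> \<in> borel_measurable unif" for \<omega>
  proof -
    have "(\<lambda>v. (\<omega>, v)) \<in> unif \<rightarrow>\<^sub>M (coins \<Otimes>\<^sub>M unif) \<Otimes>\<^sub>M unif"
      by (rule measurable_Pair1') (simp add: space_pair_measure)
    from measurable_compose[OF this Xm] show ?thesis by simp
  qed
  have Xexp: "(\<lambda>p. ennreal (exp (- s * X (fst p) (snd p)))) \<in> borel_measurable ((coins \<Otimes>\<^sub>M unif) \<Otimes>\<^sub>M unif)"
    using Xm by measurable
  \<comment> \<open>The cube of side \<open>L\<close> is cut into unit cubes, and integration over
    the position inside a unit cube becomes an expectation under \<open>unif\<close>.\<close>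
  have dX: "dst (real L) (pm A \<omega>) F = (\<integral>\<theta>. X \<omega> \<theta> \<partial>unif)" for \<omega>
  proof -
    let ?g = "\<lambda>u. ddist (tr u (pm A \<omega>)) (?f u)"
    have gi: "set_integrable lborel (cube (real L * 1)) ?g"
      using l1_integrable[OF orb_L1[OF pm_in] f] by simp
    note dec = set_integral_cube_decomp[OF zero_less_one gi, simplified]
    have sub: "\<theta> + rvec j \<in> cube (real L)" if "\<theta> \<in> cube 1" "j \<in> ibox L" for \<theta> :: "real ^ 'n" and j
      using cube_decomp(1)[of 1 "\<theta> + rvec j" L] that
      by (simp, intro bexI[of _ j]) simp_all
    have "dst (real L) (pm A \<omega>) F = (\<Sum>j\<in>ibox L. LINT \<theta>:cube 1|lborel. ?g (\<theta> + rvec j))"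
      unfolding dst_def l1d_def using dec(1) by simp
    also have "\<dots> = (\<Sum>j\<in>ibox L. \<integral>\<theta>. indicator (cube 1) \<theta> *\<^sub>R ?g (\<theta> + rvec j) \<partial>lborel)"
      by (simp add: set_lebesgue_integral_def)
    also have "\<dots> = (\<integral>\<theta>. (\<Sum>j\<in>ibox L. indicator (cube 1) \<theta> *\<^sub>R ?g (\<theta> + rvec j)) \<partial>lborel)"
      using dec(2) unfolding set_integrable_def by (intro Bochner_Integration.integral_sum[symmetric]) auto
    also have "\<dots> = (\<integral>\<theta>. indicator (cube 1) \<theta> *\<^sub>R X \<omega> \<theta> \<partial>lborel)"
    proof (intro Bochner_Integration.integral_cong refl)
      fix \<theta> :: "real ^ 'n"
      show "(\<Sum>j\<in>ibox L. indicator (cube 1) \<theta> *\<^sub>R ?g (\<theta> + rvec j)) = indicator (cube 1) \<theta> *\<^sub>R X \<omega> \<theta>"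
        unfolding X_def scaleR_sum_right using sub by (intro sum.cong refl) (auto simp: f'_def indicator_def)
    qed
    also have "\<dots> = (\<integral>\<theta>. X \<omega> \<theta> \<partial>unif)"
    proof -
      have u: "unif = density lborel (\<lambda>u. ennreal (indicator (cube 1) u :: real))"
        by (simp add: unif_def ennreal_indicator)
      show ?thesis unfolding u using Xm1[of \<omega>] by (subst integral_density) (auto cong: measurable_cong_sets)
    qed
    finally show ?thesis .
  qed
  have dm: "(\<lambda>p. dst (real L) p F) \<in> borel_measurable (borel_met pts ddist)"
    by (rule dst_measurable1[OF _ F]) simp
  have em: "(\<lambda>p. ennreal (exp (- s * dst (real L) p F))) \<in> borel_measurable (borel_met pts ddist)"
    using dm by measurable
  have "(\<integral>\<^sup>+p. ennreal (exp (- s * dst (real L) p F)) \<partial>nu A) = (\<integral>\<^sup>+\<omega>. ennreal (exp (- s * dst (real L) (pm A \<omega>) F)) \<partial>(coins \<Otimes>\<^sub>M unif))"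
    unfolding nu_def using em by (intro nn_integral_distr pm_measurable') auto
  also have "\<dots> \<le> (\<integral>\<^sup>+\<omega>. (\<integral>\<^sup>+\<theta>. ennreal (exp (- s * X \<omega> \<theta>)) \<partial>unif) \<partial>(coins \<Otimes>\<^sub>M unif))"
    unfolding dX by (intro nn_integral_mono U.exp_expectation_le[OF Xm1 Xb])
  also have "\<dots> = (\<integral>\<^sup>+\<theta>. (\<integral>\<^sup>+\<omega>. ennreal (exp (- s * X \<omega> \<theta>)) \<partial>(coins \<Otimes>\<^sub>M unif)) \<partial>unif)"
    by (rule CUU.Fubini'[symmetric]) (use Xexp in \<open>simp add: case_prod_unfold\<close>)
  also have "\<dots> \<le> (\<integral>\<^sup>+\<theta>. ennreal q ^ (L ^ CARD('n)) \<partial>(unif :: (real ^ 'n) measure))"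
    unfolding X_def by (intro nn_integral_mono exp_moment_site[OF s q] f'in)
  also have "\<dots> = ennreal q ^ (L ^ CARD('n))" using U.emeasure_space_1 by simp
  also have "\<dots> = ennreal (q ^ (L ^ CARD('n)))" using q0 by (simp add: ennreal_power)
  finally show "(\<integral>\<^sup>+p. ennreal (exp (- s * dst (real L) p F)) \<partial>nu A) \<le> ennreal (q ^ (L ^ CARD('n)))" .
qed

end

section \<open>Dimension estimates\<close>

text \<open>Shaped after the logarithm of the number of cells: a constant \<open>a\<close> for the
  phase and \<open>c\<close> bits for each site of a box of side \<open>L + k\<close>. Per volume,
  the phase and the enlargement of the box disappear.\<close>

lemma growth_tendsto:
  assumes N: "0 < N"
  shows "(\<lambda>L :: nat. (a + real ((L + k) ^ N) * c) / real L ^ N) \<longlonglongrightarrow> c"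
proof -
  have inv: "(\<lambda>L :: nat. 1 / real L) \<longlonglongrightarrow> 0" by (rule lim_1_over_n)
  have p: "(\<lambda>L :: nat. (1 / real L) ^ N) \<longlonglongrightarrow> 0 ^ N" by (intro tendsto_power inv)
  have "(\<lambda>L :: nat. a * (1 / real L) ^ N + (1 + real k * (1 / real L)) ^ N * c) \<longlonglongrightarrow> a * 0 ^ N + (1 + real k * 0) ^ N * c"
    by (intro tendsto_intros p inv)
  then have "(\<lambda>L :: nat. a * (1 / real L) ^ N + (1 + real k * (1 / real L)) ^ N * c) \<longlonglongrightarrow> c"
    using N by (simp add: zero_power)
  moreover have "\<forall>\<^sub>F L :: nat in sequentially. a * (1 / real L) ^ N + (1 + real k * (1 / real L)) ^ N * c = (a + real ((L + k) ^ N) * c) / real L ^ N"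
    using eventually_gt_at_top[of 0]
  proof eventually_elim
    case (elim L)
    then have "1 + real k * (1 / real L) = real (L + k) / real L" by (simp add: field_simps)
    then show ?case by (simp only: power_divide power_one of_nat_power add_divide_distrib) simp
  qed
  ultimately show ?thesis by (rule Lim_transform_eventually)
qed

lemma log_inverse_at_right_0: "filterlim (\<lambda>\<epsilon>. log 2 (1 / \<epsilon>)) at_top (at_right 0)"
proof -
  have "filterlim (\<lambda>\<epsilon>. 1 / ln 2 * - ln \<epsilon>) at_top (at_right (0 :: real))"
    by (rule filterlim_tendsto_pos_mult_at_top[OF tendsto_const])
       (auto intro: filterlim_compose[OF filterlim_uminus_at_top_at_bot ln_at_0])
  moreover have "\<forall>\<^sub>F \<epsilon> in at_right (0 :: real). 1 / ln 2 * - ln \<epsilon> = log 2 (1 / \<epsilon>)"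
    using eventually_at_right_less[of "0::real"] by eventually_elim (simp add: log_def ln_div)
  ultimately show ?thesis by (simp cong: filterlim_cong)
qed

text \<open>A bound at dyadic scales controls all scales, because \<open>n\<close> can be chosen
  within a bounded distance of \<open>log 2 (1 / \<epsilon>)\<close>.\<close>

lemma Limsup_ratio_le:
  fixes R :: "real \<Rightarrow> ereal"
  assumes c: "0 \<le> c" and R: "\<And>n \<epsilon>. 4 / 2 ^ n < \<epsilon> \<Longrightarrow> R \<epsilon> \<le> ereal (c * real n)"
  shows "Limsup (at_right 0) (\<lambda>\<epsilon>. R \<epsilon> / ereal (log 2 (1 / \<epsilon>))) \<le> ereal c"
proof -
  have pos: "\<forall>\<^sub>F \<epsilon> in at_right 0. 0 < log 2 (1 / \<epsilon> :: real)"
    using log_inverse_at_right_0 by (auto simp: filterlim_at_top_dense)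
  have "((\<lambda>\<epsilon>. c + 4 * c * inverse (log 2 (1 / \<epsilon>))) \<longlongrightarrow> c + 4 * c * 0) (at_right 0)"
    by (intro tendsto_intros tendsto_inverse_0_at_top log_inverse_at_right_0)
  then have lim: "((\<lambda>\<epsilon>. ereal (c + 4 * c * inverse (log 2 (1 / \<epsilon>)))) \<longlongrightarrow> ereal c) (at_right 0)" by simp
  have "Limsup (at_right 0) (\<lambda>\<epsilon>. R \<epsilon> / ereal (log 2 (1 / \<epsilon>))) \<le> Limsup (at_right 0) (\<lambda>\<epsilon>. ereal (c + 4 * c * inverse (log 2 (1 / \<epsilon>))))"
  proof (rule Limsup_mono)
    show "\<forall>\<^sub>F \<epsilon> in at_right 0. R \<epsilon> / ereal (log 2 (1 / \<epsilon>)) \<le> ereal (c + 4 * c * inverse (log 2 (1 / \<epsilon>)))"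
      using pos eventually_at_right_less[of "0::real"]
    proof eventually_elim
      case (elim \<epsilon>)
      define l where "l = log 2 (1 / \<epsilon>)"
      \<comment> \<open>As \<open>4 / \<epsilon> = 2 powr (l + 2)\<close>, rounding up
        \<open>l + 3\<close> makes \<open>4 / 2 ^ n < \<epsilon>\<close> strict, while
        \<open>n\<close> exceeds \<open>l\<close> by at most 4.\<close>
      define n where "n = nat \<lceil>l + 3\<rceil>"
      have n: "l + 3 \<le> real n" "real n \<le> l + 4" using elim unfolding n_def l_def by linarith+
      have "4 / \<epsilon> = 2 powr (l + 2)" using elim by (simp add: l_def powr_add)
      also have "\<dots> < 2 powr real n" using n by simp
      finally have "4 / \<epsilon> < 2 ^ n" by (simp add: powr_realpow)
      then have "4 / 2 ^ n < \<epsilon>" using elim by (simp add: field_simps)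
      then have "R \<epsilon> \<le> ereal (c * real n)" by (rule R)
      also have "\<dots> \<le> ereal (c * (l + 4))" using n c by (auto intro: mult_left_mono)
      finally have "R \<epsilon> / ereal l \<le> ereal (c * (l + 4)) / ereal l"
        using elim by (intro ereal_divide_right_mono) (auto simp: l_def)
      also have "\<dots> = ereal (c + 4 * c * inverse l)" using elim unfolding l_def[symmetric] by (simp add: field_simps)
      finally show ?case by (simp add: l_def)
    qed
  qed
  also have "\<dots> = ereal c" by (rule lim_imp_Limsup[OF _ lim]) simp
  finally show ?thesis .
qed

text \<open>At the scale \<open>1 / (n * 2 ^ n)\<close> the denominator is
  \<open>n + log 2 n\<close>, which is asymptotic to \<open>n\<close>. A sequence of scales tending
  to 0 is enough for a lower bound on a limsup.\<close>

lemma Limsup_ratio_ge: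
  fixes R :: "real \<Rightarrow> ereal"
  assumes n: "filterlim n at_top sequentially" and a: "(\<lambda>j. a j / real (n j)) \<longlonglongrightarrow> 1"
    and R: "\<And>j. 0 < n j \<Longrightarrow> ereal (a j) \<le> R (1 / (real (n j) * 2 ^ n j))"
  shows "1 \<le> Limsup (at_right 0) (\<lambda>\<epsilon>. R \<epsilon> / ereal (log 2 (1 / \<epsilon>)))"
proof (rule ccontr)
  assume "\<not> ?thesis"
  then have "Limsup (at_right 0) (\<lambda>\<epsilon>. R \<epsilon> / ereal (log 2 (1 / \<epsilon>))) < 1" by simp
  then obtain c :: real where c: "Limsup (at_right 0) (\<lambda>\<epsilon>. R \<epsilon> / ereal (log 2 (1 / \<epsilon>))) < ereal c" "ereal c < 1"
    by (rule ereal_dense3[THEN exE, simplified]) (metis ereal_dense2)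
  let ?x = "\<lambda>j. 1 / (real (n j) * 2 ^ n j)"
  have npos: "\<forall>\<^sub>F j in sequentially. 0 < n j" by (rule eventually_compose_filterlim[OF eventually_gt_at_top n])
  have nr: "filterlim (\<lambda>j. real (n j)) at_top sequentially"
    by (rule filterlim_compose[OF filterlim_real_sequentially n])
  have "?x \<longlonglongrightarrow> 0"
  proof (rule tendsto_sandwich[OF _ _ tendsto_const tendsto_inverse_0_at_top[OF nr]])
    show "\<forall>\<^sub>F j in sequentially. 0 \<le> ?x j" by simp
    show "\<forall>\<^sub>F j in sequentially. ?x j \<le> inverse (real (n j))"
      using npos by eventually_elim (simp add: field_simps)
  qed
  then have "filterlim ?x (at_right 0) sequentially"
    using npos by (intro tendsto_imp_filterlim_at_right) (auto elim: eventually_mono)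
  moreover have "\<forall>\<^sub>F \<epsilon> in at_right 0. R \<epsilon> / ereal (log 2 (1 / \<epsilon>)) < ereal c"
    by (rule Limsup_lessD[OF c(1)])
  ultimately have 1: "\<forall>\<^sub>F j in sequentially. R (?x j) / ereal (log 2 (1 / ?x j)) < ereal c"
    by (rule eventually_compose_filterlim[rotated])
  have "(\<lambda>j. ln (real (n j)) / real (n j)) \<longlonglongrightarrow> 0"
    by (rule filterlim_compose[OF lim_ln_over_n n])
  then have "(\<lambda>j. (a j / real (n j)) / (ln (real (n j)) / real (n j) / ln 2 + 1)) \<longlonglongrightarrow> 1 / (0 / ln 2 + 1)"
    by (intro tendsto_intros a) auto
  then have "\<forall>\<^sub>F j in sequentially. c < (a j / real (n j)) / (ln (real (n j)) / real (n j) / ln 2 + 1)"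
    using c(2) by (intro order_tendstoD(1)) auto
  then have "\<forall>\<^sub>F j in sequentially. False"
    using 1 npos eventually_compose_filterlim[OF eventually_gt_at_top[of 1] n]
  proof eventually_elim
    case (elim j)
    have l: "log 2 (1 / ?x j) = (ln (real (n j)) / real (n j) / ln 2 + 1) * real (n j)"
      using elim by (simp add: log_mult log_nat_power field_simps) (simp add: log_def field_simps)
    have lp: "0 < log 2 (1 / ?x j)"
      using elim unfolding l by (intro mult_pos_pos add_nonneg_pos) auto
    have "ereal (a j / log 2 (1 / ?x j)) = ereal (a j) / ereal (log 2 (1 / ?x j))" using lp by simp
    also have "\<dots> \<le> R (?x j) / ereal (log 2 (1 / ?x j))"
      using lp elim by (intro ereal_divide_right_mono R) auto
    also have "\<dots> < ereal c" by fact
    finally have "a j / log 2 (1 / ?x j) < c" by simp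
    then have "(a j / real (n j)) / (ln (real (n j)) / real (n j) / ln 2 + 1) < c"
      unfolding l by (simp add: mult.commute)
    then show ?case using elim by simp
  qed
  then show False by simp
qed

lemma (in lip_action) convex_mix_invariant:
  assumes "\<mu> \<in> invariant_measures M d T" "\<nu> \<in> invariant_measures M d T"
  shows "convex_mix (1/2) \<mu> (1/2) \<nu> \<in> invariant_measures M d T"
    and "A \<in> sets (borel_met M d) \<Longrightarrow> measure (convex_mix (1/2) \<mu> (1/2) \<nu>) A = (measure \<mu> A + measure \<nu> A) / 2"
proof -
  let ?m = "convex_mix (1/2) \<mu> (1/2) \<nu>"
  have m: "prob_space \<mu>" "sets \<mu> = sets (borel_met M d)" "\<And>u. distr \<mu> (borel_met M d) (T u) = \<mu>"
    and n: "prob_space \<nu>" "sets \<nu> = sets (borel_met M d)" "\<And>u. distr \<nu> (borel_met M d) (T u) = \<nu>"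
    using assms by (auto simp: invariant_measures_def)
  interpret m: prob_space \<mu> by fact
  interpret n: prob_space \<nu> by fact
  have s: "sets ?m = sets (borel_met M d)" unfolding convex_mix_def sets.sets_measure_of_eq by (rule m(2))
  have sp: "space ?m = space (borel_met M d)" "space \<mu> = space (borel_met M d)" "space \<nu> = space (borel_met M d)"
    by (intro sets_eq_imp_space_eq s m n)+
  have em: "emeasure ?m A = ennreal (1/2) * emeasure \<mu> A + ennreal (1/2) * emeasure \<nu> A" if "A \<in> sets (borel_met M d)" for A
    using that m n by (intro emeasure_convex_mix) auto
  have em': "emeasure ?m A = ennreal ((measure \<mu> A + measure \<nu> A) / 2)" if "A \<in> sets (borel_met M d)" for A
    unfolding em[OF that] m.emeasure_eq_measure n.emeasure_eq_measure
  proof -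
    have "ennreal (1/2) * ennreal a = ennreal (a / 2)" if "0 \<le> a" for a
      using that by (subst ennreal_mult[symmetric]) auto
    then show "ennreal (1/2) * ennreal (measure \<mu> A) + ennreal (1/2) * ennreal (measure \<nu> A) = ennreal ((measure \<mu> A + measure \<nu> A) / 2)"
      by (simp only: measure_nonneg add_divide_distrib) (intro ennreal_plus[symmetric], auto)
  qed
  show "measure ?m A = (measure \<mu> A + measure \<nu> A) / 2" if "A \<in> sets (borel_met M d)" for A
    unfolding measure_def[of ?m] em'[OF that] by simp
  show "?m \<in> invariant_measures M d T"
    unfolding invariant_measures_def
  proof (intro CollectI conjI allI s)
    have "emeasure ?m (space ?m) = 1"
      using m.prob_space n.prob_space unfolding em'[OF sets.top, folded sp(1)] unfolding sp by simp
    then show "prob_space ?m" by (rule prob_spaceI)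
    fix u :: "real ^ 'n"
    have Tm: "T u \<in> ?m \<rightarrow>\<^sub>M borel_met M d" "T u \<in> \<mu> \<rightarrow>\<^sub>M borel_met M d" "T u \<in> \<nu> \<rightarrow>\<^sub>M borel_met M d"
      using T_measurable[of u] s m(2) n(2) by (simp_all cong: measurable_cong_sets)
    show "distr ?m (borel_met M d) (T u) = ?m"
    proof (rule measure_eqI)
      fix A assume "A \<in> sets (distr ?m (borel_met M d) (T u))"
      then have A: "A \<in> sets (borel_met M d)" by simp
      have A': "T u -` A \<inter> space (borel_met M d) \<in> sets (borel_met M d)"
        by (rule measurable_sets[OF T_measurable A])
      have "emeasure (distr ?m (borel_met M d) (T u)) A = ennreal (1/2) * emeasure \<mu> (T u -` A \<inter> space \<mu>) + ennreal (1/2) * emeasure \<nu> (T u -` A \<inter> space \<nu>)"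
        unfolding emeasure_distr[OF Tm(1) A] sp by (rule em[OF A'])
      also have "\<dots> = ennreal (1/2) * emeasure (distr \<mu> (borel_met M d) (T u)) A + ennreal (1/2) * emeasure (distr \<nu> (borel_met M d) (T u)) A"
        by (simp only: emeasure_distr[OF Tm(2) A] emeasure_distr[OF Tm(3) A])
      also have "\<dots> = emeasure ?m A" unfolding m(3) n(3) by (rule em[OF A, symmetric])
      finally show "emeasure (distr ?m (borel_met M d) (T u)) A = emeasure ?m A" .
    qed (simp add: s)
  qed
qed

context suspension
begin

text \<open>Keeps the asymptotics of \<open>cover_pts_over\<close> only: the set is covered at a
  cost of \<open>c\<close> bits per unit volume, the limit taken at a fixed
  \<open>\<eta>\<close>.\<close>

lemma cover_growth:
  assumes S: "S \<subseteq> {0..1}" and Q: "finite Q" "card Q \<le> 2 ^ c" "\<And>x. x \<in> S \<Longrightarrow> \<exists>q\<in>Q. \<bar>x - q\<bar> \<le> \<eta>" and e: "0 < \<eta>"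
  obtains f where "f \<longlonglongrightarrow> real c"
    "\<And>L. 0 < L \<Longrightarrow> \<exists>\<C>. dcover (real L) (4 * \<eta>) (pts_over S) \<C> \<and> log 2 (real (card \<C>)) \<le> f L * real L ^ CARD('n)"
proof -
  define k where "k = 2 * (SOME r. measure wmeas {v :: real ^ 'n. \<exists>i. real r < \<bar>v $ i\<bar>} \<le> \<eta>) + 1"
  define K where "K = nat \<lceil>10 * real CARD('n) / \<eta>\<rceil> ^ CARD('n)"
  have K: "1 \<le> K" unfolding K_def using e by (intro one_le_power) (simp add: Suc_le_eq)
  define f where "f L = (log 2 (real K) + real ((L + k) ^ CARD('n)) * real c) / real L ^ CARD('n)" for L :: nat
  have "\<exists>\<C>. dcover (real L) (4 * \<eta>) (pts_over S) \<C> \<and> log 2 (real (card \<C>)) \<le> f L * real L ^ CARD('n)" if L: "0 < L" for L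
  proof -
    obtain \<C> where C: "dcover (real L) (4 * \<eta>) (pts_over S) \<C>" "card \<C> \<le> K * card Q ^ ((L + k) ^ CARD('n))"
      using cover_pts_over[OF S Q(1,3) e, of L] unfolding K_def k_def by (auto simp: add.assoc)
    have fL: "f L * real L ^ CARD('n) = log 2 (real K) + real ((L + k) ^ CARD('n)) * real c"
      using L by (simp add: f_def)
    have "log 2 (real (card \<C>)) \<le> f L * real L ^ CARD('n)"
    proof (cases "card \<C> = 0")
      \<comment> \<open>The logarithm of 0 is 0 by convention, so an empty cover does no
        harm.\<close>
      case True
      then show ?thesis unfolding fL using K by (simp add: log_def)
    next
      case False
      have "card \<C> \<le> K * 2 ^ (c * (L + k) ^ CARD('n))"
        using order_trans[OF C(2) mult_left_mono[OF power_mono[OF Q(2)]]] by (simp add: power_mult)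
      then have "real (card \<C>) \<le> real K * 2 ^ (c * (L + k) ^ CARD('n))"
        by (metis of_nat_le_iff of_nat_mult of_nat_power of_nat_numeral)
      then have "log 2 (real (card \<C>)) \<le> log 2 (real K * 2 ^ (c * (L + k) ^ CARD('n)))"
        using False by simp
      also have "\<dots> = f L * real L ^ CARD('n)"
        unfolding fL using K by (subst log_mult) (auto simp: log_nat_power)
      finally show ?thesis .
    qed
    then show ?thesis using C by auto
  qed
  moreover have "f \<longlonglongrightarrow> real c" unfolding f_def[abs_def] by (rule growth_tendsto) simp
  ultimately show ?thesis using that by blast
qed

text \<open>For the whole space an entry may be any number of \<open>[0,1]\<close>, and a grid of
  \<open>2 ^ n\<close> points approximates it to within \<open>1 / 2 ^ n\<close>; this gives
  \<open>n\<close> bits per cell.\<close>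

lemma covering_growth_le:
  assumes e: "4 / 2 ^ n < \<epsilon>"
  shows "covering_growth pts ddist tr \<epsilon> \<le> ereal (real n)"
proof -
  let ?\<eta> = "1 / 2 ^ n :: real" and ?Q = "(\<lambda>i. real i / 2 ^ n) ` {..<2 ^ n :: nat}"
  have Q: "\<exists>q\<in>?Q. \<bar>x - q\<bar> \<le> ?\<eta>" if x: "x \<in> {0..1}" for x :: real
  proof (cases "x = 1")
    \<comment> \<open>The grid consists of left endpoints, so the point 1 is served by the last
      one.\<close>
    case True
    have "\<bar>x - real (2 ^ n - 1) / 2 ^ n\<bar> = ?\<eta>" using True by (simp add: of_nat_diff field_simps)
    moreover have "real (2 ^ n - 1) / 2 ^ n \<in> ?Q" by (rule imageI) simp
    ultimately show ?thesis by (intro bexI[of _ "real (2 ^ n - 1) / 2 ^ n"]) simp_all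
  next
    case False
    define i where "i = nat \<lfloor>x * 2 ^ n\<rfloor>"
    have "0 \<le> x * 2 ^ n" using x by simp
    then have i: "real i \<le> x * 2 ^ n" "x * 2 ^ n < real i + 1" unfolding i_def by linarith+
    have "x * 2 ^ n < 2 ^ n" using x False by simp
    then have "real i < 2 ^ n" using i by linarith
    then have "i < 2 ^ n" by (metis of_nat_less_iff of_nat_numeral of_nat_power)
    moreover have "\<bar>x - real i / 2 ^ n\<bar> \<le> ?\<eta>"
    proof -
      have "x - real i / 2 ^ n = (x * 2 ^ n - real i) / 2 ^ n" by (simp add: diff_divide_distrib)
      moreover have "0 \<le> (x * 2 ^ n - real i) / 2 ^ n" using i by (intro divide_nonneg_nonneg) auto
      moreover have "(x * 2 ^ n - real i) / 2 ^ n \<le> ?\<eta>" using i by (intro divide_right_mono) auto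
      ultimately show ?thesis by linarith
    qed
    ultimately show ?thesis by auto
  qed
  have cQ: "card ?Q \<le> 2 ^ n" using card_image_le[of "{..<2 ^ n :: nat}"] by simp
  obtain f where f: "f \<longlonglongrightarrow> real n"
    "\<And>L. 0 < L \<Longrightarrow> \<exists>\<C>. dcover (real L) (4 * ?\<eta>) (pts_over {0..1}) \<C> \<and> log 2 (real (card \<C>)) \<le> f L * real L ^ CARD('n)"
    using cover_growth[OF subset_refl _ cQ Q] by auto
  have e0: "0 < \<epsilon>" using e by (rule order.strict_trans[rotated]) simp
  have "covering_growth pts ddist tr \<epsilon> \<le> ereal (f L)" if L: "0 < L" for L
  proof -
    obtain \<C> where C: "dcover (real L) (4 * ?\<eta>) pts \<C>" "log 2 (real (card \<C>)) \<le> f L * real L ^ CARD('n)"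
      using f(2)[OF L] unfolding pts_eq_pts_over by auto
    let ?n = "covering_number pts (dyn_dist pts ddist tr (real L)) \<epsilon>"
    have n1: "1 \<le> ?n" using L e0 by (intro covering_number_pos) auto
    have "?n \<le> card \<C>" using L e by (intro covering_number_le[OF _ _ _ C(1)]) auto
    then have "log 2 (real ?n) \<le> log 2 (real (card \<C>))" using n1 by simp
    then have "log 2 (real ?n) \<le> f L * real L ^ CARD('n)" using C(2) by simp
    then have "log 2 (real ?n) / real L ^ CARD('n) \<le> f L" using L by (simp add: divide_le_eq)
    then show ?thesis
      using order_trans[OF covering_growth_bounds(2)[OF e0, of "real L"]] L by simp
  qed
  then have "\<forall>\<^sub>F L in sequentially. covering_growth pts ddist tr \<epsilon> \<le> ereal (f L)"
    by (intro eventually_mono[OF eventually_gt_at_top[of 0]])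
  then show ?thesis using f(1) by (intro tendsto_lowerbound[of "\<lambda>L. ereal (f L)"]) auto
qed

lemma upper_mdim_finite: "\<bar>upper_mdim pts ddist tr\<bar> \<noteq> \<infinity>"
proof -
  have "upper_mdim pts ddist tr \<le> ereal 1"
    unfolding upper_mdim_def by (rule Limsup_ratio_le) (auto intro: covering_growth_le)
  \<comment> \<open>Finiteness in \<open>ereal\<close> also has to exclude minus infinity.\<close>
  moreover have "0 \<le> upper_mdim pts ddist tr"
    unfolding upper_mdim_def
  proof (rule le_Limsup)
    have "\<forall>\<^sub>F \<epsilon> in at_right 0. 0 < log 2 (1 / \<epsilon> :: real)"
      using log_inverse_at_right_0 by (auto simp: filterlim_at_top_dense)
    then show "\<forall>\<^sub>F \<epsilon> in at_right 0. 0 \<le> covering_growth pts ddist tr \<epsilon> / ereal (log 2 (1 / \<epsilon>))"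
      using eventually_at_right_less[of "0::real"]
      by eventually_elim (intro zero_le_divide_ereal covering_growth_bounds(1), simp_all)
  qed simp
  ultimately show ?thesis by auto
qed

text \<open>The truncated sums form a net of the entries with at most \<open>2 ^ cnt A n\<close>
  elements, and likewise for \<open>B\<close>. The bit that tells the component is paid once per
  cube, so it disappears in the limit of large cubes.\<close>

lemma rate_distortion_mix_upper:
  assumes mu: "\<mu> \<in> invariant_measures pts ddist tr"
    and mix: "\<And>E. E \<in> sets (borel_met pts ddist) \<Longrightarrow> measure \<mu> E = (measure (nu A) E + measure (nu B) E) / 2"
    and e: "4 / 2 ^ n < \<epsilon>"
  shows "rate_distortion pts ddist tr \<mu> \<epsilon> \<le> ereal (real (cnt A n + cnt B n) / 2)"
proof -
  let ?\<eta> = "1 / 2 ^ n :: real"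
  have m: "prob_space \<mu>" "sets \<mu> = sets (borel_met pts ddist)" using mu by (auto simp: invariant_measures_def)
  have r: "range (xi A) \<subseteq> {0..1}" for A using xi_bounds by auto
  have Q: "\<exists>q\<in>range (psum A n). \<bar>x - q\<bar> \<le> ?\<eta>" if "x \<in> range (xi A)" for x A
  proof -
    from that obtain b where "x = xi A b" by auto
    then have "\<bar>x - psum A n b\<bar> \<le> ?\<eta>" using xi_psum[where A = A and n = n and b = b] by simp
    then show ?thesis by blast
  qed
  obtain f where f: "f \<longlonglongrightarrow> real (cnt A n)"
    "\<And>L. 0 < L \<Longrightarrow> \<exists>\<C>. dcover (real L) (4 * ?\<eta>) (pts_over (range (xi A))) \<C> \<and> log 2 (real (card \<C>)) \<le> f L * real L ^ CARD('n)"
    using cover_growth[OF r[of A] card_range_psum[of A n] Q[of _ A]] by auto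
  obtain g where g: "g \<longlonglongrightarrow> real (cnt B n)"
    "\<And>L. 0 < L \<Longrightarrow> \<exists>\<C>. dcover (real L) (4 * ?\<eta>) (pts_over (range (xi B))) \<C> \<and> log 2 (real (card \<C>)) \<le> g L * real L ^ CARD('n)"
    using cover_growth[OF r[of B] card_range_psum[of B n] Q[of _ B]] by auto
  \<comment> \<open>The first summand equals \<open>1 / real L ^ CARD('n)\<close>; it is written so
    that \<open>growth_tendsto\<close> applies with \<open>c = 0\<close>.\<close>
  let ?h = "\<lambda>L :: nat. (1 + real ((L + 0) ^ CARD('n)) * 0) / real L ^ CARD('n) + (f L + g L) / 2"
  have "rate_distortion pts ddist tr \<mu> \<epsilon> \<le> ereal (?h L)" if L: "0 < L" for L
  proof -
    obtain \<C> where C: "dcover (real L) (4 * ?\<eta>) (pts_over (range (xi A))) \<C>" "log 2 (real (card \<C>)) \<le> f L * real L ^ CARD('n)"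
      using f(2)[OF L] by auto
    obtain \<D> where D: "dcover (real L) (4 * ?\<eta>) (pts_over (range (xi B))) \<D>" "log 2 (real (card \<D>)) \<le> g L * real L ^ CARD('n)"
      using g(2)[OF L] by auto
    have "rate_distortion_L pts ddist tr \<mu> \<epsilon> (real L) \<le> ereal (1 + (log 2 (card \<C>) + log 2 (card \<D>)) / 2)"
      by (rule rate_distortion_mix_le[OF m prob_space_nu sets_nu prob_space_nu sets_nu _ _ _ _ C(1) D(1) nu_full nu_full])
         (use L e m mix in auto)
    also have "\<dots> \<le> ereal (1 + (f L + g L) / 2 * real L ^ CARD('n))"
      using C(2) D(2) by (simp add: algebra_simps)
    finally have "rate_distortion_L pts ddist tr \<mu> \<epsilon> (real L) / ereal (real L ^ CARD('n)) \<le> ereal (1 + (f L + g L) / 2 * real L ^ CARD('n)) / ereal (real L ^ CARD('n))"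
      using L by (intro ereal_divide_right_mono) auto
    also have "\<dots> = ereal (?h L)" using L by (simp add: add_divide_distrib)
    finally show ?thesis
      using order_trans[OF rate_distortion_tendsto(2)[OF mu, of "real L"]] L by simp
  qed
  then have "\<forall>\<^sub>F L in sequentially. rate_distortion pts ddist tr \<mu> \<epsilon> \<le> ereal (?h L)"
    by (intro eventually_mono[OF eventually_gt_at_top[of 0]])
  moreover have "?h \<longlonglongrightarrow> 0 + (real (cnt A n) + real (cnt B n)) / 2"
    by (intro tendsto_intros f(1) g(1) growth_tendsto) auto
  ultimately show ?thesis by (intro tendsto_lowerbound[of "\<lambda>L. ereal (?h L)"]) auto
qed

section \<open>The rate distortion dimensions\<close>

lemma cnt_le: "cnt A n \<le> n"
  unfolding cnt_def using card_mono[of "{..<n}" "A \<inter> {..<n}"] by simp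

text \<open>A measure is the even mixture of itself with itself, so the bound for mixtures applies
  with both components equal.\<close>

lemma upper_rdim_nu_le: "upper_rdim pts ddist tr (nu A) \<le> 1"
  unfolding upper_rdim_def one_ereal_def
proof (rule Limsup_ratio_le)
  fix n and \<epsilon> :: real assume e: "4 / 2 ^ n < \<epsilon>"
  have "rate_distortion pts ddist tr (nu A) \<epsilon> \<le> ereal (real (cnt A n + cnt A n) / 2)"
    by (rule rate_distortion_mix_upper[OF nu_invariant _ e]) simp
  also have "\<dots> \<le> ereal (1 * real n)" using cnt_le[of A n] by simp
  finally show "rate_distortion pts ddist tr (nu A) \<epsilon> \<le> ereal (1 * real n)" .
qed simp

lemma upper_rdim_mix_le: "upper_rdim pts ddist tr (convex_mix (1/2) (nu A) (1/2) (nu (- A))) \<le> 1 / 2"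
proof -
  have "upper_rdim pts ddist tr (convex_mix (1/2) (nu A) (1/2) (nu (- A))) \<le> ereal (1 / 2)"
    unfolding upper_rdim_def
  proof (rule Limsup_ratio_le)
    fix n and \<epsilon> :: real assume e: "4 / 2 ^ n < \<epsilon>"
    have "cnt A n + cnt (- A) n = card (A \<inter> {..<n} \<union> - A \<inter> {..<n})"
      unfolding cnt_def by (intro card_Un_disjoint[symmetric]) auto
    also have "A \<inter> {..<n} \<union> - A \<inter> {..<n} = {..<n}" by auto
    finally have "cnt A n + cnt (- A) n = n" by simp
    then show "rate_distortion pts ddist tr (convex_mix (1/2) (nu A) (1/2) (nu (- A))) \<epsilon> \<le> ereal (1 / 2 * real n)"
      using rate_distortion_mix_upper[OF convex_mix_invariant[OF nu_invariant nu_invariant] e, of A "- A"] by simp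
  qed simp
  then show ?thesis by (simp add: one_ereal_def divide_ereal_def)
qed

text \<open>The parameter \<open>s = n * 2 ^ n\<close> is the reciprocal of the distortion, so the
  distortion term costs the constant 1, while \<open>exp (- s / 2 ^ n) = exp (- n)\<close> is at
  most \<open>1 / 2 ^ cnt A n\<close>. Together with the 4 from \<open>exp_moment_xi\<close> the
  moment is at most \<open>5 / 2 ^ cnt A n\<close>, whence \<open>ln 5\<close>.\<close>

lemma rate_distortion_nu_ge:
  assumes n: "0 < n"
  shows "ereal (real (cnt A n) - (ln 5 + 1) / ln 2) \<le> rate_distortion pts ddist tr (nu A) (1 / (real n * 2 ^ n))"
proof -
  define s where "s = real n * 2 ^ n"
  define q :: real where "q = 5 / 2 ^ cnt A n"
  define K where "K = real (cnt A n) * ln 2 - ln (5 :: real)"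
  have q: "0 < q" "q = exp (- K)"
    unfolding q_def K_def by (auto simp: exp_diff exp_of_nat_mult)
  have "exp (- s / 2 ^ n) = 1 / exp 1 ^ n"
    by (simp add: s_def exp_minus inverse_eq_divide flip: exp_of_nat_mult)
  also have "\<dots> \<le> 1 / 2 ^ n"
    using exp_ge_add_one_self[of 1] by (intro divide_left_mono power_mono) auto
  also have "\<dots> \<le> 1 / 2 ^ cnt A n" using cnt_le[of A n] by (intro divide_left_mono power_increasing) auto
  finally have "4 / 2 ^ cnt A n + exp (- s / 2 ^ n) \<le> q" by (simp add: q_def)
  then have qm: "(\<integral>\<^sup>+b. ennreal (exp (- s * \<bar>xi A b - c\<bar>)) \<partial>coin) \<le> ennreal q" for c
    by (intro order_trans[OF exp_moment_xi[where n = n] ennreal_leI]) (auto simp: s_def)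
  have "ereal ((K - s * (1 / s)) / ln 2) \<le> rate_distortion pts ddist tr (nu A) (1 / s)"
  proof (rule rate_distortion_ge[OF nu_invariant])
    show "0 \<le> s" by (simp add: s_def)
    fix L :: nat and F :: "(real ^ 'n \<Rightarrow> 'a) set"
    assume L: "0 < L" "F \<in> L1_space pts ddist (real L)"
    have "(\<integral>x. exp (- s * dst (real L) x F) \<partial>nu A) \<le> q ^ (L ^ CARD('n))"
      by (rule exp_moment_dst[OF _ _ qm L]) (use q in \<open>auto simp: s_def\<close>)
    also have "\<dots> = exp (- K * real L ^ CARD('n))"
      unfolding q(2) by (simp add: mult.commute flip: exp_of_nat_mult)
    finally show "(\<integral>x. exp (- s * dst (real L) x F) \<partial>nu A) \<le> exp (- K * real L ^ CARD('n))" .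
  qed
  moreover have "(K - s * (1 / s)) / ln 2 = real (cnt A n) - (ln 5 + 1) / ln 2"
    using n by (simp add: K_def s_def diff_divide_distrib add_divide_distrib)
  ultimately show ?thesis by (simp add: s_def)
qed

text \<open>At the end of a block contained in \<open>A\<close> only the first
  \<open>fact (g j)\<close> of the \<open>fact (Suc (g j))\<close> positions can be missing, a
  fraction \<open>1 / (g j + 1)\<close> that tends to 0.\<close>

lemma upper_rdim_nu_ge:
  assumes g: "filterlim g at_top sequentially" and A: "\<And>j. {fact (g j)..<fact (Suc (g j))} \<subseteq> A"
  shows "1 \<le> upper_rdim pts ddist tr (nu A)"
  unfolding upper_rdim_def
proof (rule Limsup_ratio_ge)
  let ?n = "\<lambda>j. fact (Suc (g j)) :: nat"
  have ng: "g j \<le> ?n j" for j using fact_ge_self[of "Suc (g j)"] by linarith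
  show n: "filterlim ?n at_top sequentially"
    by (rule filterlim_at_top_mono[OF g]) (simp only: ng eventually_True)
  show "ereal (real (cnt A (?n j)) - (ln 5 + 1) / ln 2) \<le> rate_distortion pts ddist tr (nu A) (1 / (real (?n j) * 2 ^ ?n j))" for j
    by (rule rate_distortion_nu_ge) (rule fact_gt_zero)
  have nr: "filterlim (\<lambda>j. real (?n j)) at_top sequentially"
    by (rule filterlim_compose[OF filterlim_real_sequentially n])
  have gr: "filterlim (\<lambda>j. real (g j)) at_top sequentially"
    by (rule filterlim_compose[OF filterlim_real_sequentially g])
  have l0: "(\<lambda>j. 1 - inverse (1 + real (g j))) \<longlonglongrightarrow> 1 - 0"
    by (intro tendsto_intros tendsto_inverse_0_at_top filterlim_tendsto_add_at_top[OF tendsto_const gr])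
  have "(\<lambda>j. real (cnt A (?n j)) / real (?n j)) \<longlonglongrightarrow> 1"
  proof (rule tendsto_sandwich[OF _ _ _ tendsto_const])
    show "(\<lambda>j. 1 - inverse (1 + real (g j))) \<longlonglongrightarrow> 1" using l0 by simp
    have "1 - inverse (1 + real (g j)) \<le> real (cnt A (?n j)) / real (?n j)" for j
    proof -
      have "card {fact (g j)..<?n j} \<le> cnt A (?n j)"
        unfolding cnt_def using A[of j] by (intro card_mono) auto
      then have "?n j \<le> cnt A (?n j) + fact (g j)" by simp
      then have "real (?n j) \<le> real (cnt A (?n j)) + real (fact (g j))" by (metis of_nat_add of_nat_le_iff)
      then have "(real (?n j) - real (fact (g j))) / real (?n j) \<le> real (cnt A (?n j)) / real (?n j)"
        by (intro divide_right_mono) auto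
      moreover have "(real (?n j) - real (fact (g j))) / real (?n j) = 1 - inverse (1 + real (g j))"
      proof -
        have "real (fact (g j)) / real (?n j) = inverse (1 + real (g j))"
          unfolding fact_Suc of_nat_mult by (simp add: inverse_eq_divide)
        then show ?thesis by (simp add: diff_divide_distrib del: fact_Suc)
      qed
      ultimately show ?thesis by simp
    qed
    then show "\<forall>\<^sub>F j in sequentially. 1 - inverse (1 + real (g j)) \<le> real (cnt A (?n j)) / real (?n j)" by simp
    show "\<forall>\<^sub>F j in sequentially. real (cnt A (?n j)) / real (?n j) \<le> 1"
      using cnt_le by (intro always_eventually allI) (simp add: divide_le_eq_1 del: fact_Suc of_nat_fact)
  qed
  then have "(\<lambda>j. real (cnt A (?n j)) / real (?n j) - (ln 5 + 1) / ln 2 * inverse (real (?n j))) \<longlonglongrightarrow> 1 - (ln 5 + 1) / ln 2 * 0"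
    by (intro tendsto_intros tendsto_inverse_0_at_top nr)
  then show "(\<lambda>j. (real (cnt A (?n j)) - (ln 5 + 1) / ln 2) / real (?n j)) \<longlonglongrightarrow> 1"
    by (simp add: diff_divide_distrib inverse_eq_divide del: fact_Suc)
qed

end

section \<open>The example\<close>

text \<open>Array and phase are listed in a single sequence, as the index set of cells and
  coordinates is countable. Points thereby live in a type that does not depend on the
  dimension.\<close>

definition enc :: "(int ^ 'n \<Rightarrow> real) \<Rightarrow> real ^ 'n \<Rightarrow> nat \<Rightarrow> real" where
  "enc x \<phi> k = (case from_nat k of Inl j \<Rightarrow> x j | Inr i \<Rightarrow> \<phi> $ i)"

definition enc_sym :: "(nat \<Rightarrow> real) \<Rightarrow> int ^ 'n \<Rightarrow> real" where
  "enc_sym p j = p (to_nat (Inl j :: int ^ 'n + 'n))"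

definition enc_ph :: "(nat \<Rightarrow> real) \<Rightarrow> real ^ 'n" where
  "enc_ph p = (\<chi> i. p (to_nat (Inr i :: int ^ 'n + 'n)))"

text \<open>The integer part of the phase is absorbed into the array, since the translates by integers coincide.\<close>

definition enc_mk :: "(int ^ 'n \<Rightarrow> real) \<Rightarrow> real ^ 'n \<Rightarrow> nat \<Rightarrow> real" where
  "enc_mk x \<phi> = enc (\<lambda>j. x (j + fvec \<phi>)) (\<phi> - rvec (fvec \<phi>))"

lemma enc_sym_enc: "enc_sym (enc x \<phi>) = x"
  by (simp add: fun_eq_iff enc_sym_def enc_def)

lemma enc_ph_enc: "enc_ph (enc x \<phi>) = \<phi>"
  by (simp add: vec_eq_iff enc_ph_def enc_def)

lemma suspension_enc: "suspension (enc_mk :: (int ^ 'n \<Rightarrow> real) \<Rightarrow> real ^ 'n \<Rightarrow> nat \<Rightarrow> real) enc_sym enc_ph"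
  by unfold_locales (simp_all add: enc_mk_def enc_sym_enc enc_ph_enc)

definition even_blocks :: "nat set" where
  "even_blocks = (\<Union>m\<in>Collect even. {fact m..<fact (Suc m)})"

lemma odd_block_disjoint:
  assumes "odd m"
  shows "{fact m..<fact (Suc m)} \<subseteq> - even_blocks"
proof -
  have "k < fact m' \<or> fact (Suc m') \<le> k" if k: "fact m \<le> k" "k < fact (Suc m)" and m': "even m'" for k m' :: nat
  proof (cases "m' < m")
    case True
    then have "fact (Suc m') \<le> (fact m :: nat)" by (intro fact_mono) simp
    then show ?thesis using k by linarith
  next
    case False
    then have "Suc m \<le> m'" using assms m' by (cases "m = m'") auto
    then have "fact (Suc m) \<le> (fact m' :: nat)" by (rule fact_mono)
    then show ?thesis using k by linarith
  qed
  then have "k \<notin> even_blocks" if "fact m \<le> k" "k < fact (Suc m)" for k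
    using that unfolding even_blocks_def by (metis (no_types, lifting) UN_E atLeastLessThan_iff linorder_not_less mem_Collect_eq)
  then show ?thesis by (auto simp del: fact_Suc)
qed

theorem proposition5p1:
  shows "\<exists>(M :: (nat \<Rightarrow> real) set) d (T :: real ^ 'n \<Rightarrow> (nat \<Rightarrow> real) \<Rightarrow> (nat \<Rightarrow> real)) \<nu>1 \<nu>2.
    Metric_space M d \<and> compact_space (Metric_space.mtopology M d) \<and>
    continuous_action M d T \<and>
    \<nu>1 \<in> invariant_measures M d T \<and> \<nu>2 \<in> invariant_measures M d T \<and>
    \<bar>upper_mdim M d T\<bar> \<noteq> \<infinity> \<and>
    upper_rdim M d T \<nu>1 = 1 \<and> upper_rdim M d T \<nu>2 = 1 \<and>
    upper_rdim M d T (convex_mix (1/2) \<nu>1 (1/2) \<nu>2) \<le> 1/2"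
proof -
  interpret suspension "enc_mk :: (int ^ 'n \<Rightarrow> real) \<Rightarrow> real ^ 'n \<Rightarrow> nat \<Rightarrow> real" enc_sym enc_ph
    by (rule suspension_enc)
  have g1: "filterlim (\<lambda>j :: nat. 2 * j) at_top sequentially"
    by (rule filterlim_subseq) (auto simp: strict_mono_def)
  have g2: "filterlim (\<lambda>j :: nat. 2 * j + 1) at_top sequentially"
    by (rule filterlim_subseq) (auto simp: strict_mono_def)
  have 1: "upper_rdim pts ddist tr (nu even_blocks) = 1"
  proof (rule antisym[OF upper_rdim_nu_le upper_rdim_nu_ge[OF g1]])
    fix j :: nat
    have "even (2 * j)" by simp
    then show "{fact (2 * j)..<fact (Suc (2 * j))} \<subseteq> even_blocks" unfolding even_blocks_def by blast
  qed
  have 2: "upper_rdim pts ddist tr (nu (- even_blocks)) = 1"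
    by (rule antisym[OF upper_rdim_nu_le upper_rdim_nu_ge[OF g2 odd_block_disjoint]]) simp
  show ?thesis
    by (rule exI[of _ pts], rule exI[of _ ddist], rule exI[of _ tr], rule exI[of _ "nu even_blocks"], rule exI[of _ "nu (- even_blocks)"])
       (intro conjI metric compact continuous nu_invariant upper_mdim_finite 1 2 upper_rdim_mix_le)
qed

end
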